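(* For all $\phi,\psi\in\mathbb{CE}_2^{\mathrm{HS}}(1)$ one has $\rho(\phi\circ\psi)=\rho(\phi)\circ\rho(\psi)$, and $\rho(\mathrm{id}_{\mathbb D})=\mathrm{id}$; that is, $\rho$ is a representation of the monoid $\mathbb{CE}_2^{\mathrm{HS}}(1)$ on $\mathrm{Sym}\,A^2(\mathbb D)$. Moreover, for every $k\ge0$, $\rho$ preserves $\mathcal H^k=\bigoplus_{p=0}^k\mathrm{Sym}^pA^2(\mathbb D)\subset\mathrm{Sym}\,A^2(\mathbb D)$, and for every $\phi\in\mathbb{CE}_2^{\mathrm{HS}}(1)$ the map $\rho(\phi)|_{\mathcal H^k}:\mathcal H^k\to\mathcal H^k$ is a bounded linear operator. Furthermore, the restriction $\rho|_{\mathrm{PSU}(1,1)}:\mathrm{PSU}(1,1)\to\mathbb B(\mathcal H^k)$ is a strongly continuous unitary representation.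
   Context: $\mathbb D=\{z\in\mathbb C:|z|<1\}$. $\mathbb{CE}_2^{\mathrm{emb}}(1)$ is the monoid under composition of injective holomorphic maps $\mathbb D\to\mathbb D$. For $\phi\in\mathbb{CE}_2^{\mathrm{emb}}(1)$, $F_\phi(z,w)=\frac{\phi'(z)\phi'(w)}{(\phi(z)-\phi(w))^2}-\frac1{(z-w)^2}$, which is holomorphic on $\mathbb D\times\mathbb D$ (across the diagonal). $\mathbb{CE}_2^{\mathrm{HS}}(1)=\{\phi\in\mathbb{CE}_2^{\mathrm{emb}}(1):F_\phi\in L^2(\mathbb D\times\mathbb D)\}$; it is a submonoid containing $\mathrm{PSU}(1,1)=\{z\mapsto e^{i\theta}\frac{z-\alpha}{1-\bar\alpha z}:\theta\in\mathbb R,\ |\alpha|<1\}$. $d\mu$ is Lebesgue measure on $\mathbb D^p$ divided by $\pi^p$; $A^2(\mathbb D^p)$ is the Bergman space of holomorphic functions in $L^2(\mathbb D^p,d\mu)$. $\hat\otimes$ is the Hilbert space tensor product, and $A^2(\mathbb D)^{\hat\otimes p}\cong A^2(\mathbb D^p)$ isometrically. $\mathrm{Sym}^pA^2(\mathbb D)\subset A^2(\mathbb D)^{\hat\otimes p}$ is the closed subspace of symmetric tensors, $\mathrm{Sym}^0A^2(\mathbb D)=\mathbb C\mathbf 1$ with $\|\mathbf 1\|=1$, and $\mathrm{Sym}\,A^2(\mathbb D)$ is the algebraic direct sum $\bigoplus_{p\ge0}\mathrm{Sym}^pA^2(\mathbb D)$; each $\mathcal H^k$ is a Hilbert space (orthogonal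 direct sum). $\mathbb B(H)$ denotes bounded operators on $H$. For $\phi\in\mathbb{CE}_2^{\mathrm{emb}}(1)$: $\mathcal J(\phi)(z)=\overline{\phi(\bar z)}$, $T_\phi f=\phi'\cdot(f\circ\phi)$ on $A^2(\mathbb D)$ (a contraction), and $\rho_{\mathrm{cl}}(\phi)=T_{\mathcal J(\phi)}^*$ (adjoint), extended to $\mathrm{Sym}^pA^2(\mathbb D)$ by acting diagonally, $v_1\otimes\cdots\otimes v_p\mapsto\rho_{\mathrm{cl}}(\phi)v_1\otimes\cdots\otimes\rho_{\mathrm{cl}}(\phi)v_p$, with $\rho_{\mathrm{cl}}(\phi)\mathbf 1=\mathbf 1$. For $\phi\in\mathbb{CE}_2^{\mathrm{HS}}(1)$: $\partial_\phi(P)=\int_{\mathbb D\times\mathbb D}F_\phi(\bar z,\bar w)P(z,w)\,d\mu$ for $P\in A^2(\mathbb D\times\mathbb D)$; this extends to $\partial_\phi:A^2(\mathbb D)^{\hat\otimes n}\to A^2(\mathbb D)^{\hat\otimes(n-2)}$ by $\partial_\phi(a_1\otimes\cdots\otimes a_n)=\sum_{1\le i<j\le n}\partial_\phi(a_i\otimes a_j)\,a_1\otimes\cdots\hat a_i\cdots\hat a_j\cdots\otimes a_n$ for $n\ge2$ and $\partial_\phi=0$ for $n=0,1$. It is locally nilpotent and preserves symmetric tensors, so $\exp(\partial_\phi)$ acts on $\mathrm{Sym}\,A^2(\mathbb D)$. Finally $\rho(\phi)=\rho_{\mathrm{cl}}(\phi)\circ\exp(\partial_\phi):\mathrm{Sym}\,A^2(\mathbb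 D)\to\mathrm{Sym}\,A^2(\mathbb D)$. *)

theory Defs
  imports "HOL-Complex_Analysis.Complex_Analysis"
begin

abbreviation disc :: "complex set" where
  "disc \<equiv> ball 0 1"

text \<open>Self-maps of the disc are extensional functions (\<^term>\<open>undefined\<close> off the disc), so that equality
  of elements of the monoid is equality in HOL, the product is \<^term>\<open>compose disc \<phi> \<psi>\<close> and the unit
  is \<^term>\<open>\<lambda>z\<in>disc. z\<close>.\<close>

definition CE_emb :: "(complex \<Rightarrow> complex) set" where
  "CE_emb = {\<phi> \<in> disc \<rightarrow>\<^sub>E disc. \<phi> holomorphic_on disc \<and> inj_on \<phi> disc}"

definition conj_map :: "(complex \<Rightarrow> complex) \<Rightarrow> complex \<Rightarrow> complex" where
  "conj_map \<phi> = (\<lambda>z\<in>disc. cnj (\<phi> (cnj z)))"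

text \<open>On the diagonal, where the formula has a removable singularity, division by zero gives the junk
  value 0.  The diagonal is a null set and \<open>F_kernel\<close> is only ever used under an integral.\<close>

definition F_kernel :: "(complex \<Rightarrow> complex) \<Rightarrow> complex \<Rightarrow> complex \<Rightarrow> complex" where
  "F_kernel \<phi> z w = deriv \<phi> z * deriv \<phi> w / (\<phi> z - \<phi> w)\<^sup>2 - 1 / (z - w)\<^sup>2"

definition disc_measure :: "complex measure" where
  "disc_measure = density (restrict_space lborel disc) (\<lambda>_. ennreal (1 / pi))"

text \<open>Points of the \<open>p\<close>-dimensional polydisc are extensional functions on \<^term>\<open>{..<p}\<close>.  For
  \<^term>\<open>p = 0\<close> this is a single point of mass one.\<close>

definition polydisc :: "nat \<Rightarrow> (nat \<Rightarrow> complex) set" where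
  "polydisc p = {..<p} \<rightarrow>\<^sub>E disc"

definition poly_measure :: "nat \<Rightarrow> (nat \<Rightarrow> complex) measure" where
  "poly_measure p = (\<Pi>\<^sub>M i\<in>{..<p}. disc_measure)"

definition square_integrable :: "'x measure \<Rightarrow> ('x \<Rightarrow> complex) \<Rightarrow> bool" where
  "square_integrable M f \<longleftrightarrow> f \<in> borel_measurable M \<and> integrable M (\<lambda>x. (cmod (f x))\<^sup>2)"

definition L2_inner :: "'x measure \<Rightarrow> ('x \<Rightarrow> complex) \<Rightarrow> ('x \<Rightarrow> complex) \<Rightarrow> complex" where
  "L2_inner M f g = (LINT x|M. f x * cnj (g x))"

definition L2_norm :: "'x measure \<Rightarrow> ('x \<Rightarrow> complex) \<Rightarrow> real" where
  "L2_norm M f = sqrt (LINT x|M. (cmod (f x))\<^sup>2)"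

text \<open>Elements of all Bergman spaces are normalised to vanish off their domain, so that the spaces are
  genuine complex vector spaces of functions.\<close>

definition A2_disc :: "(complex \<Rightarrow> complex) set" where
  "A2_disc = {f. f holomorphic_on disc \<and> square_integrable disc_measure f \<and> (\<forall>z. z \<notin> disc \<longrightarrow> f z = 0)}"

text \<open>Holomorphy in several variables: continuous and holomorphic in each variable separately.\<close>

definition holomorphic_polydisc :: "nat \<Rightarrow> ((nat \<Rightarrow> complex) \<Rightarrow> complex) \<Rightarrow> bool" where
  "holomorphic_polydisc p f \<longleftrightarrow>
     continuous_on (polydisc p) f \<and>
     (\<forall>z\<in>polydisc p. \<forall>i<p. (\<lambda>w. f (z(i := w))) holomorphic_on disc)"

text \<open>\<open>A2 p\<close> is the Bergman space of the \<open>p\<close>-dimensional polydisc and also serves as the \<open>p\<close>-fold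
  Hilbert space tensor power of \<^term>\<open>A2_disc\<close>; elementary tensors are the functions \<open>tens\<close> below.\<close>

definition A2 :: "nat \<Rightarrow> ((nat \<Rightarrow> complex) \<Rightarrow> complex) set" where
  "A2 p = {f. holomorphic_polydisc p f \<and> square_integrable (poly_measure p) f \<and>
              (\<forall>z. z \<notin> polydisc p \<longrightarrow> f z = 0)}"

definition tens :: "(complex \<Rightarrow> complex) list \<Rightarrow> (nat \<Rightarrow> complex) \<Rightarrow> complex" where
  "tens as = (\<lambda>z. if z \<in> polydisc (length as) then \<Prod>i<length as. (as ! i) (z i) else 0)"

definition SymA2_deg :: "nat \<Rightarrow> ((nat \<Rightarrow> complex) \<Rightarrow> complex) set" where
  "SymA2_deg p = {f \<in> A2 p. \<forall>\<sigma>. \<sigma> permutes {..<p} \<longrightarrow> (\<forall>z\<in>polydisc p. f (z \<circ> \<sigma>) = f z)}"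

definition linear_op ::
  "('x \<Rightarrow> complex) set \<Rightarrow> ('y \<Rightarrow> complex) set \<Rightarrow> (('x \<Rightarrow> complex) \<Rightarrow> 'y \<Rightarrow> complex) \<Rightarrow> bool" where
  "linear_op V W T \<longleftrightarrow>
     T \<in> V \<rightarrow> W \<and>
     (\<forall>f\<in>V. \<forall>g\<in>V. T (\<lambda>x. f x + g x) = (\<lambda>y. T f y + T g y)) \<and>
     (\<forall>c. \<forall>f\<in>V. T (\<lambda>x. c * f x) = (\<lambda>y. c * T f y))"

definition bounded_op ::
  "('x \<Rightarrow> complex) set \<Rightarrow> (('x \<Rightarrow> complex) \<Rightarrow> real) \<Rightarrow> ('y \<Rightarrow> complex) set \<Rightarrow> (('y \<Rightarrow> complex) \<Rightarrow> real)
    \<Rightarrow> (('x \<Rightarrow> complex) \<Rightarrow> 'y \<Rightarrow> complex) \<Rightarrow> bool" where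
  "bounded_op V normV W normW T \<longleftrightarrow>
     linear_op V W T \<and> (\<exists>C. \<forall>f\<in>V. normW (T f) \<le> C * normV f)"

definition unitary_op ::
  "('x \<Rightarrow> complex) set \<Rightarrow> (('x \<Rightarrow> complex) \<Rightarrow> ('x \<Rightarrow> complex) \<Rightarrow> complex)
    \<Rightarrow> (('x \<Rightarrow> complex) \<Rightarrow> 'x \<Rightarrow> complex) \<Rightarrow> bool" where
  "unitary_op V ip U \<longleftrightarrow>
     linear_op V V U \<and> U ` V = V \<and> (\<forall>f\<in>V. \<forall>g\<in>V. ip (U f) (U g) = ip f g)"

text \<open>The values on elementary tensors determine a bounded operator uniquely, since their span is dense.
  Off its domain \<^term>\<open>A2 n\<close> it is \<^term>\<open>undefined\<close>.\<close>

definition tensor_extension ::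
  "nat \<Rightarrow> nat \<Rightarrow> ((complex \<Rightarrow> complex) list \<Rightarrow> (nat \<Rightarrow> complex) \<Rightarrow> complex)
    \<Rightarrow> ((nat \<Rightarrow> complex) \<Rightarrow> complex) \<Rightarrow> (nat \<Rightarrow> complex) \<Rightarrow> complex" where
  "tensor_extension n m \<Phi> =
     (THE B. B \<in> extensional (A2 n) \<and>
             bounded_op (A2 n) (L2_norm (poly_measure n)) (A2 m) (L2_norm (poly_measure m)) B \<and>
             (\<forall>as. length as = n \<and> set as \<subseteq> A2_disc \<longrightarrow> B (tens as) = \<Phi> as))"

definition A2_adjoint ::
  "((complex \<Rightarrow> complex) \<Rightarrow> complex \<Rightarrow> complex) \<Rightarrow> (complex \<Rightarrow> complex) \<Rightarrow> complex \<Rightarrow> complex" where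
  "A2_adjoint T g =
     (THE h. h \<in> A2_disc \<and> (\<forall>f\<in>A2_disc. L2_inner disc_measure (T f) g = L2_inner disc_measure f h))"

text \<open>An element of the direct sum is a function \<open>F\<close> on the disjoint union of all polydiscs;
  its component in degree \<open>p\<close> is the function \<open>z \<mapsto> F (p, z)\<close>, i.e. \<^term>\<open>curry F p\<close>.\<close>

type_synonym graded = "nat \<times> (nat \<Rightarrow> complex) \<Rightarrow> complex"

definition SymA2 :: "graded set" where
  "SymA2 = {F. (\<forall>p. curry F p \<in> SymA2_deg p) \<and> finite {p. curry F p \<noteq> (\<lambda>_. 0)}}"

definition Hk :: "nat \<Rightarrow> graded set" where
  "Hk k = {F \<in> SymA2. \<forall>p>k. curry F p = (\<lambda>_. 0)}"

definition sym_inner :: "graded \<Rightarrow> graded \<Rightarrow> complex" where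
  "sym_inner F G =
     (\<Sum>p | curry F p \<noteq> (\<lambda>_. 0). L2_inner (poly_measure p) (curry F p) (curry G p))"

definition sym_norm :: "graded \<Rightarrow> real" where
  "sym_norm F = sqrt (Re (sym_inner F F))"

definition T_op :: "(complex \<Rightarrow> complex) \<Rightarrow> (complex \<Rightarrow> complex) \<Rightarrow> complex \<Rightarrow> complex" where
  "T_op \<phi> f = (\<lambda>z. if z \<in> disc then deriv \<phi> z * f (\<phi> z) else 0)"

definition rho_cl_disc :: "(complex \<Rightarrow> complex) \<Rightarrow> (complex \<Rightarrow> complex) \<Rightarrow> complex \<Rightarrow> complex" where
  "rho_cl_disc \<phi> = A2_adjoint (T_op (conj_map \<phi>))"

definition rho_cl_deg ::
  "nat \<Rightarrow> (complex \<Rightarrow> complex) \<Rightarrow> ((nat \<Rightarrow> complex) \<Rightarrow> complex) \<Rightarrow> (nat \<Rightarrow> complex) \<Rightarrow> complex" where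
  "rho_cl_deg p \<phi> = tensor_extension p p (\<lambda>as. tens (map (rho_cl_disc \<phi>) as))"

definition rho_cl :: "(complex \<Rightarrow> complex) \<Rightarrow> graded \<Rightarrow> graded" where
  "rho_cl \<phi> F = (\<lambda>(p, z). rho_cl_deg p \<phi> (curry F p) z)"

definition partial_pair :: "(complex \<Rightarrow> complex) \<Rightarrow> ((nat \<Rightarrow> complex) \<Rightarrow> complex) \<Rightarrow> complex" where
  "partial_pair \<phi> P = (LINT z|poly_measure 2. F_kernel \<phi> (cnj (z 0)) (cnj (z 1)) * P z)"

text \<open>The contraction from tensor degree \<open>m + 2\<close> to degree \<open>m\<close>; \<^term>\<open>nths as (- {i, j})\<close> omits
  the factors number \<open>i\<close> and \<open>j\<close>.\<close>

definition partial_deg ::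
  "nat \<Rightarrow> (complex \<Rightarrow> complex) \<Rightarrow> ((nat \<Rightarrow> complex) \<Rightarrow> complex) \<Rightarrow> (nat \<Rightarrow> complex) \<Rightarrow> complex" where
  "partial_deg m \<phi> = tensor_extension (m + 2) m
     (\<lambda>as z. \<Sum>(i, j) | i < j \<and> j < length as.
        partial_pair \<phi> (tens [as ! i, as ! j]) * tens (nths as (- {i, j})) z)"

text \<open>The components of \<open>F\<close> in degrees 0 and 1 do not contribute.\<close>

definition partial_op :: "(complex \<Rightarrow> complex) \<Rightarrow> graded \<Rightarrow> graded" where
  "partial_op \<phi> F = (\<lambda>(m, z). partial_deg m \<phi> (curry F (m + 2)) z)"

text \<open>The exponential series is a finite sum on each vector, because \<^term>\<open>partial_op \<phi>\<close> is locally
  nilpotent.\<close>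

definition exp_partial :: "(complex \<Rightarrow> complex) \<Rightarrow> graded \<Rightarrow> graded" where
  "exp_partial \<phi> F =
     (\<lambda>x. \<Sum>n | (partial_op \<phi> ^^ n) F \<noteq> (\<lambda>_. 0). (partial_op \<phi> ^^ n) F x / fact n)"

definition rho :: "(complex \<Rightarrow> complex) \<Rightarrow> graded \<Rightarrow> graded" where
  "rho \<phi> F = rho_cl \<phi> (exp_partial \<phi> F)"

definition CE_HS :: "(complex \<Rightarrow> complex) set" where
  "CE_HS = {\<phi> \<in> CE_emb. square_integrable (poly_measure 2) (\<lambda>z. F_kernel \<phi> (z 0) (z 1))}"

definition psu :: "real \<Rightarrow> complex \<Rightarrow> complex \<Rightarrow> complex" where
  "psu \<theta> \<alpha> = (\<lambda>z\<in>disc. cis \<theta> * ((z - \<alpha>) / (1 - cnj \<alpha> * z)))"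

definition PSU11 :: "(complex \<Rightarrow> complex) set" where
  "PSU11 = {psu \<theta> \<alpha> | \<theta> \<alpha>. cmod \<alpha> < 1}"

text \<open>The Lie group topology, as the quotient topology for the parametrisation
  \<^term>\<open>psu\<close> by pairs of an angle and a point of the disc.\<close>

definition PSU11_topology :: "(complex \<Rightarrow> complex) topology" where
  "PSU11_topology =
     topology (\<lambda>U. U \<subseteq> PSU11 \<and> open {(\<theta>, \<alpha>). cmod \<alpha> < 1 \<and> psu \<theta> \<alpha> \<in> U})"

lemma openin_PSU11_topology:
  "openin PSU11_topology U \<longleftrightarrow> U \<subseteq> PSU11 \<and> open {(\<theta>, \<alpha>). cmod \<alpha> < 1 \<and> psu \<theta> \<alpha> \<in> U}"
proof -
  let ?P = "\<lambda>U. {(\<theta>, \<alpha>). cmod \<alpha> < 1 \<and> psu \<theta> \<alpha> \<in> U}"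
  have int: "?P (S \<inter> T) = ?P S \<inter> ?P T" for S T by auto
  have un: "?P (\<Union>\<K>) = (\<Union>K\<in>\<K>. ?P K)" for \<K> by auto
  have "istopology (\<lambda>U. U \<subseteq> PSU11 \<and> open (?P U))"
    unfolding istopology_def int un by (blast intro: open_Int open_UN)
  then show ?thesis
    unfolding PSU11_topology_def by (simp add: topology_inverse')
qed

lemma quotient_map_PSU11_topology:
  "quotient_map (top_of_set (UNIV \<times> disc)) PSU11_topology (\<lambda>(\<theta>, \<alpha>). psu \<theta> \<alpha>)"
proof -
  let ?P = "\<lambda>U. {(\<theta>, \<alpha>). cmod \<alpha> < 1 \<and> psu \<theta> \<alpha> \<in> U}"
  have pre: "{x \<in> UNIV \<times> disc. (case x of (\<theta>, \<alpha>) \<Rightarrow> psu \<theta> \<alpha>) \<in> U} = ?P U" for U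
    by auto
  have mem: "psu \<theta> \<alpha> \<in> PSU11" if "cmod \<alpha> < 1" for \<theta> \<alpha>
    using that unfolding PSU11_def by blast
  have img: "(\<lambda>(\<theta>, \<alpha>). psu \<theta> \<alpha>) ` (UNIV \<times> disc) = PSU11"
  proof
    show "(\<lambda>(\<theta>, \<alpha>). psu \<theta> \<alpha>) ` (UNIV \<times> disc) \<subseteq> PSU11"
      using mem by auto
    show "PSU11 \<subseteq> (\<lambda>(\<theta>, \<alpha>). psu \<theta> \<alpha>) ` (UNIV \<times> disc)"
    proof
      fix g assume "g \<in> PSU11"
      then obtain \<theta> \<alpha> where "g = psu \<theta> \<alpha>" "cmod \<alpha> < 1"
        unfolding PSU11_def by blast
      then show "g \<in> (\<lambda>(\<theta>, \<alpha>). psu \<theta> \<alpha>) ` (UNIV \<times> disc)"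
        by (intro image_eqI[of _ _ "(\<theta>, \<alpha>)"]) auto
    qed
  qed
  have "?P PSU11 = UNIV \<times> disc"
    using mem by auto
  then have "openin PSU11_topology PSU11"
    by (simp add: openin_PSU11_topology open_Times)
  then have ts: "topspace PSU11_topology = PSU11"
    using openin_PSU11_topology[of "topspace PSU11_topology"] openin_subset by blast
  have op: "open (UNIV \<times> disc :: (real \<times> complex) set)" by (simp add: open_Times)
  have sub: "?P U \<subseteq> UNIV \<times> disc" for U by auto
  have "openin (top_of_set (UNIV \<times> disc)) (?P U) \<longleftrightarrow> open (?P U)" for U
    unfolding openin_open_eq[OF op] using sub[of U] by blast
  then show ?thesis
    unfolding quotient_map_def topspace_euclidean_subtopology ts pre openin_PSU11_topology
    using img by blast
qed

definition strongly_continuous_unitary_rep ::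
  "nat \<Rightarrow> ((complex \<Rightarrow> complex) \<Rightarrow> graded \<Rightarrow> graded) \<Rightarrow> bool" where
  "strongly_continuous_unitary_rep k r \<longleftrightarrow>
     (\<forall>g\<in>PSU11. unitary_op (Hk k) sym_inner (r g)) \<and>
     (\<forall>F\<in>Hk k. r (\<lambda>z\<in>disc. z) F = F) \<and>
     (\<forall>g\<in>PSU11. \<forall>h\<in>PSU11. \<forall>F\<in>Hk k. r (compose disc g h) F = r g (r h F)) \<and>
     (\<forall>F\<in>Hk k. continuous_map PSU11_topology
        (Metric_space.mtopology (Hk k) (\<lambda>G G'. sym_norm (\<lambda>x. G x - G' x))) (\<lambda>g. r g F))"

end

theory Submission
  imports Defs
begin

text \<open>
  The representation is defined by completion and by adjoints, so that none of its values is given by a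
  formula.  Every operator in it is, however, the adjoint of an explicit operator on functions, and all
  identities are checked on the explicit side.  In tensor degree \<open>p\<close> the classical part of \<open>rho \<phi>\<close> is the
  adjoint of the weighted composition operator
  \<open>T\<^sub>\<psi> f (z\<^sub>1, \<dots>, z\<^sub>p) = \<psi>'(z\<^sub>1) \<cdots> \<psi>'(z\<^sub>p) f (\<psi>(z\<^sub>1), \<dots>, \<psi>(z\<^sub>p))\<close> with \<open>\<psi> = conj_map \<phi>\<close>
  (\<open>rho_cl_deg_eq\<close>).  On symmetric tensors the contraction by \<open>\<phi>\<close> is a multiple of the adjoint \<open>c(G)\<close> of the
  operator \<open>f \<mapsto> f \<otimes> G\<close>, where \<open>G\<close> is the kernel \<open>F\<close> of \<open>conj_map \<phi>\<close>, extended holomorphically across the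
  diagonal; the multiple is the number of pairs of tensor factors (\<open>partial_op_eq\<close>).

  Multiplicativity rests on three identities for the explicit operators.  The kernel is a cocycle:
  writing \<open>G\<^sub>\<phi>\<close> for the extended kernel of \<open>\<phi>\<close>, the chain rule gives \<open>G\<^sub>\<phi>\<^sub>\<psi> = T\<^sub>\<psi> G\<^sub>\<phi> + G\<^sub>\<psi>\<close>
  (\<open>kernel2_compose\<close>).  Composition is compatible with tensor products, \<open>T\<^sub>\<psi> (f \<otimes> G) = T\<^sub>\<psi> f \<otimes> T\<^sub>\<psi> G\<close>, and
  taking adjoints turns this into \<open>c(G) T\<^sub>\<psi>\<^sup>* = T\<^sub>\<psi>\<^sup>* c(T\<^sub>\<psi> G)\<close> (\<open>contr_poly_T_adj\<close>).  Finally
  contractions of symmetric tensors are additive in the kernel and commute with each other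
  (\<open>contr_commute\<close>), so that their exponentials multiply (\<open>exp_op_add\<close>).  With all maps replaced by their
  conjugates, these identities combine to
  \<open>T\<^sub>\<phi>\<^sup>* exp c(G\<^sub>\<phi>) T\<^sub>\<psi>\<^sup>* exp c(G\<^sub>\<psi>) = T\<^sub>\<phi>\<^sup>* T\<^sub>\<psi>\<^sup>* exp c(T\<^sub>\<psi> G\<^sub>\<phi> + G\<^sub>\<psi>) = T\<^sub>\<phi>\<^sub>\<psi>\<^sup>* exp c(G\<^sub>\<phi>\<^sub>\<psi>)\<close>.

  The analysis enters through the reproducing kernel.  The mean value property of holomorphic functions,
  moved around the disc by automorphisms, shows that evaluation at \<open>w\<close> is the inner product with
  \<open>\<Prod>i. 1 / (1 - cnj (w\<^sub>i) z\<^sub>i)\<^sup>2\<close> (\<open>A2_reproducing\<close>).  Hence Bergman spaces are complete and admit adjoints by the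
  Riesz theorem; and since these kernels are elementary tensors, a bounded operator is determined by its
  values on elementary tensors (\<open>tensor_extension_eq\<close>).  That weighted composition is a contraction is the
  change of variables formula for injective holomorphic maps.

  On tensors of degree at most \<open>k\<close> the exponential is a fixed finite sum of bounded operators, which
  gives boundedness.  For an automorphism the kernel vanishes identically, so only \<open>T\<^sub>\<psi>\<^sup>*\<close> is left; \<open>T\<^sub>\<psi>\<close>
  is isometric because \<open>\<psi>\<close> is onto, and its adjoint is composition with the inverse automorphism.  These
  explicit functions depend continuously on the parameters at every point, and their norm is constant;
  together this yields convergence in the mean (\<open>L2_convergence\<close>), that is, strong continuity.
\<close>

section \<open>Square integrable functions\<close>

lemma cmod_add_sq_le: "(cmod (a + b))\<^sup>2 \<le> 2 * (cmod a)\<^sup>2 + 2 * (cmod b)\<^sup>2"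
proof -
  have "(cmod (a + b))\<^sup>2 \<le> (cmod a + cmod b)\<^sup>2"
    by (intro power_mono norm_triangle_ineq) auto
  also have "\<dots> \<le> 2 * (cmod a)\<^sup>2 + 2 * (cmod b)\<^sup>2"
    using sum_squares_bound[of "cmod a" "cmod b"] by (simp add: power2_sum)
  finally show ?thesis .
qed

lemma square_integrable_measurable:
  "square_integrable M f \<Longrightarrow> f \<in> borel_measurable M"
  by (simp add: square_integrable_def)

lemma square_integrable_iff_nn:
  "square_integrable M f \<longleftrightarrow>
     f \<in> borel_measurable M \<and> (\<integral>\<^sup>+x. ennreal ((cmod (f x))\<^sup>2) \<partial>M) < \<infinity>"
  unfolding square_integrable_def by (auto simp: integrable_iff_bounded)

lemma cnj_measurable: "f \<in> borel_measurable M \<Longrightarrow> (\<lambda>x. cnj (f x)) \<in> borel_measurable M"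
  by (rule borel_measurable_continuous_on) (auto intro: continuous_intros)

lemma square_integrable_zero: "square_integrable M (\<lambda>_. 0)"
  by (simp add: square_integrable_def)

lemma square_integrable_add:
  assumes "square_integrable M f" "square_integrable M g"
  shows "square_integrable M (\<lambda>x. f x + g x)"
  unfolding square_integrable_def
proof
  show m: "(\<lambda>x. f x + g x) \<in> borel_measurable M"
    using assms by (auto simp: square_integrable_def)
  show "integrable M (\<lambda>x. (cmod (f x + g x))\<^sup>2)"
  proof (rule Bochner_Integration.integrable_bound)
    show "integrable M (\<lambda>x. 2 * (cmod (f x))\<^sup>2 + 2 * (cmod (g x))\<^sup>2)"
      using assms by (auto simp: square_integrable_def)
    show "(\<lambda>x. (cmod (f x + g x))\<^sup>2) \<in> borel_measurable M"
      using m by measurable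
    show "AE x in M. norm ((cmod (f x + g x))\<^sup>2) \<le> norm (2 * (cmod (f x))\<^sup>2 + 2 * (cmod (g x))\<^sup>2)"
      by (rule AE_I2) (simp add: cmod_add_sq_le)
  qed
qed

lemma square_integrable_scale:
  assumes "square_integrable M f"
  shows "square_integrable M (\<lambda>x. c * f x)"
  using assms by (auto simp: square_integrable_def norm_mult power_mult_distrib)

lemma square_integrable_diff:
  assumes "square_integrable M f" "square_integrable M g"
  shows "square_integrable M (\<lambda>x. f x - g x)"
  using square_integrable_add[OF assms(1) square_integrable_scale[OF assms(2), of "-1"]] by simp

lemma square_integrable_mult:
  assumes "square_integrable M f" "square_integrable M g"
  shows "integrable M (\<lambda>x. f x * cnj (g x))"
proof (rule Bochner_Integration.integrable_bound)
  show "integrable M (\<lambda>x. (cmod (f x))\<^sup>2 + (cmod (g x))\<^sup>2)"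
    using assms by (auto simp: square_integrable_def)
  show "(\<lambda>x. f x * cnj (g x)) \<in> borel_measurable M"
    by (rule borel_measurable_times[OF square_integrable_measurable[OF assms(1)]
          cnj_measurable[OF square_integrable_measurable[OF assms(2)]]])
  have "a * b \<le> a\<^sup>2 + b\<^sup>2" if "0 \<le> a" "0 \<le> b" for a b :: real
  proof -
    have "2 * (a * b) \<le> a\<^sup>2 + b\<^sup>2" using sum_squares_bound[of a b] by simp
    moreover have "0 \<le> a * b" using that by simp
    ultimately show ?thesis by linarith
  qed
  then show "AE x in M. norm (f x * cnj (g x)) \<le> norm ((cmod (f x))\<^sup>2 + (cmod (g x))\<^sup>2)"
    by (intro AE_I2) (simp add: norm_mult)
qed

lemma L2_inner_add_left:
  assumes "square_integrable M f" "square_integrable M g" "square_integrable M h"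
  shows "L2_inner M (\<lambda>x. f x + g x) h = L2_inner M f h + L2_inner M g h"
  unfolding L2_inner_def distrib_right
  by (intro Bochner_Integration.integral_add square_integrable_mult assms)

lemma L2_inner_add_right:
  assumes "square_integrable M f" "square_integrable M g" "square_integrable M h"
  shows "L2_inner M h (\<lambda>x. f x + g x) = L2_inner M h f + L2_inner M h g"
  unfolding L2_inner_def distrib_left complex_cnj_add
  by (intro Bochner_Integration.integral_add square_integrable_mult assms)

lemma L2_inner_scale_left: "L2_inner M (\<lambda>x. c * f x) g = c * L2_inner M f g"
  unfolding L2_inner_def mult.assoc by simp

lemma L2_inner_scale_right: "L2_inner M f (\<lambda>x. c * g x) = cnj c * L2_inner M f g"
proof -
  have "L2_inner M f (\<lambda>x. c * g x) = (LINT x|M. cnj c * (f x * cnj (g x)))"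
    unfolding L2_inner_def by (intro Bochner_Integration.integral_cong) auto
  then show ?thesis by (simp add: L2_inner_def)
qed

lemma L2_inner_diff_left:
  assumes "square_integrable M f" "square_integrable M g" "square_integrable M h"
  shows "L2_inner M (\<lambda>x. f x - g x) h = L2_inner M f h - L2_inner M g h"
  unfolding L2_inner_def left_diff_distrib
  by (intro Bochner_Integration.integral_diff square_integrable_mult assms)

lemma L2_inner_diff_right:
  assumes "square_integrable M f" "square_integrable M g" "square_integrable M h"
  shows "L2_inner M h (\<lambda>x. f x - g x) = L2_inner M h f - L2_inner M h g"
  unfolding L2_inner_def right_diff_distrib complex_cnj_diff
  by (intro Bochner_Integration.integral_diff square_integrable_mult assms)

lemma L2_inner_cnj: "L2_inner M g f = cnj (L2_inner M f g)"
proof -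
  have "cnj (L2_inner M f g) = (LINT x|M. cnj (f x * cnj (g x)))"
    unfolding L2_inner_def by (rule Bochner_Integration.integral_cnj[symmetric])
  also have "\<dots> = L2_inner M g f"
    unfolding L2_inner_def by (intro Bochner_Integration.integral_cong refl) (simp add: mult.commute)
  finally show ?thesis by (rule sym)
qed

lemma L2_inner_zero_left [simp]: "L2_inner M (\<lambda>_. 0) g = 0"
  by (simp add: L2_inner_def)

lemma L2_inner_zero_right [simp]: "L2_inner M g (\<lambda>_. 0) = 0"
  by (simp add: L2_inner_def)

lemma L2_norm_nonneg [simp]: "0 \<le> L2_norm M f"
  by (simp add: L2_norm_def)

lemma L2_norm_sq: "(L2_norm M f)\<^sup>2 = (LINT x|M. (cmod (f x))\<^sup>2)"
  by (simp add: L2_norm_def)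

lemma L2_inner_self: "L2_inner M f f = of_real ((L2_norm M f)\<^sup>2)"
  unfolding L2_norm_sq L2_inner_def integral_complex_of_real[symmetric]
  by (intro Bochner_Integration.integral_cong refl complex_norm_square[symmetric])

lemma L2_norm_zero [simp]: "L2_norm M (\<lambda>_. 0) = 0"
  by (simp add: L2_norm_def)

lemma nn_integral_L2_norm:
  assumes "square_integrable M f"
  shows "(\<integral>\<^sup>+x. ennreal ((cmod (f x))\<^sup>2) \<partial>M) = ennreal ((L2_norm M f)\<^sup>2)"
  unfolding L2_norm_sq using assms
  by (intro nn_integral_eq_integral) (auto simp: square_integrable_def)

lemma L2_norm_le_nn:
  assumes "f \<in> borel_measurable M"
    and "(\<integral>\<^sup>+x. ennreal ((cmod (f x))\<^sup>2) \<partial>M) \<le> ennreal (B\<^sup>2)" "0 \<le> B"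
  shows "square_integrable M f" "L2_norm M f \<le> B"
proof -
  show sq: "square_integrable M f"
    using assms(1) le_less_trans[OF assms(2) ennreal_less_top] by (simp add: square_integrable_iff_nn)
  have "(L2_norm M f)\<^sup>2 \<le> B\<^sup>2"
    using assms(2) nn_integral_L2_norm[OF sq] by simp
  then show "L2_norm M f \<le> B"
    using assms(3) by (rule power2_le_imp_le)
qed

lemma L2_Cauchy_Schwarz:
  assumes f: "square_integrable M f" and g: "square_integrable M g"
  shows "cmod (L2_inner M f g) \<le> L2_norm M f * L2_norm M g"
proof -
  have [measurable]: "f \<in> borel_measurable M" "g \<in> borel_measurable M"
    using f g by (auto simp: square_integrable_def)
  let ?I = "LINT x|M. cmod (f x * cnj (g x))"
  have 1: "cmod (L2_inner M f g) \<le> ?I"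
    unfolding L2_inner_def by (rule integral_norm_bound)
  have "ennreal ?I = (\<integral>\<^sup>+x. ennreal (cmod (f x * cnj (g x))) \<partial>M)"
    by (rule nn_integral_eq_integral[symmetric])
       (use square_integrable_mult[OF f g] in auto)
  then have "ennreal (?I\<^sup>2) = (\<integral>\<^sup>+x. ennreal (cmod (f x)) * ennreal (cmod (g x)) \<partial>M)\<^sup>2"
    by (simp add: norm_mult ennreal_mult ennreal_power[symmetric])
  also have "\<dots> \<le> (\<integral>\<^sup>+x. (ennreal (cmod (f x)))\<^sup>2 \<partial>M) * (\<integral>\<^sup>+x. (ennreal (cmod (g x)))\<^sup>2 \<partial>M)"
    by (rule Cauchy_Schwarz_nn_integral) auto
  also have "\<dots> = ennreal ((L2_norm M f * L2_norm M g)\<^sup>2)"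
    using nn_integral_L2_norm[OF f] nn_integral_L2_norm[OF g]
    by (simp add: ennreal_power ennreal_mult power_mult_distrib)
  finally have "?I\<^sup>2 \<le> (L2_norm M f * L2_norm M g)\<^sup>2"
    by simp
  then have "?I \<le> L2_norm M f * L2_norm M g"
    by (rule power2_le_imp_le) simp
  with 1 show ?thesis by linarith
qed

lemma L2_norm_scale: "L2_norm M (\<lambda>x. c * f x) = cmod c * L2_norm M f"
  unfolding L2_norm_def by (simp add: norm_mult power_mult_distrib real_sqrt_mult)

lemma L2_norm_add_sq:
  assumes "square_integrable M f" "square_integrable M g"
  shows "(L2_norm M (\<lambda>x. f x + g x))\<^sup>2 =
         (L2_norm M f)\<^sup>2 + 2 * Re (L2_inner M f g) + (L2_norm M g)\<^sup>2"
proof -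
  have "complex_of_real ((L2_norm M (\<lambda>x. f x + g x))\<^sup>2) = L2_inner M (\<lambda>x. f x + g x) (\<lambda>x. f x + g x)"
    by (simp add: L2_inner_self)
  also have "\<dots> = L2_inner M f f + L2_inner M f g + (L2_inner M g f + L2_inner M g g)"
    using assms by (simp add: L2_inner_add_left L2_inner_add_right square_integrable_add)
  also have "\<dots> = of_real ((L2_norm M f)\<^sup>2) + L2_inner M f g + (cnj (L2_inner M f g) + of_real ((L2_norm M g)\<^sup>2))"
    by (simp add: L2_inner_self L2_inner_cnj[of M g f])
  finally show ?thesis
    by (simp add: complex_eq_iff)
qed

lemma L2_norm_triangle:
  assumes "square_integrable M f" "square_integrable M g"
  shows "L2_norm M (\<lambda>x. f x + g x) \<le> L2_norm M f + L2_norm M g"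
proof (rule power2_le_imp_le)
  have "Re (L2_inner M f g) \<le> L2_norm M f * L2_norm M g"
    using L2_Cauchy_Schwarz[OF assms] complex_Re_le_cmod order_trans by blast
  then show "(L2_norm M (\<lambda>x. f x + g x))\<^sup>2 \<le> (L2_norm M f + L2_norm M g)\<^sup>2"
    by (simp add: L2_norm_add_sq[OF assms] power2_sum)
qed simp

lemma L2_norm_diff_commute: "L2_norm M (\<lambda>x. f x - g x) = L2_norm M (\<lambda>x. g x - f x)"
  unfolding L2_norm_def by (simp add: norm_minus_commute)

lemma L2_parallelogram:
  assumes "square_integrable M f" "square_integrable M g"
  shows "(L2_norm M (\<lambda>x. f x + g x))\<^sup>2 + (L2_norm M (\<lambda>x. f x - g x))\<^sup>2 =
         2 * (L2_norm M f)\<^sup>2 + 2 * (L2_norm M g)\<^sup>2"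
  using L2_norm_add_sq[OF assms] L2_norm_add_sq[OF assms(1) square_integrable_scale[OF assms(2), of "-1"]]
    L2_norm_scale[of M "-1" g] L2_inner_scale_right[of M f "-1" g]
  by simp

lemma L2_inner_cong:
  assumes "\<And>x. x \<in> space M \<Longrightarrow> f x = f' x" "\<And>x. x \<in> space M \<Longrightarrow> g x = g' x"
  shows "L2_inner M f g = L2_inner M f' g'"
  unfolding L2_inner_def using assms by (intro Bochner_Integration.integral_cong) auto

lemma square_integrable_cong:
  assumes "\<And>x. x \<in> space M \<Longrightarrow> f x = g x"
  shows "square_integrable M f \<longleftrightarrow> square_integrable M g"
proof -
  have "f \<in> borel_measurable M \<longleftrightarrow> g \<in> borel_measurable M"
    using assms by (intro measurable_cong) auto
  moreover have "integrable M (\<lambda>x. (cmod (f x))\<^sup>2) \<longleftrightarrow> integrable M (\<lambda>x. (cmod (g x))\<^sup>2)"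
    using assms by (intro Bochner_Integration.integrable_cong) auto
  ultimately show ?thesis by (simp add: square_integrable_def)
qed

section \<open>Hilbert spaces of functions\<close>

text \<open>The vectors are functions rather than classes modulo null sets: by \<open>definite\<close> a null function in the
  space vanishes everywhere, as is the case for holomorphic functions.\<close>

locale hilbert_fun =
  fixes M :: "'x measure" and V :: "('x \<Rightarrow> complex) set"
  assumes sq: "f \<in> V \<Longrightarrow> square_integrable M f"
    and zero: "(\<lambda>_. 0) \<in> V"
    and add: "f \<in> V \<Longrightarrow> g \<in> V \<Longrightarrow> (\<lambda>x. f x + g x) \<in> V"
    and scale: "f \<in> V \<Longrightarrow> (\<lambda>x. c * f x) \<in> V"
    and definite: "f \<in> V \<Longrightarrow> L2_norm M f = 0 \<Longrightarrow> f = (\<lambda>_. 0)"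
    and complete: "(\<And>n. X n \<in> V) \<Longrightarrow>
        (\<And>e. 0 < e \<Longrightarrow> \<exists>N. \<forall>m\<ge>N. \<forall>n\<ge>N. L2_norm M (\<lambda>x. X m x - X n x) < e) \<Longrightarrow>
        \<exists>h\<in>V. (\<lambda>n. L2_norm M (\<lambda>x. X n x - h x)) \<longlonglongrightarrow> 0"
begin

lemma diff: "f \<in> V \<Longrightarrow> g \<in> V \<Longrightarrow> (\<lambda>x. f x - g x) \<in> V"
  using add[OF _ scale[of g "-1"], of f] by simp

text \<open>Test against the difference \<open>f - g\<close>.\<close>

lemma eqI_inner:
  assumes f: "f \<in> V" and g: "g \<in> V" and eq: "\<And>h. h \<in> V \<Longrightarrow> L2_inner M h f = L2_inner M h g"
  shows "f = g"
proof -
  let ?d = "\<lambda>x. f x - g x"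
  have d: "?d \<in> V" by (rule diff[OF f g])
  have "L2_inner M ?d ?d = L2_inner M ?d f - L2_inner M ?d g"
    by (intro L2_inner_diff_right sq f g d)
  also have "\<dots> = 0" using eq[OF d] by simp
  finally have "L2_norm M ?d = 0"
    by (simp add: L2_inner_self)
  from definite[OF d this] show "f = g"
    by (simp add: fun_eq_iff)
qed

text \<open>Riesz representation: the representing vector minimises
  \<open>\<parallel>f\<parallel>\<^sup>2 - 2 Re \<Lambda>(f)\<close>.  By the parallelogram law every minimising sequence is Cauchy, and the
  first variation at its limit gives the formula.\<close>

lemma riesz:
  assumes ladd: "\<And>f g. f \<in> V \<Longrightarrow> g \<in> V \<Longrightarrow> \<Lambda> (\<lambda>x. f x + g x) = \<Lambda> f + \<Lambda> g"
    and lscale: "\<And>c f. f \<in> V \<Longrightarrow> \<Lambda> (\<lambda>x. c * f x) = c * \<Lambda> f"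
    and bound: "\<And>f. f \<in> V \<Longrightarrow> cmod (\<Lambda> f) \<le> C * L2_norm M f"
  shows "\<exists>h\<in>V. \<forall>f\<in>V. \<Lambda> f = L2_inner M f h"
proof -
  let ?N = "L2_norm M"
  define J where "J f = (?N f)\<^sup>2 - 2 * Re (\<Lambda> f)" for f
  have lower: "- (C\<^sup>2) \<le> J f" if "f \<in> V" for f
  proof -
    have "Re (\<Lambda> f) \<le> C * ?N f"
      using bound[OF that] complex_Re_le_cmod order_trans by blast
    moreover have "0 \<le> (?N f - C)\<^sup>2" by simp
    ultimately show ?thesis unfolding J_def by (simp add: power2_diff mult.commute mult.assoc)
  qed
  then have bdd: "bdd_below (J ` V)" by (auto intro!: bdd_belowI)
  define I where "I = Inf (J ` V)"
  have I_le: "I \<le> J f" if "f \<in> V" for f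
    unfolding I_def using bdd that by (auto intro: cInf_lower)
  have "\<exists>f\<in>V. J f < I + inverse (real (Suc n))" for n
  proof -
    have "I < I + inverse (real (Suc n))" by simp
    then show ?thesis
      unfolding I_def using cInf_lessD[of "J ` V"] zero by blast
  qed
  then obtain X where X: "\<And>n. X n \<in> V" and JX: "\<And>n. J (X n) < I + inverse (real (Suc n))"
    by metis
  \<comment> \<open>The value of \<open>J\<close> at the midpoint of two almost minimising vectors is at least the infimum.\<close>
  have cauchy: "(?N (\<lambda>x. X m x - X n x))\<^sup>2 \<le> 2 * inverse (real (Suc m)) + 2 * inverse (real (Suc n))" for m n
  proof -
    let ?h = "\<lambda>x. (1/2) * (X m x + X n x)"
    have "I \<le> J ?h" by (intro I_le scale add X)
    moreover have "J ?h = (?N (\<lambda>x. X m x + X n x))\<^sup>2 / 4 - Re (\<Lambda> (X m)) - Re (\<Lambda> (X n))"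
      unfolding J_def L2_norm_scale lscale[OF add[OF X X]] ladd[OF X X]
      by (simp add: power_mult_distrib power_divide add_divide_distrib)
    moreover have "(?N (\<lambda>x. X m x + X n x))\<^sup>2 + (?N (\<lambda>x. X m x - X n x))\<^sup>2 = 2 * (?N (X m))\<^sup>2 + 2 * (?N (X n))\<^sup>2"
      by (intro L2_parallelogram sq X)
    ultimately show ?thesis
      using JX[of m] JX[of n] unfolding J_def by linarith
  qed
  have "\<exists>h\<in>V. (\<lambda>n. ?N (\<lambda>x. X n x - h x)) \<longlonglongrightarrow> 0"
  proof (rule complete[OF X])
    fix e :: real assume e: "0 < e"
    obtain K where K: "inverse (real (Suc K)) < e\<^sup>2 / 4"
      using reals_Archimedean[of "e\<^sup>2 / 4"] e by auto
    show "\<exists>N. \<forall>m\<ge>N. \<forall>n\<ge>N. ?N (\<lambda>x. X m x - X n x) < e"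
    proof (intro exI allI impI)
      fix m n assume "K \<le> m" "K \<le> n"
      then have "inverse (real (Suc m)) \<le> inverse (real (Suc K))" "inverse (real (Suc n)) \<le> inverse (real (Suc K))"
        by auto
      then have "(?N (\<lambda>x. X m x - X n x))\<^sup>2 < e\<^sup>2"
        using cauchy[of m n] K by linarith
      then show "?N (\<lambda>x. X m x - X n x) < e"
        by (rule power2_less_imp_less) (use e in simp)
    qed
  qed
  then obtain h where h: "h \<in> V" and lim: "(\<lambda>n. ?N (\<lambda>x. X n x - h x)) \<longlonglongrightarrow> 0" by blast
  have inner_lim: "(\<lambda>n. L2_inner M (X n) f) \<longlonglongrightarrow> L2_inner M h f" if f: "f \<in> V" for f
  proof (rule Lim_null_comparison[THEN LIM_zero_cancel])
    show "\<forall>\<^sub>F n in sequentially. norm (L2_inner M (X n) f - L2_inner M h f) \<le> ?N (\<lambda>x. X n x - h x) * ?N f"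
    proof (rule always_eventually, rule allI)
      fix n
      have "L2_inner M (X n) f - L2_inner M h f = L2_inner M (\<lambda>x. X n x - h x) f"
        by (intro L2_inner_diff_left[symmetric] sq X h f)
      then show "norm (L2_inner M (X n) f - L2_inner M h f) \<le> ?N (\<lambda>x. X n x - h x) * ?N f"
        using L2_Cauchy_Schwarz[OF sq[OF diff[OF X h]] sq[OF f], of n] by simp
    qed
    show "(\<lambda>n. ?N (\<lambda>x. X n x - h x) * ?N f) \<longlonglongrightarrow> 0"
      using tendsto_mult_left_zero[OF lim] .
  qed
  have real_part: "Re (\<Lambda> f) = Re (L2_inner M h f)" if f: "f \<in> V" for f
  proof -
    \<comment> \<open>Moving from the minimiser in the direction \<open>f\<close> does not decrease \<open>J\<close>.\<close>
    have var: "0 \<le> t\<^sup>2 * (?N f)\<^sup>2 + 2 * t * (Re (L2_inner M h f) - Re (\<Lambda> f))" for t :: real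
    proof (rule LIMSEQ_le_const)
      have "(\<lambda>n. t\<^sup>2 * (?N f)\<^sup>2 + 2 * t * (Re (L2_inner M (X n) f) - Re (\<Lambda> f)) + inverse (real (Suc n)))
          \<longlonglongrightarrow> t\<^sup>2 * (?N f)\<^sup>2 + 2 * t * (Re (L2_inner M h f) - Re (\<Lambda> f)) + 0"
        by (intro tendsto_intros inner_lim[OF f] LIMSEQ_inverse_real_of_nat)
      then show "(\<lambda>n. t\<^sup>2 * (?N f)\<^sup>2 + 2 * t * (Re (L2_inner M (X n) f) - Re (\<Lambda> f)) + inverse (real (Suc n)))
          \<longlonglongrightarrow> t\<^sup>2 * (?N f)\<^sup>2 + 2 * t * (Re (L2_inner M h f) - Re (\<Lambda> f))"
        by simp
      show "\<exists>N. \<forall>n\<ge>N. 0 \<le> t\<^sup>2 * (?N f)\<^sup>2 + 2 * t * (Re (L2_inner M (X n) f) - Re (\<Lambda> f)) + inverse (real (Suc n))"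
      proof (intro exI allI impI)
        fix n
        let ?g = "\<lambda>x. of_real t * f x"
        have g: "?g \<in> V" by (rule scale[OF f])
        have "J (X n) < J (\<lambda>x. X n x + ?g x) + inverse (real (Suc n))"
          using JX[of n] I_le[OF add[OF X g]] by (meson add_mono le_less_trans less_le_trans add_le_cancel_right)
        moreover have "J (\<lambda>x. X n x + ?g x) = J (X n) + t\<^sup>2 * (?N f)\<^sup>2
            + 2 * t * (Re (L2_inner M (X n) f) - Re (\<Lambda> f))"
          unfolding J_def L2_norm_add_sq[OF sq[OF X] sq[OF g]] ladd[OF X g] lscale[OF f]
            L2_norm_scale L2_inner_scale_right
          by (simp add: power_mult_distrib algebra_simps)
        ultimately show "0 \<le> t\<^sup>2 * (?N f)\<^sup>2 + 2 * t * (Re (L2_inner M (X n) f) - Re (\<Lambda> f)) + inverse (real (Suc n))"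
          by linarith
      qed
    qed
    \<comment> \<open>A parabola through the origin that stays nonnegative has slope 0 there.\<close>
    have quad: "b = 0" if "\<And>t::real. 0 \<le> t\<^sup>2 * a + 2 * t * b" "0 \<le> a" for a b :: real
    proof (rule ccontr)
      assume b: "b \<noteq> 0"
      let ?t = "- b / (a + 1)"
      have "?t\<^sup>2 * a + 2 * ?t * b = (b\<^sup>2 / (a+1)) * (a / (a+1) - 2)"
        by (simp add: power2_eq_square right_diff_distrib)
      moreover have "a / (a+1) - 2 < 0" using \<open>0 \<le> a\<close> by (simp add: field_simps)
      moreover have "b\<^sup>2 / (a+1) > 0" using b \<open>0 \<le> a\<close> by simp
      ultimately have "?t\<^sup>2 * a + 2 * ?t * b < 0" by (metis mult_pos_neg)
      with that(1)[of ?t] show False by linarith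
    qed
    have "Re (L2_inner M h f) - Re (\<Lambda> f) = 0"
      by (rule quad[OF var]) simp
    then show ?thesis by simp
  qed
  have "\<Lambda> f = L2_inner M f h" if f: "f \<in> V" for f
  proof -
    have 1: "Re (\<Lambda> f) = Re (L2_inner M f h)"
      using real_part[OF f] L2_inner_cnj[of M f h] by simp
    \<comment> \<open>The imaginary part at \<open>f\<close> is the real part at \<open>- \<i> f\<close>.\<close>
    have "Re (\<Lambda> (\<lambda>x. - \<i> * f x)) = Re (L2_inner M h (\<lambda>x. - \<i> * f x))"
      by (rule real_part[OF scale[OF f]])
    then have "Im (\<Lambda> f) = Im (L2_inner M f h)"
      unfolding lscale[OF f] L2_inner_scale_right using L2_inner_cnj[of M f h] by simp
    with 1 show ?thesis by (simp add: complex_eq_iff)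
  qed
  with h show ?thesis by blast
qed

end

section \<open>Adjoints\<close>

definition adj ::
  "'x measure \<Rightarrow> ('x \<Rightarrow> complex) set \<Rightarrow> 'y measure
    \<Rightarrow> (('x \<Rightarrow> complex) \<Rightarrow> 'y \<Rightarrow> complex) \<Rightarrow> ('y \<Rightarrow> complex) \<Rightarrow> 'x \<Rightarrow> complex" where
  "adj M V N T g = (THE h. h \<in> V \<and> (\<forall>f\<in>V. L2_inner N (T f) g = L2_inner M f h))"

locale hilbert_op = X: hilbert_fun M V + Y: hilbert_fun N W
  for M :: "'x measure" and V and N :: "'y measure" and W +
  fixes T :: "('x \<Rightarrow> complex) \<Rightarrow> 'y \<Rightarrow> complex" and C :: real
  assumes lin: "linear_op V W T"
    and bound: "f \<in> V \<Longrightarrow> L2_norm N (T f) \<le> C * L2_norm M f"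
    and C_nonneg: "0 \<le> C"
begin

lemma in_W: "f \<in> V \<Longrightarrow> T f \<in> W"
  using lin by (auto simp: linear_op_def)

lemma T_add: "f \<in> V \<Longrightarrow> g \<in> V \<Longrightarrow> T (\<lambda>x. f x + g x) = (\<lambda>y. T f y + T g y)"
  using lin by (auto simp: linear_op_def)

lemma T_scale: "f \<in> V \<Longrightarrow> T (\<lambda>x. c * f x) = (\<lambda>y. c * T f y)"
  using lin by (auto simp: linear_op_def)

abbreviation "Tadj \<equiv> adj M V N T"

lemma adj_ex1:
  assumes g: "g \<in> W"
  shows "\<exists>!h. h \<in> V \<and> (\<forall>f\<in>V. L2_inner N (T f) g = L2_inner M f h)"
proof -
  have "\<exists>h\<in>V. \<forall>f\<in>V. L2_inner N (T f) g = L2_inner M f h"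
  proof (rule X.riesz)
    show "L2_inner N (T (\<lambda>x. f x + f' x)) g = L2_inner N (T f) g + L2_inner N (T f') g"
      if "f \<in> V" "f' \<in> V" for f f'
      using that by (simp add: T_add L2_inner_add_left Y.sq in_W g)
    show "L2_inner N (T (\<lambda>x. c * f x)) g = c * L2_inner N (T f) g" if "f \<in> V" for f c
      using that by (simp add: T_scale L2_inner_scale_left)
    show "cmod (L2_inner N (T f) g) \<le> (C * L2_norm N g) * L2_norm M f" if "f \<in> V" for f
    proof -
      have "cmod (L2_inner N (T f) g) \<le> L2_norm N (T f) * L2_norm N g"
        using that by (intro L2_Cauchy_Schwarz Y.sq in_W g)
      also have "\<dots> \<le> (C * L2_norm M f) * L2_norm N g"
        by (intro mult_right_mono bound that) simp
      finally show ?thesis by (simp add: mult_ac)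
    qed
  qed
  then obtain h where h: "h \<in> V" "\<forall>f\<in>V. L2_inner N (T f) g = L2_inner M f h" by blast
  show ?thesis
  proof (rule ex1I[of _ h])
    show "h \<in> V \<and> (\<forall>f\<in>V. L2_inner N (T f) g = L2_inner M f h)" using h by blast
    show "h' = h" if h': "h' \<in> V \<and> (\<forall>f\<in>V. L2_inner N (T f) g = L2_inner M f h')" for h'
    proof (rule X.eqI_inner)
      show "h' \<in> V" "h \<in> V" using h h' by blast+
      show "L2_inner M f h' = L2_inner M f h" if "f \<in> V" for f
        using h(2)[rule_format, OF that] conjunct2[OF h', rule_format, OF that] by (simp only:)
    qed
  qed
qed

lemma adj_in: "g \<in> W \<Longrightarrow> Tadj g \<in> V"
  and adj_inner: "g \<in> W \<Longrightarrow> f \<in> V \<Longrightarrow> L2_inner N (T f) g = L2_inner M f (Tadj g)"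
  using theI'[OF adj_ex1, of g, folded adj_def] by blast+

lemma adj_eqI:
  assumes "g \<in> W" "h \<in> V" "\<And>f. f \<in> V \<Longrightarrow> L2_inner N (T f) g = L2_inner M f h"
  shows "Tadj g = h"
  unfolding adj_def by (rule the1_equality[OF adj_ex1[OF assms(1)]]) (use assms(2,3) in blast)

lemma adj_inner': "g \<in> W \<Longrightarrow> f \<in> V \<Longrightarrow> L2_inner M (Tadj g) f = L2_inner N g (T f)"
  using adj_inner[of g f] L2_inner_cnj[of M "Tadj g" f] L2_inner_cnj[of N g "T f"] by simp

lemma adj_linear: "linear_op W V Tadj"
  unfolding linear_op_def
proof (intro conjI ballI allI)
  show "Tadj \<in> W \<rightarrow> V" using adj_in by auto
  show "Tadj (\<lambda>x. g x + g' x) = (\<lambda>y. Tadj g y + Tadj g' y)" if "g \<in> W" "g' \<in> W" for g g'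
    using that
    by (intro adj_eqI Y.add X.add adj_in)
      (simp_all only: L2_inner_add_right X.sq Y.sq in_W adj_in adj_inner[symmetric])
  show "Tadj (\<lambda>x. c * g x) = (\<lambda>y. c * Tadj g y)" if "g \<in> W" for g c
    using that
    by (intro adj_eqI Y.scale X.scale adj_in) (simp_all only: L2_inner_scale_right adj_inner[symmetric])
qed

text \<open>Apply the defining identity to the vector \<open>Tadj g\<close> itself and divide by its norm.\<close>

lemma adj_bound:
  assumes g: "g \<in> W"
  shows "L2_norm M (Tadj g) \<le> C * L2_norm N g"
proof -
  let ?h = "Tadj g"
  have h: "?h \<in> V" by (rule adj_in[OF g])
  have "(L2_norm M ?h)\<^sup>2 = cmod (L2_inner M ?h ?h)"
    by (simp add: L2_inner_self norm_power)
  also have "\<dots> = cmod (L2_inner N (T ?h) g)"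
    by (simp add: adj_inner[OF g h])
  also have "\<dots> \<le> L2_norm N (T ?h) * L2_norm N g"
    by (intro L2_Cauchy_Schwarz Y.sq in_W g h)
  also have "\<dots> \<le> (C * L2_norm M ?h) * L2_norm N g"
    by (intro mult_right_mono bound h) simp
  finally have *: "L2_norm M ?h * L2_norm M ?h \<le> L2_norm M ?h * (C * L2_norm N g)"
    by (simp add: power2_eq_square mult_ac)
  show ?thesis
  proof (cases "L2_norm M ?h = 0")
    case True
    then show ?thesis using C_nonneg by simp
  next
    case False
    then have "0 < L2_norm M ?h"
      using L2_norm_nonneg[of M ?h] by linarith
    with * show ?thesis by (simp only: mult_le_cancel_left_pos)
  qed
qed

end

section \<open>Change of variables under injective holomorphic maps\<close>

text \<open>The real coordinates in which a holomorphic map becomes a map with a Jacobian determinant.\<close>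

definition of_vec :: "real^2 \<Rightarrow> complex" where
  "of_vec v = Complex (v $ 1) (v $ 2)"

definition to_vec :: "complex \<Rightarrow> real^2" where
  "to_vec z = (\<chi> i. if i = 1 then Re z else Im z)"

lemma of_vec_to_vec [simp]: "of_vec (to_vec z) = z"
  by (simp add: of_vec_def to_vec_def)

lemma to_vec_of_vec [simp]: "to_vec (of_vec v) = v"
  by (auto simp: of_vec_def to_vec_def vec_eq_iff forall_2)

lemma bounded_linear_of_vec: "bounded_linear of_vec"
proof -
  have "linear of_vec"
    by (rule linearI) (auto simp: of_vec_def complex_eq_iff)
  then show ?thesis by (simp add: linear_conv_bounded_linear)
qed

lemma bounded_linear_to_vec: "bounded_linear to_vec"
proof -
  have "linear to_vec"
    by (rule linearI) (auto simp: to_vec_def vec_eq_iff)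
  then show ?thesis by (simp add: linear_conv_bounded_linear)
qed

lemma measurable_of_vec [measurable]: "of_vec \<in> borel_measurable borel"
  and measurable_to_vec [measurable]: "to_vec \<in> borel_measurable borel"
  using bounded_linear_of_vec bounded_linear_to_vec
  by (auto intro!: borel_measurable_continuous_onI linear_continuous_on)

lemma to_vec_image: "to_vec ` A = of_vec -` A"
proof
  show "of_vec -` A \<subseteq> to_vec ` A"
    by (metis (no_types, lifting) image_iff subsetI to_vec_of_vec vimage_eq)
qed auto

lemma Basis_vec_2: "(Basis :: (real^2) set) = {axis 1 1, axis 2 1}"
  by (auto simp: Basis_vec_def UNIV_2)

lemma lborel_complex_eq: "distr lborel borel of_vec = (lborel :: complex measure)"
proof (rule lborel_eqI[symmetric])
  fix l u :: complex
  assume le: "\<And>b. b \<in> Basis \<Longrightarrow> l \<bullet> b \<le> u \<bullet> b"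
  have le': "Re l \<le> Re u" "Im l \<le> Im u"
    using le[of 1] le[of \<i>] by (auto simp: Basis_complex_def)
  have vim: "of_vec -` box l u = box (to_vec l) (to_vec u)"
    by (auto simp: in_box_complex_iff mem_box_cart of_vec_def to_vec_def forall_2)
  have "axis 1 1 \<noteq> (axis 2 1 :: real^2)"
    by (simp add: axis_eq_axis)
  then have "emeasure lborel (box (to_vec l) (to_vec u)) = ennreal ((Re u - Re l) * (Im u - Im l))"
    using le' by (subst emeasure_lborel_box) (auto simp: Basis_vec_2 inner_axis to_vec_def)
  then show "emeasure (distr lborel borel of_vec) (box l u) = ennreal (\<Prod>b\<in>Basis. (u - l) \<bullet> b)"
    by (subst emeasure_distr) (auto simp: vim Basis_complex_def)
qed simp

lemma det_mult_complex:
  "det (matrix (\<lambda>h. to_vec (a * of_vec h))) = (cmod a)\<^sup>2"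
  by (simp add: det_2 matrix_def to_vec_def of_vec_def axis_def cmod_power2 flip: power2_eq_square)

text \<open>By the Cauchy-Riemann equations the Jacobian determinant of \<open>\<phi>\<close> as a map of the plane is
  \<open>\<bar>\<phi>'\<bar>\<^sup>2\<close>.\<close>

lemma emeasure_holomorphic_image:
  assumes hol: "\<phi> holomorphic_on S" and S: "open S" and inj: "inj_on \<phi> S"
    and A: "A \<in> sets borel" "A \<subseteq> S" and im: "\<phi> ` A \<in> sets borel" and fin: "emeasure lborel (\<phi> ` A) < \<infinity>"
  shows "(\<integral>\<^sup>+z. ennreal ((cmod (deriv \<phi> z))\<^sup>2) * indicator A z \<partial>lborel) = emeasure lborel (\<phi> ` A)"
proof -
  let ?f = "\<lambda>v. to_vec (\<phi> (of_vec v))" and ?A = "of_vec -` A"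
  let ?f' = "\<lambda>v h. to_vec (deriv \<phi> (of_vec v) * of_vec h)"
  have A': "?A \<in> sets borel" using measurable_sets[OF measurable_of_vec A(1)] by simp
  have der: "(?f has_derivative ?f' v) (at v within ?A)" if "v \<in> ?A" for v
  proof -
    have "(\<phi> has_field_derivative deriv \<phi> (of_vec v)) (at (of_vec v))"
      using holomorphic_derivI[OF hol S] A(2) that by auto
    then have 1: "(\<phi> has_derivative (*) (deriv \<phi> (of_vec v))) (at (of_vec v))"
      by (simp add: has_field_derivative_def)
    have 2: "(of_vec has_derivative of_vec) (at v within ?A)"
      by (rule bounded_linear_imp_has_derivative[OF bounded_linear_of_vec])
    have "((\<lambda>v. \<phi> (of_vec v)) has_derivative (\<lambda>h. deriv \<phi> (of_vec v) * of_vec h)) (at v within ?A)"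
      using has_derivative_compose[OF 2 1] .
    then show ?thesis
      by (rule bounded_linear.has_derivative[OF bounded_linear_to_vec])
  qed
  have inj': "inj_on ?f ?A"
  proof (rule inj_onI)
    fix v w assume vw: "v \<in> ?A" "w \<in> ?A" "?f v = ?f w"
    then have "\<phi> (of_vec v) = \<phi> (of_vec w)" by (metis of_vec_to_vec)
    then have "of_vec v = of_vec w"
      using inj vw A(2) by (auto simp: inj_on_def)
    then show "v = w" by (metis to_vec_of_vec)
  qed
  have img: "?f ` ?A = of_vec -` (\<phi> ` A)"
  proof -
    have "?f ` ?A = to_vec ` \<phi> ` (of_vec ` ?A)" unfolding image_image ..
    also have "of_vec ` ?A = A" by (metis of_vec_to_vec surj_def surj_image_vimage_eq)
    finally show ?thesis by (simp add: to_vec_image)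
  qed
  have im': "?f ` ?A \<in> sets borel"
    unfolding img using measurable_sets[OF measurable_of_vec im] by simp
  have em: "emeasure lborel (\<phi> ` A) = emeasure lborel (?f ` ?A)"
    unfolding img lborel_complex_eq[symmetric] using im by (subst emeasure_distr) simp_all
  have lm: "?f ` ?A \<in> lmeasurable"
    using im' fin em by (auto simp: fmeasurable_def)
  have "((\<lambda>v. \<bar>det (matrix (?f' v))\<bar>) has_integral measure lebesgue (?f ` ?A)) ?A"
    using has_measure_differentiable_image[OF _ der inj', of "measure lebesgue (?f ` ?A)"] lm A' by auto
  then have hi: "((\<lambda>v. (cmod (deriv \<phi> (of_vec v)))\<^sup>2) has_integral measure lebesgue (?f ` ?A)) ?A"
    by (simp add: det_mult_complex)
  have meas: "(\<lambda>z. ennreal ((cmod (deriv \<phi> z))\<^sup>2) * indicator A z) \<in> borel_measurable borel"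
  proof -
    have "continuous_on S (deriv \<phi>)"
      using holomorphic_deriv[OF hol S] by (rule holomorphic_on_imp_continuous_on)
    then have "continuous_on S (\<lambda>z. (cmod (deriv \<phi> z))\<^sup>2)"
      by (intro continuous_intros)
    then have "(\<lambda>z. indicator S z *\<^sub>R (cmod (deriv \<phi> z))\<^sup>2) \<in> borel_measurable borel"
      using S by (intro borel_measurable_continuous_on_indicator) auto
    then have "(\<lambda>z. ennreal (indicator S z *\<^sub>R (cmod (deriv \<phi> z))\<^sup>2) * indicator A z) \<in> borel_measurable borel"
      using A(1) by measurable
    also have "(\<lambda>z. ennreal (indicator S z *\<^sub>R (cmod (deriv \<phi> z))\<^sup>2) * indicator A z) =
      (\<lambda>z. ennreal ((cmod (deriv \<phi> z))\<^sup>2) * indicator A z)"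
      using A(2) by (auto simp: fun_eq_iff indicator_def)
    finally show ?thesis .
  qed
  have "(\<integral>\<^sup>+z. ennreal ((cmod (deriv \<phi> z))\<^sup>2) * indicator A z \<partial>lborel) =
        (\<integral>\<^sup>+v. ennreal ((cmod (deriv \<phi> (of_vec v)))\<^sup>2) * indicator ?A v \<partial>lborel)"
    unfolding lborel_complex_eq[symmetric] using meas
    by (subst nn_integral_distr) (auto simp: indicator_def intro!: nn_integral_cong)
  also have "\<dots> = ennreal (measure lebesgue (?f ` ?A))"
    by (rule nn_integral_has_integral_lebesgue'[OF _ hi]) simp
  also have "\<dots> = emeasure lborel (?f ` ?A)"
    using lm im' fin em by (simp add: measure_def)
  finally show ?thesis using em by simp
qed

lemma measurable_disc_measure_iff:
  "f \<in> measurable disc_measure N \<longleftrightarrow> f \<in> measurable (restrict_space borel disc) N"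
  unfolding disc_measure_def by (simp add: measurable_def space_restrict_space sets_restrict_space)

lemma space_disc_measure [simp]: "space disc_measure = disc"
  by (simp add: disc_measure_def space_restrict_space)

lemma sets_disc_measure: "sets disc_measure = {A \<in> sets borel. A \<subseteq> disc}"
  by (auto simp: disc_measure_def sets_restrict_space)

lemma measurable_continuous_disc:
  assumes "continuous_on disc f"
  shows "f \<in> borel_measurable disc_measure"
  using borel_measurable_continuous_on_restrict[OF assms] by (simp add: measurable_disc_measure_iff)

lemma measurable_disc_disc:
  assumes "continuous_on disc f" "f ` disc \<subseteq> disc"
  shows "f \<in> measurable disc_measure disc_measure"
proof -
  have "f \<in> measurable (restrict_space borel disc) (restrict_space borel disc)"
    using borel_measurable_continuous_on_restrict[OF assms(1)] assms(2)
    by (intro measurable_restrict_space2) (auto simp: space_restrict_space)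
  moreover have "sets disc_measure = sets (restrict_space borel disc)"
    by (simp add: disc_measure_def sets_restrict_space)
  ultimately show ?thesis
    by (simp add: measurable_cong_sets[of disc_measure "restrict_space borel disc" disc_measure "restrict_space borel disc"])
qed

lemma nn_integral_disc_measure:
  assumes "f \<in> borel_measurable disc_measure"
  shows "(\<integral>\<^sup>+z. f z \<partial>disc_measure) = ennreal (1 / pi) * (\<integral>\<^sup>+z. f z * indicator disc z \<partial>lborel)"
proof -
  have f: "f \<in> borel_measurable (restrict_space lborel disc)"
    using assms unfolding measurable_disc_measure_iff by (simp add: measurable_def space_restrict_space sets_restrict_space)
  have "(\<integral>\<^sup>+z. f z \<partial>disc_measure) = (\<integral>\<^sup>+z. ennreal (1 / pi) * f z \<partial>restrict_space lborel disc)"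
    unfolding disc_measure_def using f by (subst nn_integral_density) auto
  also have "\<dots> = ennreal (1 / pi) * (\<integral>\<^sup>+z. f z \<partial>restrict_space lborel disc)"
    using f by (rule nn_integral_cmult)
  finally show ?thesis by (simp add: nn_integral_restrict_space)
qed

lemma emeasure_disc_measure:
  assumes "A \<in> sets disc_measure"
  shows "emeasure disc_measure A = ennreal (1 / pi) * emeasure lborel A"
proof -
  have "emeasure disc_measure A = (\<integral>\<^sup>+z. indicator A z \<partial>disc_measure)"
    using assms by simp
  also have "\<dots> = ennreal (1 / pi) * (\<integral>\<^sup>+z. indicator A z * indicator disc z \<partial>lborel)"
    using assms by (intro nn_integral_disc_measure) auto
  also have "(\<lambda>z. indicator A z * indicator disc z :: ennreal) = indicator A"
    using assms by (auto simp: sets_disc_measure indicator_def fun_eq_iff)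
  finally show ?thesis using assms by (simp add: sets_disc_measure)
qed

lemma emeasure_disc_measure_ball:
  assumes "0 \<le> r" "r \<le> 1"
  shows "emeasure disc_measure (ball 0 r) = ennreal (r\<^sup>2)"
proof -
  have "ball 0 r \<in> sets disc_measure"
    using assms by (auto simp: sets_disc_measure)
  moreover have "emeasure lborel (ball (0::complex) r) = ennreal (pi * r\<^sup>2)"
    using assms by (simp add: emeasure_ball unit_ball_vol_2)
  ultimately show ?thesis
    by (simp add: emeasure_disc_measure ennreal_mult[symmetric])
qed

lemma emeasure_disc_measure_disc: "emeasure disc_measure disc = 1"
  using emeasure_disc_measure_ball[of 1] by simp

interpretation disc: finite_measure disc_measure
  by (rule finite_measureI) (simp add: emeasure_disc_measure_disc)

lemma CE_embD:
  assumes "\<phi> \<in> CE_emb"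
  shows "\<phi> holomorphic_on disc" "inj_on \<phi> disc" "\<phi> ` disc \<subseteq> disc" "\<phi> \<in> extensional disc"
    "\<And>z. z \<in> disc \<Longrightarrow> \<phi> z \<in> disc" "continuous_on disc \<phi>" "continuous_on disc (deriv \<phi>)"
    "deriv \<phi> holomorphic_on disc"
  using assms unfolding CE_emb_def
  by (auto simp: PiE_def intro: holomorphic_on_imp_continuous_on holomorphic_deriv)

lemma CE_emb_measurable:
  assumes "\<phi> \<in> CE_emb"
  shows "\<phi> \<in> measurable disc_measure disc_measure" "deriv \<phi> \<in> borel_measurable disc_measure"
  using CE_embD[OF assms] by (auto intro: measurable_disc_disc measurable_continuous_disc)

text \<open>An injective holomorphic map carries \<open>\<bar>\<phi>'\<bar>\<^sup>2 d\<mu>\<close> to the restriction of \<open>\<mu>\<close> to its image.  This is why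
  composition with \<open>\<phi>\<close>, weighted by \<open>\<phi>'\<close>, contracts \<open>L\<^sup>2\<close>, and is isometric when \<open>\<phi>\<close> is onto.\<close>

lemma distr_disc_measure:
  assumes \<phi>: "\<phi> \<in> CE_emb"
  shows "distr (density disc_measure (\<lambda>z. ennreal ((cmod (deriv \<phi> z))\<^sup>2))) disc_measure \<phi> =
         density disc_measure (indicator (\<phi> ` disc))"
proof (rule measure_eqI)
  note [measurable] = CE_emb_measurable[OF \<phi>]
  have op: "open (\<phi> ` disc)"
    using open_mapping_thm3[OF CE_embD(1)[OF \<phi>] open_ball CE_embD(2)[OF \<phi>]] .
  then have [measurable]: "\<phi> ` disc \<in> sets disc_measure"
    using CE_embD(3)[OF \<phi>] by (auto simp: sets_disc_measure)
  show "sets (distr (density disc_measure (\<lambda>z. ennreal ((cmod (deriv \<phi> z))\<^sup>2))) disc_measure \<phi>) =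
      sets (density disc_measure (indicator (\<phi> ` disc)))"
    by simp
  fix E assume "E \<in> sets (distr (density disc_measure (\<lambda>z. ennreal ((cmod (deriv \<phi> z))\<^sup>2))) disc_measure \<phi>)"
  then have E[measurable]: "E \<in> sets disc_measure" by simp
  let ?A = "\<phi> -` E \<inter> disc"
  have A[measurable]: "?A \<in> sets disc_measure"
    using measurable_sets[OF CE_emb_measurable(1)[OF \<phi>] E] by simp
  have im: "\<phi> ` ?A = E \<inter> \<phi> ` disc" by auto
  have Eb: "E \<inter> \<phi> ` disc \<in> sets disc_measure" by simp
  have "emeasure lborel (E \<inter> \<phi> ` disc) \<le> emeasure lborel disc"
    using Eb by (intro emeasure_mono) (auto simp: sets_disc_measure)
  also have "\<dots> < \<infinity>" by (simp add: emeasure_ball)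
  finally have fin: "emeasure lborel (E \<inter> \<phi> ` disc) < \<infinity>" .
  have "emeasure (distr (density disc_measure (\<lambda>z. ennreal ((cmod (deriv \<phi> z))\<^sup>2))) disc_measure \<phi>) E =
      emeasure (density disc_measure (\<lambda>z. ennreal ((cmod (deriv \<phi> z))\<^sup>2))) ?A"
    by (subst emeasure_distr) simp_all
  also have "\<dots> = (\<integral>\<^sup>+z. ennreal ((cmod (deriv \<phi> z))\<^sup>2) * indicator ?A z \<partial>disc_measure)"
    by (subst emeasure_density) simp_all
  also have "\<dots> = ennreal (1 / pi) * (\<integral>\<^sup>+z. ennreal ((cmod (deriv \<phi> z))\<^sup>2) * indicator ?A z * indicator disc z \<partial>lborel)"
    by (rule nn_integral_disc_measure) simp
  also have "(\<integral>\<^sup>+z. ennreal ((cmod (deriv \<phi> z))\<^sup>2) * indicator ?A z * indicator disc z \<partial>lborel) =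
      (\<integral>\<^sup>+z. ennreal ((cmod (deriv \<phi> z))\<^sup>2) * indicator ?A z \<partial>lborel)"
    by (intro nn_integral_cong) (auto simp: indicator_def)
  also have "\<dots> = emeasure lborel (\<phi> ` ?A)"
    using A Eb fin unfolding sets_disc_measure
    by (intro emeasure_holomorphic_image[OF CE_embD(1)[OF \<phi>] open_ball CE_embD(2)[OF \<phi>]]) (auto simp: im)
  also have "ennreal (1 / pi) * \<dots> = emeasure disc_measure (E \<inter> \<phi> ` disc)"
    unfolding im using Eb by (simp add: emeasure_disc_measure)
  also have "\<dots> = emeasure (density disc_measure (indicator (\<phi> ` disc))) E"
    by (subst emeasure_density) (auto simp: indicator_inter_arith[symmetric] Int_commute)
  finally show "emeasure (distr (density disc_measure (\<lambda>z. ennreal ((cmod (deriv \<phi> z))\<^sup>2))) disc_measure \<phi>) E =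
         emeasure (density disc_measure (indicator (\<phi> ` disc))) E" .
qed

lemma nn_integral_change_disc:
  assumes \<phi>: "\<phi> \<in> CE_emb" and g: "g \<in> borel_measurable disc_measure"
  shows "(\<integral>\<^sup>+z. ennreal ((cmod (deriv \<phi> z))\<^sup>2) * g (\<phi> z) \<partial>disc_measure) =
         (\<integral>\<^sup>+z. indicator (\<phi> ` disc) z * g z \<partial>disc_measure)"
proof -
  note [measurable] = CE_emb_measurable[OF \<phi>] g
  have "open (\<phi> ` disc)"
    using open_mapping_thm3[OF CE_embD(1)[OF \<phi>] open_ball CE_embD(2)[OF \<phi>]] .
  then have [measurable]: "\<phi> ` disc \<in> sets disc_measure"
    using CE_embD(3)[OF \<phi>] by (auto simp: sets_disc_measure)
  have "(\<integral>\<^sup>+z. indicator (\<phi> ` disc) z * g z \<partial>disc_measure) =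
      (\<integral>\<^sup>+z. g z \<partial>distr (density disc_measure (\<lambda>z. ennreal ((cmod (deriv \<phi> z))\<^sup>2))) disc_measure \<phi>)"
    unfolding distr_disc_measure[OF \<phi>] by (subst nn_integral_density) simp_all
  also have "\<dots> = (\<integral>\<^sup>+z. g (\<phi> z) \<partial>density disc_measure (\<lambda>z. ennreal ((cmod (deriv \<phi> z))\<^sup>2)))"
    by (subst nn_integral_distr) simp_all
  also have "\<dots> = (\<integral>\<^sup>+z. ennreal ((cmod (deriv \<phi> z))\<^sup>2) * g (\<phi> z) \<partial>disc_measure)"
    by (subst nn_integral_density) simp_all
  finally show ?thesis by simp
qed

lemma integral_change_disc:
  fixes g :: "complex \<Rightarrow> complex"
  assumes \<phi>: "\<phi> \<in> CE_emb" and onto: "\<phi> ` disc = disc" and g: "g \<in> borel_measurable disc_measure"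
  shows "(LINT z|disc_measure. (cmod (deriv \<phi> z))\<^sup>2 *\<^sub>R g (\<phi> z)) = (LINT z|disc_measure. g z)"
proof -
  note [measurable] = CE_emb_measurable[OF \<phi>] g
  have "density disc_measure (indicator disc) = density disc_measure (\<lambda>_. 1)"
    by (rule density_cong) (auto simp: sets_disc_measure intro!: borel_measurable_indicator)
  then have "disc_measure = distr (density disc_measure (\<lambda>z. ennreal ((cmod (deriv \<phi> z))\<^sup>2))) disc_measure \<phi>"
    unfolding distr_disc_measure[OF \<phi>] onto by (simp add: density_1)
  then have "(LINT z|disc_measure. g z) =
      (LINT z|distr (density disc_measure (\<lambda>z. ennreal ((cmod (deriv \<phi> z))\<^sup>2))) disc_measure \<phi>. g z)"
    by simp
  also have "\<dots> = (LINT z|density disc_measure (\<lambda>z. ennreal ((cmod (deriv \<phi> z))\<^sup>2)). g (\<phi> z))"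
    by (subst integral_distr) simp_all
  also have "\<dots> = (LINT z|disc_measure. (cmod (deriv \<phi> z))\<^sup>2 *\<^sub>R g (\<phi> z))"
    by (subst integral_density) simp_all
  finally show ?thesis by simp
qed

section \<open>Automorphisms of the disc\<close>

lemma one_minus_cnj_mult_ne:
  assumes "cmod a < 1" "cmod z < 1"
  shows "1 - cnj a * z \<noteq> 0"
proof
  assume "1 - cnj a * z = 0"
  then have "1 = cnj a * z" by (rule iffD1[OF right_minus_eq])
  from arg_cong[OF this, of cmod] have "cmod (cnj a) * cmod z = 1"
    unfolding norm_mult by (simp only: norm_one)
  then have "cmod a * cmod z = 1" by (simp only: complex_mod_cnj)
  moreover have "cmod a * cmod z < 1 * 1"
    using assms by (intro mult_strict_mono') auto
  ultimately show False by simp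
qed

lemma psu_eq_Moebius: "z \<in> disc \<Longrightarrow> psu \<theta> \<alpha> z = Moebius_function \<theta> \<alpha> z"
  by (simp add: psu_def Moebius_function_def cis_conv_exp)

lemma psu_in_disc: "cmod \<alpha> < 1 \<Longrightarrow> z \<in> disc \<Longrightarrow> psu \<theta> \<alpha> z \<in> disc"
  using Moebius_function_norm_lt_1[of \<alpha> z \<theta>] by (simp add: psu_eq_Moebius)

text \<open>Solving \<open>u = cis \<theta> (z - \<alpha>) / (1 - cnj \<alpha> z)\<close> for \<open>z\<close> gives a map of the same form.\<close>

lemma psu_inverse:
  assumes \<alpha>: "cmod \<alpha> < 1" and z: "z \<in> disc"
  shows "psu (-\<theta>) (- \<alpha> * cis \<theta>) (psu \<theta> \<alpha> z) = z"
proof -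
  have d: "1 - cnj \<alpha> * z \<noteq> 0" "1 - cnj \<alpha> * \<alpha> \<noteq> 0"
    by (rule one_minus_cnj_mult_ne; use \<alpha> z in simp)+
  have cc: "cis (-\<theta>) * cis \<theta> = 1" by (simp add: cis_mult)
  define u where "u = (z - \<alpha>) / (1 - cnj \<alpha> * z)"
  have u: "u * (1 - cnj \<alpha> * z) = z - \<alpha>" using d by (simp add: u_def)
  have num: "(u + \<alpha>) * (1 - cnj \<alpha> * z) = z * (1 - cnj \<alpha> * \<alpha>)"
    unfolding distrib_right u by (simp add: algebra_simps)
  have den: "(1 + cnj \<alpha> * u) * (1 - cnj \<alpha> * z) = 1 - cnj \<alpha> * \<alpha>"
    unfolding distrib_right mult.assoc u by (simp add: algebra_simps)
  have den0: "1 + cnj \<alpha> * u \<noteq> 0" using den d by auto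
  have "(u + \<alpha>) / (1 + cnj \<alpha> * u) = ((u + \<alpha>) * (1 - cnj \<alpha> * z)) / ((1 + cnj \<alpha> * u) * (1 - cnj \<alpha> * z))"
    using d by simp
  also have "\<dots> = z" unfolding num den using d by simp
  finally have *: "(u + \<alpha>) / (1 + cnj \<alpha> * u) = z" .
  have pe: "psu \<theta> \<alpha> z = cis \<theta> * u" using z by (simp add: psu_def u_def)
  have mem: "(cis \<theta> * u \<in> disc) = True" using psu_in_disc[OF \<alpha> z, of \<theta>] unfolding pe by (rule eqTrueI)
  have num': "cis \<theta> * u - (- \<alpha> * cis \<theta>) = cis \<theta> * (u + \<alpha>)"
    by (simp add: distrib_left mult.commute)
  have rearr: "(- a * p) * (q * v) = - (a * (p * q) * v)" for a p q v :: complex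
    by (simp add: mult_ac)
  have den': "1 - cnj (- \<alpha> * cis \<theta>) * (cis \<theta> * u) = 1 + cnj \<alpha> * u"
    by (simp only: complex_cnj_mult complex_cnj_minus cis_cnj rearr cc mult_1_right diff_minus_eq_add)
  have "psu (-\<theta>) (- \<alpha> * cis \<theta>) (psu \<theta> \<alpha> z) = cis (-\<theta>) * (cis \<theta> * (u + \<alpha>) / (1 + cnj \<alpha> * u))"
    unfolding pe by (simp only: psu_def restrict_apply mem if_True num' den')
  also have "\<dots> = (cis (-\<theta>) * cis \<theta>) * ((u + \<alpha>) / (1 + cnj \<alpha> * u))"
    by (simp only: times_divide_eq_right mult.assoc)
  finally show ?thesis unfolding cc * by simp
qed

lemma psu_inverse':
  assumes \<alpha>: "cmod \<alpha> < 1" and z: "z \<in> disc"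
  shows "psu \<theta> \<alpha> (psu (-\<theta>) (- \<alpha> * cis \<theta>) z) = z"
proof -
  have "- (- \<alpha> * cis \<theta>) * cis (-\<theta>) = \<alpha>"
    by (simp add: mult.assoc cis_mult)
  moreover have "cmod (- \<alpha> * cis \<theta>) < 1" using \<alpha> by (simp add: norm_mult)
  ultimately show ?thesis
    using psu_inverse[OF _ z, of "- \<alpha> * cis \<theta>" "-\<theta>"] by (simp only: minus_minus)
qed

lemma psu_onto: "cmod \<alpha> < 1 \<Longrightarrow> psu \<theta> \<alpha> ` disc = disc"
proof
  assume a: "cmod \<alpha> < 1"
  then show "psu \<theta> \<alpha> ` disc \<subseteq> disc" using psu_in_disc by blast
  show "disc \<subseteq> psu \<theta> \<alpha> ` disc"
  proof
    fix z :: complex assume z: "z \<in> disc"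
    have "psu (-\<theta>) (- \<alpha> * cis \<theta>) z \<in> disc"
      using a z by (intro psu_in_disc) (auto simp: norm_mult)
    with psu_inverse'[OF a z, of \<theta>] show "z \<in> psu \<theta> \<alpha> ` disc" by (metis imageI)
  qed
qed

lemma has_field_derivative_psu:
  assumes \<alpha>: "cmod \<alpha> < 1" and z: "z \<in> disc"
  shows "(psu \<theta> \<alpha> has_field_derivative cis \<theta> * (1 - cnj \<alpha> * \<alpha>) / (1 - cnj \<alpha> * z)\<^sup>2) (at z)"
proof (rule has_field_derivative_transform_within_open)
  have d: "1 - cnj \<alpha> * z \<noteq> 0" by (rule one_minus_cnj_mult_ne) (use \<alpha> z in auto)
  show "((\<lambda>z. cis \<theta> * ((z - \<alpha>) / (1 - cnj \<alpha> * z))) has_field_derivative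
      cis \<theta> * (1 - cnj \<alpha> * \<alpha>) / (1 - cnj \<alpha> * z)\<^sup>2) (at z)"
  proof -
    have 1: "((\<lambda>z. z - \<alpha>) has_field_derivative 1) (at z)"
      using DERIV_diff[OF DERIV_ident DERIV_const, of \<alpha>] by simp
    have 2: "((\<lambda>z. 1 - cnj \<alpha> * z) has_field_derivative - cnj \<alpha>) (at z)"
      using DERIV_diff[OF DERIV_const DERIV_cmult[OF DERIV_ident, of "cnj \<alpha>"], of 1] by simp
    have num: "1 * (1 - cnj \<alpha> * z) - (z - \<alpha>) * (- cnj \<alpha>) = 1 - cnj \<alpha> * \<alpha>"
      by (simp add: algebra_simps)
    show ?thesis
      using DERIV_cmult[OF DERIV_divide[OF 1 2 d], of "cis \<theta>"] unfolding num
      by (simp only: power2_eq_square times_divide_eq_right)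
  qed
  show "open disc" "z \<in> disc" using z by auto
  show "cis \<theta> * ((y - \<alpha>) / (1 - cnj \<alpha> * y)) = psu \<theta> \<alpha> y" if "y \<in> disc" for y
    using that by (simp add: psu_def)
qed

lemma deriv_psu:
  "cmod \<alpha> < 1 \<Longrightarrow> z \<in> disc \<Longrightarrow> deriv (psu \<theta> \<alpha>) z = cis \<theta> * (1 - cnj \<alpha> * \<alpha>) / (1 - cnj \<alpha> * z)\<^sup>2"
  by (rule DERIV_imp_deriv[OF has_field_derivative_psu])

lemma psu_in_CE_emb:
  assumes \<alpha>: "cmod \<alpha> < 1"
  shows "psu \<theta> \<alpha> \<in> CE_emb"
  unfolding CE_emb_def
proof (intro CollectI conjI)
  show "psu \<theta> \<alpha> \<in> disc \<rightarrow>\<^sub>E disc"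
    using psu_in_disc[OF \<alpha>] by (auto simp: psu_def)
  show "psu \<theta> \<alpha> holomorphic_on disc"
    using has_field_derivative_psu[OF \<alpha>] by (subst holomorphic_on_open) blast+
  show "inj_on (psu \<theta> \<alpha>) disc"
    by (rule inj_on_inverseI) (rule psu_inverse[OF \<alpha>])
qed

section \<open>The mean value property and the Bergman kernel\<close>

text \<open>Rotation by the angle \<open>pi / k\<close> preserves the measure and the ball, and changes the sign of \<open>z\<^sup>k\<close>.\<close>

lemma integral_power_ball_0:
  assumes "0 < k"
  shows "(LINT z|disc_measure. z ^ k * indicator (ball 0 r) z) = (0 :: complex)"
proof -
  let ?\<theta> = "pi / real k" and ?g = "\<lambda>z. z ^ k * indicator (ball 0 r) z :: complex"
  have psu: "psu ?\<theta> 0 z = cis ?\<theta> * z" if "z \<in> disc" for z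
    using that by (simp add: psu_def)
  have om: "cis ?\<theta> ^ k = -1"
    using assms by (simp add: Complex.DeMoivre)
  have "?g \<in> borel_measurable disc_measure"
    unfolding measurable_disc_measure_iff by (rule measurable_restrict_space1) (intro borel_measurable_times borel_measurable_power
        borel_measurable_indicator measurable_ident_sets, auto)
  then have "(LINT z|disc_measure. ?g z) =
      (LINT z|disc_measure. (cmod (deriv (psu ?\<theta> 0) z))\<^sup>2 *\<^sub>R ?g (psu ?\<theta> 0 z))"
    by (intro integral_change_disc[symmetric] psu_in_CE_emb psu_onto) auto
  also have "\<dots> = (LINT z|disc_measure. - ?g z)"
  proof (rule Bochner_Integration.integral_cong)
    fix z assume "z \<in> space disc_measure"
    then have z: "z \<in> disc" by simp
    have "indicator (ball 0 r) (cis ?\<theta> * z) = (indicator (ball 0 r) z :: complex)"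
      by (simp add: indicator_def norm_mult)
    then show "(cmod (deriv (psu ?\<theta> 0) z))\<^sup>2 *\<^sub>R ?g (psu ?\<theta> 0 z) = - ?g z"
      using z deriv_psu[of 0 z ?\<theta>] by (simp add: psu power_mult_distrib om)
  qed simp
  finally show ?thesis by simp
qed

text \<open>On a concentric disc of radius less than 1 the power series at the origin converges absolutely and
  uniformly, so it may be integrated termwise; only the constant term contributes.\<close>

lemma mean_value_ball:
  assumes hol: "f holomorphic_on disc" and r: "0 < r" "r < 1"
  shows "(LINT z|disc_measure. f z * indicator (ball 0 r) z) = of_real (r\<^sup>2) * f 0"
proof -
  define a where "a n = (deriv ^^ n) f 0 / fact n" for n
  have ser: "(\<lambda>n. a n * z ^ n) sums f z" if "z \<in> disc" for z
    using holomorphic_power_series[OF hol that] by (simp add: a_def)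
  obtain s where s: "r < s" "s < 1" using r dense by blast
  have "summable (\<lambda>n. a n * of_real s ^ n)"
    using ser[of "of_real s"] s r by (auto simp: sums_iff)
  then have summ: "summable (\<lambda>n. norm (a n * of_real r ^ n))"
    by (rule powser_insidea) (use r s in auto)
  let ?B = "ball (0::complex) r"
  let ?f = "\<lambda>n z. a n * z ^ n * indicator ?B z"
  have meas: "(\<lambda>z. z ^ n * indicator ?B z :: complex) \<in> borel_measurable disc_measure" for n
    unfolding measurable_disc_measure_iff by (rule measurable_restrict_space1) (intro borel_measurable_times borel_measurable_power
        borel_measurable_indicator measurable_ident_sets, auto)
  have bnd: "norm (?f n z) \<le> norm (a n * of_real r ^ n)" for n z
    using r by (auto simp: indicator_def norm_mult norm_power intro!: mult_left_mono power_mono)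
  have int: "integrable disc_measure (?f n)" for n
  proof (rule disc.integrable_const_bound)
    show "AE z in disc_measure. norm (?f n z) \<le> norm (a n * of_real r ^ n)"
      using bnd by blast
    show "?f n \<in> borel_measurable disc_measure"
      using borel_measurable_times[OF borel_measurable_const meas[of n], of "a n"] by (simp add: mult.assoc)
  qed
  have intn: "(LINT z|disc_measure. norm (?f n z)) \<le> norm (a n * of_real r ^ n)" for n
  proof -
    have "(LINT z|disc_measure. norm (?f n z)) \<le> (LINT z|disc_measure. norm (a n * of_real r ^ n))"
      using int bnd by (intro integral_mono) auto
    then show ?thesis by (simp add: measure_def emeasure_disc_measure_disc)
  qed
  have "(\<lambda>n. LINT z|disc_measure. ?f n z) sums (LINT z|disc_measure. (\<Sum>n. ?f n z))"
  proof (rule sums_integral[OF int])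
    show "AE z in disc_measure. summable (\<lambda>n. norm (?f n z))"
      by (rule AE_I2, rule summable_comparison_test'[OF summ]) (use bnd in auto)
    show "summable (\<lambda>n. LINT z|disc_measure. norm (?f n z))"
      by (rule summable_comparison_test'[OF summ]) (use intn in auto)
  qed
  moreover have "(LINT z|disc_measure. (\<Sum>n. ?f n z)) = (LINT z|disc_measure. f z * indicator ?B z)"
  proof (rule Bochner_Integration.integral_cong)
    fix z assume "z \<in> space disc_measure"
    then have "(\<lambda>n. a n * z ^ n * indicator ?B z) sums (f z * indicator ?B z)"
      by (intro sums_mult2 ser) simp
    then show "(\<Sum>n. ?f n z) = f z * indicator ?B z" by (simp add: sums_iff)
  qed simp
  ultimately have "(\<lambda>n. LINT z|disc_measure. ?f n z) sums (LINT z|disc_measure. f z * indicator ?B z)"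
    by simp
  moreover have "(LINT z|disc_measure. ?f n z) = (if n = 0 then of_real (r\<^sup>2) * f 0 else 0)" for n
  proof (cases "n = 0")
    case True
    have B: "?B \<in> sets disc_measure" using r by (auto simp: sets_disc_measure)
    have "(LINT z|disc_measure. indicator ?B z :: complex) = (LINT z|disc_measure. of_real (indicator ?B z))"
      by (intro Bochner_Integration.integral_cong) (auto simp: indicator_def)
    also have "\<dots> = of_real (LINT z|disc_measure. indicator ?B z)"
      by (rule integral_complex_of_real)
    also have "(LINT z|disc_measure. indicator ?B z) = measure disc_measure ?B"
      using sets.sets_into_space[OF B] by (simp add: Int_absorb2)
    also have "\<dots> = r\<^sup>2"
      using r by (simp add: measure_def emeasure_disc_measure_ball)
    finally show ?thesis using True by (simp add: a_def)
  next
    case False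
    then show ?thesis using integral_power_ball_0[of n r] by (simp add: mult.assoc)
  qed
  ultimately have "(\<lambda>n. if n = 0 then of_real (r\<^sup>2) * f 0 else 0) sums (LINT z|disc_measure. f z * indicator ?B z)"
    by simp
  then show ?thesis
    using sums_unique2[OF _ sums_single[of 0 "\<lambda>_. of_real (r\<^sup>2) * f 0"]] by blast
qed

text \<open>The radius tends to 1, with \<open>\<bar>f\<bar>\<close> as a dominating function.\<close>

lemma mean_value_disc:
  assumes hol: "f holomorphic_on disc" and int: "integrable disc_measure f"
  shows "(LINT z|disc_measure. f z) = f 0"
proof -
  define r where "r n = 1 - inverse (real (Suc (Suc n)))" for n
  have r: "0 < r n" "r n < 1" for n by (auto simp: r_def field_simps)
  have "(\<lambda>n. inverse (real (Suc (Suc n)))) \<longlonglongrightarrow> 0"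
    using LIMSEQ_Suc[OF LIMSEQ_inverse_real_of_nat] .
  then have "(\<lambda>n. 1 - inverse (real (Suc (Suc n)))) \<longlonglongrightarrow> 1 - 0"
    by (intro tendsto_intros)
  then have rl: "r \<longlonglongrightarrow> 1" by (simp add: r_def[abs_def])
  have "(\<lambda>n. LINT z|disc_measure. f z * indicator (ball 0 (r n)) z) \<longlonglongrightarrow> (LINT z|disc_measure. f z)"
  proof (rule integral_dominated_convergence)
    show "integrable disc_measure (\<lambda>z. norm (f z))" using int by simp
    show f: "f \<in> borel_measurable disc_measure" using int by simp
    show "(\<lambda>z. f z * indicator (ball 0 (r n)) z) \<in> borel_measurable disc_measure" for n
      using r[of n] by (intro borel_measurable_times f borel_measurable_indicator) (auto simp: sets_disc_measure)
    show "AE z in disc_measure. norm (f z * indicator (ball 0 (r n)) z) \<le> norm (f z)" for n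
      by (auto simp: indicator_def)
    show "AE z in disc_measure. (\<lambda>n. f z * indicator (ball 0 (r n)) z) \<longlonglongrightarrow> f z"
    proof (rule AE_I2)
      fix z assume "z \<in> space disc_measure"
      then have "cmod z < 1" by simp
      then have "\<forall>\<^sub>F n in sequentially. cmod z < r n" using rl order_tendstoD(1) by blast
      then have "\<forall>\<^sub>F n in sequentially. f z * indicator (ball 0 (r n)) z = f z"
        by eventually_elim (simp add: indicator_def)
      then show "(\<lambda>n. f z * indicator (ball 0 (r n)) z) \<longlonglongrightarrow> f z"
        by (rule tendsto_eventually)
    qed
  qed
  then have "(\<lambda>n. of_real ((r n)\<^sup>2) * f 0) \<longlonglongrightarrow> (LINT z|disc_measure. f z)"
    unfolding mean_value_ball[OF hol r] .
  moreover have "(\<lambda>n. of_real ((r n)\<^sup>2) * f 0) \<longlonglongrightarrow> of_real (1\<^sup>2) * f 0"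
    by (intro tendsto_intros rl)
  ultimately have "(LINT z|disc_measure. f z) = of_real (1\<^sup>2) * f 0"
    by (rule LIMSEQ_unique)
  then show ?thesis by simp
qed

definition bergman :: "complex \<Rightarrow> complex \<Rightarrow> complex" where
  "bergman w z = (if z \<in> disc then 1 / (1 - cnj w * z)\<^sup>2 else 0)"

lemma A2_discD:
  assumes "f \<in> A2_disc"
  shows "f holomorphic_on disc" "square_integrable disc_measure f" "z \<notin> disc \<Longrightarrow> f z = 0"
  using assms by (auto simp: A2_disc_def)

lemma square_integrable_bounded:
  assumes "finite_measure M" "f \<in> borel_measurable M" "\<And>x. x \<in> space M \<Longrightarrow> cmod (f x) \<le> B"
  shows "square_integrable M f"
  unfolding square_integrable_def
proof
  interpret finite_measure M by fact
  show "integrable M (\<lambda>x. (cmod (f x))\<^sup>2)"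
  proof (rule integrable_const_bound)
    show "AE x in M. norm ((cmod (f x))\<^sup>2) \<le> B\<^sup>2"
      using assms(3) by (intro AE_I2) (auto intro!: power_mono)
    show "(\<lambda>x. (cmod (f x))\<^sup>2) \<in> borel_measurable M" using assms(2) by measurable
  qed
qed fact

lemma bergman_bound:
  assumes w: "cmod w < 1" and z: "z \<in> disc"
  shows "cmod (bergman w z) \<le> 1 / (1 - cmod w)\<^sup>2"
proof -
  have "cmod (cnj w * z) \<le> cmod w"
    using w z by (simp add: norm_mult mult_left_le)
  then have "1 - cmod w \<le> cmod (1 - cnj w * z)"
    using norm_triangle_ineq2[of 1 "cnj w * z"] by simp
  then have "(1 - cmod w)\<^sup>2 \<le> (cmod (1 - cnj w * z))\<^sup>2"
    using w by (intro power_mono) auto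
  moreover have "0 < (1 - cmod w)\<^sup>2" using w by simp
  ultimately have "1 / (cmod (1 - cnj w * z))\<^sup>2 \<le> 1 / (1 - cmod w)\<^sup>2"
    by (intro divide_left_mono mult_pos_pos) auto
  then show ?thesis
    using z by (simp add: bergman_def norm_divide norm_power)
qed

lemma bergman_in_A2_disc:
  assumes w: "w \<in> disc"
  shows "bergman w \<in> A2_disc"
  unfolding A2_disc_def
proof (intro CollectI conjI allI impI)
  have ne: "1 - cnj w * z \<noteq> 0" if "z \<in> disc" for z
    by (rule one_minus_cnj_mult_ne) (use that w in auto)
  have "(\<lambda>z. 1 / (1 - cnj w * z)\<^sup>2) holomorphic_on disc"
    using ne by (intro holomorphic_intros) auto
  then show hol: "bergman w holomorphic_on disc"
    by (rule holomorphic_transform) (simp add: bergman_def)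
  show "square_integrable disc_measure (bergman w)"
  proof (rule square_integrable_bounded)
    show "finite_measure disc_measure" by unfold_locales
    show "bergman w \<in> borel_measurable disc_measure"
      using hol by (intro measurable_continuous_disc holomorphic_on_imp_continuous_on)
  qed (use bergman_bound w in auto)
qed (simp add: bergman_def)

text \<open>The reproducing property of the Bergman kernel is the mean value property, transported from the
  origin to \<open>w\<close> by the automorphism \<open>z \<mapsto> (z + w) / (1 + cnj w * z)\<close>.\<close>

lemma bergman_reproducing:
  assumes f: "f \<in> A2_disc" and w: "w \<in> disc"
  shows "L2_inner disc_measure f (bergman w) = f w"
proof -
  define \<phi> where "\<phi> = psu 0 (- w)"
  have cw: "cmod (- w) < 1" using w by simp
  have emb: "\<phi> \<in> CE_emb" and onto: "\<phi> ` disc = disc"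
    unfolding \<phi>_def using psu_in_CE_emb[OF cw] psu_onto[OF cw] by auto
  note D = CE_embD[OF emb]
  define c where "c = 1 - cnj w * w"
  have creal: "c = of_real (1 - (cmod w)\<^sup>2)"
    unfolding c_def of_real_diff complex_norm_square by (simp add: mult.commute)
  have c0: "c \<noteq> 0" unfolding c_def by (rule one_minus_cnj_mult_ne) (use w in auto)
  have d\<phi>: "deriv \<phi> z = c / (1 + cnj w * z)\<^sup>2" if "z \<in> disc" for z
    using deriv_psu[OF cw that, of 0] by (simp add: \<phi>_def c_def)
  have \<phi>z: "\<phi> z = (z + w) / (1 + cnj w * z)" if "z \<in> disc" for z
    using that by (simp add: \<phi>_def psu_def)
  have ne: "1 + cnj w * z \<noteq> 0" if "z \<in> disc" for z
    using one_minus_cnj_mult_ne[of "- w" z] cw that by (simp only: complex_cnj_minus mult_minus_left diff_minus_eq_add mem_ball_0 not_False_eq_True)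
  \<comment> \<open>In the transported integral the conjugate of one factor \<open>\<phi>'\<close> cancels against the kernel, which leaves a
    holomorphic integrand.\<close>
  have key: "deriv \<phi> z * bergman w (\<phi> z) = 1 / c" if z: "z \<in> disc" for z
  proof -
    have "1 - cnj w * \<phi> z = c / (1 + cnj w * z)"
      using ne[OF z] by (simp add: \<phi>z[OF z] c_def field_simps)
    then show ?thesis
      using ne[OF z] c0 D(5)[OF z] by (simp add: bergman_def d\<phi>[OF z] power_divide power2_eq_square)
  qed
  let ?g = "\<lambda>z. f z * cnj (bergman w z)"
  let ?h = "\<lambda>z. deriv \<phi> z * f (\<phi> z) / c"
  have eq: "(cmod (deriv \<phi> z))\<^sup>2 *\<^sub>R ?g (\<phi> z) = ?h z" if z: "z \<in> disc" for z
  proof -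
    have "(cmod (deriv \<phi> z))\<^sup>2 *\<^sub>R ?g (\<phi> z) = deriv \<phi> z * f (\<phi> z) * cnj (deriv \<phi> z * bergman w (\<phi> z))"
      by (simp add: scaleR_conv_of_real complex_norm_square del: of_real_power)
    moreover have "cnj (1 / c) = 1 / c" by (simp add: creal)
    ultimately show ?thesis unfolding key[OF z] by simp
  qed
  have gi: "integrable disc_measure ?g"
    by (rule square_integrable_mult[OF A2_discD(2)[OF f] A2_discD(2)[OF bergman_in_A2_disc[OF w]]])
  have [measurable]: "f \<in> borel_measurable disc_measure" "\<phi> \<in> measurable disc_measure disc_measure"
    "deriv \<phi> \<in> borel_measurable disc_measure"
    using A2_discD(2)[OF f] CE_emb_measurable[OF emb] by (auto simp: square_integrable_def)
  have hol: "?h holomorphic_on disc"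
    using holomorphic_on_compose_gen[OF D(1) A2_discD(1)[OF f] D(3)] c0 unfolding o_def
    by (intro holomorphic_on_divide holomorphic_on_mult D(8) holomorphic_on_const)
  have int: "integrable disc_measure ?h"
  proof (rule integrableI_bounded)
    show "?h \<in> borel_measurable disc_measure" by measurable
    have "(\<integral>\<^sup>+z. norm (?h z) \<partial>disc_measure) = (\<integral>\<^sup>+z. ennreal ((cmod (deriv \<phi> z))\<^sup>2) * ennreal (norm (?g (\<phi> z))) \<partial>disc_measure)"
    proof (rule nn_integral_cong)
      fix z assume "z \<in> space disc_measure"
      then have z: "z \<in> disc" by simp
      have "norm (?h z) = (cmod (deriv \<phi> z))\<^sup>2 * norm (?g (\<phi> z))"
        unfolding eq[OF z, symmetric] by simp
      then show "ennreal (norm (?h z)) = ennreal ((cmod (deriv \<phi> z))\<^sup>2) * ennreal (norm (?g (\<phi> z)))"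
        by (simp add: ennreal_mult)
    qed
    also have "\<dots> = (\<integral>\<^sup>+z. indicator (\<phi> ` disc) z * ennreal (norm (?g z)) \<partial>disc_measure)"
      using gi by (intro nn_integral_change_disc[OF emb]) simp
    also have "\<dots> \<le> (\<integral>\<^sup>+z. ennreal (norm (?g z)) \<partial>disc_measure)"
      by (intro nn_integral_mono) (auto simp: indicator_def)
    also have "\<dots> < \<infinity>" using gi by (simp add: integrable_iff_bounded)
    finally show "(\<integral>\<^sup>+z. norm (?h z) \<partial>disc_measure) < \<infinity>" .
  qed
  have "L2_inner disc_measure f (bergman w) = (LINT z|disc_measure. (cmod (deriv \<phi> z))\<^sup>2 *\<^sub>R ?g (\<phi> z))"
    unfolding L2_inner_def using gi by (intro integral_change_disc[symmetric] emb onto) simp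
  also have "\<dots> = (LINT z|disc_measure. ?h z)"
    by (intro Bochner_Integration.integral_cong refl) (simp add: eq)
  also have "\<dots> = ?h 0" by (rule mean_value_disc[OF hol int])
  also have "\<dots> = f w" using c0 by (simp add: d\<phi> \<phi>z)
  finally show ?thesis .
qed

section \<open>The polydisc\<close>

interpretation PM: product_sigma_finite "\<lambda>_::nat. disc_measure"
  by unfold_locales

lemma space_poly_measure [simp]: "space (poly_measure p) = polydisc p"
  by (simp add: poly_measure_def polydisc_def space_PiM)

lemma polydiscD: "z \<in> polydisc p \<Longrightarrow> i < p \<Longrightarrow> z i \<in> disc"
  by (auto simp: polydisc_def PiE_def)

lemma polydisc_undefined: "z \<in> polydisc p \<Longrightarrow> p \<le> i \<Longrightarrow> z i = undefined"
  by (auto simp: polydisc_def PiE_def extensional_def)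

lemma polydiscI: "(\<And>i. i < p \<Longrightarrow> z i \<in> disc) \<Longrightarrow> (\<And>i. p \<le> i \<Longrightarrow> z i = undefined) \<Longrightarrow> z \<in> polydisc p"
  by (auto simp: polydisc_def PiE_def extensional_def)

lemma polydisc_eqI: "z \<in> polydisc p \<Longrightarrow> w \<in> polydisc p \<Longrightarrow> (\<And>i. i < p \<Longrightarrow> z i = w i) \<Longrightarrow> z = w"
  unfolding polydisc_def by (rule PiE_ext) auto

lemma polydisc_0: "polydisc 0 = {\<lambda>_. undefined}"
  by (simp add: polydisc_def)

lemma polydisc_upd: "z \<in> polydisc p \<Longrightarrow> i < p \<Longrightarrow> w \<in> disc \<Longrightarrow> z(i := w) \<in> polydisc p"
  by (auto intro!: polydiscI simp: polydiscD polydisc_undefined dest: polydiscD)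

lemma polydisc_upd_Suc: "z \<in> polydisc p \<Longrightarrow> w \<in> disc \<Longrightarrow> z(p := w) \<in> polydisc (Suc p)"
  by (rule polydiscI) (auto simp: less_Suc_eq polydisc_undefined dest: polydiscD)

lemma emeasure_poly_measure: "emeasure (poly_measure p) (polydisc p) = 1"
  using PM.emeasure_PiM[of "{..<p}" "\<lambda>_. disc"] sets.top[of disc_measure]
  by (simp add: poly_measure_def polydisc_def emeasure_disc_measure_disc)

lemma finite_measure_poly: "finite_measure (poly_measure p)"
  by (rule finite_measureI) (simp add: emeasure_poly_measure)

lemma poly_measure_0: "poly_measure 0 = count_space {\<lambda>_. undefined}"
  by (simp add: poly_measure_def PiM_empty)

lemma measurable_poly_component:
  assumes "i < p"
  shows "(\<lambda>z. z i) \<in> measurable (poly_measure p) disc_measure"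
  unfolding poly_measure_def using assms by (intro measurable_component_singleton) simp

lemma measurable_polyI:
  assumes "\<And>i. i < p \<Longrightarrow> (\<lambda>x. F x i) \<in> measurable N disc_measure"
    and "\<And>x i. x \<in> space N \<Longrightarrow> p \<le> i \<Longrightarrow> F x i = undefined"
  shows "F \<in> measurable N (poly_measure p)"
proof -
  have "(\<lambda>x. \<lambda>i\<in>{..<p}. F x i) \<in> measurable N (poly_measure p)"
    unfolding poly_measure_def by (rule measurable_restrict) (simp add: assms(1))
  moreover have "(\<lambda>i\<in>{..<p}. F x i) = F x" if "x \<in> space N" for x
    using assms(2)[OF that] by (auto simp: restrict_def fun_eq_iff)
  ultimately show ?thesis by (subst measurable_cong) auto
qed

lemma measurable_continuous_polydisc:
  assumes "continuous_on (polydisc p) f"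
  shows "f \<in> borel_measurable (poly_measure p)"
proof -
  have disc_borel: "(\<lambda>z. z) \<in> measurable disc_measure borel"
    by (rule measurable_continuous_disc) (rule continuous_on_id)
  have "(\<lambda>z. z) \<in> measurable (poly_measure p) borel"
  proof (rule measurable_coordinatewise_then_product)
    fix i
    show "(\<lambda>z. z i) \<in> borel_measurable (poly_measure p)"
    proof (cases "i < p")
      case True
      from measurable_compose[OF measurable_poly_component[OF this] disc_borel] show ?thesis .
    next
      case False
      then have "z i = undefined" if "z \<in> space (poly_measure p)" for z
        using that by (simp add: polydisc_undefined)
      then have "(\<lambda>z. z i) \<in> borel_measurable (poly_measure p) \<longleftrightarrow>
          (\<lambda>_. undefined :: complex) \<in> borel_measurable (poly_measure p)"
        by (rule measurable_cong)
      then show ?thesis by simp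
    qed
  qed
  then have "(\<lambda>z. z) \<in> measurable (poly_measure p) (restrict_space borel (polydisc p))"
    by (rule measurable_restrict_space2[rotated]) simp
  from measurable_compose[OF this borel_measurable_continuous_on_restrict[OF assms]] show ?thesis .
qed

lemma nn_integral_poly_Suc:
  assumes "f \<in> borel_measurable (poly_measure (Suc p))"
  shows "(\<integral>\<^sup>+z. f z \<partial>poly_measure (Suc p)) = (\<integral>\<^sup>+z. \<integral>\<^sup>+u. f (z(p := u)) \<partial>disc_measure \<partial>poly_measure p)"
  using assms unfolding poly_measure_def lessThan_Suc by (intro PM.product_nn_integral_insert) auto

lemma integral_poly_Suc:
  fixes f :: "(nat \<Rightarrow> complex) \<Rightarrow> complex"
  assumes "integrable (poly_measure (Suc p)) f"
  shows "(LINT z|poly_measure (Suc p). f z) = (LINT z|poly_measure p. LINT u|disc_measure. f (z(p := u)))"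
  using assms unfolding poly_measure_def lessThan_Suc by (intro PM.product_integral_insert) auto

lemma measurable_poly_upd: "(\<lambda>(z, u). z(p := u)) \<in> measurable (poly_measure p \<Otimes>\<^sub>M disc_measure) (poly_measure (Suc p))"
  unfolding poly_measure_def lessThan_Suc by (rule measurable_add_dim)

lemma measurable_poly_slice:
  assumes "z \<in> polydisc p"
  shows "(\<lambda>u. z(p := u)) \<in> measurable disc_measure (poly_measure (Suc p))"
  using measurable_compose[OF measurable_Pair1'[of z "poly_measure p" disc_measure] measurable_poly_upd] assms by simp

lemma nn_integral_poly_prod:
  assumes "\<And>i. i < p \<Longrightarrow> f i \<in> borel_measurable disc_measure"
  shows "(\<integral>\<^sup>+z. (\<Prod>i<p. f i (z i)) \<partial>poly_measure p) = (\<Prod>i<p. \<integral>\<^sup>+u. f i u \<partial>disc_measure)"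
  unfolding poly_measure_def using assms by (intro PM.product_nn_integral_prod) auto

lemma integral_poly_prod:
  fixes f :: "nat \<Rightarrow> complex \<Rightarrow> complex"
  assumes "\<And>i. i < p \<Longrightarrow> integrable disc_measure (f i)"
  shows "(LINT z|poly_measure p. (\<Prod>i<p. f i (z i))) = (\<Prod>i<p. LINT u|disc_measure. f i u)"
  unfolding poly_measure_def using assms by (intro PM.product_integral_prod) auto

section \<open>Bergman spaces of polydiscs\<close>

lemma A2_D:
  assumes "f \<in> A2 p"
  shows "holomorphic_polydisc p f" "square_integrable (poly_measure p) f" "z \<notin> polydisc p \<Longrightarrow> f z = 0"
    "continuous_on (polydisc p) f"
    "z \<in> polydisc p \<Longrightarrow> i < p \<Longrightarrow> (\<lambda>w. f (z(i := w))) holomorphic_on disc"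
  using assms by (auto simp: A2_def holomorphic_polydisc_def)

lemma A2_I:
  assumes "holomorphic_polydisc p f" "square_integrable (poly_measure p) f" "\<And>z. z \<notin> polydisc p \<Longrightarrow> f z = 0"
  shows "f \<in> A2 p"
  using assms by (auto simp: A2_def)

lemma A2_zero: "(\<lambda>_. 0) \<in> A2 p"
  by (rule A2_I) (simp_all add: holomorphic_polydisc_def square_integrable_zero)

lemma A2_add:
  assumes f: "f \<in> A2 p" and g: "g \<in> A2 p"
  shows "(\<lambda>x. f x + g x) \<in> A2 p"
proof (rule A2_I)
  show "holomorphic_polydisc p (\<lambda>x. f x + g x)"
    unfolding holomorphic_polydisc_def
    by (intro conjI ballI allI impI continuous_on_add holomorphic_on_add A2_D(4,5)[OF f] A2_D(4,5)[OF g])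
  show "square_integrable (poly_measure p) (\<lambda>x. f x + g x)"
    by (intro square_integrable_add A2_D(2) f g)
qed (simp add: A2_D(3)[OF f] A2_D(3)[OF g])

lemma A2_scale:
  assumes f: "f \<in> A2 p"
  shows "(\<lambda>x. c * f x) \<in> A2 p"
proof (rule A2_I)
  show "holomorphic_polydisc p (\<lambda>x. c * f x)"
    unfolding holomorphic_polydisc_def
    by (intro conjI ballI allI impI continuous_on_mult continuous_on_const holomorphic_on_mult
        holomorphic_on_const A2_D(4,5)[OF f])
  show "square_integrable (poly_measure p) (\<lambda>x. c * f x)"
    by (intro square_integrable_scale A2_D(2) f)
qed (simp add: A2_D(3)[OF f])

lemma continuous_on_polydisc_component: "continuous_on S (\<lambda>z::nat \<Rightarrow> complex. z i)"
  by (rule continuous_on_subset[OF continuous_on_product_coordinates]) auto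

text \<open>Almost every slice of a square integrable function is square integrable, by Tonelli.  A slice of a
  function in the Bergman space need not be square integrable without exception a priori, which is why the
  statements about slices below assume it.\<close>

lemma square_integrable_poly_slice:
  assumes f: "square_integrable (poly_measure (Suc p)) f"
  shows "AE z in poly_measure p. square_integrable disc_measure (\<lambda>u. f (z(p := u)))"
proof -
  let ?h = "\<lambda>z. ennreal ((cmod (f z))\<^sup>2)"
  have m: "f \<in> borel_measurable (poly_measure (Suc p))"
    using f by (simp add: square_integrable_def)
  have h: "?h \<in> borel_measurable (poly_measure (Suc p))" using m by measurable
  have "(\<lambda>(z, u). ?h (z(p := u))) \<in> borel_measurable (poly_measure p \<Otimes>\<^sub>M disc_measure)"
    using measurable_compose[OF measurable_poly_upd h] by (simp add: split_beta')
  then have hm: "(\<lambda>z. \<integral>\<^sup>+u. ?h (z(p := u)) \<partial>disc_measure) \<in> borel_measurable (poly_measure p)"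
    by (rule disc.borel_measurable_nn_integral)
  have "(\<integral>\<^sup>+z. \<integral>\<^sup>+u. ?h (z(p := u)) \<partial>disc_measure \<partial>poly_measure p) < \<infinity>"
    using f unfolding nn_integral_poly_Suc[OF h, symmetric] by (simp add: square_integrable_iff_nn)
  then have "AE z in poly_measure p. (\<integral>\<^sup>+u. ?h (z(p := u)) \<partial>disc_measure) \<noteq> \<infinity>"
    by (intro nn_integral_PInf_AE hm) auto
  then show ?thesis
    using AE_space
  proof eventually_elim
    case (elim z)
    then have "(\<lambda>u. f (z(p := u))) \<in> borel_measurable disc_measure"
      using measurable_compose[OF measurable_poly_slice m] by auto
    with elim show ?case by (simp add: square_integrable_iff_nn top.not_eq_extremum)
  qed
qed

lemma A2_slice_in_A2_disc:
  assumes f: "f \<in> A2 (Suc p)" and z: "z \<in> polydisc p"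
    and sq: "square_integrable disc_measure (\<lambda>u. f (z(p := u)))"
  shows "(\<lambda>u. if u \<in> disc then f (z(p := u)) else 0) \<in> A2_disc"
  unfolding A2_disc_def
proof (intro CollectI conjI allI impI)
  have z0: "z(p := 0) \<in> polydisc (Suc p)" using z by (rule polydisc_upd_Suc) simp
  have "(\<lambda>u. f ((z(p := 0))(p := u))) holomorphic_on disc"
    by (rule A2_D(5)[OF f z0]) simp
  then show "(\<lambda>u. if u \<in> disc then f (z(p := u)) else 0) holomorphic_on disc"
    by (rule holomorphic_transform) simp
  show "square_integrable disc_measure (\<lambda>u. if u \<in> disc then f (z(p := u)) else 0)"
    using sq by (subst square_integrable_cong) auto
qed simp

lemma A2_slice_eval:
  assumes f: "f \<in> A2 (Suc p)" and w: "w \<in> disc" and z: "z \<in> polydisc p"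
    and sq: "square_integrable disc_measure (\<lambda>u. f (z(p := u)))"
  shows "L2_inner disc_measure (\<lambda>u. f (z(p := u))) (bergman w) = f (z(p := w))"
proof -
  have "L2_inner disc_measure (\<lambda>u. f (z(p := u))) (bergman w) =
      L2_inner disc_measure (\<lambda>u. if u \<in> disc then f (z(p := u)) else 0) (bergman w)"
    by (intro L2_inner_cong) auto
  also have "\<dots> = f (z(p := w))"
    using bergman_reproducing[OF A2_slice_in_A2_disc[OF f z sq] w] w by simp
  finally show ?thesis .
qed

text \<open>Fixing the last coordinate is bounded because evaluation in that coordinate is pairing with the
  Bergman kernel.\<close>

lemma A2_fix_last:
  assumes f: "f \<in> A2 (Suc p)" and w: "w \<in> disc"
  shows "(\<lambda>z. if z \<in> polydisc p then f (z(p := w)) else 0) \<in> A2 p" (is "?g \<in> _")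
proof (rule A2_I)
  note up = polydisc_upd_Suc[OF _ w]
  have "continuous_on (polydisc p) (\<lambda>z. z(p := w))"
  proof (rule continuous_on_coordinatewise_then_product)
    show "continuous_on (polydisc p) (\<lambda>z. (z(p := w)) i)" for i
      by (cases "i = p") (auto intro: continuous_on_polydisc_component)
  qed
  then have "continuous_on (polydisc p) (\<lambda>z. f (z(p := w)))"
    by (rule continuous_on_compose2[OF A2_D(4)[OF f]]) (use up in auto)
  then have cont: "continuous_on (polydisc p) ?g"
    by (rule continuous_on_eq) simp
  have "(\<lambda>u. ?g (z(i := u))) holomorphic_on disc" if z: "z \<in> polydisc p" and i: "i < p" for z i
  proof -
    have "(\<lambda>u. f ((z(p := w))(i := u))) holomorphic_on disc"
      by (rule A2_D(5)[OF f up[OF z]]) (use i in simp)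
    then show ?thesis
      by (rule holomorphic_transform) (use i z in \<open>simp add: polydisc_upd fun_upd_twist\<close>)
  qed
  with cont show "holomorphic_polydisc p ?g" by (simp add: holomorphic_polydisc_def)
  let ?h = "\<lambda>z. ennreal ((cmod (f z))\<^sup>2)" and ?c = "(L2_norm disc_measure (bergman w))\<^sup>2"
  have m: "?h \<in> borel_measurable (poly_measure (Suc p))"
    using A2_D(2)[OF f] by (auto simp: square_integrable_def)
  have "(\<integral>\<^sup>+z. ennreal ((cmod (?g z))\<^sup>2) \<partial>poly_measure p) \<le>
      (\<integral>\<^sup>+z. ennreal ?c * (\<integral>\<^sup>+u. ?h (z(p := u)) \<partial>disc_measure) \<partial>poly_measure p)"
  proof (rule nn_integral_mono_AE)
    show "AE z in poly_measure p. ennreal ((cmod (?g z))\<^sup>2) \<le> ennreal ?c * (\<integral>\<^sup>+u. ?h (z(p := u)) \<partial>disc_measure)"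
      using square_integrable_poly_slice[OF A2_D(2)[OF f]] AE_space
    proof eventually_elim
      case (elim z)
      then have z: "z \<in> polydisc p" by simp
      have "cmod (?g z) \<le> L2_norm disc_measure (\<lambda>u. f (z(p := u))) * L2_norm disc_measure (bergman w)"
        using L2_Cauchy_Schwarz[OF elim(1) A2_discD(2)[OF bergman_in_A2_disc[OF w]]]
        unfolding A2_slice_eval[OF f w z elim(1)] using z by simp
      from power_mono[OF this, of 2]
      have "(cmod (?g z))\<^sup>2 \<le> ?c * (L2_norm disc_measure (\<lambda>u. f (z(p := u))))\<^sup>2"
        by (simp only: power_mult_distrib mult.commute norm_ge_zero)
      then have "ennreal ((cmod (?g z))\<^sup>2) \<le> ennreal (?c * (L2_norm disc_measure (\<lambda>u. f (z(p := u))))\<^sup>2)"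
        by (rule ennreal_leI)
      also have "\<dots> = ennreal ?c * ennreal ((L2_norm disc_measure (\<lambda>u. f (z(p := u))))\<^sup>2)"
        by (rule ennreal_mult) auto
      finally show ?case
        unfolding nn_integral_L2_norm[OF elim(1)] .
    qed
  qed
  also have "\<dots> = ennreal ?c * (\<integral>\<^sup>+z. \<integral>\<^sup>+u. ?h (z(p := u)) \<partial>disc_measure \<partial>poly_measure p)"
  proof (rule nn_integral_cmult)
      have "(\<lambda>(z, u). ?h (z(p := u))) \<in> borel_measurable (poly_measure p \<Otimes>\<^sub>M disc_measure)"
      using measurable_compose[OF measurable_poly_upd m] by (simp add: split_beta')
    then show "(\<lambda>z. \<integral>\<^sup>+u. ?h (z(p := u)) \<partial>disc_measure) \<in> borel_measurable (poly_measure p)"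
      by (rule disc.borel_measurable_nn_integral)
  qed
  also have "\<dots> = ennreal ?c * ennreal ((L2_norm (poly_measure (Suc p)) f)\<^sup>2)"
    unfolding nn_integral_poly_Suc[OF m, symmetric] nn_integral_L2_norm[OF A2_D(2)[OF f]] ..
  also have "\<dots> < \<infinity>" by (simp add: ennreal_mult_less_top)
  finally show "square_integrable (poly_measure p) ?g"
    using measurable_continuous_polydisc[OF cont] by (simp add: square_integrable_iff_nn)
qed simp

section \<open>Elementary tensors\<close>

lemma tens_in_A2:
  assumes as: "set as \<subseteq> A2_disc" and p: "length as = p"
  shows "tens as \<in> A2 p"
proof (rule A2_I)
  have mem: "as ! i \<in> A2_disc" if "i < p" for i
    using as p that nth_mem by blast
  have cont: "continuous_on (polydisc p) (\<lambda>z. \<Prod>i<p. (as ! i) (z i))"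
  proof (rule continuous_on_prod)
    fix i assume i: "i \<in> {..<p}"
    have "continuous_on disc (as ! i)"
      using A2_discD(1)[OF mem] i by (auto intro: holomorphic_on_imp_continuous_on)
    then show "continuous_on (polydisc p) (\<lambda>z. (as ! i) (z i))"
      by (rule continuous_on_compose2[OF _ continuous_on_polydisc_component]) (use i polydiscD in auto)
  qed
  have cont': "continuous_on (polydisc p) (tens as)"
    by (rule continuous_on_eq[OF cont]) (simp add: tens_def p)
  have "(\<lambda>w. tens as (z(i := w))) holomorphic_on disc" if z: "z \<in> polydisc p" and i: "i < p" for z i
  proof -
    have "(\<lambda>w. \<Prod>j<p. (as ! j) ((z(i := w)) j)) holomorphic_on disc"
    proof (rule holomorphic_on_prod)
      fix j assume "j \<in> {..<p}"
      then show "(\<lambda>w. (as ! j) ((z(i := w)) j)) holomorphic_on disc"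
        using A2_discD(1)[OF mem] by (cases "j = i") auto
    qed
    then show ?thesis
      by (rule holomorphic_transform) (use z i p in \<open>simp add: tens_def polydisc_upd\<close>)
  qed
  with cont' show "holomorphic_polydisc p (tens as)" by (simp add: holomorphic_polydisc_def)
  have m: "as ! i \<in> borel_measurable disc_measure" if "i < p" for i
    using A2_discD(2)[OF mem[OF that]] by (rule square_integrable_measurable)
  have "(\<integral>\<^sup>+z. ennreal ((cmod (tens as z))\<^sup>2) \<partial>poly_measure p) =
      (\<integral>\<^sup>+z. (\<Prod>i<p. ennreal ((cmod ((as ! i) (z i)))\<^sup>2)) \<partial>poly_measure p)"
    by (intro nn_integral_cong) (simp add: tens_def p prod_ennreal prod_norm prod_power_distrib flip: prod_norm)
  also have "\<dots> = (\<Prod>i<p. \<integral>\<^sup>+u. ennreal ((cmod ((as ! i) u))\<^sup>2) \<partial>disc_measure)"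
  proof (rule nn_integral_poly_prod)
    fix i assume "i < p"
    from m[OF this] show "(\<lambda>u. ennreal ((cmod ((as ! i) u))\<^sup>2)) \<in> borel_measurable disc_measure" by measurable
  qed
  also have "\<dots> = (\<Prod>i<p. ennreal ((L2_norm disc_measure (as ! i))\<^sup>2))"
    by (intro prod.cong refl nn_integral_L2_norm A2_discD(2) mem) simp
  also have "\<dots> < \<infinity>" by (simp add: prod_ennreal)
  finally show "square_integrable (poly_measure p) (tens as)"
    using measurable_continuous_polydisc[OF cont'] by (simp add: square_integrable_iff_nn)
qed (simp add: tens_def p)

lemma L2_inner_tens:
  assumes "set as \<subseteq> A2_disc" "set bs \<subseteq> A2_disc" "length as = p" "length bs = p"
  shows "L2_inner (poly_measure p) (tens as) (tens bs) = (\<Prod>i<p. L2_inner disc_measure (as ! i) (bs ! i))"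
proof -
  have "L2_inner (poly_measure p) (tens as) (tens bs) =
      (LINT z|poly_measure p. (\<Prod>i<p. (as ! i) (z i) * cnj ((bs ! i) (z i))))"
    unfolding L2_inner_def
  proof (rule Bochner_Integration.integral_cong)
    fix z assume "z \<in> space (poly_measure p)"
    then have "tens as z = (\<Prod>i<p. (as ! i) (z i))" "tens bs z = (\<Prod>i<p. (bs ! i) (z i))"
      unfolding tens_def assms(3,4) by simp_all
    then show "tens as z * cnj (tens bs z) = (\<Prod>i<p. (as ! i) (z i) * cnj ((bs ! i) (z i)))"
      by (simp only: prod.distrib cnj_prod)
  qed simp
  also have "\<dots> = (\<Prod>i<p. LINT u|disc_measure. (as ! i) u * cnj ((bs ! i) u))"
  proof (rule integral_poly_prod)
    fix i assume "i < p"
    then have "as ! i \<in> set as" "bs ! i \<in> set bs" by (auto intro!: nth_mem simp: assms(3,4))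
    then have "as ! i \<in> A2_disc" "bs ! i \<in> A2_disc" using assms(1,2) by blast+
    then show "integrable disc_measure (\<lambda>u. (as ! i) u * cnj ((bs ! i) u))"
      by (intro square_integrable_mult A2_discD)
  qed
  finally show ?thesis by (simp add: L2_inner_def)
qed

definition poly_bergman :: "nat \<Rightarrow> (nat \<Rightarrow> complex) \<Rightarrow> (nat \<Rightarrow> complex) \<Rightarrow> complex" where
  "poly_bergman p w = tens (map (\<lambda>i. bergman (w i)) [0..<p])"

lemma set_bergman_list: "w \<in> polydisc p \<Longrightarrow> set (map (\<lambda>i. bergman (w i)) [0..<p]) \<subseteq> A2_disc"
  using polydiscD by (auto intro!: bergman_in_A2_disc)

lemma poly_bergman_in_A2: "w \<in> polydisc p \<Longrightarrow> poly_bergman p w \<in> A2 p"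
  unfolding poly_bergman_def by (intro tens_in_A2 set_bergman_list) auto

lemma poly_bergman_eq: "z \<in> polydisc p \<Longrightarrow> poly_bergman p w z = (\<Prod>i<p. bergman (w i) (z i))"
  by (simp add: poly_bergman_def tens_def)

text \<open>The product kernel reproduces by Fubini, one variable at a time.\<close>

lemma A2_reproducing:
  assumes "f \<in> A2 p" "w \<in> polydisc p"
  shows "L2_inner (poly_measure p) f (poly_bergman p w) = f w"
  using assms
proof (induction p arbitrary: f w)
  case 0
  have "poly_bergman 0 w (\<lambda>_. undefined) = 1"
    by (simp add: poly_bergman_eq polydisc_0)
  moreover have "w = (\<lambda>_. undefined)" using 0 by (simp add: polydisc_0)
  ultimately show ?case
    by (simp add: L2_inner_def poly_measure_0 lebesgue_integral_count_space_finite)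
next
  case (Suc p)
  note f = Suc.prems(1) and w = Suc.prems(2)
  define v where "v = restrict w {..<p}"
  have v: "v \<in> polydisc p" by (rule polydiscI) (use polydiscD[OF w] in \<open>simp_all add: v_def\<close>)
  have wv: "v(p := w p) = w"
    using w polydisc_undefined[OF w] by (auto simp: v_def fun_eq_iff restrict_def)
  have wp: "w p \<in> disc" using w polydiscD by blast
  let ?g = "\<lambda>z. if z \<in> polydisc p then f (z(p := w p)) else 0"
  have int: "integrable (poly_measure (Suc p)) (\<lambda>z. f z * cnj (poly_bergman (Suc p) w z))"
    by (intro square_integrable_mult A2_D(2) f poly_bergman_in_A2 w)
  have K: "poly_bergman (Suc p) w (z(p := u)) = poly_bergman p v z * bergman (w p) u"
    if "z \<in> polydisc p" "u \<in> disc" for z u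
    using that by (simp add: poly_bergman_eq polydisc_upd_Suc v_def)
  have "L2_inner (poly_measure (Suc p)) f (poly_bergman (Suc p) w) =
      (LINT z|poly_measure p. LINT u|disc_measure. f (z(p := u)) * cnj (poly_bergman (Suc p) w (z(p := u))))"
    unfolding L2_inner_def by (rule integral_poly_Suc[OF int])
  also have "\<dots> = (LINT z|poly_measure p. ?g z * cnj (poly_bergman p v z))"
  proof (rule integral_cong_AE)
    have m1: "(\<lambda>(z, u). f (z(p := u)) * cnj (poly_bergman (Suc p) w (z(p := u)))) \<in>
        borel_measurable (poly_measure p \<Otimes>\<^sub>M disc_measure)"
      using measurable_compose[OF measurable_poly_upd borel_measurable_integrable[OF int]]
      by (simp add: split_beta')
    then show "(\<lambda>z. LINT u|disc_measure. f (z(p := u)) * cnj (poly_bergman (Suc p) w (z(p := u)))) \<in>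
        borel_measurable (poly_measure p)"
      by (rule disc.borel_measurable_lebesgue_integral)
    show "(\<lambda>z. ?g z * cnj (poly_bergman p v z)) \<in> borel_measurable (poly_measure p)"
      by (intro borel_measurable_integrable square_integrable_mult A2_D(2) A2_fix_last f wp poly_bergman_in_A2 v)
    show "AE z in poly_measure p.
        (LINT u|disc_measure. f (z(p := u)) * cnj (poly_bergman (Suc p) w (z(p := u)))) =
        ?g z * cnj (poly_bergman p v z)"
      using square_integrable_poly_slice[OF A2_D(2)[OF f]] AE_space
    proof eventually_elim
      case (elim z)
      then have z: "z \<in> polydisc p" by simp
      have "(LINT u|disc_measure. f (z(p := u)) * cnj (poly_bergman (Suc p) w (z(p := u)))) =
          (LINT u|disc_measure. (f (z(p := u)) * cnj (bergman (w p) u)) * cnj (poly_bergman p v z))"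
        by (intro Bochner_Integration.integral_cong) (auto simp: K[OF z])
      also have "\<dots> = L2_inner disc_measure (\<lambda>u. f (z(p := u))) (bergman (w p)) * cnj (poly_bergman p v z)"
        unfolding L2_inner_def by (rule Bochner_Integration.integral_mult_left_zero)
      also have "\<dots> = ?g z * cnj (poly_bergman p v z)"
        unfolding A2_slice_eval[OF f wp z elim(1)] using z by simp
      finally show ?case .
    qed
  qed
  also have "\<dots> = ?g v"
    using Suc.IH[OF A2_fix_last[OF f wp] v] by (simp add: L2_inner_def)
  also have "\<dots> = f w" using v wv by simp
  finally show ?case .
qed

section \<open>Completeness\<close>

text \<open>The reciprocal of this function bounds the norm of the reproducing kernel at \<open>w\<close>.\<close>

definition bdry_dist :: "nat \<Rightarrow> (nat \<Rightarrow> complex) \<Rightarrow> real" where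
  "bdry_dist p w = (\<Prod>i<p. (1 - cmod (w i))\<^sup>2)"

lemma bdry_dist_pos: "w \<in> polydisc p \<Longrightarrow> 0 < bdry_dist p w"
  unfolding bdry_dist_def using polydiscD by (intro prod_pos) fastforce

lemma continuous_bdry_dist: "continuous_on S (bdry_dist p)"
  unfolding bdry_dist_def[abs_def]
  by (intro continuous_intros continuous_on_polydisc_component)

lemma L2_norm_poly_bergman:
  assumes w: "w \<in> polydisc p"
  shows "L2_norm (poly_measure p) (poly_bergman p w) \<le> 1 / bdry_dist p w"
proof (rule L2_norm_le_nn(2))
  show "poly_bergman p w \<in> borel_measurable (poly_measure p)"
    by (intro square_integrable_measurable A2_D(2) poly_bergman_in_A2 w)
  show "0 \<le> 1 / bdry_dist p w" using bdry_dist_pos[OF w] by simp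
  have "cmod (poly_bergman p w z) \<le> 1 / bdry_dist p w" if z: "z \<in> polydisc p" for z
  proof -
    have "cmod (poly_bergman p w z) = (\<Prod>i<p. cmod (bergman (w i) (z i)))"
      by (simp add: poly_bergman_eq[OF z] prod_norm)
    also have "\<dots> \<le> (\<Prod>i<p. 1 / (1 - cmod (w i))\<^sup>2)"
    proof (rule prod_mono)
      fix i assume "i \<in> {..<p}"
      then have "w i \<in> disc" "z i \<in> disc" using polydiscD w z by auto
      then show "0 \<le> cmod (bergman (w i) (z i)) \<and> cmod (bergman (w i) (z i)) \<le> 1 / (1 - cmod (w i))\<^sup>2"
        using bergman_bound[of "w i" "z i"] by simp
    qed
    also have "\<dots> = 1 / bdry_dist p w" by (simp add: bdry_dist_def prod_dividef)
    finally show ?thesis .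
  qed
  then have "(\<integral>\<^sup>+z. ennreal ((cmod (poly_bergman p w z))\<^sup>2) \<partial>poly_measure p) \<le>
      (\<integral>\<^sup>+z. ennreal ((1 / bdry_dist p w)\<^sup>2) \<partial>poly_measure p)"
    by (intro nn_integral_mono ennreal_leI power_mono) auto
  also have "\<dots> = ennreal ((1 / bdry_dist p w)\<^sup>2)"
    by (simp add: emeasure_poly_measure)
  finally show "(\<integral>\<^sup>+z. ennreal ((cmod (poly_bergman p w z))\<^sup>2) \<partial>poly_measure p) \<le> ennreal ((1 / bdry_dist p w)\<^sup>2)" .
qed

lemma A2_pointwise_bound:
  assumes f: "f \<in> A2 p" and w: "w \<in> polydisc p"
  shows "bdry_dist p w * cmod (f w) \<le> L2_norm (poly_measure p) f"
proof -
  have "cmod (f w) \<le> L2_norm (poly_measure p) f * L2_norm (poly_measure p) (poly_bergman p w)"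
    using L2_Cauchy_Schwarz[OF A2_D(2)[OF f] A2_D(2)[OF poly_bergman_in_A2[OF w]]]
    unfolding A2_reproducing[OF f w] .
  also have "\<dots> \<le> L2_norm (poly_measure p) f * (1 / bdry_dist p w)"
    by (intro mult_left_mono L2_norm_poly_bergman w) simp
  finally show ?thesis
    using bdry_dist_pos[OF w] by (simp add: field_simps)
qed

lemma A2_diff: "f \<in> A2 p \<Longrightarrow> g \<in> A2 p \<Longrightarrow> (\<lambda>x. f x - g x) \<in> A2 p"
  using A2_add[OF _ A2_scale[of g p "-1"]] by simp

text \<open>Convergence in the mean implies convergence of \<open>bdry_dist p * X n\<close> uniformly on the whole
  polydisc, hence locally uniform convergence of \<open>X n\<close>.  Fatou's lemma then identifies the pointwise
  limit with the limit in the mean.\<close>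

lemma A2_complete:
  assumes X: "\<And>n. X n \<in> A2 p"
    and cauchy: "\<And>e. 0 < e \<Longrightarrow> \<exists>N. \<forall>m\<ge>N. \<forall>n\<ge>N. L2_norm (poly_measure p) (\<lambda>x. X m x - X n x) < e"
  shows "\<exists>h\<in>A2 p. (\<lambda>n. L2_norm (poly_measure p) (\<lambda>x. X n x - h x)) \<longlonglongrightarrow> 0"
proof -
  let ?N = "L2_norm (poly_measure p)" and ?b = "bdry_dist p"
  have pt: "?b w * cmod (X m w - X n w) \<le> ?N (\<lambda>x. X m x - X n x)" if "w \<in> polydisc p" for m n w
    by (rule A2_pointwise_bound[OF A2_diff[OF X X] that])
  have conv: "convergent (\<lambda>n. X n w)" if w: "w \<in> polydisc p" for w
  proof (rule Cauchy_convergent, rule metric_CauchyI)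
    fix e :: real assume "0 < e"
    then have "0 < ?b w * e" using bdry_dist_pos[OF w] by simp
    from cauchy[OF this] obtain N where N: "\<And>m n. N \<le> m \<Longrightarrow> N \<le> n \<Longrightarrow> ?N (\<lambda>x. X m x - X n x) < ?b w * e"
      by blast
    show "\<exists>N. \<forall>m\<ge>N. \<forall>n\<ge>N. dist (X m w) (X n w) < e"
    proof (intro exI allI impI)
      fix m n assume "N \<le> m" "N \<le> n"
      then have "?b w * cmod (X m w - X n w) < ?b w * e"
        using pt[OF w, of m n] N[of m n] by linarith
      then show "dist (X m w) (X n w) < e"
        using bdry_dist_pos[OF w] by (simp add: dist_norm)
    qed
  qed
  define h where "h w = (if w \<in> polydisc p then lim (\<lambda>n. X n w) else 0)" for w
  have lim: "(\<lambda>n. X n w) \<longlonglongrightarrow> h w" if "w \<in> polydisc p" for w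
    using conv[OF that, unfolded convergent_LIMSEQ_iff] that by (simp add: h_def)
  have unif: "\<exists>N. \<forall>n\<ge>N. \<forall>w\<in>polydisc p. ?b w * cmod (X n w - h w) \<le> e" if e: "0 < e" for e
  proof -
    from cauchy[OF e] obtain N where N: "\<And>m n. N \<le> m \<Longrightarrow> N \<le> n \<Longrightarrow> ?N (\<lambda>x. X m x - X n x) < e"
      by blast
    have "?b w * cmod (X n w - h w) \<le> e" if "N \<le> n" "w \<in> polydisc p" for n w
    proof (rule LIMSEQ_le_const2)
      show "(\<lambda>m. ?b w * cmod (X n w - X m w)) \<longlonglongrightarrow> ?b w * cmod (X n w - h w)"
        by (intro tendsto_intros lim that)
      show "\<exists>M. \<forall>m\<ge>M. ?b w * cmod (X n w - X m w) \<le> e"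
        using pt[OF that(2), of n] N[OF that(1)] by (meson le_less_trans less_imp_le)
    qed
    then show ?thesis by blast
  qed
  have cont: "continuous_on (polydisc p) h"
  proof -
    have "uniform_limit (polydisc p) (\<lambda>n w. of_real (?b w) * X n w) (\<lambda>w. of_real (?b w) * h w) sequentially"
    proof (rule uniform_limitI)
      fix e :: real assume "0 < e"
      then obtain N where N: "\<And>n w. N \<le> n \<Longrightarrow> w \<in> polydisc p \<Longrightarrow> ?b w * cmod (X n w - h w) \<le> e / 2"
        using unif[of "e / 2"] by auto
      show "\<forall>\<^sub>F n in sequentially. \<forall>w\<in>polydisc p. dist (of_real (?b w) * X n w) (of_real (?b w) * h w) < e"
      proof (rule eventually_sequentiallyI, rule ballI)
        fix n w assume n: "N \<le> n" and w: "w \<in> polydisc p"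
        have "dist (of_real (?b w) * X n w) (of_real (?b w) * h w) = ?b w * cmod (X n w - h w)"
          using bdry_dist_pos[OF w] by (simp add: dist_norm right_diff_distrib[symmetric] norm_mult)
        also have "\<dots> < e" using N[OF n w] \<open>0 < e\<close> by linarith
        finally show "dist (of_real (?b w) * X n w) (of_real (?b w) * h w) < e" .
      qed
    qed
    then have "continuous_on (polydisc p) (\<lambda>w. of_real (?b w) * h w)"
      by (rule uniform_limit_theorem[rotated])
        (auto intro!: always_eventually continuous_on_mult continuous_on_of_real continuous_bdry_dist A2_D(4)[OF X])
    then have "continuous_on (polydisc p) (\<lambda>w. of_real (?b w) * h w / of_real (?b w))"
      using bdry_dist_pos by (intro continuous_on_divide continuous_on_of_real continuous_bdry_dist) force+
    then show ?thesis
      by (rule continuous_on_eq) (use bdry_dist_pos in force)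
  qed
  have hol: "(\<lambda>u. h (z(i := u))) holomorphic_on disc" if z: "z \<in> polydisc p" and i: "i < p" for z i
  proof (rule holomorphic_uniform_sequence)
    show "open disc" by simp
    show "(\<lambda>u. X n (z(i := u))) holomorphic_on disc" for n by (rule A2_D(5)[OF X z i])
    fix x :: complex assume x: "x \<in> disc"
    define d where "d = (1 - cmod x) / 2"
    have d: "0 < d" using x by (simp add: d_def)
    have sub: "cball x d \<subseteq> disc"
    proof
      fix y assume "y \<in> cball x d"
      then have "cmod y \<le> cmod x + d"
        using norm_triangle_ineq[of x "y - x"] by (simp add: dist_norm norm_minus_commute)
      then show "y \<in> disc" using x by (simp add: d_def field_simps)
    qed
    have "continuous_on (cball x d) (\<lambda>u. ?b (z(i := u)))"
    proof (rule continuous_on_compose2[OF continuous_bdry_dist[of UNIV]])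
      show "continuous_on (cball x d) (\<lambda>u. z(i := u))"
      proof (rule continuous_on_coordinatewise_then_product)
        show "continuous_on (cball x d) (\<lambda>u. (z(i := u)) j)" for j
          by (cases "j = i") (auto intro: continuous_intros)
      qed
    qed simp
    then obtain y where y: "y \<in> cball x d" and min: "\<And>u. u \<in> cball x d \<Longrightarrow> ?b (z(i := y)) \<le> ?b (z(i := u))"
      using continuous_attains_inf[OF compact_cball, of x d] d by fastforce
    define m where "m = ?b (z(i := y))"
    have m: "0 < m" unfolding m_def using y sub by (intro bdry_dist_pos polydisc_upd z i) auto
    have "uniform_limit (cball x d) (\<lambda>n u. X n (z(i := u))) (\<lambda>u. h (z(i := u))) sequentially"
    proof (rule uniform_limitI)
      fix e :: real assume e: "0 < e"
      then obtain N where N: "\<And>n w. N \<le> n \<Longrightarrow> w \<in> polydisc p \<Longrightarrow> ?b w * cmod (X n w - h w) \<le> m * e / 2"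
        using unif[of "m * e / 2"] m by auto
      show "\<forall>\<^sub>F n in sequentially. \<forall>u\<in>cball x d. dist (X n (z(i := u))) (h (z(i := u))) < e"
      proof (rule eventually_sequentiallyI, rule ballI)
        fix n u assume n: "N \<le> n" and u: "u \<in> cball x d"
        have w: "z(i := u) \<in> polydisc p" using u sub by (intro polydisc_upd z i) auto
        have "m * cmod (X n (z(i := u)) - h (z(i := u))) \<le> ?b (z(i := u)) * cmod (X n (z(i := u)) - h (z(i := u)))"
          unfolding m_def by (intro mult_right_mono min u) simp
        also have "\<dots> \<le> m * e / 2" by (rule N[OF n w])
        also have "\<dots> < m * e" using m e by simp
        finally show "dist (X n (z(i := u))) (h (z(i := u))) < e"
          using m by (simp add: dist_norm)
      qed
    qed
    with d sub show "\<exists>d>0. cball x d \<subseteq> disc \<and> uniform_limit (cball x d) (\<lambda>n u. X n (z(i := u))) (\<lambda>u. h (z(i := u))) sequentially"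
      by blast
  qed
  have hm: "h \<in> borel_measurable (poly_measure p)" by (rule measurable_continuous_polydisc[OF cont])
  have Xm: "X n \<in> borel_measurable (poly_measure p)" for n
    by (rule measurable_continuous_polydisc[OF A2_D(4)[OF X]])
  have fatou: "square_integrable (poly_measure p) (\<lambda>x. X n x - h x) \<and> ?N (\<lambda>x. X n x - h x) \<le> e"
    if N: "\<And>m n. N \<le> m \<Longrightarrow> N \<le> n \<Longrightarrow> ?N (\<lambda>x. X m x - X n x) < e" and n: "N \<le> n" and e: "0 < e" for N n e
  proof -
    have meas: "(\<lambda>x. X n x - h x) \<in> borel_measurable (poly_measure p)"
      by (intro borel_measurable_diff Xm hm)
    have "(\<integral>\<^sup>+x. ennreal ((cmod (X n x - h x))\<^sup>2) \<partial>poly_measure p) =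
        (\<integral>\<^sup>+x. liminf (\<lambda>m. ennreal ((cmod (X n x - X m x))\<^sup>2)) \<partial>poly_measure p)"
    proof (rule nn_integral_cong)
      fix x assume "x \<in> space (poly_measure p)"
      then have "(\<lambda>m. ennreal ((cmod (X n x - X m x))\<^sup>2)) \<longlonglongrightarrow> ennreal ((cmod (X n x - h x))\<^sup>2)"
        by (intro tendsto_intros lim) simp
      then show "ennreal ((cmod (X n x - h x))\<^sup>2) = liminf (\<lambda>m. ennreal ((cmod (X n x - X m x))\<^sup>2))"
        by (intro lim_imp_Liminf[symmetric]) simp_all
    qed
    also have "\<dots> \<le> liminf (\<lambda>m. \<integral>\<^sup>+x. ennreal ((cmod (X n x - X m x))\<^sup>2) \<partial>poly_measure p)"
      by (intro nn_integral_liminf) (use Xm in measurable)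
    also have "\<dots> \<le> ennreal (e\<^sup>2)"
    proof (rule Liminf_le)
      show "\<forall>\<^sub>F m in sequentially. (\<integral>\<^sup>+x. ennreal ((cmod (X n x - X m x))\<^sup>2) \<partial>poly_measure p) \<le> ennreal (e\<^sup>2)"
      proof (rule eventually_sequentiallyI)
        fix m assume "N \<le> m"
        then have "?N (\<lambda>x. X n x - X m x) < e" using N n by blast
        then have "(?N (\<lambda>x. X n x - X m x))\<^sup>2 \<le> e\<^sup>2" by (intro power_mono) auto
        then show "(\<integral>\<^sup>+x. ennreal ((cmod (X n x - X m x))\<^sup>2) \<partial>poly_measure p) \<le> ennreal (e\<^sup>2)"
          unfolding nn_integral_L2_norm[OF A2_D(2)[OF A2_diff[OF X X]]] by (rule ennreal_leI)
      qed
    qed simp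
    finally show ?thesis
      using L2_norm_le_nn[OF meas, of e] e by simp
  qed
  have "h \<in> A2 p"
  proof (rule A2_I)
    show "holomorphic_polydisc p h" using cont hol by (simp add: holomorphic_polydisc_def)
    obtain N where "\<And>m n. N \<le> m \<Longrightarrow> N \<le> n \<Longrightarrow> ?N (\<lambda>x. X m x - X n x) < 1"
      using cauchy[of 1] by auto
    from fatou[OF this order_refl] have "square_integrable (poly_measure p) (\<lambda>x. X N x - h x)" by simp
    from square_integrable_diff[OF A2_D(2)[OF X[of N]] this]
    show "square_integrable (poly_measure p) h" by simp
  qed (simp add: h_def)
  moreover have "(\<lambda>n. ?N (\<lambda>x. X n x - h x)) \<longlonglongrightarrow> 0"
  proof (rule LIMSEQ_I)
    fix r :: real assume "0 < r"
    then have r: "0 < r / 2" by simp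
    obtain N where N: "\<And>m n. N \<le> m \<Longrightarrow> N \<le> n \<Longrightarrow> ?N (\<lambda>x. X m x - X n x) < r / 2"
      using cauchy[OF r] by auto
    have "?N (\<lambda>x. X n x - h x) \<le> r / 2" if "N \<le> n" for n
      using fatou[OF N that r] by simp
    then show "\<exists>N. \<forall>n\<ge>N. norm (?N (\<lambda>x. X n x - h x) - 0) < r"
      using \<open>0 < r\<close> by (intro exI[of _ N]) fastforce
  qed
  ultimately show ?thesis by blast
qed

interpretation A2: hilbert_fun "poly_measure p" "A2 p" for p
proof
  show "f = (\<lambda>_. 0)" if f: "f \<in> A2 p" and 0: "L2_norm (poly_measure p) f = 0" for f
  proof
    fix w
    show "f w = 0"
    proof (cases "w \<in> polydisc p")
      case True
      from A2_pointwise_bound[OF f this] bdry_dist_pos[OF True] 0 show ?thesis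
        by (simp add: mult_le_0_iff)
    qed (rule A2_D(3)[OF f])
  qed
qed (fact A2_D A2_zero A2_add A2_scale A2_complete)+

lemma tens_single: "z \<in> polydisc 1 \<Longrightarrow> tens [f] z = f (z 0)"
  by (simp add: tens_def)

lemma L2_inner_tens_single:
  assumes "f \<in> A2_disc" "g \<in> A2_disc"
  shows "L2_inner (poly_measure 1) (tens [f]) (tens [g]) = L2_inner disc_measure f g"
  using L2_inner_tens[of "[f]" "[g]" 1] assms by simp

text \<open>Functions of one-element tuples are a copy of functions on the disc; completeness of \<open>A2_disc\<close> is
  inherited through this identification.\<close>

lemma A2_1_tens:
  assumes H: "H \<in> A2 1"
  shows "\<exists>h\<in>A2_disc. tens [h] = H"
proof -
  define s where "s u = (\<lambda>_::nat. undefined :: complex)(0 := u)" for u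
  have s: "s u \<in> polydisc 1" if "u \<in> disc" for u
    using polydisc_upd_Suc[of "\<lambda>_. undefined" 0 u] that by (simp add: s_def polydisc_0)
  have s0: "s (z 0) = z" if "z \<in> polydisc 1" for z
    using polydisc_undefined[OF that] by (auto simp: s_def fun_eq_iff)
  define h where "h u = (if u \<in> disc then H (s u) else 0)" for u
  have "(\<lambda>u. H ((s 0)(0 := u))) holomorphic_on disc"
    by (rule A2_D(5)[OF H s]) auto
  then have hol: "h holomorphic_on disc"
    by (rule holomorphic_transform) (simp add: h_def s_def)
  have Hm: "(\<lambda>z. ennreal ((cmod (H z))\<^sup>2)) \<in> borel_measurable (poly_measure (Suc 0))"
    using A2_D(2)[OF H] by (auto simp: square_integrable_def)
  have "(\<integral>\<^sup>+u. ennreal ((cmod (h u))\<^sup>2) \<partial>disc_measure) = (\<integral>\<^sup>+u. ennreal ((cmod (H (s u)))\<^sup>2) \<partial>disc_measure)"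
    by (intro nn_integral_cong) (simp add: h_def)
  also have "\<dots> = (\<integral>\<^sup>+z. ennreal ((cmod (H z))\<^sup>2) \<partial>poly_measure (Suc 0))"
    unfolding nn_integral_poly_Suc[OF Hm] poly_measure_0 s_def
    by (simp add: nn_integral_count_space_finite fun_upd_def)
  also have "\<dots> < \<infinity>" using A2_D(2)[OF H] by (simp add: square_integrable_iff_nn)
  finally have "square_integrable disc_measure h"
    using measurable_continuous_disc[OF holomorphic_on_imp_continuous_on[OF hol]]
    by (simp add: square_integrable_iff_nn)
  with hol have "h \<in> A2_disc" by (simp add: A2_disc_def h_def)
  moreover have "tens [h] z = H z" for z
  proof (cases "z \<in> polydisc 1")
    case True
    then show ?thesis using polydiscD[OF True, of 0] by (simp add: tens_single h_def s0)
  next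
    case False
    then show ?thesis using A2_D(3)[OF H] by (simp add: tens_def)
  qed
  ultimately show ?thesis by blast
qed

lemma A2_disc_zero: "(\<lambda>_. 0) \<in> A2_disc"
  by (simp add: A2_disc_def square_integrable_zero)

lemma A2_disc_add:
  assumes "f \<in> A2_disc" "g \<in> A2_disc"
  shows "(\<lambda>x. f x + g x) \<in> A2_disc"
  using A2_discD[OF assms(1)] A2_discD[OF assms(2)]
  by (simp add: A2_disc_def square_integrable_add holomorphic_on_add)

lemma A2_disc_scale:
  assumes "f \<in> A2_disc"
  shows "(\<lambda>x. c * f x) \<in> A2_disc"
  using A2_discD[OF assms]
  by (simp add: A2_disc_def square_integrable_scale holomorphic_on_mult holomorphic_on_const)

lemma A2_disc_diff: "f \<in> A2_disc \<Longrightarrow> g \<in> A2_disc \<Longrightarrow> (\<lambda>x. f x - g x) \<in> A2_disc"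
  using A2_disc_add[OF _ A2_disc_scale[of g "-1"]] by simp

lemma L2_norm_tens_single:
  assumes "f \<in> A2_disc"
  shows "L2_norm (poly_measure 1) (tens [f]) = L2_norm disc_measure f"
proof -
  have "complex_of_real ((L2_norm (poly_measure 1) (tens [f]))\<^sup>2) = of_real ((L2_norm disc_measure f)\<^sup>2)"
    unfolding L2_inner_self[symmetric] by (rule L2_inner_tens_single[OF assms assms])
  then have "(L2_norm (poly_measure 1) (tens [f]))\<^sup>2 = (L2_norm disc_measure f)\<^sup>2"
    by (simp only: of_real_eq_iff)
  then show ?thesis by (simp add: power2_eq_iff_nonneg)
qed

lemma tens_single_diff: "tens [\<lambda>x. f x - g x] = (\<lambda>z. tens [f] z - tens [g] z)"
  by (auto simp: tens_def)

interpretation A2_disc: hilbert_fun disc_measure A2_disc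
proof
  show "f = (\<lambda>_. 0)" if f: "f \<in> A2_disc" and 0: "L2_norm disc_measure f = 0" for f
  proof
    fix u
    show "f u = 0"
    proof (cases "u \<in> disc")
      case True
      have "cmod (f u) \<le> L2_norm disc_measure f * L2_norm disc_measure (bergman u)"
        using L2_Cauchy_Schwarz[OF A2_discD(2)[OF f] A2_discD(2)[OF bergman_in_A2_disc[OF True]]]
        unfolding bergman_reproducing[OF f True] .
      then show ?thesis by (simp add: 0)
    qed (rule A2_discD(3)[OF f])
  qed
next
  fix X :: "nat \<Rightarrow> complex \<Rightarrow> complex"
  assume X: "\<And>n. X n \<in> A2_disc"
    and cauchy: "\<And>e. 0 < e \<Longrightarrow> \<exists>N. \<forall>m\<ge>N. \<forall>n\<ge>N. L2_norm disc_measure (\<lambda>x. X m x - X n x) < e"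
  have nrm: "L2_norm (poly_measure 1) (\<lambda>x. tens [f] x - tens [g] x) = L2_norm disc_measure (\<lambda>x. f x - g x)"
    if "f \<in> A2_disc" "g \<in> A2_disc" for f g
    unfolding tens_single_diff[symmetric] by (intro L2_norm_tens_single A2_disc_diff that)
  have "\<exists>H\<in>A2 1. (\<lambda>n. L2_norm (poly_measure 1) (\<lambda>x. tens [X n] x - H x)) \<longlonglongrightarrow> 0"
  proof (rule A2_complete)
    show "tens [X n] \<in> A2 1" for n using X by (intro tens_in_A2) auto
    show "\<exists>N. \<forall>m\<ge>N. \<forall>n\<ge>N. L2_norm (poly_measure 1) (\<lambda>x. tens [X m] x - tens [X n] x) < e" if "0 < e" for e
      unfolding nrm[OF X X] by (rule cauchy[OF that])
  qed
  then obtain h where h: "h \<in> A2_disc" and "(\<lambda>n. L2_norm (poly_measure 1) (\<lambda>x. tens [X n] x - tens [h] x)) \<longlonglongrightarrow> 0"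
    using A2_1_tens by blast
  then show "\<exists>h\<in>A2_disc. (\<lambda>n. L2_norm disc_measure (\<lambda>x. X n x - h x)) \<longlonglongrightarrow> 0"
    unfolding nrm[OF X h] by blast
qed (fact A2_discD A2_disc_zero A2_disc_add A2_disc_scale)+

section \<open>Operators determined by their values on elementary tensors\<close>

text \<open>Elementary tensors are total, because the Bergman kernels are among them.\<close>

lemma A2_eqI_tens:
  assumes f: "f \<in> A2 p" and g: "g \<in> A2 p"
    and eq: "\<And>as. length as = p \<Longrightarrow> set as \<subseteq> A2_disc \<Longrightarrow>
      L2_inner (poly_measure p) f (tens as) = L2_inner (poly_measure p) g (tens as)"
  shows "f = g"
proof
  fix w
  show "f w = g w"
  proof (cases "w \<in> polydisc p")
    case True
    have "L2_inner (poly_measure p) f (poly_bergman p w) = L2_inner (poly_measure p) g (poly_bergman p w)"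
      unfolding poly_bergman_def by (intro eq set_bergman_list True) simp
    then show ?thesis by (simp add: A2_reproducing[OF _ True] f g)
  next
    case False
    then show ?thesis by (simp add: A2_D(3)[OF f] A2_D(3)[OF g])
  qed
qed

abbreviation bounded_A2 where
  "bounded_A2 n m \<equiv> bounded_op (A2 n) (L2_norm (poly_measure n)) (A2 m) (L2_norm (poly_measure m))"

lemma bounded_opD:
  assumes "bounded_op V nV W nW T"
  shows "f \<in> V \<Longrightarrow> T f \<in> W" "f \<in> V \<Longrightarrow> g \<in> V \<Longrightarrow> T (\<lambda>x. f x + g x) = (\<lambda>y. T f y + T g y)"
    "f \<in> V \<Longrightarrow> T (\<lambda>x. c * f x) = (\<lambda>y. c * T f y)"
  using assms by (auto simp: bounded_op_def linear_op_def)

text \<open>For a fixed point \<open>w\<close> the functional \<open>f \<mapsto> B f w - B' f w\<close> is bounded, hence represented by a vector;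
  this vector is orthogonal to all elementary tensors.\<close>

lemma bounded_A2_eqI:
  assumes B: "bounded_A2 n m B" and B': "bounded_A2 n m B'"
    and eq: "\<And>as. length as = n \<Longrightarrow> set as \<subseteq> A2_disc \<Longrightarrow> B (tens as) = B' (tens as)"
    and f: "f \<in> A2 n"
  shows "B f = B' f"
proof
  fix w
  show "B f w = B' f w"
  proof (cases "w \<in> polydisc m")
    case True
    obtain C C' where C: "\<And>f. f \<in> A2 n \<Longrightarrow> L2_norm (poly_measure m) (B f) \<le> C * L2_norm (poly_measure n) f"
      and C': "\<And>f. f \<in> A2 n \<Longrightarrow> L2_norm (poly_measure m) (B' f) \<le> C' * L2_norm (poly_measure n) f"
      using B B' by (auto simp: bounded_op_def)
    note L = bounded_opD[OF B] and L' = bounded_opD[OF B']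
    let ?b = "bdry_dist m w"
    have "\<exists>h\<in>A2 n. \<forall>f\<in>A2 n. B f w - B' f w = L2_inner (poly_measure n) f h"
    proof (rule A2.riesz)
      show "cmod (B f w - B' f w) \<le> ((C + C') / ?b) * L2_norm (poly_measure n) f" if f: "f \<in> A2 n" for f
      proof -
        have "?b * cmod (B f w - B' f w) \<le> ?b * (cmod (B f w) + cmod (B' f w))"
          using bdry_dist_pos[OF True] by (intro mult_left_mono norm_triangle_ineq4) auto
        also have "\<dots> \<le> L2_norm (poly_measure m) (B f) + L2_norm (poly_measure m) (B' f)"
          unfolding distrib_left by (intro add_mono A2_pointwise_bound L(1) L'(1) f True)
        also have "\<dots> \<le> (C + C') * L2_norm (poly_measure n) f"
          using C[OF f] C'[OF f] by (simp add: distrib_right)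
        finally show ?thesis
          using bdry_dist_pos[OF True] by (simp add: field_simps)
      qed
    qed (simp_all add: L(2,3) L'(2,3) right_diff_distrib)
    then obtain h where h: "h \<in> A2 n" and rep: "\<And>f. f \<in> A2 n \<Longrightarrow> B f w - B' f w = L2_inner (poly_measure n) f h"
      by blast
    have "h = (\<lambda>_. 0)"
    proof (rule A2_eqI_tens[OF h A2_zero])
      fix as assume as: "length as = n" "set as \<subseteq> A2_disc"
      have "L2_inner (poly_measure n) (tens as) h = 0"
        using rep[OF tens_in_A2[OF as(2,1)]] eq[OF as] by simp
      then show "L2_inner (poly_measure n) h (tens as) = L2_inner (poly_measure n) (\<lambda>_. 0) (tens as)"
        using L2_inner_cnj[of "poly_measure n" h "tens as"] by simp
    qed
    with rep[OF f] show ?thesis by simp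
  next
    case False
    then show ?thesis
      using A2_D(3)[OF bounded_opD(1)[OF B f]] A2_D(3)[OF bounded_opD(1)[OF B' f]] by simp
  qed
qed

lemma bounded_op_cong:
  assumes "\<And>f. f \<in> V \<Longrightarrow> T f = T' f" "\<And>f g. f \<in> V \<Longrightarrow> g \<in> V \<Longrightarrow> (\<lambda>x. f x + g x) \<in> V"
    "\<And>c f. f \<in> V \<Longrightarrow> (\<lambda>x. c * f x) \<in> V" "bounded_op V nV W nW T"
  shows "bounded_op V nV W nW T'"
proof -
  have "linear_op V W T'"
    using assms(4) unfolding bounded_op_def linear_op_def
    by (simp add: assms(1)[symmetric] assms(2,3) Pi_iff)
  moreover have "\<exists>C. \<forall>f\<in>V. nW (T' f) \<le> C * nV f"
    using assms(4) unfolding bounded_op_def by (simp add: assms(1)[symmetric])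
  ultimately show ?thesis by (simp add: bounded_op_def)
qed

lemma tensor_extension_eq:
  assumes B: "bounded_A2 n m B"
    and eq: "\<And>as. length as = n \<Longrightarrow> set as \<subseteq> A2_disc \<Longrightarrow> B (tens as) = \<Phi> as"
    and f: "f \<in> A2 n"
  shows "tensor_extension n m \<Phi> f = B f"
proof -
  let ?R = "restrict B (A2 n)"
  have R: "bounded_A2 n m ?R"
    by (rule bounded_op_cong[OF _ A2_add A2_scale B]) simp
  have "tensor_extension n m \<Phi> = ?R"
    unfolding tensor_extension_def
  proof (rule the_equality)
    show "?R \<in> extensional (A2 n) \<and> bounded_A2 n m ?R \<and>
        (\<forall>as. length as = n \<and> set as \<subseteq> A2_disc \<longrightarrow> ?R (tens as) = \<Phi> as)"
      using R by (auto simp: eq tens_in_A2)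
    fix B' assume B': "B' \<in> extensional (A2 n) \<and> bounded_A2 n m B' \<and>
        (\<forall>as. length as = n \<and> set as \<subseteq> A2_disc \<longrightarrow> B' (tens as) = \<Phi> as)"
    show "B' = ?R"
    proof (rule extensionalityI[of _ "A2 n"])
      show "B' f = ?R f" if "f \<in> A2 n" for f
        by (rule bounded_A2_eqI[OF _ R _ that]) (use B' in \<open>auto simp: eq tens_in_A2\<close>)
    qed (use B' in auto)
  qed
  then show ?thesis using f by simp
qed

section \<open>Weighted composition operators\<close>

lemma T_op_in_A2_disc:
  assumes \<phi>: "\<phi> \<in> CE_emb" and f: "f \<in> A2_disc"
  shows "T_op \<phi> f \<in> A2_disc" "L2_norm disc_measure (T_op \<phi> f) \<le> 1 * L2_norm disc_measure f"
proof -
  note D = CE_embD[OF \<phi>]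
  have "(\<lambda>z. deriv \<phi> z * f (\<phi> z)) holomorphic_on disc"
    using holomorphic_on_compose_gen[OF D(1) A2_discD(1)[OF f] D(3)] unfolding o_def
    by (intro holomorphic_on_mult D(8))
  then have hol: "T_op \<phi> f holomorphic_on disc"
    by (rule holomorphic_transform) (simp add: T_op_def)
  have m: "T_op \<phi> f \<in> borel_measurable disc_measure"
    by (rule measurable_continuous_disc[OF holomorphic_on_imp_continuous_on[OF hol]])
  have fm: "(\<lambda>z. ennreal ((cmod (f z))\<^sup>2)) \<in> borel_measurable disc_measure"
    using A2_discD(2)[OF f] by (auto simp: square_integrable_def)
  have "(\<integral>\<^sup>+z. ennreal ((cmod (T_op \<phi> f z))\<^sup>2) \<partial>disc_measure) =
      (\<integral>\<^sup>+z. ennreal ((cmod (deriv \<phi> z))\<^sup>2) * ennreal ((cmod (f (\<phi> z)))\<^sup>2) \<partial>disc_measure)"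
    by (intro nn_integral_cong) (simp add: T_op_def norm_mult power_mult_distrib ennreal_mult)
  also have "\<dots> \<le> (\<integral>\<^sup>+z. ennreal ((cmod (f z))\<^sup>2) \<partial>disc_measure)"
    unfolding nn_integral_change_disc[OF \<phi> fm] by (intro nn_integral_mono) (auto simp: indicator_def)
  also have "\<dots> = ennreal ((L2_norm disc_measure f)\<^sup>2)"
    by (rule nn_integral_L2_norm[OF A2_discD(2)[OF f]])
  finally have "square_integrable disc_measure (T_op \<phi> f) \<and> L2_norm disc_measure (T_op \<phi> f) \<le> L2_norm disc_measure f"
    using L2_norm_le_nn[OF m] by simp
  with hol show "T_op \<phi> f \<in> A2_disc" "L2_norm disc_measure (T_op \<phi> f) \<le> 1 * L2_norm disc_measure f"
    by (simp_all add: A2_disc_def T_op_def)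
qed

lemma hilbert_op_T_op:
  assumes "\<phi> \<in> CE_emb"
  shows "hilbert_op disc_measure A2_disc disc_measure A2_disc (T_op \<phi>) 1"
proof unfold_locales
  show "linear_op A2_disc A2_disc (T_op \<phi>)"
    unfolding linear_op_def using T_op_in_A2_disc(1)[OF assms] by (auto simp: T_op_def fun_eq_iff algebra_simps)
qed (use T_op_in_A2_disc(2)[OF assms] in auto)

definition poly_map :: "nat \<Rightarrow> (complex \<Rightarrow> complex) \<Rightarrow> (nat \<Rightarrow> complex) \<Rightarrow> nat \<Rightarrow> complex" where
  "poly_map p \<phi> z = (\<lambda>i\<in>{..<p}. \<phi> (z i))"

text \<open>The \<open>p\<close>-fold tensor power of \<open>T_op \<phi>\<close>.\<close>

definition poly_T ::
  "nat \<Rightarrow> (complex \<Rightarrow> complex) \<Rightarrow> ((nat \<Rightarrow> complex) \<Rightarrow> complex) \<Rightarrow> (nat \<Rightarrow> complex) \<Rightarrow> complex" where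
  "poly_T p \<phi> f z = (if z \<in> polydisc p then (\<Prod>i<p. deriv \<phi> (z i)) * f (poly_map p \<phi> z) else 0)"

lemma poly_map_polydisc:
  assumes \<phi>: "\<phi> ` disc \<subseteq> disc" and z: "z \<in> polydisc p"
  shows "poly_map p \<phi> z \<in> polydisc p"
proof (rule polydiscI)
  fix i assume "i < p"
  then show "poly_map p \<phi> z i \<in> disc"
    using \<phi> polydiscD[OF z \<open>i < p\<close>] by (simp add: poly_map_def image_subset_iff del: mem_ball_0)
qed (simp add: poly_map_def)

lemma poly_map_measurable:
  assumes \<phi>: "\<phi> \<in> measurable disc_measure disc_measure"
  shows "poly_map p \<phi> \<in> measurable (poly_measure p) (poly_measure p)"
proof (rule measurable_polyI)
  show "(\<lambda>z. poly_map p \<phi> z i) \<in> measurable (poly_measure p) disc_measure" if "i < p" for i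
    using measurable_compose[OF measurable_poly_component[OF that] \<phi>] that by (simp add: poly_map_def)
qed (simp add: poly_map_def)

text \<open>Induction on the dimension, with the change of variables on the disc in the last coordinate.\<close>

lemma nn_integral_change_poly:
  assumes \<phi>: "\<phi> \<in> CE_emb" and "g \<in> borel_measurable (poly_measure p)"
  shows "(\<integral>\<^sup>+z. (\<Prod>i<p. ennreal ((cmod (deriv \<phi> (z i)))\<^sup>2)) * g (poly_map p \<phi> z) \<partial>poly_measure p) =
         (\<integral>\<^sup>+z. (\<Prod>i<p. indicator (\<phi> ` disc) (z i)) * g z \<partial>poly_measure p)"
  using assms(2)
proof (induction p arbitrary: g)
  case 0
  show ?case by (simp add: poly_measure_0 nn_integral_count_space_finite poly_map_def)
next
  case (Suc p)
  note g[measurable] = Suc.prems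
  note \<phi>m[measurable] = CE_emb_measurable[OF \<phi>]
  have "open (\<phi> ` disc)"
    using open_mapping_thm3[OF CE_embD(1)[OF \<phi>] open_ball CE_embD(2)[OF \<phi>]] .
  then have im[measurable]: "\<phi> ` disc \<in> sets disc_measure"
    using CE_embD(3)[OF \<phi>] by (auto simp: sets_disc_measure)
  have comp: "(\<lambda>z. h (z i)) \<in> borel_measurable (poly_measure q)"
    if "h \<in> borel_measurable disc_measure" "i < q" for i q and h :: "complex \<Rightarrow> ennreal"
    by (rule measurable_compose[OF measurable_poly_component[OF that(2)] that(1)])
  have pm: "(\<lambda>z. \<Prod>i<q. h (z i)) \<in> borel_measurable (poly_measure q)"
    if "h \<in> borel_measurable disc_measure" for q and h :: "complex \<Rightarrow> ennreal"
    by (rule borel_measurable_prod_ennreal) (use comp[OF that] in auto)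
  let ?w = "\<lambda>u. ennreal ((cmod (deriv \<phi> u))\<^sup>2)" and ?i = "\<lambda>u. indicator (\<phi> ` disc) u :: ennreal"
  have wm: "?w \<in> borel_measurable disc_measure" and imm: "?i \<in> borel_measurable disc_measure"
    by measurable
  let ?G = "\<lambda>y. \<integral>\<^sup>+u. ?i u * g (y(p := u)) \<partial>disc_measure"
  have gu: "(\<lambda>(y, u). g (y(p := u))) \<in> borel_measurable (poly_measure p \<Otimes>\<^sub>M disc_measure)"
    using measurable_compose[OF measurable_poly_upd g] by (simp add: split_beta' fun_upd_def)
  then have "(\<lambda>(y, u). ?i u * g (y(p := u))) \<in> borel_measurable (poly_measure p \<Otimes>\<^sub>M disc_measure)"
    unfolding split_beta' by measurable
  then have Gm: "?G \<in> borel_measurable (poly_measure p)"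
    by (rule disc.borel_measurable_nn_integral)
  have upd: "poly_map (Suc p) \<phi> (z(p := u)) = (poly_map p \<phi> z)(p := \<phi> u)" for z u
    by (auto simp: poly_map_def fun_eq_iff restrict_def)
  have prod_upd: "(\<Prod>i<Suc p. h ((z(p := u)) i)) = (\<Prod>i<p. h (z i)) * h u" for h :: "complex \<Rightarrow> ennreal" and z u
    by simp
  have slice: "(\<lambda>u. g (y(p := u))) \<in> borel_measurable disc_measure" if "y \<in> polydisc p" for y
    by (rule measurable_compose[OF measurable_poly_slice[OF that] g])
  have "(\<integral>\<^sup>+z. (\<Prod>i<Suc p. ?w (z i)) * g (poly_map (Suc p) \<phi> z) \<partial>poly_measure (Suc p)) =
      (\<integral>\<^sup>+z. \<integral>\<^sup>+u. ((\<Prod>i<p. ?w (z i)) * ?w u) * g ((poly_map p \<phi> z)(p := \<phi> u)) \<partial>disc_measure \<partial>poly_measure p)"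
    unfolding upd[symmetric] prod_upd[of ?w, symmetric]
    by (rule nn_integral_poly_Suc[OF borel_measurable_times_ennreal[OF pm[OF wm]
        measurable_compose[OF poly_map_measurable[OF \<phi>m(1)] g]]])
  also have "\<dots> = (\<integral>\<^sup>+z. (\<Prod>i<p. ?w (z i)) * ?G (poly_map p \<phi> z) \<partial>poly_measure p)"
  proof (rule nn_integral_cong)
    fix z assume "z \<in> space (poly_measure p)"
    then have y: "poly_map p \<phi> z \<in> polydisc p"
      using poly_map_polydisc[OF CE_embD(3)[OF \<phi>]] by simp
    have "(\<integral>\<^sup>+u. ((\<Prod>i<p. ?w (z i)) * ?w u) * g ((poly_map p \<phi> z)(p := \<phi> u)) \<partial>disc_measure) =
        (\<integral>\<^sup>+u. (\<Prod>i<p. ?w (z i)) * (?w u * g ((poly_map p \<phi> z)(p := \<phi> u))) \<partial>disc_measure)"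
      by (simp only: mult.assoc)
    also have "\<dots> = (\<Prod>i<p. ?w (z i)) * (\<integral>\<^sup>+u. ?w u * g ((poly_map p \<phi> z)(p := \<phi> u)) \<partial>disc_measure)"
      by (rule nn_integral_cmult[OF borel_measurable_times_ennreal[OF wm measurable_compose[OF \<phi>m(1) slice[OF y]]]])
    also have "(\<integral>\<^sup>+u. ?w u * g ((poly_map p \<phi> z)(p := \<phi> u)) \<partial>disc_measure) = ?G (poly_map p \<phi> z)"
      by (rule nn_integral_change_disc[OF \<phi> slice[OF y]])
    finally show "(\<integral>\<^sup>+u. ((\<Prod>i<p. ?w (z i)) * ?w u) * g ((poly_map p \<phi> z)(p := \<phi> u)) \<partial>disc_measure) =
        (\<Prod>i<p. ?w (z i)) * ?G (poly_map p \<phi> z)" .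
  qed
  also have "\<dots> = (\<integral>\<^sup>+z. (\<Prod>i<p. ?i (z i)) * ?G z \<partial>poly_measure p)"
    by (rule Suc.IH[OF Gm])
  also have "\<dots> = (\<integral>\<^sup>+z. \<integral>\<^sup>+u. ((\<Prod>i<p. ?i (z i)) * ?i u) * g (z(p := u)) \<partial>disc_measure \<partial>poly_measure p)"
  proof (rule nn_integral_cong)
    fix z assume "z \<in> space (poly_measure p)"
    then have z: "z \<in> polydisc p" by simp
    show "(\<Prod>i<p. ?i (z i)) * ?G z = (\<integral>\<^sup>+u. ((\<Prod>i<p. ?i (z i)) * ?i u) * g (z(p := u)) \<partial>disc_measure)"
      unfolding mult.assoc
      by (rule nn_integral_cmult[symmetric, OF borel_measurable_times_ennreal[OF imm slice[OF z]]])
  qed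
  also have "\<dots> = (\<integral>\<^sup>+z. (\<Prod>i<Suc p. ?i (z i)) * g z \<partial>poly_measure (Suc p))"
    unfolding prod_upd[of ?i, symmetric]
    by (rule nn_integral_poly_Suc[symmetric, OF borel_measurable_times_ennreal[OF pm[OF imm] g]])
  finally show ?case .
qed

lemma poly_T_nn:
  assumes \<phi>: "\<phi> \<in> CE_emb" and f: "f \<in> borel_measurable (poly_measure p)"
  shows "(\<integral>\<^sup>+z. ennreal ((cmod (poly_T p \<phi> f z))\<^sup>2) \<partial>poly_measure p) =
      (\<integral>\<^sup>+z. (\<Prod>i<p. indicator (\<phi> ` disc) (z i)) * ennreal ((cmod (f z))\<^sup>2) \<partial>poly_measure p)"
proof -
  have fm: "(\<lambda>z. ennreal ((cmod (f z))\<^sup>2)) \<in> borel_measurable (poly_measure p)"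
    using f by measurable
  have "(\<integral>\<^sup>+z. ennreal ((cmod (poly_T p \<phi> f z))\<^sup>2) \<partial>poly_measure p) =
      (\<integral>\<^sup>+z. (\<Prod>i<p. ennreal ((cmod (deriv \<phi> (z i)))\<^sup>2)) * ennreal ((cmod (f (poly_map p \<phi> z)))\<^sup>2) \<partial>poly_measure p)"
    by (intro nn_integral_cong)
      (simp add: poly_T_def norm_mult power_mult_distrib ennreal_mult prod_nonneg prod_ennreal prod_power_distrib flip: prod_norm)
  then show ?thesis unfolding nn_integral_change_poly[OF \<phi> fm] .
qed

lemma poly_T_measurable:
  assumes \<phi>: "\<phi> \<in> CE_emb" and f: "f \<in> borel_measurable (poly_measure p)"
  shows "poly_T p \<phi> f \<in> borel_measurable (poly_measure p)"
proof -
  have "(\<lambda>z. (\<Prod>i<p. deriv \<phi> (z i)) * f (poly_map p \<phi> z)) \<in> borel_measurable (poly_measure p)"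
  proof (intro borel_measurable_times borel_measurable_prod)
    show "(\<lambda>z. deriv \<phi> (z i)) \<in> borel_measurable (poly_measure p)" if "i \<in> {..<p}" for i
      using that by (intro measurable_compose[OF measurable_poly_component CE_emb_measurable(2)[OF \<phi>]]) simp
    show "(\<lambda>z. f (poly_map p \<phi> z)) \<in> borel_measurable (poly_measure p)"
      by (rule measurable_compose[OF poly_map_measurable[OF CE_emb_measurable(1)[OF \<phi>]] f])
  qed
  then show ?thesis
    by (rule iffD1[OF measurable_cong, rotated]) (simp add: poly_T_def)
qed

lemma poly_T_square_integrable:
  assumes \<phi>: "\<phi> \<in> CE_emb" and f: "square_integrable (poly_measure p) f"
  shows "square_integrable (poly_measure p) (poly_T p \<phi> f)"
    "L2_norm (poly_measure p) (poly_T p \<phi> f) \<le> L2_norm (poly_measure p) f"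
proof -
  note fm = square_integrable_measurable[OF f]
  have "(\<integral>\<^sup>+z. ennreal ((cmod (poly_T p \<phi> f z))\<^sup>2) \<partial>poly_measure p) \<le>
      (\<integral>\<^sup>+z. ennreal ((cmod (f z))\<^sup>2) \<partial>poly_measure p)"
    unfolding poly_T_nn[OF \<phi> fm]
  proof (rule nn_integral_mono)
    fix z
    have "(\<Prod>i<p. indicator (\<phi> ` disc) (z i)) \<le> (1 :: ennreal)"
      by (induction p) (auto simp: indicator_def)
    then show "(\<Prod>i<p. indicator (\<phi> ` disc) (z i)) * ennreal ((cmod (f z))\<^sup>2) \<le> ennreal ((cmod (f z))\<^sup>2)"
      using mult_right_mono[of _ "1::ennreal" "ennreal ((cmod (f z))\<^sup>2)"] by simp
  qed
  also have "\<dots> = ennreal ((L2_norm (poly_measure p) f)\<^sup>2)"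
    by (rule nn_integral_L2_norm[OF f])
  finally have le: "(\<integral>\<^sup>+z. ennreal ((cmod (poly_T p \<phi> f z))\<^sup>2) \<partial>poly_measure p) \<le> \<dots>" .
  show "square_integrable (poly_measure p) (poly_T p \<phi> f)"
    "L2_norm (poly_measure p) (poly_T p \<phi> f) \<le> L2_norm (poly_measure p) f"
    using L2_norm_le_nn[OF poly_T_measurable[OF \<phi> fm] le] by auto
qed

lemma poly_T_norm_onto:
  assumes \<phi>: "\<phi> \<in> CE_emb" and onto: "\<phi> ` disc = disc" and f: "square_integrable (poly_measure p) f"
  shows "L2_norm (poly_measure p) (poly_T p \<phi> f) = L2_norm (poly_measure p) f"
proof -
  have "(\<integral>\<^sup>+z. ennreal ((cmod (poly_T p \<phi> f z))\<^sup>2) \<partial>poly_measure p) =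
      (\<integral>\<^sup>+z. ennreal ((cmod (f z))\<^sup>2) \<partial>poly_measure p)"
    unfolding poly_T_nn[OF \<phi> square_integrable_measurable[OF f]] onto
  proof (rule nn_integral_cong)
    fix z assume "z \<in> space (poly_measure p)"
    then have "z i \<in> disc" if "i < p" for i using that polydiscD by simp
    then have "(\<Prod>i<p. indicator disc (z i)) = (\<Prod>i<p. 1 :: ennreal)"
      by (intro prod.cong) (auto simp: indicator_def simp del: mem_ball_0)
    then show "(\<Prod>i<p. indicator disc (z i)) * ennreal ((cmod (f z))\<^sup>2) = ennreal ((cmod (f z))\<^sup>2)" by simp
  qed
  then have "(L2_norm (poly_measure p) (poly_T p \<phi> f))\<^sup>2 = (L2_norm (poly_measure p) f)\<^sup>2"
    unfolding nn_integral_L2_norm[OF f] nn_integral_L2_norm[OF poly_T_square_integrable(1)[OF \<phi> f]] by simp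
  then show ?thesis by (simp add: power2_eq_iff_nonneg)
qed

lemma continuous_poly_map:
  assumes "continuous_on disc \<phi>"
  shows "continuous_on (polydisc p) (poly_map p \<phi>)"
proof (rule continuous_on_coordinatewise_then_product)
  fix i
  show "continuous_on (polydisc p) (\<lambda>z. poly_map p \<phi> z i)"
  proof (cases "i < p")
    case True
    have "continuous_on (polydisc p) (\<lambda>z. \<phi> (z i))"
      by (rule continuous_on_compose2[OF assms continuous_on_polydisc_component]) (use polydiscD True in blast)
    then show ?thesis using True by (simp add: poly_map_def)
  qed (simp add: poly_map_def)
qed

lemma poly_T_in_A2:
  assumes \<phi>: "\<phi> \<in> CE_emb" and f: "f \<in> A2 p"
  shows "poly_T p \<phi> f \<in> A2 p"
proof (rule A2_I)
  note D = CE_embD[OF \<phi>]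
  have pm: "poly_map p \<phi> z \<in> polydisc p" if "z \<in> polydisc p" for z
    using poly_map_polydisc[OF D(3)] that by blast
  have "continuous_on (polydisc p) (\<lambda>z. (\<Prod>i<p. deriv \<phi> (z i)) * f (poly_map p \<phi> z))"
  proof (intro continuous_on_mult continuous_on_prod)
    show "continuous_on (polydisc p) (\<lambda>z. deriv \<phi> (z i))" if "i \<in> {..<p}" for i
      by (rule continuous_on_compose2[OF D(7) continuous_on_polydisc_component]) (use polydiscD that in blast)
    show "continuous_on (polydisc p) (\<lambda>z. f (poly_map p \<phi> z))"
      by (rule continuous_on_compose2[OF A2_D(4)[OF f] continuous_poly_map[OF D(6)]]) (use pm in blast)
  qed
  then have cont: "continuous_on (polydisc p) (poly_T p \<phi> f)"
    by (rule continuous_on_eq) (simp add: poly_T_def)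
  have "(\<lambda>w. poly_T p \<phi> f (z(i := w))) holomorphic_on disc" if z: "z \<in> polydisc p" and i: "i < p" for z i
  proof -
    have 1: "(\<lambda>w. \<Prod>j<p. deriv \<phi> ((z(i := w)) j)) holomorphic_on disc"
    proof (rule holomorphic_on_prod)
      fix j assume "j \<in> {..<p}"
      show "(\<lambda>w. deriv \<phi> ((z(i := w)) j)) holomorphic_on disc"
        using D(8) by (cases "j = i") auto
    qed
    have upd: "poly_map p \<phi> (z(i := w)) = (poly_map p \<phi> z)(i := \<phi> w)" for w
      using i by (auto simp: poly_map_def fun_eq_iff restrict_def)
    have "(\<lambda>w. f ((poly_map p \<phi> z)(i := \<phi> w))) holomorphic_on disc"
      using holomorphic_on_compose_gen[OF D(1) A2_D(5)[OF f pm[OF z] i] D(3)] by (simp add: o_def)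
    then have "(\<lambda>w. (\<Prod>j<p. deriv \<phi> ((z(i := w)) j)) * f (poly_map p \<phi> (z(i := w)))) holomorphic_on disc"
      unfolding upd by (intro holomorphic_on_mult 1)
    then show ?thesis
      by (rule holomorphic_transform) (use z i in \<open>simp add: poly_T_def polydisc_upd\<close>)
  qed
  with cont show "holomorphic_polydisc p (poly_T p \<phi> f)"
    by (simp add: holomorphic_polydisc_def)
  show "square_integrable (poly_measure p) (poly_T p \<phi> f)"
    by (rule poly_T_square_integrable(1)[OF \<phi> A2_D(2)[OF f]])
qed (simp add: poly_T_def)

lemma hilbert_op_poly_T:
  assumes \<phi>: "\<phi> \<in> CE_emb"
  shows "hilbert_op (poly_measure p) (A2 p) (poly_measure p) (A2 p) (poly_T p \<phi>) 1"
proof unfold_locales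
  show "linear_op (A2 p) (A2 p) (poly_T p \<phi>)"
    unfolding linear_op_def using poly_T_in_A2[OF \<phi>] by (auto simp: poly_T_def fun_eq_iff algebra_simps)
  show "L2_norm (poly_measure p) (poly_T p \<phi> f) \<le> 1 * L2_norm (poly_measure p) f" if "f \<in> A2 p" for f
    using poly_T_square_integrable(2)[OF \<phi> A2_D(2)[OF that]] by simp
qed simp

lemma poly_T_tens:
  assumes \<phi>: "\<phi> \<in> CE_emb" and p: "length as = p"
  shows "poly_T p \<phi> (tens as) = tens (map (T_op \<phi>) as)"
proof
  fix z
  show "poly_T p \<phi> (tens as) z = tens (map (T_op \<phi>) as) z"
  proof (cases "z \<in> polydisc p")
    case True
    have "poly_map p \<phi> z \<in> polydisc p"
      using poly_map_polydisc[OF CE_embD(3)[OF \<phi>] True] .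
    then have "poly_T p \<phi> (tens as) z = (\<Prod>i<p. deriv \<phi> (z i)) * (\<Prod>i<p. (as ! i) (\<phi> (z i)))"
      using True by (simp add: poly_T_def tens_def p) (simp add: poly_map_def)
    also have "\<dots> = (\<Prod>i<p. (T_op \<phi> (as ! i)) (z i))"
      unfolding prod.distrib[symmetric] using polydiscD[OF True]
      by (intro prod.cong) (simp_all add: T_op_def del: mem_ball_0)
    finally show ?thesis using True p by (simp add: tens_def)
  next
    case False
    then show ?thesis using p by (simp add: poly_T_def tens_def)
  qed
qed

lemma conj_map_in_CE_emb:
  assumes \<phi>: "\<phi> \<in> CE_emb"
  shows "conj_map \<phi> \<in> CE_emb"
  unfolding CE_emb_def
proof (intro CollectI conjI)
  note D = CE_embD[OF \<phi>]
  have cd: "cnj z \<in> disc \<longleftrightarrow> z \<in> disc" for z by simp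
  show "conj_map \<phi> \<in> disc \<rightarrow>\<^sub>E disc"
    using D(5) by (auto simp: conj_map_def)
  have "cnj \<circ> \<phi> \<circ> cnj holomorphic_on disc"
  proof (rule holomorphic_on_compose_cnj_cnj)
    have "cnj ` disc = disc"
      using cd by (force simp: image_cnj_conv_vimage_cnj)
    then show "\<phi> holomorphic_on cnj ` disc" using D(1) by simp
  qed simp
  then show "conj_map \<phi> holomorphic_on disc"
    by (rule holomorphic_transform) (simp add: conj_map_def)
  show "inj_on (conj_map \<phi>) disc"
  proof (rule inj_onI)
    fix x y assume xy: "x \<in> disc" "y \<in> disc" "conj_map \<phi> x = conj_map \<phi> y"
    then have "\<phi> (cnj x) = \<phi> (cnj y)"
      by (simp add: conj_map_def)
    then have "cnj x = cnj y"
      by (rule inj_onD[OF D(2)]) (use xy in auto)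
    then show "x = y" by simp
  qed
qed

abbreviation poly_T_adj where
  "poly_T_adj p \<phi> \<equiv> adj (poly_measure p) (A2 p) (poly_measure p) (poly_T p \<phi>)"

lemma rho_cl_disc_adj: "rho_cl_disc \<phi> = adj disc_measure A2_disc disc_measure (T_op (conj_map \<phi>))"
  unfolding rho_cl_disc_def A2_adjoint_def adj_def ..

text \<open>The \<open>p\<close>-fold tensor power of an adjoint is the adjoint of the \<open>p\<close>-fold tensor power, and the
  latter is an explicit weighted composition operator in \<open>p\<close> variables.\<close>

lemma rho_cl_deg_eq:
  assumes \<phi>: "\<phi> \<in> CE_emb" and f: "f \<in> A2 p"
  shows "rho_cl_deg p \<phi> f = poly_T_adj p (conj_map \<phi>) f"
proof -
  let ?\<psi> = "conj_map \<phi>"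
  have \<psi>: "?\<psi> \<in> CE_emb" by (rule conj_map_in_CE_emb[OF \<phi>])
  interpret T: hilbert_op "poly_measure p" "A2 p" "poly_measure p" "A2 p" "poly_T p ?\<psi>" 1
    by (rule hilbert_op_poly_T[OF \<psi>])
  interpret T1: hilbert_op disc_measure A2_disc disc_measure A2_disc "T_op ?\<psi>" 1
    by (rule hilbert_op_T_op[OF \<psi>])
  show ?thesis
    unfolding rho_cl_deg_def
  proof (rule tensor_extension_eq[OF _ _ f])
    show "bounded_A2 p p (poly_T_adj p ?\<psi>)"
      unfolding bounded_op_def using T.adj_linear T.adj_bound by blast
    fix as assume as: "length as = p" "set as \<subseteq> A2_disc"
    have ras: "set (map (rho_cl_disc \<phi>) as) \<subseteq> A2_disc"
      using as(2) T1.adj_in unfolding rho_cl_disc_adj by auto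
    show "poly_T_adj p ?\<psi> (tens as) = tens (map (rho_cl_disc \<phi>) as)"
    proof (rule A2_eqI_tens)
      show "poly_T_adj p ?\<psi> (tens as) \<in> A2 p" by (intro T.adj_in tens_in_A2 as)
      show "tens (map (rho_cl_disc \<phi>) as) \<in> A2 p" by (rule tens_in_A2[OF ras]) (simp add: as)
      fix bs assume bs: "length bs = p" "set bs \<subseteq> A2_disc"
      have Tbs: "set (map (T_op ?\<psi>) bs) \<subseteq> A2_disc"
        using bs(2) T1.in_W by auto
      have "L2_inner (poly_measure p) (poly_T_adj p ?\<psi> (tens as)) (tens bs) =
          L2_inner (poly_measure p) (tens as) (tens (map (T_op ?\<psi>) bs))"
        unfolding poly_T_tens[OF \<psi> bs(1), symmetric] by (intro T.adj_inner' tens_in_A2 as bs)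
      also have "\<dots> = (\<Prod>i<p. L2_inner disc_measure (as ! i) (map (T_op ?\<psi>) bs ! i))"
        by (rule L2_inner_tens[OF as(2) Tbs as(1)]) (simp add: bs)
      also have "\<dots> = (\<Prod>i<p. L2_inner disc_measure (map (rho_cl_disc \<phi>) as ! i) (bs ! i))"
      proof (rule prod.cong)
        fix i assume "i \<in> {..<p}"
        then have i: "i < length as" "i < length bs" using as bs by auto
        then have "as ! i \<in> A2_disc" "bs ! i \<in> A2_disc" using as bs nth_mem by blast+
        then show "L2_inner disc_measure (as ! i) (map (T_op ?\<psi>) bs ! i) =
            L2_inner disc_measure (map (rho_cl_disc \<phi>) as ! i) (bs ! i)"
          using i by (simp add: rho_cl_disc_adj T1.adj_inner')
      qed simp
      also have "\<dots> = L2_inner (poly_measure p) (tens (map (rho_cl_disc \<phi>) as)) (tens bs)"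
        by (rule L2_inner_tens[OF ras bs(2) _ bs(1), symmetric]) (simp add: as)
      finally show "L2_inner (poly_measure p) (poly_T_adj p ?\<psi> (tens as)) (tens bs) = \<dots>" .
    qed
  qed
qed

section \<open>Permuting variables\<close>

definition perm_op ::
  "nat \<Rightarrow> (nat \<Rightarrow> nat) \<Rightarrow> ((nat \<Rightarrow> complex) \<Rightarrow> complex) \<Rightarrow> (nat \<Rightarrow> complex) \<Rightarrow> complex" where
  "perm_op p \<sigma> f z = (if z \<in> polydisc p then f (z \<circ> \<sigma>) else 0)"

lemma polydisc_perm:
  assumes \<sigma>: "\<sigma> permutes {..<p}" and z: "z \<in> polydisc p"
  shows "z \<circ> \<sigma> \<in> polydisc p"
proof (rule polydiscI)
  show "(z \<circ> \<sigma>) i \<in> disc" if "i < p" for i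
    using polydiscD[OF z, of "\<sigma> i"] permutes_in_image[OF \<sigma>, of i] that by simp
  show "(z \<circ> \<sigma>) i = undefined" if "p \<le> i" for i
    using polydisc_undefined[OF z that] permutes_not_in[OF \<sigma>, of i] that by simp
qed

lemma measurable_perm:
  assumes \<sigma>: "\<sigma> permutes {..<p}"
  shows "(\<lambda>z. z \<circ> \<sigma>) \<in> measurable (poly_measure p) (poly_measure p)"
proof (rule measurable_polyI)
  show "(\<lambda>z. (z \<circ> \<sigma>) i) \<in> measurable (poly_measure p) disc_measure" if "i < p" for i
    using measurable_poly_component[of "\<sigma> i" p] permutes_in_image[OF \<sigma>, of i] that by simp
  show "(z \<circ> \<sigma>) i = undefined" if "z \<in> space (poly_measure p)" "p \<le> i" for z i
    using polydisc_undefined[of z p i] permutes_not_in[OF \<sigma>, of i] that by simp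
qed

text \<open>Both sides give the same measure to every box, and boxes determine a measure on the product.\<close>

lemma distr_perm:
  assumes \<sigma>: "\<sigma> permutes {..<p}"
  shows "distr (poly_measure p) (poly_measure p) (\<lambda>z. z \<circ> \<sigma>) = poly_measure p"
  unfolding poly_measure_def
proof (rule PM.PiM_eqI, fold poly_measure_def)
  fix A assume A: "\<And>i. i \<in> {..<p} \<Longrightarrow> A i \<in> sets disc_measure"
  have inv: "inv \<sigma> permutes {..<p}" by (rule permutes_inv[OF \<sigma>])
  have sub: "A i \<subseteq> disc" if "i < p" for i using A[of i] that by (simp add: sets_disc_measure)
  have A': "A (inv \<sigma> i) \<in> sets disc_measure" if "i \<in> {..<p}" for i
    using A permutes_in_image[OF inv, of i] that by simp
  have eq: "(\<lambda>z. z \<circ> \<sigma>) -` (Pi\<^sub>E {..<p} A) \<inter> polydisc p = Pi\<^sub>E {..<p} (\<lambda>i. A (inv \<sigma> i))"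
  proof (intro equalityI subsetI)
    fix z assume "z \<in> (\<lambda>z. z \<circ> \<sigma>) -` (Pi\<^sub>E {..<p} A) \<inter> polydisc p"
    then have z: "z \<in> polydisc p" and zs: "z \<circ> \<sigma> \<in> Pi\<^sub>E {..<p} A" by blast+
    have m: "z (\<sigma> i) \<in> A i" if "i < p" for i
      using PiE_mem[OF zs, of i] that by simp
    have "z i \<in> A (inv \<sigma> i)" if "i < p" for i
    proof -
      have "inv \<sigma> i < p" using permutes_in_image[OF inv, of i] that by simp
      from m[OF this] show ?thesis unfolding permutes_inverses(1)[OF \<sigma>] .
    qed
    with z show "z \<in> Pi\<^sub>E {..<p} (\<lambda>i. A (inv \<sigma> i))" by (simp add: polydisc_def PiE_def)
  next
    fix z assume z: "z \<in> Pi\<^sub>E {..<p} (\<lambda>i. A (inv \<sigma> i))"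
    have zi: "z i \<in> A (inv \<sigma> i)" if "i < p" for i using PiE_mem[OF z, of i] that by simp
    have zp: "z \<in> polydisc p"
    proof (rule polydiscI)
      show "z i \<in> disc" if "i < p" for i
      proof -
        have "inv \<sigma> i < p" using permutes_in_image[OF inv, of i] that by simp
        from zi[OF that] sub[OF this] show ?thesis by blast
      qed
      show "z i = undefined" if "p \<le> i" for i
        using PiE_arb[OF z, of i] that by simp
    qed
    have "z (\<sigma> i) \<in> A i" if "i < p" for i
    proof -
      have "\<sigma> i < p" using permutes_in_image[OF \<sigma>, of i] that by simp
      from zi[OF this] show ?thesis unfolding permutes_inverses(2)[OF \<sigma>] .
    qed
    moreover have "z \<circ> \<sigma> \<in> extensional {..<p}"
      using polydisc_perm[OF \<sigma> zp] by (simp add: polydisc_def PiE_def)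
    ultimately show "z \<in> (\<lambda>z. z \<circ> \<sigma>) -` (Pi\<^sub>E {..<p} A) \<inter> polydisc p"
      using zp by (simp add: PiE_def)
  qed
  have "emeasure (distr (poly_measure p) (poly_measure p) (\<lambda>z. z \<circ> \<sigma>)) (Pi\<^sub>E {..<p} A) =
      emeasure (poly_measure p) (Pi\<^sub>E {..<p} (\<lambda>i. A (inv \<sigma> i)))"
    unfolding eq[symmetric]
  proof (subst emeasure_distr[OF measurable_perm[OF \<sigma>]])
    show "Pi\<^sub>E {..<p} A \<in> sets (poly_measure p)"
      unfolding poly_measure_def by (rule sets_PiM_I_finite) (use A in auto)
  qed simp
  also have "\<dots> = (\<Prod>i<p. emeasure disc_measure (A (inv \<sigma> i)))"
    unfolding poly_measure_def using A' by (intro PM.emeasure_PiM) auto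
  also have "\<dots> = (\<Prod>i<p. emeasure disc_measure (A i))"
    using prod.permute[OF inv, of "\<lambda>i. emeasure disc_measure (A i)"] unfolding o_def by (rule sym)
  finally show "emeasure (distr (poly_measure p) (poly_measure p) (\<lambda>z. z \<circ> \<sigma>)) (Pi\<^sub>E {..<p} A) =
      (\<Prod>i<p. emeasure disc_measure (A i))" .
qed (simp_all add: poly_measure_def)

lemma L2_inner_perm:
  assumes \<sigma>: "\<sigma> permutes {..<p}"
    and f: "f \<in> borel_measurable (poly_measure p)" and g: "g \<in> borel_measurable (poly_measure p)"
  shows "L2_inner (poly_measure p) (perm_op p \<sigma> f) (perm_op p \<sigma> g) = L2_inner (poly_measure p) f g"
proof -
  have "L2_inner (poly_measure p) (perm_op p \<sigma> f) (perm_op p \<sigma> g) =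
      (LINT z|poly_measure p. f (z \<circ> \<sigma>) * cnj (g (z \<circ> \<sigma>)))"
    unfolding L2_inner_def by (intro Bochner_Integration.integral_cong) (simp_all add: perm_op_def)
  also have "\<dots> = (LINT z|distr (poly_measure p) (poly_measure p) (\<lambda>z. z \<circ> \<sigma>). f z * cnj (g z))"
    by (rule integral_distr[symmetric, OF measurable_perm[OF \<sigma>] borel_measurable_times[OF f cnj_measurable[OF g]]])
  finally show ?thesis unfolding distr_perm[OF \<sigma>] L2_inner_def .
qed

lemma perm_op_in_A2:
  assumes \<sigma>: "\<sigma> permutes {..<p}" and f: "f \<in> A2 p"
  shows "perm_op p \<sigma> f \<in> A2 p"
proof (rule A2_I)
  note pp = polydisc_perm[OF \<sigma>]
  have "continuous_on (polydisc p) (\<lambda>z. z \<circ> \<sigma>)"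
    by (rule continuous_on_coordinatewise_then_product) (simp add: continuous_on_polydisc_component)
  then have "continuous_on (polydisc p) (\<lambda>z. f (z \<circ> \<sigma>))"
    by (rule continuous_on_compose2[OF A2_D(4)[OF f]]) (use pp in blast)
  then have cont: "continuous_on (polydisc p) (perm_op p \<sigma> f)"
    by (rule continuous_on_eq) (simp add: perm_op_def)
  have "(\<lambda>w. perm_op p \<sigma> f (z(i := w))) holomorphic_on disc" if z: "z \<in> polydisc p" and i: "i < p" for z i
  proof -
    have i': "inv \<sigma> i < p" using permutes_in_image[OF permutes_inv[OF \<sigma>], of i] i by simp
    have upd: "z(i := w) \<circ> \<sigma> = (z \<circ> \<sigma>)(inv \<sigma> i := w)" for w
    proof
      fix k
      show "(z(i := w) \<circ> \<sigma>) k = ((z \<circ> \<sigma>)(inv \<sigma> i := w)) k"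
        using permutes_inverses(1)[OF \<sigma>, of i] permutes_inverses(2)[OF \<sigma>, of k]
        unfolding fun_upd_def o_def by metis
    qed
    show ?thesis
      by (rule holomorphic_transform[OF A2_D(5)[OF f pp[OF z] i']])
        (simp only: perm_op_def polydisc_upd[OF z i] upd if_True)
  qed
  with cont show "holomorphic_polydisc p (perm_op p \<sigma> f)" by (simp add: holomorphic_polydisc_def)
  have "(\<integral>\<^sup>+z. ennreal ((cmod (perm_op p \<sigma> f z))\<^sup>2) \<partial>poly_measure p) =
      (\<integral>\<^sup>+z. ennreal ((cmod (f (z \<circ> \<sigma>)))\<^sup>2) \<partial>poly_measure p)"
    by (intro nn_integral_cong) (simp add: perm_op_def)
  also have "\<dots> = (\<integral>\<^sup>+z. ennreal ((cmod (f z))\<^sup>2) \<partial>distr (poly_measure p) (poly_measure p) (\<lambda>z. z \<circ> \<sigma>))"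
    using A2_D(2)[OF f] by (intro nn_integral_distr[symmetric] measurable_perm[OF \<sigma>]) (auto simp: square_integrable_def)
  also have "\<dots> < \<infinity>" unfolding distr_perm[OF \<sigma>] using A2_D(2)[OF f] by (simp add: square_integrable_iff_nn)
  finally show "square_integrable (poly_measure p) (perm_op p \<sigma> f)"
    using measurable_continuous_polydisc[OF cont] by (simp add: square_integrable_iff_nn)
qed (simp add: perm_op_def)

lemma perm_op_inv:
  assumes \<sigma>: "\<sigma> permutes {..<p}" and f: "f \<in> A2 p"
  shows "perm_op p (inv \<sigma>) (perm_op p \<sigma> f) = f"
proof
  fix z :: "nat \<Rightarrow> complex"
  have "(z \<circ> inv \<sigma>) \<circ> \<sigma> = z"
    unfolding comp_assoc permutes_inv_o(2)[OF \<sigma>] by (rule comp_id)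
  then show "perm_op p (inv \<sigma>) (perm_op p \<sigma> f) z = f z"
    unfolding perm_op_def using polydisc_perm[OF permutes_inv[OF \<sigma>], of z] A2_D(3)[OF f, of z]
    by (simp del: o_apply)
qed

lemma L2_inner_perm_adj:
  assumes \<sigma>: "\<sigma> permutes {..<p}" and f: "f \<in> A2 p" and g: "g \<in> A2 p"
  shows "L2_inner (poly_measure p) (perm_op p \<sigma> f) g = L2_inner (poly_measure p) f (perm_op p (inv \<sigma>) g)"
proof -
  have inv: "inv \<sigma> permutes {..<p}" by (rule permutes_inv[OF \<sigma>])
  have "L2_inner (poly_measure p) (perm_op p \<sigma> f) g =
      L2_inner (poly_measure p) (perm_op p (inv \<sigma>) (perm_op p \<sigma> f)) (perm_op p (inv \<sigma>) g)"
    by (intro L2_inner_perm[symmetric] inv square_integrable_measurable A2_D(2) perm_op_in_A2 \<sigma> f g)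
  then show ?thesis by (simp only: perm_op_inv[OF \<sigma> f])
qed

lemma SymA2_deg_iff:
  "f \<in> SymA2_deg p \<longleftrightarrow> f \<in> A2 p \<and> (\<forall>\<sigma>. \<sigma> permutes {..<p} \<longrightarrow> perm_op p \<sigma> f = f)"
proof -
  have "(\<forall>z\<in>polydisc p. f (z \<circ> \<sigma>) = f z) \<longleftrightarrow> perm_op p \<sigma> f = f" if "f \<in> A2 p" for \<sigma>
  proof
    assume *: "\<forall>z\<in>polydisc p. f (z \<circ> \<sigma>) = f z"
    show "perm_op p \<sigma> f = f"
    proof
      show "perm_op p \<sigma> f z = f z" for z
        using * A2_D(3)[OF that, of z] unfolding perm_op_def by (cases "z \<in> polydisc p") auto
    qed
  next
    assume *: "perm_op p \<sigma> f = f"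
    show "\<forall>z\<in>polydisc p. f (z \<circ> \<sigma>) = f z"
    proof
      show "f (z \<circ> \<sigma>) = f z" if "z \<in> polydisc p" for z
        using fun_cong[OF *, of z] that unfolding perm_op_def by (simp only: if_True)
    qed
  qed
  then show ?thesis unfolding SymA2_deg_def by blast
qed

lemma SymA2_degD:
  assumes "f \<in> SymA2_deg p"
  shows "f \<in> A2 p" "\<sigma> permutes {..<p} \<Longrightarrow> perm_op p \<sigma> f = f"
  using assms by (auto simp: SymA2_deg_iff)

section \<open>Tensoring with a kernel\<close>

text \<open>The identification of \<open>polydisc m \<times> polydisc n\<close> with \<open>polydisc (m + n)\<close>.\<close>

definition join :: "nat \<Rightarrow> (nat \<Rightarrow> complex) \<Rightarrow> (nat \<Rightarrow> complex) \<Rightarrow> nat \<Rightarrow> complex" where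
  "join m z y i = (if i < m then z i else y (i - m))"

lemma polydisc_norm: "z \<in> polydisc p \<Longrightarrow> i < p \<Longrightarrow> cmod (z i) < 1"
  using polydiscD[of z p i] by simp

lemma join_polydisc: "z \<in> polydisc m \<Longrightarrow> y \<in> polydisc n \<Longrightarrow> join m z y \<in> polydisc (m + n)"
  by (rule polydiscI) (auto simp: join_def polydisc_norm polydisc_undefined)

lemma restrict_join: "z \<in> polydisc m \<Longrightarrow> restrict (join m z y) {..<m} = z"
  by (auto simp: join_def fun_eq_iff restrict_def polydisc_undefined)

lemma shift_join: "(\<lambda>k. join m z y (m + k)) = y"
  by (simp add: join_def)

lemma restrict_polydisc: "z \<in> polydisc (m + n) \<Longrightarrow> restrict z {..<m} \<in> polydisc m"
  by (rule polydiscI) (auto simp: polydisc_norm)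

lemma shift_polydisc: "z \<in> polydisc (m + n) \<Longrightarrow> (\<lambda>k. z (m + k)) \<in> polydisc n"
  by (rule polydiscI) (auto simp: polydisc_norm polydisc_undefined)

lemma measurable_join:
  "(\<lambda>(z, y). join m z y) \<in> measurable (poly_measure m \<Otimes>\<^sub>M poly_measure n) (poly_measure (m + n))"
proof (rule measurable_polyI)
  show "(\<lambda>x. (case x of (z, y) \<Rightarrow> join m z y) i) \<in> measurable (poly_measure m \<Otimes>\<^sub>M poly_measure n) disc_measure"
    if "i < m + n" for i
  proof (cases "i < m")
    case True
    from measurable_compose[OF measurable_fst measurable_poly_component[OF this]] this
    show ?thesis by (simp add: join_def split_beta')
  next
    case False
    then have "i - m < n" using that by simp
    from measurable_compose[OF measurable_snd measurable_poly_component[OF this]] False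
    show ?thesis by (simp add: join_def split_beta')
  qed
  show "(case x of (z, y) \<Rightarrow> join m z y) i = undefined"
    if "x \<in> space (poly_measure m \<Otimes>\<^sub>M poly_measure n)" "m + n \<le> i" for x i
    using that polydisc_undefined[of "snd x" n "i - m"]
    by (auto simp: join_def space_pair_measure split_beta')
qed

lemma prod_lessThan_add:
  "(\<Prod>i<m + n. f i) = (\<Prod>i<m. f i) * (\<Prod>k<n. f (m + k) :: 'a::comm_monoid_mult)" for m n :: nat
  by (induction n) (simp_all add: mult.assoc)

lemma sigma_finite_poly: "sigma_finite_measure (poly_measure p)"
proof -
  interpret finite_measure "poly_measure p" by (rule finite_measure_poly)
  show ?thesis by unfold_locales
qed

lemma distr_join:
  "distr (poly_measure m \<Otimes>\<^sub>M poly_measure n) (poly_measure (m + n)) (\<lambda>(z, y). join m z y) = poly_measure (m + n)"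
  unfolding poly_measure_def[of "m + n"]
proof (rule PM.PiM_eqI, fold poly_measure_def)
  interpret N: sigma_finite_measure "poly_measure n" by (rule sigma_finite_poly)
  fix A assume A: "\<And>i. i \<in> {..<m + n} \<Longrightarrow> A i \<in> sets disc_measure"
  have sub: "A i \<subseteq> disc" if "i < m + n" for i using A[of i] that by (simp add: sets_disc_measure)
  let ?B = "Pi\<^sub>E {..<m} A" and ?C = "Pi\<^sub>E {..<n} (\<lambda>k. A (m + k))"
  have eq: "(\<lambda>(z, y). join m z y) -` (Pi\<^sub>E {..<m + n} A) \<inter> (polydisc m \<times> polydisc n) = ?B \<times> ?C"
  proof (intro equalityI subsetI)
    fix x assume *: "x \<in> (\<lambda>(z, y). join m z y) -` (Pi\<^sub>E {..<m + n} A) \<inter> (polydisc m \<times> polydisc n)"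
    obtain z y where x: "x = (z, y)" by (cases x)
    from * have z: "z \<in> polydisc m" and y: "y \<in> polydisc n" and J: "join m z y \<in> Pi\<^sub>E {..<m + n} A"
      unfolding x by simp_all
    have j: "join m z y i \<in> A i" if "i < m + n" for i
      using PiE_mem[OF J, of i] that by simp
    have "z i \<in> A i" if "i < m" for i using j[of i] that by (simp add: join_def)
    moreover have "y k \<in> A (m + k)" if "k < n" for k using j[of "m + k"] that by (simp add: join_def)
    ultimately show "x \<in> ?B \<times> ?C" using x z y by (simp add: polydisc_def PiE_def)
  next
    fix x assume *: "x \<in> ?B \<times> ?C"
    obtain z y where x: "x = (z, y)" by (cases x)
    from * have z: "z \<in> ?B" and y: "y \<in> ?C" unfolding x by (simp_all only: mem_Times_iff fst_conv snd_conv)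
    have zi: "z i \<in> A i" if "i < m" for i using PiE_mem[OF z, of i] that by simp
    have yi: "y k \<in> A (m + k)" if "k < n" for k using PiE_mem[OF y, of k] that by simp
    have zp: "z \<in> polydisc m"
    proof (rule polydiscI)
      show "z i \<in> disc" if "i < m" for i using zi[OF that] sub[of i] that by auto
      show "z i = undefined" if "m \<le> i" for i using PiE_arb[OF z, of i] that by simp
    qed
    have yp: "y \<in> polydisc n"
    proof (rule polydiscI)
      show "y i \<in> disc" if "i < n" for i using yi[OF that] sub[of "m + i"] that by auto
      show "y i = undefined" if "n \<le> i" for i using PiE_arb[OF y, of i] that by simp
    qed
    have "join m z y i \<in> A i" if "i < m + n" for i
    proof (cases "i < m")
      case True
      then show ?thesis using zi[OF True] by (simp add: join_def)
    next
      case False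
      then have "y (i - m) \<in> A (m + (i - m))" using that by (intro yi) simp
      then show ?thesis using False by (simp add: join_def)
    qed
    moreover have "join m z y \<in> extensional {..<m + n}"
      using join_polydisc[OF zp yp] by (simp add: polydisc_def PiE_def)
    ultimately show "x \<in> (\<lambda>(z, y). join m z y) -` (Pi\<^sub>E {..<m + n} A) \<inter> (polydisc m \<times> polydisc n)"
      using x zp yp by (simp add: PiE_def)
  qed
  have BC: "?B \<in> sets (poly_measure m)" "?C \<in> sets (poly_measure n)" and S: "Pi\<^sub>E {..<m + n} A \<in> sets (poly_measure (m + n))"
    unfolding poly_measure_def by (rule sets_PiM_I_finite; use A in simp)+
  have "emeasure (distr (poly_measure m \<Otimes>\<^sub>M poly_measure n) (poly_measure (m + n)) (\<lambda>(z, y). join m z y)) (Pi\<^sub>E {..<m + n} A) =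
      emeasure (poly_measure m \<Otimes>\<^sub>M poly_measure n) (?B \<times> ?C)"
    unfolding eq[symmetric] emeasure_distr[OF measurable_join S] by (simp add: space_pair_measure)
  also have "\<dots> = emeasure (poly_measure m) ?B * emeasure (poly_measure n) ?C"
    by (rule N.emeasure_pair_measure_Times[OF BC])
  also have "emeasure (poly_measure m) ?B = (\<Prod>i<m. emeasure disc_measure (A i))"
    unfolding poly_measure_def by (rule PM.emeasure_PiM) (use A in simp_all)
  also have "emeasure (poly_measure n) ?C = (\<Prod>k<n. emeasure disc_measure (A (m + k)))"
    unfolding poly_measure_def by (rule PM.emeasure_PiM) (use A in simp_all)
  finally show "emeasure (distr (poly_measure m \<Otimes>\<^sub>M poly_measure n) (poly_measure (m + n)) (\<lambda>(z, y). join m z y)) (Pi\<^sub>E {..<m + n} A) =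
      (\<Prod>i<m + n. emeasure disc_measure (A i))"
    by (simp add: prod_lessThan_add)
qed (simp_all add: poly_measure_def)

lemma nn_integral_join:
  assumes f: "f \<in> borel_measurable (poly_measure (m + n))"
  shows "(\<integral>\<^sup>+x. f x \<partial>poly_measure (m + n)) = (\<integral>\<^sup>+z. \<integral>\<^sup>+y. f (join m z y) \<partial>poly_measure n \<partial>poly_measure m)"
proof -
  interpret N: sigma_finite_measure "poly_measure n" by (rule sigma_finite_poly)
  have "(\<integral>\<^sup>+x. f x \<partial>poly_measure (m + n)) = (\<integral>\<^sup>+x. f (case x of (z, y) \<Rightarrow> join m z y) \<partial>(poly_measure m \<Otimes>\<^sub>M poly_measure n))"
    by (subst distr_join[symmetric], rule nn_integral_distr[OF measurable_join]) (simp add: f)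
  also have "\<dots> = (\<integral>\<^sup>+z. \<integral>\<^sup>+y. f (case (z, y) of (z, y) \<Rightarrow> join m z y) \<partial>poly_measure n \<partial>poly_measure m)"
    by (rule N.nn_integral_fst[symmetric]) (rule measurable_compose[OF measurable_join f])
  finally show ?thesis by simp
qed

lemma integral_join:
  fixes f :: "(nat \<Rightarrow> complex) \<Rightarrow> complex"
  assumes f: "integrable (poly_measure (m + n)) f"
  shows "(LINT x|poly_measure (m + n). f x) = (LINT z|poly_measure m. LINT y|poly_measure n. f (join m z y))"
proof -
  interpret pair_sigma_finite "poly_measure m" "poly_measure n"
    unfolding pair_sigma_finite_def using sigma_finite_poly by blast
  have fm: "f \<in> borel_measurable (poly_measure (m + n))" using f by simp
  have int: "integrable (poly_measure m \<Otimes>\<^sub>M poly_measure n) (\<lambda>x. f (case x of (z, y) \<Rightarrow> join m z y))"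
    by (rule integrable_distr[OF measurable_join]) (simp add: distr_join f)
  have "(LINT x|poly_measure (m + n). f x) = (LINT x|(poly_measure m \<Otimes>\<^sub>M poly_measure n). f (case x of (z, y) \<Rightarrow> join m z y))"
    by (subst distr_join[symmetric], rule integral_distr[OF measurable_join fm])
  also have "\<dots> = (LINT z|poly_measure m. LINT y|poly_measure n. f (case (z, y) of (z, y) \<Rightarrow> join m z y))"
    by (rule integral_fst'[symmetric, OF int])
  finally show ?thesis by simp
qed

text \<open>The tensor product \<open>f \<otimes> G\<close>, with the kernel in the last two variables.\<close>

definition mul_ker ::
  "nat \<Rightarrow> ((nat \<Rightarrow> complex) \<Rightarrow> complex) \<Rightarrow> ((nat \<Rightarrow> complex) \<Rightarrow> complex) \<Rightarrow> (nat \<Rightarrow> complex) \<Rightarrow> complex" where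
  "mul_ker m G f z = (if z \<in> polydisc (m + 2) then f (restrict z {..<m}) * G (\<lambda>k. z (m + k)) else 0)"

lemma mul_ker_join:
  assumes "z \<in> polydisc m" "y \<in> polydisc 2"
  shows "mul_ker m G f (join m z y) = f z * G y"
  using join_polydisc[OF assms] unfolding mul_ker_def restrict_join[OF assms(1)] shift_join by (simp only: if_True)

lemma mul_ker_in_A2:
  assumes G: "G \<in> A2 2" and f: "f \<in> A2 m"
  shows "mul_ker m G f \<in> A2 (m + 2)"
    "L2_norm (poly_measure (m + 2)) (mul_ker m G f) \<le> L2_norm (poly_measure 2) G * L2_norm (poly_measure m) f"
proof -
  have c1: "continuous_on (polydisc (m + 2)) (\<lambda>z. restrict z {..<m})"
  proof (rule continuous_on_coordinatewise_then_product)
    show "continuous_on (polydisc (m + 2)) (\<lambda>z. restrict z {..<m} i)" for i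
      by (cases "i < m") (simp_all add: continuous_on_polydisc_component)
  qed
  have c2: "continuous_on (polydisc (m + 2)) (\<lambda>z. \<lambda>k. z (m + k))"
    by (rule continuous_on_coordinatewise_then_product) (rule continuous_on_polydisc_component)
  have "continuous_on (polydisc (m + 2)) (\<lambda>z. f (restrict z {..<m}) * G (\<lambda>k. z (m + k)))"
    by (intro continuous_on_mult continuous_on_compose2[OF A2_D(4)[OF f] c1] continuous_on_compose2[OF A2_D(4)[OF G] c2])
      (use restrict_polydisc[of _ m 2] shift_polydisc[of _ m 2] in blast)+
  then have cont: "continuous_on (polydisc (m + 2)) (mul_ker m G f)"
    by (rule continuous_on_eq) (simp add: mul_ker_def)
  have hol: "(\<lambda>w. mul_ker m G f (z(i := w))) holomorphic_on disc" if z: "z \<in> polydisc (m + 2)" and i: "i < m + 2" for z i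
  proof (cases "i < m")
    case True
    have upd: "restrict (z(i := w)) {..<m} = (restrict z {..<m})(i := w)" "(\<lambda>k. (z(i := w)) (m + k)) = (\<lambda>k. z (m + k))" for w
      using True by (auto simp: fun_eq_iff restrict_def)
    have "(\<lambda>w. f ((restrict z {..<m})(i := w)) * G (\<lambda>k. z (m + k))) holomorphic_on disc"
      by (intro holomorphic_on_mult holomorphic_on_const A2_D(5)[OF f restrict_polydisc[OF z] True])
    then show ?thesis
      by (rule holomorphic_transform) (use z i in \<open>simp add: mul_ker_def polydisc_upd upd del: fun_upd_apply\<close>)
  next
    case False
    then have upd: "restrict (z(i := w)) {..<m} = restrict z {..<m}" "(\<lambda>k. (z(i := w)) (m + k)) = (\<lambda>k. z (m + k))(i - m := w)" for w
      by (auto simp: fun_eq_iff restrict_def)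
    have "i - m < 2" using False i by simp
    then have "(\<lambda>w. f (restrict z {..<m}) * G ((\<lambda>k. z (m + k))(i - m := w))) holomorphic_on disc"
      by (intro holomorphic_on_mult holomorphic_on_const A2_D(5)[OF G shift_polydisc[OF z]])
    then show ?thesis
      by (rule holomorphic_transform) (use z i in \<open>simp add: mul_ker_def polydisc_upd upd del: fun_upd_apply\<close>)
  qed
  have meas: "mul_ker m G f \<in> borel_measurable (poly_measure (m + 2))"
    by (rule measurable_continuous_polydisc[OF cont])
  let ?nf = "L2_norm (poly_measure m) f" and ?nG = "L2_norm (poly_measure 2) G"
  have gm: "(\<lambda>y. ennreal ((cmod (G y))\<^sup>2)) \<in> borel_measurable (poly_measure 2)"
    and fm: "(\<lambda>z. ennreal ((cmod (f z))\<^sup>2)) \<in> borel_measurable (poly_measure m)"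
    using A2_D(2)[OF G] A2_D(2)[OF f] by (auto simp: square_integrable_def)
  have "(\<integral>\<^sup>+x. ennreal ((cmod (mul_ker m G f x))\<^sup>2) \<partial>poly_measure (m + 2)) =
      (\<integral>\<^sup>+z. \<integral>\<^sup>+y. ennreal ((cmod (mul_ker m G f (join m z y)))\<^sup>2) \<partial>poly_measure 2 \<partial>poly_measure m)"
    by (rule nn_integral_join) (use meas in measurable)
  also have "\<dots> = (\<integral>\<^sup>+z. \<integral>\<^sup>+y. ennreal ((cmod (f z))\<^sup>2) * ennreal ((cmod (G y))\<^sup>2) \<partial>poly_measure 2 \<partial>poly_measure m)"
    by (intro nn_integral_cong) (simp add: mul_ker_join norm_mult power_mult_distrib ennreal_mult)
  also have "\<dots> = (\<integral>\<^sup>+z. ennreal ((cmod (f z))\<^sup>2) * ennreal (?nG\<^sup>2) \<partial>poly_measure m)"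
    by (simp only: nn_integral_cmult[OF gm] nn_integral_L2_norm[OF A2_D(2)[OF G]])
  also have "\<dots> = ennreal (?nf\<^sup>2) * ennreal (?nG\<^sup>2)"
    by (simp only: nn_integral_multc[OF fm] nn_integral_L2_norm[OF A2_D(2)[OF f]])
  also have "\<dots> = ennreal ((?nG * ?nf)\<^sup>2)"
    by (simp add: power_mult_distrib ennreal_mult mult.commute)
  finally have le: "(\<integral>\<^sup>+x. ennreal ((cmod (mul_ker m G f x))\<^sup>2) \<partial>poly_measure (m + 2)) \<le> ennreal ((?nG * ?nf)\<^sup>2)"
    by simp
  note sq = L2_norm_le_nn[OF meas le]
  show "L2_norm (poly_measure (m + 2)) (mul_ker m G f) \<le> ?nG * ?nf" by (rule sq(2)) simp
  show "mul_ker m G f \<in> A2 (m + 2)"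
  proof (rule A2_I)
    show "holomorphic_polydisc (m + 2) (mul_ker m G f)"
      unfolding holomorphic_polydisc_def using cont hol by blast
    show "square_integrable (poly_measure (m + 2)) (mul_ker m G f)" by (rule sq(1)) simp
  qed (simp only: mul_ker_def if_False)
qed

lemma L2_inner_tens_mul_ker:
  assumes bs: "length bs = m" "set bs \<subseteq> A2_disc" and ab: "a \<in> A2_disc" "b \<in> A2_disc"
    and G: "G \<in> A2 2" and f: "f \<in> A2 m"
  shows "L2_inner (poly_measure (m + 2)) (tens (bs @ [a, b])) (mul_ker m G f) =
    L2_inner (poly_measure m) (tens bs) f * L2_inner (poly_measure 2) (tens [a, b]) G"
proof -
  have tj: "tens (bs @ [a, b]) (join m z y) = tens bs z * tens [a, b] y"
    if z: "z \<in> polydisc m" and y: "y \<in> polydisc 2" for z y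
  proof -
    have "join m z y \<in> polydisc (m + 2)" by (rule join_polydisc[OF z y])
    moreover have len: "length (bs @ [a, b]) = m + 2" using bs(1) by simp
    ultimately have "tens (bs @ [a, b]) (join m z y) = (\<Prod>i<m + 2. ((bs @ [a, b]) ! i) (join m z y i))"
      unfolding tens_def len by (simp only: if_True)
    also have "\<dots> = (\<Prod>i<m. (bs ! i) (z i)) * (\<Prod>k<2. ([a, b] ! k) (y k))"
      unfolding prod_lessThan_add using bs(1)
      by (intro arg_cong2[where f = "(*)"] prod.cong) (simp_all add: nth_append join_def)
    also have "(\<Prod>i<m. (bs ! i) (z i)) = tens bs z"
      using z unfolding tens_def bs(1) by (simp only: if_True)
    also have "(\<Prod>k<2. ([a, b] ! k) (y k)) = tens [a, b] y"
    proof -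
      have "length [a, b] = 2" by simp
      then show ?thesis using y unfolding tens_def by (simp only: if_True)
    qed
    finally show ?thesis .
  qed
  have "integrable (poly_measure (m + 2)) (\<lambda>x. tens (bs @ [a, b]) x * cnj (mul_ker m G f x))"
    by (intro square_integrable_mult A2_D(2) tens_in_A2 mul_ker_in_A2 G f) (use bs ab in auto)
  from integral_join[OF this]
  have "L2_inner (poly_measure (m + 2)) (tens (bs @ [a, b])) (mul_ker m G f) =
      (LINT z|poly_measure m. LINT y|poly_measure 2. tens (bs @ [a, b]) (join m z y) * cnj (mul_ker m G f (join m z y)))"
    by (simp add: L2_inner_def)
  also have "\<dots> = (LINT z|poly_measure m. LINT y|poly_measure 2. (tens bs z * cnj (f z)) * (tens [a, b] y * cnj (G y)))"
    by (intro Bochner_Integration.integral_cong refl) (simp add: tj mul_ker_join mult_ac)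
  also have "\<dots> = (LINT z|poly_measure m. (tens bs z * cnj (f z)) * L2_inner (poly_measure 2) (tens [a, b]) G)"
    unfolding L2_inner_def by (simp only: Bochner_Integration.integral_mult_right_zero)
  also have "\<dots> = L2_inner (poly_measure m) (tens bs) f * L2_inner (poly_measure 2) (tens [a, b]) G"
    by (simp only: Bochner_Integration.integral_mult_left_zero L2_inner_def)
  finally show ?thesis .
qed

section \<open>Contractions\<close>

lemma L2_norm_perm:
  assumes \<sigma>: "\<sigma> permutes {..<p}" and f: "f \<in> A2 p"
  shows "L2_norm (poly_measure p) (perm_op p \<sigma> f) = L2_norm (poly_measure p) f"
proof -
  have fm: "f \<in> borel_measurable (poly_measure p)" by (rule square_integrable_measurable[OF A2_D(2)[OF f]])
  have "complex_of_real ((L2_norm (poly_measure p) (perm_op p \<sigma> f))\<^sup>2) = of_real ((L2_norm (poly_measure p) f)\<^sup>2)"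
    unfolding L2_inner_self[symmetric] by (rule L2_inner_perm[OF \<sigma> fm fm])
  then have "(L2_norm (poly_measure p) (perm_op p \<sigma> f))\<^sup>2 = (L2_norm (poly_measure p) f)\<^sup>2"
    by (simp only: of_real_eq_iff)
  then show ?thesis by (simp add: power2_eq_iff_nonneg)
qed

lemma perm_op_linear:
  "perm_op p \<sigma> (\<lambda>x. f x + g x) = (\<lambda>x. perm_op p \<sigma> f x + perm_op p \<sigma> g x)"
  "perm_op p \<sigma> (\<lambda>x. c * f x) = (\<lambda>x. c * perm_op p \<sigma> f x)"
  by (auto simp: perm_op_def fun_eq_iff)

lemma mul_ker_linear:
  "mul_ker m G (\<lambda>x. f x + g x) = (\<lambda>x. mul_ker m G f x + mul_ker m G g x)"
  "mul_ker m G (\<lambda>x. c * f x) = (\<lambda>x. c * mul_ker m G f x)"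
  by (auto simp: mul_ker_def fun_eq_iff algebra_simps)

lemma hilbert_op_perm_mul:
  assumes \<sigma>: "\<sigma> permutes {..<m + 2}" and G: "G \<in> A2 2"
  shows "hilbert_op (poly_measure m) (A2 m) (poly_measure (m + 2)) (A2 (m + 2))
    (\<lambda>f. perm_op (m + 2) \<sigma> (mul_ker m G f)) (L2_norm (poly_measure 2) G)"
proof unfold_locales
  show "linear_op (A2 m) (A2 (m + 2)) (\<lambda>f. perm_op (m + 2) \<sigma> (mul_ker m G f))"
    unfolding linear_op_def
    by (intro conjI ballI allI Pi_I perm_op_in_A2 \<sigma> mul_ker_in_A2 G) (simp_all only: perm_op_linear mul_ker_linear)
  show "L2_norm (poly_measure (m + 2)) (perm_op (m + 2) \<sigma> (mul_ker m G f)) \<le>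
      L2_norm (poly_measure 2) G * L2_norm (poly_measure m) f" if f: "f \<in> A2 m" for f
    unfolding L2_norm_perm[OF \<sigma> mul_ker_in_A2(1)[OF G f]] by (rule mul_ker_in_A2(2)[OF G f])
qed simp

lemma hilbert_op_mul_ker:
  assumes G: "G \<in> A2 2"
  shows "hilbert_op (poly_measure m) (A2 m) (poly_measure (m + 2)) (A2 (m + 2)) (mul_ker m G) (L2_norm (poly_measure 2) G)"
proof unfold_locales
  show "linear_op (A2 m) (A2 (m + 2)) (mul_ker m G)"
    unfolding linear_op_def
    by (intro conjI ballI allI Pi_I mul_ker_in_A2 G) (simp_all only: mul_ker_linear)
  show "L2_norm (poly_measure (m + 2)) (mul_ker m G f) \<le> L2_norm (poly_measure 2) G * L2_norm (poly_measure m) f"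
    if f: "f \<in> A2 m" for f
    by (rule mul_ker_in_A2(2)[OF G f])
qed simp

text \<open>Partial inner product with \<open>G\<close> in the last two variables.\<close>

abbreviation contr where
  "contr m G \<equiv> adj (poly_measure m) (A2 m) (poly_measure (m + 2)) (mul_ker m G)"

text \<open>The same contraction in the pair of variables that is selected by \<open>\<sigma>\<close>.\<close>

abbreviation perm_contr where
  "perm_contr m G \<sigma> \<equiv>
     adj (poly_measure m) (A2 m) (poly_measure (m + 2)) (\<lambda>f. perm_op (m + 2) \<sigma> (mul_ker m G f))"

lemma contr_in: "G \<in> A2 2 \<Longrightarrow> f \<in> A2 (m + 2) \<Longrightarrow> contr m G f \<in> A2 m"
  by (rule hilbert_op.adj_in[OF hilbert_op_mul_ker])

lemma contr_inner:
  "G \<in> A2 2 \<Longrightarrow> f \<in> A2 (m + 2) \<Longrightarrow> g \<in> A2 m \<Longrightarrow>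
    L2_inner (poly_measure (m + 2)) (mul_ker m G g) f = L2_inner (poly_measure m) g (contr m G f)"
  by (rule hilbert_op.adj_inner[OF hilbert_op_mul_ker])

lemma contr_eqI:
  "G \<in> A2 2 \<Longrightarrow> f \<in> A2 (m + 2) \<Longrightarrow> h \<in> A2 m \<Longrightarrow>
    (\<And>g. g \<in> A2 m \<Longrightarrow> L2_inner (poly_measure (m + 2)) (mul_ker m G g) f = L2_inner (poly_measure m) g h) \<Longrightarrow>
    contr m G f = h"
  by (rule hilbert_op.adj_eqI[OF hilbert_op_mul_ker])

text \<open>Permuting variables is unitary, so its adjoint is the inverse permutation, which fixes symmetric tensors.\<close>

lemma perm_contr_sym:
  assumes \<sigma>: "\<sigma> permutes {..<m + 2}" and G: "G \<in> A2 2" and f: "f \<in> SymA2_deg (m + 2)"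
  shows "perm_contr m G \<sigma> f = contr m G f"
proof (rule hilbert_op.adj_eqI[OF hilbert_op_perm_mul[OF \<sigma> G]])
  note fA = SymA2_degD(1)[OF f]
  show "f \<in> A2 (m + 2)" by (rule fA)
  show "contr m G f \<in> A2 m" by (rule contr_in[OF G fA])
  fix g assume g: "g \<in> A2 m"
  have "L2_inner (poly_measure (m + 2)) (perm_op (m + 2) \<sigma> (mul_ker m G g)) f =
      L2_inner (poly_measure (m + 2)) (mul_ker m G g) (perm_op (m + 2) (inv \<sigma>) f)"
    by (rule L2_inner_perm_adj[OF \<sigma> mul_ker_in_A2(1)[OF G g] fA])
  also have "\<dots> = L2_inner (poly_measure m) g (contr m G f)"
    unfolding SymA2_degD(2)[OF f permutes_inv[OF \<sigma>]] by (rule contr_inner[OF G fA g])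
  finally show "L2_inner (poly_measure (m + 2)) (perm_op (m + 2) \<sigma> (mul_ker m G g)) f =
      L2_inner (poly_measure m) g (contr m G f)" .
qed

lemma perm_mul_ker:
  assumes \<sigma>: "\<sigma> permutes {..<m}"
  shows "perm_op (m + 2) \<sigma> (mul_ker m G g) = mul_ker m G (perm_op m \<sigma> g)"
proof
  fix z
  have \<sigma>2: "\<sigma> permutes {..<m + 2}" by (rule permutes_subset[OF \<sigma>]) auto
  show "perm_op (m + 2) \<sigma> (mul_ker m G g) z = mul_ker m G (perm_op m \<sigma> g) z"
  proof (cases "z \<in> polydisc (m + 2)")
    case True
    have 1: "restrict (z \<circ> \<sigma>) {..<m} = restrict z {..<m} \<circ> \<sigma>"
    proof
      fix i
      show "restrict (z \<circ> \<sigma>) {..<m} i = (restrict z {..<m} \<circ> \<sigma>) i"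
        using permutes_in_image[OF \<sigma>, of i] by (simp add: restrict_def)
    qed
    have 2: "(\<lambda>k. (z \<circ> \<sigma>) (m + k)) = (\<lambda>k. z (m + k))"
    proof
      fix k
      show "(z \<circ> \<sigma>) (m + k) = z (m + k)"
        using permutes_not_in[OF \<sigma>, of "m + k"] by simp
    qed
    show ?thesis
      unfolding perm_op_def mul_ker_def 1 2
      using True polydisc_perm[OF \<sigma>2 True] restrict_polydisc[OF True] by (simp only: if_True)
  next
    case False
    then show ?thesis unfolding perm_op_def mul_ker_def by (simp only: if_False)
  qed
qed

text \<open>A permutation of the first \<open>m\<close> variables commutes with tensoring by \<open>G\<close> (\<open>perm_mul_ker\<close>), so its adjoint
  commutes with the contraction.\<close>

lemma contr_sym:
  assumes G: "G \<in> A2 2" and f: "f \<in> SymA2_deg (m + 2)"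
  shows "contr m G f \<in> SymA2_deg m"
  unfolding SymA2_deg_iff
proof (intro conjI allI impI)
  note fA = SymA2_degD(1)[OF f]
  show cA: "contr m G f \<in> A2 m" by (rule contr_in[OF G fA])
  fix \<sigma> assume \<sigma>: "\<sigma> permutes {..<m}"
  have inv: "inv \<sigma> permutes {..<m}" by (rule permutes_inv[OF \<sigma>])
  have inv2: "inv \<sigma> permutes {..<m + 2}" by (rule permutes_subset[OF inv]) auto
  show "perm_op m \<sigma> (contr m G f) = contr m G f"
  proof (rule A2.eqI_inner[OF perm_op_in_A2[OF \<sigma> cA] cA])
    fix g assume g: "g \<in> A2 m"
    have pg: "perm_op m (inv \<sigma>) g \<in> A2 m" by (rule perm_op_in_A2[OF inv g])
    have "L2_inner (poly_measure m) g (perm_op m \<sigma> (contr m G f)) =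
        L2_inner (poly_measure m) (perm_op m (inv \<sigma>) g) (contr m G f)"
      using L2_inner_perm_adj[OF inv g cA] unfolding permutes_inv_inv[OF \<sigma>] by (rule sym)
    also have "\<dots> = L2_inner (poly_measure (m + 2)) (perm_op (m + 2) (inv \<sigma>) (mul_ker m G g)) f"
      unfolding contr_inner[OF G fA pg, symmetric] perm_mul_ker[OF inv] ..
    also have "\<dots> = L2_inner (poly_measure (m + 2)) (mul_ker m G g) (perm_op (m + 2) (inv (inv \<sigma>)) f)"
      by (rule L2_inner_perm_adj[OF inv2 mul_ker_in_A2(1)[OF G g] fA])
    also have "\<dots> = L2_inner (poly_measure m) g (contr m G f)"
      unfolding SymA2_degD(2)[OF f permutes_inv[OF inv2]] by (rule contr_inner[OF G fA g])
    finally show "L2_inner (poly_measure m) g (perm_op m \<sigma> (contr m G f)) = L2_inner (poly_measure m) g (contr m G f)" .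
  qed
qed

lemma contr_linear:
  assumes G: "G \<in> A2 2"
  shows "f \<in> A2 (m + 2) \<Longrightarrow> g \<in> A2 (m + 2) \<Longrightarrow> contr m G (\<lambda>x. f x + g x) = (\<lambda>x. contr m G f x + contr m G g x)"
    "f \<in> A2 (m + 2) \<Longrightarrow> contr m G (\<lambda>x. c * f x) = (\<lambda>x. c * contr m G f x)"
  using hilbert_op.adj_linear[OF hilbert_op_mul_ker[OF G], of m] unfolding linear_op_def by blast+

lemma contr_bound:
  assumes G: "G \<in> A2 2" and f: "f \<in> A2 (m + 2)"
  shows "L2_norm (poly_measure m) (contr m G f) \<le> L2_norm (poly_measure 2) G * L2_norm (poly_measure (m + 2)) f"
  by (rule hilbert_op.adj_bound[OF hilbert_op_mul_ker[OF G] f])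

lemma contr_add_kernel:
  assumes G: "G \<in> A2 2" and H: "H \<in> A2 2" and f: "f \<in> A2 (m + 2)"
  shows "contr m (\<lambda>x. G x + H x) f = (\<lambda>x. contr m G f x + contr m H f x)"
proof (rule contr_eqI[OF A2_add[OF G H] f A2_add[OF contr_in[OF G f] contr_in[OF H f]]])
  fix g assume g: "g \<in> A2 m"
  have "mul_ker m (\<lambda>x. G x + H x) g = (\<lambda>x. mul_ker m G g x + mul_ker m H g x)"
    by (auto simp: mul_ker_def fun_eq_iff algebra_simps)
  then show "L2_inner (poly_measure (m + 2)) (mul_ker m (\<lambda>x. G x + H x) g) f =
      L2_inner (poly_measure m) g (\<lambda>x. contr m G f x + contr m H f x)"
    by (simp only: L2_inner_add_left[OF A2_D(2)[OF mul_ker_in_A2(1)[OF G g]] A2_D(2)[OF mul_ker_in_A2(1)[OF H g]] A2_D(2)[OF f]]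
        L2_inner_add_right[OF A2_D(2)[OF contr_in[OF G f]] A2_D(2)[OF contr_in[OF H f]] A2_D(2)[OF g]]
        contr_inner[OF G f g] contr_inner[OF H f g])
qed

text \<open>Two contractions commute on symmetric tensors: their adjoints differ by the permutation that
  exchanges the two blocks of new variables.\<close>

lemma mul_ker_swap:
  fixes m :: nat
  assumes G: "G \<in> A2 2" and H: "H \<in> A2 2"
  defines "\<sigma> \<equiv> Transposition.transpose m (m + 2) \<circ> Transposition.transpose (m + 1) (m + 3)"
  shows "perm_op (m + 2 + 2) \<sigma> (mul_ker (m + 2) G (mul_ker m H g)) = mul_ker (m + 2) H (mul_ker m G g)"
proof
  fix z
  have \<sigma>: "\<sigma> permutes {..<m + 2 + 2}"
    unfolding \<sigma>_def by (intro permutes_compose permutes_swap_id) auto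
  have exp: "mul_ker (m + 2) G' (mul_ker m H' g) y =
      g (restrict y {..<m}) * H' (\<lambda>k. restrict y {..<m + 2} (m + k)) * G' (\<lambda>k. y (m + 2 + k))"
    if y: "y \<in> polydisc (m + 2 + 2)" for y G' H'
  proof -
    have "restrict (restrict y {..<m + 2}) {..<m} = restrict y {..<m}"
      by (auto simp: restrict_def fun_eq_iff)
    then show ?thesis
      unfolding mul_ker_def using y restrict_polydisc[OF y] by (simp only: if_True)
  qed
  show "perm_op (m + 2 + 2) \<sigma> (mul_ker (m + 2) G (mul_ker m H g)) z = mul_ker (m + 2) H (mul_ker m G g) z"
  proof (cases "z \<in> polydisc (m + 2 + 2)")
    case True
    have s: "\<sigma> i = i" if "i < m" for i using that by (simp add: \<sigma>_def Transposition.transpose_def)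
    have s': "\<sigma> m = m + 2" "\<sigma> (m + 1) = m + 3" "\<sigma> (m + 2) = m" "\<sigma> (m + 3) = m + 1"
      by (simp_all add: \<sigma>_def Transposition.transpose_def)
    have s'': "\<sigma> (m + 2 + k) = m + 2 + k" if "2 \<le> k" for k using that by (simp add: \<sigma>_def Transposition.transpose_def)
    have 1: "restrict (z \<circ> \<sigma>) {..<m} = restrict z {..<m}"
      by (auto simp: restrict_def fun_eq_iff s)
    have 2: "(\<lambda>k. restrict (z \<circ> \<sigma>) {..<m + 2} (m + k)) = (\<lambda>k. z (m + 2 + k))"
    proof
      fix k :: nat
      consider "k = 0" | "k = 1" | "2 \<le> k" by linarith
      then show "restrict (z \<circ> \<sigma>) {..<m + 2} (m + k) = z (m + 2 + k)"
      proof cases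
        case 3
        then show ?thesis using polydisc_undefined[OF True, of "m + 2 + k"] by (simp add: restrict_def)
      qed (use s' in \<open>simp_all add: restrict_def numeral_3_eq_3\<close>)
    qed
    have 3: "(\<lambda>k. (z \<circ> \<sigma>) (m + 2 + k)) = (\<lambda>k. restrict z {..<m + 2} (m + k))"
    proof
      fix k :: nat
      consider "k = 0" | "k = 1" | "2 \<le> k" by linarith
      then show "(z \<circ> \<sigma>) (m + 2 + k) = restrict z {..<m + 2} (m + k)"
      proof cases
        case 3
        then show ?thesis using polydisc_undefined[OF True, of "m + 2 + k"] s''[OF 3] by (simp add: restrict_def)
      qed (use s' in \<open>simp_all add: restrict_def numeral_3_eq_3\<close>)
    qed
    have "perm_op (m + 2 + 2) \<sigma> (mul_ker (m + 2) G (mul_ker m H g)) z = mul_ker (m + 2) G (mul_ker m H g) (z \<circ> \<sigma>)"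
      using True unfolding perm_op_def by (simp only: if_True)
    also have "\<dots> = g (restrict z {..<m}) * H (\<lambda>k. z (m + 2 + k)) * G (\<lambda>k. restrict z {..<m + 2} (m + k))"
      unfolding exp[OF polydisc_perm[OF \<sigma> True]] 1 2 3 ..
    also have "\<dots> = mul_ker (m + 2) H (mul_ker m G g) z"
      unfolding exp[OF True] by (simp only: mult_ac)
    finally show ?thesis .
  next
    case False
    then show ?thesis unfolding perm_op_def mul_ker_def by (simp only: if_False)
  qed
qed

lemma contr_commute:
  assumes G: "G \<in> A2 2" and H: "H \<in> A2 2" and f: "f \<in> SymA2_deg (m + 2 + 2)"
  shows "contr m H (contr (m + 2) G f) = contr m G (contr (m + 2) H f)"
proof -
  define \<sigma> where "\<sigma> = Transposition.transpose m (m + 2) \<circ> Transposition.transpose (m + 1) (m + 3)"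
  have \<sigma>: "\<sigma> permutes {..<m + 2 + 2}"
    unfolding \<sigma>_def by (intro permutes_compose permutes_swap_id) auto
  note fA = SymA2_degD(1)[OF f]
  note cG = contr_in[OF G fA] and cH = contr_in[OF H fA]
  show ?thesis
  proof (rule contr_eqI[OF H cG contr_in[OF G cH]])
    fix g assume g: "g \<in> A2 m"
    note mG = mul_ker_in_A2(1)[OF G g] and mH = mul_ker_in_A2(1)[OF H g]
    have "L2_inner (poly_measure (m + 2)) (mul_ker m H g) (contr (m + 2) G f) =
        L2_inner (poly_measure (m + 2 + 2)) (mul_ker (m + 2) G (mul_ker m H g)) f"
      by (rule contr_inner[OF G fA mH, symmetric])
    also have "\<dots> = L2_inner (poly_measure (m + 2 + 2)) (mul_ker (m + 2) G (mul_ker m H g)) (perm_op (m + 2 + 2) (inv \<sigma>) f)"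
      unfolding SymA2_degD(2)[OF f permutes_inv[OF \<sigma>]] ..
    also have "\<dots> = L2_inner (poly_measure (m + 2 + 2)) (mul_ker (m + 2) H (mul_ker m G g)) f"
      unfolding L2_inner_perm_adj[OF \<sigma> mul_ker_in_A2(1)[OF G mH] fA, symmetric]
        mul_ker_swap[OF G H, of m g, folded \<sigma>_def] ..
    also have "\<dots> = L2_inner (poly_measure m) g (contr m G (contr (m + 2) H f))"
      unfolding contr_inner[OF H fA mG] by (rule contr_inner[OF G cH g])
    finally show "L2_inner (poly_measure (m + 2)) (mul_ker m H g) (contr (m + 2) G f) =
        L2_inner (poly_measure m) g (contr m G (contr (m + 2) H f))" .
  qed
qed

section \<open>Contractions and composition operators\<close>

lemma poly_T_mul_ker:
  assumes \<psi>: "\<psi> \<in> CE_emb"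
  shows "poly_T (m + 2) \<psi> (mul_ker m G g) = mul_ker m (poly_T 2 \<psi> G) (poly_T m \<psi> g)"
proof
  fix z
  show "poly_T (m + 2) \<psi> (mul_ker m G g) z = mul_ker m (poly_T 2 \<psi> G) (poly_T m \<psi> g) z"
  proof (cases "z \<in> polydisc (m + 2)")
    case True
    note r = restrict_polydisc[OF True] and s = shift_polydisc[OF True]
      and pm = poly_map_polydisc[OF CE_embD(3)[OF \<psi>] True]
    have 1: "restrict (poly_map (m + 2) \<psi> z) {..<m} = poly_map m \<psi> (restrict z {..<m})"
      by (auto simp: poly_map_def restrict_def fun_eq_iff)
    have 2: "(\<lambda>k. poly_map (m + 2) \<psi> z (m + k)) = poly_map 2 \<psi> (\<lambda>k. z (m + k))"
      by (auto simp: poly_map_def restrict_def fun_eq_iff)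
    have 3: "(\<Prod>i<m + 2. deriv \<psi> (z i)) = (\<Prod>i<m. deriv \<psi> (restrict z {..<m} i)) * (\<Prod>k<2. deriv \<psi> (z (m + k)))"
      unfolding prod_lessThan_add by simp
    show ?thesis
      unfolding poly_T_def mul_ker_def 1 2 using True r s pm
      by (simp only: if_True 3 mult_ac)
  next
    case False
    then show ?thesis unfolding poly_T_def mul_ker_def by (simp only: if_False)
  qed
qed

lemma poly_T_perm:
  assumes \<psi>: "\<psi> \<in> CE_emb" and \<sigma>: "\<sigma> permutes {..<p}"
  shows "poly_T p \<psi> (perm_op p \<sigma> g) = perm_op p \<sigma> (poly_T p \<psi> g)"
proof
  fix z
  show "poly_T p \<psi> (perm_op p \<sigma> g) z = perm_op p \<sigma> (poly_T p \<psi> g) z"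
  proof (cases "z \<in> polydisc p")
    case True
    have 1: "poly_map p \<psi> z \<circ> \<sigma> = poly_map p \<psi> (z \<circ> \<sigma>)"
    proof
      fix i
      show "(poly_map p \<psi> z \<circ> \<sigma>) i = poly_map p \<psi> (z \<circ> \<sigma>) i"
        using permutes_in_image[OF \<sigma>, of i] by (simp add: poly_map_def restrict_def)
    qed
    have 2: "(\<Prod>i<p. deriv \<psi> ((z \<circ> \<sigma>) i)) = (\<Prod>i<p. deriv \<psi> (z i))"
      using prod.permute[OF \<sigma>, of "\<lambda>i. deriv \<psi> (z i)"] unfolding o_def by (rule sym)
    show ?thesis
      unfolding poly_T_def perm_op_def using True polydisc_perm[OF \<sigma> True]
        poly_map_polydisc[OF CE_embD(3)[OF \<psi>] True] by (simp only: if_True 1 2)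
  next
    case False
    then show ?thesis unfolding poly_T_def perm_op_def by (simp only: if_False)
  qed
qed

lemma poly_T_adj_in: "\<psi> \<in> CE_emb \<Longrightarrow> f \<in> A2 p \<Longrightarrow> poly_T_adj p \<psi> f \<in> A2 p"
  by (rule hilbert_op.adj_in[OF hilbert_op_poly_T])

lemma poly_T_adj_inner:
  "\<psi> \<in> CE_emb \<Longrightarrow> f \<in> A2 p \<Longrightarrow> g \<in> A2 p \<Longrightarrow>
    L2_inner (poly_measure p) (poly_T p \<psi> g) f = L2_inner (poly_measure p) g (poly_T_adj p \<psi> f)"
  by (rule hilbert_op.adj_inner[OF hilbert_op_poly_T])

lemma poly_T_adj_linear:
  assumes \<psi>: "\<psi> \<in> CE_emb"
  shows "f \<in> A2 p \<Longrightarrow> g \<in> A2 p \<Longrightarrow> poly_T_adj p \<psi> (\<lambda>x. f x + g x) = (\<lambda>x. poly_T_adj p \<psi> f x + poly_T_adj p \<psi> g x)"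
    "f \<in> A2 p \<Longrightarrow> poly_T_adj p \<psi> (\<lambda>x. c * f x) = (\<lambda>x. c * poly_T_adj p \<psi> f x)"
  using hilbert_op.adj_linear[OF hilbert_op_poly_T[OF \<psi>], of p] unfolding linear_op_def by blast+

lemma poly_T_adj_sym:
  assumes \<psi>: "\<psi> \<in> CE_emb" and f: "f \<in> SymA2_deg p"
  shows "poly_T_adj p \<psi> f \<in> SymA2_deg p"
  unfolding SymA2_deg_iff
proof (intro conjI allI impI)
  note fA = SymA2_degD(1)[OF f]
  show tA: "poly_T_adj p \<psi> f \<in> A2 p" by (rule poly_T_adj_in[OF \<psi> fA])
  fix \<sigma> assume \<sigma>: "\<sigma> permutes {..<p}"
  have inv: "inv \<sigma> permutes {..<p}" by (rule permutes_inv[OF \<sigma>])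
  show "perm_op p \<sigma> (poly_T_adj p \<psi> f) = poly_T_adj p \<psi> f"
  proof (rule A2.eqI_inner[OF perm_op_in_A2[OF \<sigma> tA] tA])
    fix g assume g: "g \<in> A2 p"
    have pg: "perm_op p (inv \<sigma>) g \<in> A2 p" by (rule perm_op_in_A2[OF inv g])
    have "L2_inner (poly_measure p) g (perm_op p \<sigma> (poly_T_adj p \<psi> f)) =
        L2_inner (poly_measure p) (perm_op p (inv \<sigma>) g) (poly_T_adj p \<psi> f)"
      using L2_inner_perm_adj[OF inv g tA] unfolding permutes_inv_inv[OF \<sigma>] by (rule sym)
    also have "\<dots> = L2_inner (poly_measure p) (perm_op p (inv \<sigma>) (poly_T p \<psi> g)) f"
      unfolding poly_T_adj_inner[OF \<psi> fA pg, symmetric] poly_T_perm[OF \<psi> inv] ..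
    also have "\<dots> = L2_inner (poly_measure p) (poly_T p \<psi> g) (perm_op p (inv (inv \<sigma>)) f)"
      by (rule L2_inner_perm_adj[OF inv poly_T_in_A2[OF \<psi> g] fA])
    also have "\<dots> = L2_inner (poly_measure p) g (poly_T_adj p \<psi> f)"
      unfolding SymA2_degD(2)[OF f permutes_inv[OF inv]] by (rule poly_T_adj_inner[OF \<psi> fA g])
    finally show "L2_inner (poly_measure p) g (perm_op p \<sigma> (poly_T_adj p \<psi> f)) = L2_inner (poly_measure p) g (poly_T_adj p \<psi> f)" .
  qed
qed

text \<open>The adjoint form of \<open>poly_T_mul_ker\<close>.\<close>

lemma contr_poly_T_adj:
  assumes \<psi>: "\<psi> \<in> CE_emb" and G: "G \<in> A2 2" and f: "f \<in> A2 (m + 2)"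
  shows "contr m G (poly_T_adj (m + 2) \<psi> f) = poly_T_adj m \<psi> (contr m (poly_T 2 \<psi> G) f)"
proof (rule contr_eqI[OF G poly_T_adj_in[OF \<psi> f]])
  note TG = poly_T_in_A2[OF \<psi> G]
  note cf = contr_in[OF TG f]
  show "poly_T_adj m \<psi> (contr m (poly_T 2 \<psi> G) f) \<in> A2 m" by (rule poly_T_adj_in[OF \<psi> cf])
  fix g assume g: "g \<in> A2 m"
  have "L2_inner (poly_measure (m + 2)) (mul_ker m G g) (poly_T_adj (m + 2) \<psi> f) =
      L2_inner (poly_measure (m + 2)) (poly_T (m + 2) \<psi> (mul_ker m G g)) f"
    by (rule poly_T_adj_inner[OF \<psi> f mul_ker_in_A2(1)[OF G g], symmetric])
  also have "\<dots> = L2_inner (poly_measure m) (poly_T m \<psi> g) (contr m (poly_T 2 \<psi> G) f)"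
    unfolding poly_T_mul_ker[OF \<psi>] by (rule contr_inner[OF TG f poly_T_in_A2[OF \<psi> g]])
  also have "\<dots> = L2_inner (poly_measure m) g (poly_T_adj m \<psi> (contr m (poly_T 2 \<psi> G) f))"
    by (rule poly_T_adj_inner[OF \<psi> cf g])
  finally show "L2_inner (poly_measure (m + 2)) (mul_ker m G g) (poly_T_adj (m + 2) \<psi> f) =
      L2_inner (poly_measure m) g (poly_T_adj m \<psi> (contr m (poly_T 2 \<psi> G) f))" .
qed

section \<open>The contraction on elementary tensors\<close>

text \<open>The positions below \<open>n\<close>, with \<open>i\<close> and \<open>j\<close> moved to the end and the others in their order.\<close>

definition pair_list :: "nat \<Rightarrow> nat \<Rightarrow> nat \<Rightarrow> nat list" where
  "pair_list n i j = nths [0..<n] (- {i, j}) @ [i, j]"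

definition pair_perm :: "nat \<Rightarrow> nat \<Rightarrow> nat \<Rightarrow> nat \<Rightarrow> nat" where
  "pair_perm n i j k = (if k < n then pair_list n i j ! k else k)"

lemma pair_list:
  assumes "i < j" "j < n"
  shows "distinct (pair_list n i j)" "set (pair_list n i j) = {..<n}" "length (pair_list n i j) = n"
proof -
  have s: "set (nths [0..<n] (- {i, j})) = {..<n} - {i, j}"
  proof
    show "set (nths [0..<n] (- {i, j})) \<subseteq> {..<n} - {i, j}" by (auto simp: set_nths)
    show "{..<n} - {i, j} \<subseteq> set (nths [0..<n] (- {i, j}))"
    proof
      fix x assume "x \<in> {..<n} - {i, j}"
      then show "x \<in> set (nths [0..<n] (- {i, j}))"
        unfolding set_nths by (intro CollectI exI[of _ x]) auto
    qed
  qed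
  show d: "distinct (pair_list n i j)"
    unfolding pair_list_def distinct_append s using assms by (simp add: distinct_nthsI)
  show st: "set (pair_list n i j) = {..<n}"
    unfolding pair_list_def set_append s using assms by auto
  show "length (pair_list n i j) = n"
    using distinct_card[OF d] st by simp
qed

lemma pair_perm_permutes:
  assumes "i < j" "j < n"
  shows "pair_perm n i j permutes {..<n}"
proof (rule bij_imp_permutes)
  have "bij_betw ((!) (pair_list n i j)) {..<n} {..<n}"
    by (rule bij_betw_nth[OF pair_list(1)[OF assms]]) (simp_all only: pair_list(2,3)[OF assms])
  moreover have "bij_betw (pair_perm n i j) {..<n} {..<n} \<longleftrightarrow> bij_betw ((!) (pair_list n i j)) {..<n} {..<n}"
    by (rule bij_betw_cong) (simp add: pair_perm_def)
  ultimately show "bij_betw (pair_perm n i j) {..<n} {..<n}" by (rule iffD2[rotated])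
qed (simp add: pair_perm_def)

lemma pair_perm_map:
  assumes "i < j" "j < n" "length as = n"
  shows "map (\<lambda>k. as ! pair_perm n i j k) [0..<n] = nths as (- {i, j}) @ [as ! i, as ! j]"
proof -
  have "map (\<lambda>k. as ! pair_perm n i j k) [0..<n] = map ((!) as) (map ((!) (pair_list n i j)) [0..<n])"
    by (simp add: pair_perm_def)
  also have "map ((!) (pair_list n i j)) [0..<n] = pair_list n i j"
    using map_nth[of "pair_list n i j"] pair_list(3)[OF assms(1,2)] by simp
  also have "map ((!) as) (pair_list n i j) = nths (map ((!) as) [0..<n]) (- {i, j}) @ [as ! i, as ! j]"
    by (simp add: pair_list_def nths_map)
  also have "map ((!) as) [0..<n] = as"
    using map_nth[of as] assms(3) by simp
  finally show ?thesis .
qed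

lemma perm_op_tens:
  assumes \<sigma>: "\<sigma> permutes {..<p}" and as: "length as = p"
  shows "perm_op p (inv \<sigma>) (tens as) = tens (map (\<lambda>k. as ! \<sigma> k) [0..<p])"
proof
  fix z
  show "perm_op p (inv \<sigma>) (tens as) z = tens (map (\<lambda>k. as ! \<sigma> k) [0..<p]) z"
  proof (cases "z \<in> polydisc p")
    case True
    have "perm_op p (inv \<sigma>) (tens as) z = (\<Prod>i<p. (as ! i) (z (inv \<sigma> i)))"
      unfolding perm_op_def tens_def as using True polydisc_perm[OF permutes_inv[OF \<sigma>] True]
      by (simp only: if_True o_apply)
    also have "\<dots> = (\<Prod>k<p. (as ! \<sigma> k) (z k))"
      using prod.permute[OF \<sigma>, of "\<lambda>i. (as ! i) (z (inv \<sigma> i))"]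
      unfolding o_def permutes_inverses(2)[OF \<sigma>] .
    also have "\<dots> = tens (map (\<lambda>k. as ! \<sigma> k) [0..<p]) z"
      using True by (simp add: tens_def)
    finally show ?thesis .
  next
    case False
    then show ?thesis by (simp add: perm_op_def tens_def)
  qed
qed

lemma perm_contr_tens:
  assumes G: "G \<in> A2 2" and ij: "i < j" "j < m + 2" and as: "length as = m + 2" "set as \<subseteq> A2_disc"
  shows "perm_contr m G (pair_perm (m + 2) i j) (tens as) =
    (\<lambda>z. L2_inner (poly_measure 2) (tens [as ! i, as ! j]) G * tens (nths as (- {i, j})) z)"
proof (rule hilbert_op.adj_eqI[OF hilbert_op_perm_mul[OF pair_perm_permutes[OF ij] G] tens_in_A2[OF as(2,1)]])
  let ?\<sigma> = "pair_perm (m + 2) i j" and ?bs = "nths as (- {i, j})"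
  let ?c = "L2_inner (poly_measure 2) (tens [as ! i, as ! j]) G"
  note \<sigma> = pair_perm_permutes[OF ij]
  have bs: "length ?bs = m" "set ?bs \<subseteq> A2_disc"
  proof -
    have "length (map (\<lambda>k. as ! ?\<sigma> k) [0..<m + 2]) = m + 2" by simp
    then show "length ?bs = m" unfolding pair_perm_map[OF ij as(1)] by simp
    show "set ?bs \<subseteq> A2_disc" using as(2) set_nths_subset by (rule subset_trans[rotated])
  qed
  have "as ! i \<in> set as" "as ! j \<in> set as" using ij as(1) by (auto intro!: nth_mem)
  then have ab: "as ! i \<in> A2_disc" "as ! j \<in> A2_disc" using as(2) by blast+
  show "(\<lambda>z. ?c * tens ?bs z) \<in> A2 m" by (rule A2_scale[OF tens_in_A2[OF bs(2,1)]])
  fix g assume g: "g \<in> A2 m"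
  have "L2_inner (poly_measure (m + 2)) (perm_op (m + 2) ?\<sigma> (mul_ker m G g)) (tens as) =
      L2_inner (poly_measure (m + 2)) (mul_ker m G g) (tens (?bs @ [as ! i, as ! j]))"
    unfolding L2_inner_perm_adj[OF \<sigma> mul_ker_in_A2(1)[OF G g] tens_in_A2[OF as(2,1)]]
      perm_op_tens[OF \<sigma> as(1)] pair_perm_map[OF ij as(1)] ..
  also have "\<dots> = cnj (L2_inner (poly_measure m) (tens ?bs) g * ?c)"
    unfolding L2_inner_cnj[of _ "mul_ker m G g"] L2_inner_tens_mul_ker[OF bs ab G g] ..
  also have "\<dots> = L2_inner (poly_measure m) g (\<lambda>z. ?c * tens ?bs z)"
    unfolding L2_inner_scale_right L2_inner_cnj[of _ g] by (simp only: complex_cnj_mult mult.commute)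
  finally show "L2_inner (poly_measure (m + 2)) (perm_op (m + 2) ?\<sigma> (mul_ker m G g)) (tens as) =
      L2_inner (poly_measure m) g (\<lambda>z. ?c * tens ?bs z)" .
qed

definition pairs :: "nat \<Rightarrow> (nat \<times> nat) set" where
  "pairs n = {(i, j). i < j \<and> j < n}"

lemma finite_pairs: "finite (pairs n)"
  unfolding pairs_def by (rule finite_subset[of _ "{..<n} \<times> {..<n}"]) auto

lemma bounded_A2_sum:
  assumes "finite I" "\<And>i. i \<in> I \<Longrightarrow> bounded_A2 n m (B i)"
  shows "bounded_A2 n m (\<lambda>f z. \<Sum>i\<in>I. B i f z)"
  using assms
proof (induction I)
  case empty
  show ?case
    unfolding bounded_op_def linear_op_def by (auto simp: A2_zero intro!: exI[of _ 0])
next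
  case (insert i I)
  have B: "bounded_A2 n m (B i)" and S: "bounded_A2 n m (\<lambda>f z. \<Sum>i\<in>I. B i f z)" (is "bounded_A2 n m ?S")
    using insert by auto
  obtain C C' where C: "\<And>f. f \<in> A2 n \<Longrightarrow> L2_norm (poly_measure m) (B i f) \<le> C * L2_norm (poly_measure n) f"
    and C': "\<And>f. f \<in> A2 n \<Longrightarrow> L2_norm (poly_measure m) (?S f) \<le> C' * L2_norm (poly_measure n) f"
    using B S unfolding bounded_op_def by blast
  note L = bounded_opD[OF B] and L' = bounded_opD[OF S]
  have eq: "(\<lambda>f z. \<Sum>i\<in>insert i I. B i f z) = (\<lambda>f z. B i f z + ?S f z)"
    using insert by simp
  have "linear_op (A2 n) (A2 m) (\<lambda>f z. B i f z + ?S f z)"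
    unfolding linear_op_def
  proof (intro conjI ballI allI)
    show "(\<lambda>f z. B i f z + ?S f z) \<in> A2 n \<rightarrow> A2 m"
      by (intro Pi_I A2_add L(1) L'(1))
    show "(\<lambda>z. B i (\<lambda>x. f x + g x) z + ?S (\<lambda>x. f x + g x) z) = (\<lambda>y. (B i f y + ?S f y) + (B i g y + ?S g y))"
      if "f \<in> A2 n" "g \<in> A2 n" for f g
    proof
      fix y
      have "(\<Sum>i\<in>I. B i (\<lambda>x. f x + g x) y) = ?S f y + ?S g y"
        using fun_cong[OF L'(2)[OF that], of y] .
      then show "B i (\<lambda>x. f x + g x) y + ?S (\<lambda>x. f x + g x) y = (B i f y + ?S f y) + (B i g y + ?S g y)"
        unfolding L(2)[OF that] by (simp only: add_ac)
    qed
    show "(\<lambda>z. B i (\<lambda>x. c * f x) z + ?S (\<lambda>x. c * f x) z) = (\<lambda>y. c * (B i f y + ?S f y))" if "f \<in> A2 n" for f c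
    proof
      fix y
      have "(\<Sum>i\<in>I. B i (\<lambda>x. c * f x) y) = c * ?S f y"
        using fun_cong[OF L'(3)[OF that], of c y] .
      then show "B i (\<lambda>x. c * f x) y + ?S (\<lambda>x. c * f x) y = c * (B i f y + ?S f y)"
        unfolding L(3)[OF that] by (simp only: distrib_left)
    qed
  qed
  moreover have "L2_norm (poly_measure m) (\<lambda>z. B i f z + ?S f z) \<le> (C + C') * L2_norm (poly_measure n) f"
    if f: "f \<in> A2 n" for f
    using L2_norm_triangle[OF A2_D(2)[OF L(1)[OF f]] A2_D(2)[OF L'(1)[OF f]]] C[OF f] C'[OF f]
    by (simp add: distrib_right)
  ultimately show ?case unfolding eq bounded_op_def by blast
qed

text \<open>Each summand in the definition of the contraction is bounded, being the adjoint of tensoring with \<open>G\<close>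
  followed by a permutation; so the sum is the operator singled out by the values on elementary tensors.\<close>

lemma partial_deg_eq:
  assumes G: "G \<in> A2 2"
    and ae: "AE z in poly_measure 2. G z = cnj (F_kernel \<phi> (cnj (z 0)) (cnj (z 1)))"
    and F: "(\<lambda>z. F_kernel \<phi> (cnj (z 0)) (cnj (z 1))) \<in> borel_measurable (poly_measure 2)"
    and f: "f \<in> A2 (m + 2)"
  shows "partial_deg m \<phi> f = (\<lambda>z. \<Sum>(i, j)\<in>pairs (m + 2). perm_contr m G (pair_perm (m + 2) i j) f z)"
  unfolding partial_deg_def
proof (rule tensor_extension_eq[OF _ _ f])
  show "bounded_A2 (m + 2) m (\<lambda>f z. \<Sum>(i, j)\<in>pairs (m + 2). perm_contr m G (pair_perm (m + 2) i j) f z)"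
    unfolding split_beta'
  proof (rule bounded_A2_sum[OF finite_pairs])
    fix x assume x: "x \<in> pairs (m + 2)"
    then have ij: "fst x < snd x" "snd x < m + 2" by (auto simp: pairs_def)
    show "bounded_A2 (m + 2) m (perm_contr m G (pair_perm (m + 2) (fst x) (snd x)))"
      unfolding bounded_op_def
      using hilbert_op.adj_linear[OF hilbert_op_perm_mul[OF pair_perm_permutes[OF ij] G]]
        hilbert_op.adj_bound[OF hilbert_op_perm_mul[OF pair_perm_permutes[OF ij] G]] by blast
  qed
  fix as assume as: "length as = m + 2" "set as \<subseteq> A2_disc"
  have pp: "partial_pair \<phi> P = L2_inner (poly_measure 2) P G" if "P \<in> A2 2" for P
    unfolding partial_pair_def L2_inner_def
  proof (rule integral_cong_AE)
    have Pm: "P \<in> borel_measurable (poly_measure 2)" by (rule square_integrable_measurable[OF A2_D(2)[OF that]])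
    show "(\<lambda>z. F_kernel \<phi> (cnj (z 0)) (cnj (z 1)) * P z) \<in> borel_measurable (poly_measure 2)"
      by (rule borel_measurable_times[OF F Pm])
    show "(\<lambda>z. P z * cnj (G z)) \<in> borel_measurable (poly_measure 2)"
      by (rule borel_measurable_times[OF Pm cnj_measurable[OF square_integrable_measurable[OF A2_D(2)[OF G]]]])
    show "AE z in poly_measure 2. F_kernel \<phi> (cnj (z 0)) (cnj (z 1)) * P z = P z * cnj (G z)"
      using ae by eventually_elim simp
  qed
  show "(\<lambda>z. \<Sum>(i, j)\<in>pairs (m + 2). perm_contr m G (pair_perm (m + 2) i j) (tens as) z) =
    (\<lambda>z. \<Sum>(i, j) | i < j \<and> j < length as. partial_pair \<phi> (tens [as ! i, as ! j]) * tens (nths as (- {i, j})) z)"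
    unfolding as(1) pairs_def
  proof (rule ext, rule sum.cong[OF refl], clarify)
    fix z i j assume ij: "i < j" "j < m + 2"
    then have "as ! i \<in> set as" "as ! j \<in> set as" using as(1) by (auto intro!: nth_mem)
    then have t: "tens [as ! i, as ! j] \<in> A2 2" using as(2) by (intro tens_in_A2) auto
    show "perm_contr m G (pair_perm (m + 2) i j) (tens as) z =
        partial_pair \<phi> (tens [as ! i, as ! j]) * tens (nths as (- {i, j})) z"
      unfolding perm_contr_tens[OF G ij as] pp[OF t] ..
  qed
qed

lemma partial_deg_sym:
  assumes G: "G \<in> A2 2"
    and ae: "AE z in poly_measure 2. G z = cnj (F_kernel \<phi> (cnj (z 0)) (cnj (z 1)))"
    and F: "(\<lambda>z. F_kernel \<phi> (cnj (z 0)) (cnj (z 1))) \<in> borel_measurable (poly_measure 2)"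
    and f: "f \<in> SymA2_deg (m + 2)"
  shows "partial_deg m \<phi> f = (\<lambda>z. of_nat (card (pairs (m + 2))) * contr m G f z)"
proof -
  have "(\<lambda>z. \<Sum>(i, j)\<in>pairs (m + 2). perm_contr m G (pair_perm (m + 2) i j) f z) =
      (\<lambda>z. \<Sum>x\<in>pairs (m + 2). contr m G f z)"
    unfolding pairs_def
  proof (rule ext, rule sum.cong[OF refl], clarify)
    fix z i j assume ij: "i < j" "j < m + 2"
    show "perm_contr m G (pair_perm (m + 2) i j) f z = contr m G f z"
      unfolding perm_contr_sym[OF pair_perm_permutes[OF ij] G f] ..
  qed
  then show ?thesis
    unfolding partial_deg_eq[OF G ae F SymA2_degD(1)[OF f]] by simp
qed

section \<open>The kernel across the diagonal\<close>

lemma F_kernel_commute: "F_kernel \<phi> z w = F_kernel \<phi> w z"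
  unfolding F_kernel_def by (simp add: power2_commute mult.commute)

lemma F_kernel_diag [simp]: "F_kernel \<phi> z z = 0"
  by (simp add: F_kernel_def)

lemma CE_emb_deriv_nonzero:
  assumes \<phi>: "\<phi> \<in> CE_emb" and z: "z \<in> disc"
  shows "deriv \<phi> z \<noteq> 0"
  by (rule holomorphic_injective_imp_regular[OF CE_embD(1)[OF \<phi>] open_ball CE_embD(2)[OF \<phi>] z])

text \<open>Write \<open>q\<close> for the difference quotient of \<open>\<phi>\<close> at \<open>z\<close>.  The numerator
  \<open>\<phi>'(z) \<phi>'(w) - q(w)\<^sup>2\<close> of the kernel vanishes to second order at \<open>w = z\<close>, which shows by dividing
  out \<open>w - z\<close> twice.\<close>

lemma F_kernel_extension:
  assumes \<phi>: "\<phi> \<in> CE_emb" and z: "z \<in> disc"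
  shows "\<exists>h. h holomorphic_on disc \<and> (\<forall>w\<in>disc. w \<noteq> z \<longrightarrow> h w = F_kernel \<phi> z w)"
proof -
  note D = CE_embD[OF \<phi>]
  define q where "q w = (if w = z then deriv \<phi> z else (\<phi> w - \<phi> z) / (w - z))" for w
  have q: "q holomorphic_on disc"
    unfolding q_def[abs_def] by (rule pole_lemma_open[OF D(1) open_ball])
  have qz: "q z = deriv \<phi> z" by (simp add: q_def)
  have q0: "q w \<noteq> 0" if w: "w \<in> disc" for w
  proof (cases "w = z")
    case True
    then show ?thesis using CE_emb_deriv_nonzero[OF \<phi> z] qz by simp
  next
    case False
    then have "\<phi> w \<noteq> \<phi> z" using inj_onD[OF D(2) _ w z] by blast
    then show ?thesis using False by (simp add: q_def)
  qed
  have \<phi>q: "\<phi> w = \<phi> z + (w - z) * q w" for w by (simp add: q_def)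
  have dq: "(q has_field_derivative deriv q w) (at w)" if "w \<in> disc" for w
    by (rule holomorphic_derivI[OF q open_ball that])
  have d\<phi>: "deriv \<phi> w = q w + (w - z) * deriv q w" if w: "w \<in> disc" for w
  proof -
    have "((\<lambda>w. w - z) has_field_derivative 1) (at w)"
      using DERIV_diff[OF DERIV_ident DERIV_const, of z] by simp
    from DERIV_add[OF DERIV_const DERIV_mult[OF this dq[OF w]], of "\<phi> z"]
    have "((\<lambda>w. \<phi> z + (w - z) * q w) has_field_derivative q w + (w - z) * deriv q w) (at w)"
      by (simp add: algebra_simps)
    then have "(\<phi> has_field_derivative q w + (w - z) * deriv q w) (at w)"
      unfolding \<phi>q[symmetric] .
    then show ?thesis by (rule DERIV_imp_deriv)
  qed
  define r where "r w = (if w = z then deriv q z else (q w - q z) / (w - z))" for w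
  have r: "r holomorphic_on disc"
    unfolding r_def[abs_def] by (rule pole_lemma_open[OF q open_ball])
  have rq: "q w - q z = (w - z) * r w" for w by (simp add: r_def)
  \<comment> \<open>Up to the first factor \<open>w - z\<close>, this is the numerator; it vanishes at \<open>z\<close> once more.\<close>
  define n where "n w = q z * deriv q w - q w * r w" for w
  have n: "n holomorphic_on disc"
    unfolding n_def[abs_def] by (intro holomorphic_intros q r holomorphic_deriv) auto
  have nz: "n z = 0" by (simp add: n_def r_def)
  define s where "s w = (if w = z then deriv n z else (n w - n z) / (w - z))" for w
  have s: "s holomorphic_on disc"
    unfolding s_def[abs_def] by (rule pole_lemma_open[OF n open_ball])
  have num: "deriv \<phi> z * deriv \<phi> w - (q w)\<^sup>2 = (w - z)\<^sup>2 * s w" if w: "w \<in> disc" "w \<noteq> z" for w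
  proof -
    have "deriv \<phi> z * deriv \<phi> w - (q w)\<^sup>2 = q w * (q z - q w) + (w - z) * (q z * deriv q w)"
      unfolding d\<phi>[OF w(1)] qz[symmetric] by (simp add: algebra_simps power2_eq_square)
    also have "q z - q w = - ((w - z) * r w)" unfolding rq[symmetric] by simp
    also have "q w * - ((w - z) * r w) + (w - z) * (q z * deriv q w) = (w - z) * n w"
      by (simp add: n_def algebra_simps)
    also have "n w = (w - z) * s w" using w(2) by (simp add: s_def nz)
    finally show ?thesis by (simp add: power2_eq_square mult.assoc)
  qed
  have "(\<lambda>w. s w / (q w)\<^sup>2) holomorphic_on disc"
    by (intro holomorphic_intros s q) (use q0 in auto)
  moreover have "s w / (q w)\<^sup>2 = F_kernel \<phi> z w" if w: "w \<in> disc" "w \<noteq> z" for w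
  proof -
    have a: "(w - z)\<^sup>2 \<noteq> 0" using w by simp
    have b: "(q w)\<^sup>2 \<noteq> 0" using q0[OF w(1)] by simp
    have "(\<phi> z - \<phi> w)\<^sup>2 = (w - z)\<^sup>2 * (q w)\<^sup>2"
      using \<phi>q[of w] by (simp add: power_mult_distrib[symmetric] power2_commute)
    moreover have "(z - w)\<^sup>2 = (w - z)\<^sup>2" by (rule power2_commute)
    ultimately have "F_kernel \<phi> z w = deriv \<phi> z * deriv \<phi> w / ((w - z)\<^sup>2 * (q w)\<^sup>2) - 1 / (w - z)\<^sup>2"
      unfolding F_kernel_def by simp
    also have "\<dots> = (deriv \<phi> z * deriv \<phi> w - (q w)\<^sup>2) / ((w - z)\<^sup>2 * (q w)\<^sup>2)"
      using a b by (simp add: diff_divide_distrib)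
    also have "\<dots> = s w / (q w)\<^sup>2" unfolding num[OF w] using a by simp
    finally show ?thesis ..
  qed
  ultimately show ?thesis by blast
qed

text \<open>The removable singularity is removed in the second variable with the first one fixed.  Symmetry of
  the result (\<open>F_ext_commute\<close>) makes it holomorphic in the first variable too.\<close>

definition F_ext :: "(complex \<Rightarrow> complex) \<Rightarrow> complex \<Rightarrow> complex \<Rightarrow> complex" where
  "F_ext \<phi> z = (SOME h. h holomorphic_on disc \<and> (\<forall>w\<in>disc. w \<noteq> z \<longrightarrow> h w = F_kernel \<phi> z w))"

lemma F_ext:
  assumes "\<phi> \<in> CE_emb" "z \<in> disc"
  shows "F_ext \<phi> z holomorphic_on disc" "w \<in> disc \<Longrightarrow> w \<noteq> z \<Longrightarrow> F_ext \<phi> z w = F_kernel \<phi> z w"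
  using someI_ex[OF F_kernel_extension[OF assms]] unfolding F_ext_def by blast+

lemma F_ext_commute:
  assumes "\<phi> \<in> CE_emb" "z \<in> disc" "w \<in> disc"
  shows "F_ext \<phi> z w = F_ext \<phi> w z"
  using F_ext(2)[OF assms(1,2), of w] F_ext(2)[OF assms(1,3), of z] assms F_kernel_commute[of \<phi> z w]
  by (cases "z = w") auto

text \<open>Joint continuity at the diagonal: on a circle \<open>\<bar>\<zeta>\<bar> = r\<close> that encloses both arguments the kernel has
  no singularity, and Cauchy's formula recovers the extension from its values there.\<close>

lemma continuous_F_ext_ball:
  assumes \<phi>: "\<phi> \<in> CE_emb" and r: "0 < r" "r < 1"
  shows "continuous_on (ball 0 r \<times> ball 0 r) (\<lambda>(z, w). F_ext \<phi> z w)"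
proof -
  note D = CE_embD[OF \<phi>]
  let ?c = "circlepath 0 r"
  have path: "cmod (?c t) = r" for t
    using r by (simp add: circlepath_def part_circlepath_def norm_mult)
  have cd: "?c t \<in> disc" for t using path[of t] r by simp
  let ?v = "\<lambda>t. 2 * pi * \<i> * r * exp (2 * of_real pi * \<i> * of_real t)"
  let ?I = "\<lambda>p t. F_kernel \<phi> (fst p) (?c t) / (?c t - snd p) * ?v t"
  have pc: "continuous_on S ?c" for S :: "real set"
    unfolding circlepath_def part_circlepath_def by (intro continuous_intros)
  have cont: "continuous_on ((ball 0 r \<times> ball 0 r) \<times> cbox 0 1) (\<lambda>(p, t). ?I p t)"
  proof -
    let ?S = "(ball 0 r \<times> ball 0 r) \<times> cbox 0 (1::real) :: ((complex \<times> complex) \<times> real) set"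
    have c: "continuous_on ?S (\<lambda>x. ?c (snd x))"
      by (rule continuous_on_compose2[OF pc[of UNIV] continuous_on_snd[OF continuous_on_id]]) simp
    have z: "continuous_on ?S (\<lambda>x. fst (fst x))" and w: "continuous_on ?S (\<lambda>x. snd (fst x))"
      by (intro continuous_intros)+
    have zd: "fst (fst x) \<in> disc" if "x \<in> ?S" for x using that r by (auto simp: mem_Times_iff)
    have ne1: "fst (fst x) \<noteq> ?c (snd x)" if "x \<in> ?S" for x
    proof
      assume "fst (fst x) = ?c (snd x)"
      then have "cmod (fst (fst x)) = r" by (simp only: path)
      then show False using that by (simp add: mem_Times_iff)
    qed
    have ne2: "?c (snd x) - snd (fst x) \<noteq> 0" if "x \<in> ?S" for x
    proof
      assume "?c (snd x) - snd (fst x) = 0"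
      then have "?c (snd x) = snd (fst x)" by (rule iffD1[OF right_minus_eq])
      from arg_cong[OF this, of cmod] have "cmod (snd (fst x)) = r" unfolding path by (rule sym)
      then show False using that by (simp add: mem_Times_iff)
    qed
    have f1: "continuous_on ?S (\<lambda>x. \<phi> (fst (fst x)))" "continuous_on ?S (\<lambda>x. deriv \<phi> (fst (fst x)))"
      by (rule continuous_on_compose2[OF D(6) z] continuous_on_compose2[OF D(7) z]; use zd in blast)+
    have f2: "continuous_on ?S (\<lambda>x. \<phi> (?c (snd x)))" "continuous_on ?S (\<lambda>x. deriv \<phi> (?c (snd x)))"
      by (rule continuous_on_compose2[OF D(6) c] continuous_on_compose2[OF D(7) c]; use cd in blast)+
    have ne3: "\<phi> (fst (fst x)) - \<phi> (?c (snd x)) \<noteq> 0" if "x \<in> ?S" for x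
      using inj_onD[OF D(2) _ zd[OF that] cd] ne1[OF that] by auto
    have sq1: "\<forall>x\<in>?S. (fst (fst x) - ?c (snd x))\<^sup>2 \<noteq> 0"
      using ne1 by (intro ballI power_not_zero) (simp only: right_minus_eq not_False_eq_True)
    have sq3: "\<forall>x\<in>?S. (\<phi> (fst (fst x)) - \<phi> (?c (snd x)))\<^sup>2 \<noteq> 0"
      by (intro ballI power_not_zero ne3)
    have "continuous_on ?S (\<lambda>x. F_kernel \<phi> (fst (fst x)) (?c (snd x)))"
      unfolding F_kernel_def
      by (intro continuous_on_diff continuous_on_divide continuous_on_mult continuous_on_power
          continuous_on_const f1 f2 z c sq1 sq3)
    then show ?thesis
      unfolding split_beta' using ne2
      by (intro continuous_on_mult continuous_on_divide continuous_on_diff c w continuous_intros) auto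
  qed
  have cont2: "continuous_on (ball 0 r \<times> ball 0 r) (\<lambda>p. integral (cbox 0 1) (?I p) / (2 * pi * \<i>))"
    by (intro continuous_on_divide integral_continuous_on_param[OF cont] continuous_on_const) simp
  have eq: "integral (cbox 0 1) (?I (z, w)) / (2 * pi * \<i>) = F_ext \<phi> z w"
    if z: "z \<in> ball 0 r" and w: "w \<in> ball 0 r" for z w
  proof -
    have zd: "z \<in> disc" using z r by simp
    have "((\<lambda>u. F_ext \<phi> z u / (u - w)) has_contour_integral (2 * of_real pi * \<i> * F_ext \<phi> z w)) ?c"
    proof (rule Cauchy_integral_circlepath_simple)
      show "F_ext \<phi> z holomorphic_on cball 0 r"
        by (rule holomorphic_on_subset[OF F_ext(1)[OF \<phi> zd]]) (use r in auto)
    qed (use w in simp)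
    then have "((\<lambda>t. F_ext \<phi> z (?c t) / (?c t - w) * vector_derivative ?c (at t within {0..1})) has_integral
        (2 * of_real pi * \<i> * F_ext \<phi> z w)) {0..1}"
      unfolding has_contour_integral_def .
    moreover have "F_ext \<phi> z (?c t) / (?c t - w) * vector_derivative ?c (at t within {0..1}) = ?I (z, w) t"
      if t: "t \<in> {0..1}" for t
    proof -
      have "?c t \<noteq> z" using path[of t] z by auto
      then have 1: "F_ext \<phi> z (?c t) = F_kernel \<phi> z (?c t)" by (rule F_ext(2)[OF \<phi> zd cd])
      have "vector_derivative ?c (at t within {0..1}) = ?v t"
        using t by (intro vector_derivative_circlepath01) auto
      then show ?thesis unfolding 1 by simp
    qed
    ultimately have "(?I (z, w) has_integral (2 * of_real pi * \<i> * F_ext \<phi> z w)) {0..1}"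
      by (rule has_integral_cong[THEN iffD1, rotated])
    then have "integral (cbox 0 1) (?I (z, w)) = 2 * of_real pi * \<i> * F_ext \<phi> z w"
      unfolding cbox_interval by (rule integral_unique)
    then show ?thesis by simp
  qed
  show ?thesis
    by (rule continuous_on_eq[OF cont2]) (use eq in auto)
qed

lemma continuous_F_ext:
  assumes \<phi>: "\<phi> \<in> CE_emb"
  shows "continuous_on (disc \<times> disc) (\<lambda>(z, w). F_ext \<phi> z w)"
proof -
  have "continuous (at p) (\<lambda>(z, w). F_ext \<phi> z w)" if p: "p \<in> disc \<times> disc" for p
  proof -
    obtain a b where ab: "p = (a, b)" by (cases p)
    obtain r where r: "max (cmod a) (cmod b) < r" "r < 1"
      using dense[of "max (cmod a) (cmod b)" 1] p ab by auto
    have r0: "0 < r" using r(1) norm_ge_zero[of a] by linarith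
    have "continuous_on (ball 0 r \<times> ball 0 r) (\<lambda>(z, w). F_ext \<phi> z w)"
      by (rule continuous_F_ext_ball[OF \<phi> r0 r(2)])
    moreover have "open (ball 0 r \<times> ball 0 r :: (complex \<times> complex) set)" by (simp add: open_Times)
    moreover have "p \<in> ball 0 r \<times> ball 0 r" using r ab by simp
    ultimately show ?thesis using continuous_on_eq_continuous_at by blast
  qed
  then show ?thesis by (simp add: continuous_at_imp_continuous_on)
qed

definition kernel2 :: "(complex \<Rightarrow> complex) \<Rightarrow> (nat \<Rightarrow> complex) \<Rightarrow> complex" where
  "kernel2 \<phi> z = (if z \<in> polydisc 2 then F_ext \<phi> (z 0) (z 1) else 0)"

lemma polydisc2D: "z \<in> polydisc 2 \<Longrightarrow> z 0 \<in> disc" "z \<in> polydisc 2 \<Longrightarrow> z 1 \<in> disc"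
  using polydiscD[of z 2 0] polydiscD[of z 2 1] by auto

lemma holomorphic_kernel2:
  assumes \<phi>: "\<phi> \<in> CE_emb"
  shows "holomorphic_polydisc 2 (kernel2 \<phi>)"
  unfolding holomorphic_polydisc_def
proof (intro conjI ballI allI impI)
  have "continuous_on (polydisc 2) (\<lambda>z. (z 0, z 1))"
    by (intro continuous_on_Pair continuous_on_polydisc_component)
  then have "continuous_on (polydisc 2) (\<lambda>z. case (z 0, z 1) of (z, w) \<Rightarrow> F_ext \<phi> z w)"
    by (rule continuous_on_compose2[OF continuous_F_ext[OF \<phi>]]) (use polydisc2D in auto)
  then show "continuous_on (polydisc 2) (kernel2 \<phi>)"
    by (rule continuous_on_eq) (simp add: kernel2_def)
  fix z i assume z: "z \<in> polydisc 2" and i: "i < (2::nat)"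
  show "(\<lambda>w. kernel2 \<phi> (z(i := w))) holomorphic_on disc"
  proof (cases "i = 0")
    case True
    show ?thesis
    proof (rule holomorphic_transform[OF F_ext(1)[OF \<phi> polydisc2D(2)[OF z]]])
      fix w assume w: "w \<in> disc"
      show "F_ext \<phi> (z 1) w = kernel2 \<phi> (z(i := w))"
        using polydisc_upd[OF z i w] F_ext_commute[OF \<phi> polydisc2D(2)[OF z] w]
        by (simp add: kernel2_def True)
    qed
  next
    case False
    then have i1: "i = 1" using i by simp
    show ?thesis
    proof (rule holomorphic_transform[OF F_ext(1)[OF \<phi> polydisc2D(1)[OF z]]])
      fix w assume w: "w \<in> disc"
      show "F_ext \<phi> (z 0) w = kernel2 \<phi> (z(i := w))"
        using polydisc_upd[OF z i w] by (simp add: kernel2_def i1)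
    qed
  qed
qed

definition pt2 :: "complex \<Rightarrow> complex \<Rightarrow> nat \<Rightarrow> complex" where
  "pt2 a b = (\<lambda>_. undefined)(0 := a, 1 := b)"

lemma nn_integral_poly_2:
  assumes f: "f \<in> borel_measurable (poly_measure 2)"
  shows "(\<integral>\<^sup>+z. f z \<partial>poly_measure 2) = (\<integral>\<^sup>+a. \<integral>\<^sup>+b. f (pt2 a b) \<partial>disc_measure \<partial>disc_measure)"
    "(\<lambda>(a, b). f (pt2 a b)) \<in> borel_measurable (disc_measure \<Otimes>\<^sub>M disc_measure)"
proof -
  have "(\<lambda>x. pt2 (fst x) (snd x)) \<in> measurable (disc_measure \<Otimes>\<^sub>M disc_measure) (poly_measure 2)"
  proof (rule measurable_polyI)
    show "(\<lambda>x. pt2 (fst x) (snd x) i) \<in> measurable (disc_measure \<Otimes>\<^sub>M disc_measure) disc_measure" if "i < 2" for i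
    proof (cases "i = 0")
      case True
      then show ?thesis by (simp add: pt2_def)
    next
      case False
      then have "i = 1" using that by simp
      then show ?thesis by (simp add: pt2_def)
    qed
  qed (simp add: pt2_def)
  from measurable_compose[OF this f]
  show m: "(\<lambda>(a, b). f (pt2 a b)) \<in> borel_measurable (disc_measure \<Otimes>\<^sub>M disc_measure)"
    by (simp add: split_beta')
  have two: "(2::nat) = Suc (Suc 0)" by simp
  note f' = f[unfolded two]
  define g where "g = (\<lambda>z. \<integral>\<^sup>+b. f (z(Suc 0 := b)) \<partial>disc_measure)"
  have "(\<lambda>(z, u). f (z(Suc 0 := u))) \<in> borel_measurable (poly_measure (Suc 0) \<Otimes>\<^sub>M disc_measure)"
    using measurable_compose[OF measurable_poly_upd f'] by (simp add: split_beta' fun_upd_def)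
  then have g: "g \<in> borel_measurable (poly_measure (Suc 0))"
    unfolding g_def by (rule disc.borel_measurable_nn_integral)
  have "(\<integral>\<^sup>+z. f z \<partial>poly_measure 2) = (\<integral>\<^sup>+z. g z \<partial>poly_measure (Suc 0))"
    unfolding two g_def by (rule nn_integral_poly_Suc[OF f'])
  also have "\<dots> = (\<integral>\<^sup>+z. \<integral>\<^sup>+a. g (z(0 := a)) \<partial>disc_measure \<partial>poly_measure 0)"
    by (rule nn_integral_poly_Suc[OF g])
  also have "\<dots> = (\<integral>\<^sup>+a. \<integral>\<^sup>+b. f (pt2 a b) \<partial>disc_measure \<partial>disc_measure)"
    by (simp add: poly_measure_0 nn_integral_count_space_finite g_def pt2_def fun_upd_def)
  finally show "(\<integral>\<^sup>+z. f z \<partial>poly_measure 2) = (\<integral>\<^sup>+a. \<integral>\<^sup>+b. f (pt2 a b) \<partial>disc_measure \<partial>disc_measure)" .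
qed

lemma AE_off_diagonal: "AE z in poly_measure 2. z 0 \<noteq> z 1"
proof -
  have mc: "(\<lambda>z. z i) \<in> borel_measurable (poly_measure 2)" if "i < 2" for i
    using measurable_compose[OF measurable_poly_component[OF that] measurable_continuous_disc[OF continuous_on_id]] by simp
  have N: "{z \<in> space (poly_measure 2). z 0 = z 1} \<in> sets (poly_measure 2)"
    by (rule measurable_equality_set[OF mc[of 0] mc[of 1]]) simp_all
  define f :: "(nat \<Rightarrow> complex) \<Rightarrow> ennreal" where "f = indicator {z \<in> space (poly_measure 2). z 0 = z 1}"
  have f: "f \<in> borel_measurable (poly_measure 2)" unfolding f_def using N by simp
  have "(\<integral>\<^sup>+z. f z \<partial>poly_measure 2) = (\<integral>\<^sup>+a. \<integral>\<^sup>+b. f (pt2 a b) \<partial>disc_measure \<partial>disc_measure)"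
    by (rule nn_integral_poly_2(1)[OF f])
  also have "\<dots> = (\<integral>\<^sup>+a. 0 \<partial>disc_measure)"
  proof (rule nn_integral_cong)
    fix a assume "a \<in> space disc_measure"
    then have S: "{a} \<in> sets disc_measure" by (simp add: sets_disc_measure)
    have "(\<integral>\<^sup>+b. f (pt2 a b) \<partial>disc_measure) \<le> (\<integral>\<^sup>+b. indicator {a} b \<partial>disc_measure)"
      by (rule nn_integral_mono) (simp add: f_def indicator_def pt2_def)
    also have "\<dots> = 0" using S by (simp add: emeasure_disc_measure)
    finally show "(\<integral>\<^sup>+b. f (pt2 a b) \<partial>disc_measure) = 0" by simp
  qed
  finally have "(\<integral>\<^sup>+z. f z \<partial>poly_measure 2) = 0" by simp
  then have "AE z in poly_measure 2. f z = 0"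
    by (simp add: nn_integral_0_iff_AE[OF f])
  then show ?thesis
    using AE_space
  proof eventually_elim
    case (elim z)
    show ?case
    proof
      assume "z 0 = z 1"
      then have "f z = 1" using elim(2) by (simp add: f_def)
      then show False using elim(1) by simp
    qed
  qed
qed

lemma AE_kernel2:
  assumes \<phi>: "\<phi> \<in> CE_emb"
  shows "AE z in poly_measure 2. kernel2 \<phi> z = F_kernel \<phi> (z 0) (z 1)"
  using AE_off_diagonal AE_space
proof eventually_elim
  case (elim z)
  then have z: "z \<in> polydisc 2" by simp
  then show ?case
    using F_ext(2)[OF \<phi> polydisc2D(1)[OF z] polydisc2D(2)[OF z]] elim(1) by (simp add: kernel2_def)
qed

lemma CE_HSD:
  assumes "\<phi> \<in> CE_HS"
  shows "\<phi> \<in> CE_emb" "square_integrable (poly_measure 2) (\<lambda>z. F_kernel \<phi> (z 0) (z 1))"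
  using assms by (auto simp: CE_HS_def)

lemma kernel2_in_A2:
  assumes \<phi>: "\<phi> \<in> CE_HS"
  shows "kernel2 \<phi> \<in> A2 2"
proof (rule A2_I)
  note E = CE_HSD[OF \<phi>]
  show h: "holomorphic_polydisc 2 (kernel2 \<phi>)" by (rule holomorphic_kernel2[OF E(1)])
  have "(\<integral>\<^sup>+z. ennreal ((cmod (kernel2 \<phi> z))\<^sup>2) \<partial>poly_measure 2) =
      (\<integral>\<^sup>+z. ennreal ((cmod (F_kernel \<phi> (z 0) (z 1)))\<^sup>2) \<partial>poly_measure 2)"
  proof (rule nn_integral_cong_AE)
    show "AE z in poly_measure 2. ennreal ((cmod (kernel2 \<phi> z))\<^sup>2) = ennreal ((cmod (F_kernel \<phi> (z 0) (z 1)))\<^sup>2)"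
      using AE_kernel2[OF E(1)] by eventually_elim simp
  qed
  then show "square_integrable (poly_measure 2) (kernel2 \<phi>)"
    using E(2) h measurable_continuous_polydisc[of 2 "kernel2 \<phi>"]
    by (simp add: square_integrable_iff_nn holomorphic_polydisc_def)
qed (simp add: kernel2_def)

lemma A2_eqI_AE:
  assumes f: "f \<in> A2 p" and g: "g \<in> A2 p" and ae: "AE z in poly_measure p. f z = g z"
  shows "f = g"
proof -
  have "(LINT z|poly_measure p. (cmod (f z - g z))\<^sup>2) = (LINT z|poly_measure p. 0)"
  proof (rule integral_cong_AE)
    show "(\<lambda>z. (cmod (f z - g z))\<^sup>2) \<in> borel_measurable (poly_measure p)"
      using A2_D(2)[OF A2_diff[OF f g]] by (auto simp: square_integrable_def)
    show "AE z in poly_measure p. (cmod (f z - g z))\<^sup>2 = 0"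
      using ae by eventually_elim simp
  qed simp
  then have "L2_norm (poly_measure p) (\<lambda>z. f z - g z) = 0"
    by (simp add: L2_norm_def)
  from A2.definite[OF A2_diff[OF f g] this] show ?thesis
    by (simp add: fun_eq_iff)
qed

section \<open>Complex conjugation\<close>

lemma lborel_cnj: "distr lborel borel cnj = lborel"
proof (rule lborel_eqI[symmetric])
  fix l u :: complex
  assume le: "\<And>b. b \<in> Basis \<Longrightarrow> l \<bullet> b \<le> u \<bullet> b"
  have le': "Re l \<le> Re u" "Im l \<le> Im u"
    using le[of 1] le[of \<i>] by (auto simp: Basis_complex_def)
  have m: "cnj \<in> borel_measurable borel" by (rule cnj_measurable) simp
  have vim: "cnj -` box l u = box (Complex (Re l) (- Im u)) (Complex (Re u) (- Im l))"
    by (auto simp: in_box_complex_iff)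
  have "emeasure lborel (box (Complex (Re l) (- Im u)) (Complex (Re u) (- Im l))) = ennreal ((Re u - Re l) * (Im u - Im l))"
    using le' by (subst emeasure_lborel_box) (auto simp: Basis_complex_def)
  then show "emeasure (distr lborel borel cnj) (box l u) = ennreal (\<Prod>b\<in>Basis. (u - l) \<bullet> b)"
    using m by (subst emeasure_distr) (auto simp: vim Basis_complex_def)
qed simp

lemma measurable_cnj_disc: "cnj \<in> measurable disc_measure disc_measure"
  by (rule measurable_disc_disc) (auto intro: continuous_intros)

lemma distr_cnj: "distr disc_measure disc_measure cnj = disc_measure"
proof (rule measure_eqI)
  fix E assume "E \<in> sets (distr disc_measure disc_measure cnj)"
  then have E: "E \<in> sets disc_measure" by simp
  have m: "cnj \<in> measurable lborel borel" using cnj_measurable[of "\<lambda>x. x" lborel] by simp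
  have sub: "cnj -` E \<subseteq> disc"
  proof
    fix z assume "z \<in> cnj -` E"
    then have "cnj z \<in> disc" using E by (auto simp: sets_disc_measure)
    then show "z \<in> disc" by simp
  qed
  have E': "cnj -` E \<in> sets disc_measure"
    using measurable_sets[OF measurable_cnj_disc E] sub by (simp add: Int_absorb2)
  have "emeasure (distr disc_measure disc_measure cnj) E = emeasure disc_measure (cnj -` E)"
    using sub by (subst emeasure_distr[OF measurable_cnj_disc E]) (simp add: Int_absorb2)
  also have "\<dots> = ennreal (1 / pi) * emeasure lborel (cnj -` E)"
    by (rule emeasure_disc_measure[OF E'])
  also have "emeasure lborel (cnj -` E) = emeasure (distr lborel borel cnj) E"
    using E by (subst emeasure_distr[OF m]) (simp_all add: sets_disc_measure)
  also have "ennreal (1 / pi) * \<dots> = emeasure disc_measure E"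
    unfolding lborel_cnj by (rule emeasure_disc_measure[OF E, symmetric])
  finally show "emeasure (distr disc_measure disc_measure cnj) E = emeasure disc_measure E" .
qed simp

lemma nn_integral_cnj:
  assumes g: "g \<in> borel_measurable disc_measure"
  shows "(\<integral>\<^sup>+z. g (cnj z) \<partial>disc_measure) = (\<integral>\<^sup>+z. g z \<partial>disc_measure)"
proof -
  have "(\<integral>\<^sup>+z. g z \<partial>distr disc_measure disc_measure cnj) = (\<integral>\<^sup>+z. g (cnj z) \<partial>disc_measure)"
    using g by (intro nn_integral_distr measurable_cnj_disc) simp
  then show ?thesis by (simp add: distr_cnj)
qed

lemma deriv_conj_map:
  assumes \<phi>: "\<phi> \<in> CE_emb" and z: "z \<in> disc"
  shows "deriv (conj_map \<phi>) z = cnj (deriv \<phi> (cnj z))"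
proof (rule DERIV_imp_deriv)
  have "(\<phi> has_field_derivative deriv \<phi> (cnj z)) (at (cnj z))"
    by (rule holomorphic_derivI[OF CE_embD(1)[OF \<phi>] open_ball]) (use z in simp)
  from has_field_derivative_cnj_cnj[OF this]
  show "(conj_map \<phi> has_field_derivative cnj (deriv \<phi> (cnj z))) (at z)"
    by (rule has_field_derivative_transform_within_open[of _ _ _ disc]) (use z in \<open>auto simp: conj_map_def\<close>)
qed

lemma F_kernel_conj_map:
  assumes \<phi>: "\<phi> \<in> CE_emb" and z: "z \<in> disc" and w: "w \<in> disc"
  shows "F_kernel (conj_map \<phi>) z w = cnj (F_kernel \<phi> (cnj z) (cnj w))"
  unfolding F_kernel_def deriv_conj_map[OF \<phi> z] deriv_conj_map[OF \<phi> w]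
  using z w by (simp add: conj_map_def)

lemma measurable_cnj_poly: "poly_map 2 cnj \<in> measurable (poly_measure 2) (poly_measure 2)"
  by (rule poly_map_measurable[OF measurable_cnj_disc])

text \<open>Conjugation of both variables preserves the measure and turns one kernel into the conjugate of the
  other.\<close>

lemma conj_map_in_CE_HS:
  assumes \<phi>: "\<phi> \<in> CE_HS"
  shows "conj_map \<phi> \<in> CE_HS"
    "(\<lambda>z. F_kernel \<phi> (cnj (z 0)) (cnj (z 1))) \<in> borel_measurable (poly_measure 2)"
proof -
  note E = CE_HSD[OF \<phi>]
  let ?f = "\<lambda>z. F_kernel \<phi> (z 0) (z 1)" and ?h = "\<lambda>z. F_kernel \<phi> (cnj (z 0)) (cnj (z 1))"
  have fm: "?f \<in> borel_measurable (poly_measure 2)" by (rule square_integrable_measurable[OF E(2)])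
  have h_eq: "?f (poly_map 2 cnj z) = ?h z" for z by (simp add: poly_map_def)
  show hm: "?h \<in> borel_measurable (poly_measure 2)"
    using measurable_compose[OF measurable_cnj_poly fm] unfolding h_eq .
  have fm': "(\<lambda>z. ennreal ((cmod (?f z))\<^sup>2)) \<in> borel_measurable (poly_measure 2)" using fm by measurable
  have hm': "(\<lambda>z. ennreal ((cmod (?h z))\<^sup>2)) \<in> borel_measurable (poly_measure 2)" using hm by measurable
  let ?F = "\<lambda>a b. ennreal ((cmod (F_kernel \<phi> a b))\<^sup>2)"
  have Fm: "(\<lambda>(a, b). ?F a b) \<in> borel_measurable (disc_measure \<Otimes>\<^sub>M disc_measure)"
    using nn_integral_poly_2(2)[OF fm'] by (simp add: pt2_def)
  have "(\<integral>\<^sup>+z. ennreal ((cmod (?h z))\<^sup>2) \<partial>poly_measure 2) =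
      (\<integral>\<^sup>+a. \<integral>\<^sup>+b. ?F (cnj a) (cnj b) \<partial>disc_measure \<partial>disc_measure)"
    using nn_integral_poly_2(1)[OF hm'] by (simp add: pt2_def)
  also have "\<dots> = (\<integral>\<^sup>+a. \<integral>\<^sup>+b. ?F (cnj a) b \<partial>disc_measure \<partial>disc_measure)"
  proof (rule nn_integral_cong)
    fix a assume "a \<in> space disc_measure"
    then have "cnj a \<in> space disc_measure" by simp
    from measurable_compose[OF measurable_Pair1'[OF this] Fm]
    have "(\<lambda>b. ?F (cnj a) b) \<in> borel_measurable disc_measure" by simp
    from nn_integral_cnj[OF this]
    show "(\<integral>\<^sup>+b. ?F (cnj a) (cnj b) \<partial>disc_measure) = (\<integral>\<^sup>+b. ?F (cnj a) b \<partial>disc_measure)" .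
  qed
  also have "\<dots> = (\<integral>\<^sup>+a. \<integral>\<^sup>+b. ?F a b \<partial>disc_measure \<partial>disc_measure)"
    by (rule nn_integral_cnj[OF disc.borel_measurable_nn_integral[OF Fm]])
  also have "\<dots> = (\<integral>\<^sup>+z. ennreal ((cmod (?f z))\<^sup>2) \<partial>poly_measure 2)"
    using nn_integral_poly_2(1)[OF fm'] by (simp add: pt2_def)
  also have "\<dots> < \<infinity>" using E(2) by (simp add: square_integrable_iff_nn)
  finally have sq: "square_integrable (poly_measure 2) (\<lambda>z. cnj (?h z))"
    using cnj_measurable[OF hm] by (simp add: square_integrable_iff_nn)
  have "square_integrable (poly_measure 2) (\<lambda>z. F_kernel (conj_map \<phi>) (z 0) (z 1))"
  proof (rule iffD1[OF square_integrable_cong sq])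
    fix z assume "z \<in> space (poly_measure 2)"
    then have z: "z \<in> polydisc 2" by simp
    show "cnj (?h z) = F_kernel (conj_map \<phi>) (z 0) (z 1)"
      by (rule F_kernel_conj_map[OF E(1) polydisc2D(1)[OF z] polydisc2D(2)[OF z], symmetric])
  qed
  then show "conj_map \<phi> \<in> CE_HS"
    using conj_map_in_CE_emb[OF E(1)] by (simp add: CE_HS_def)
qed

lemma conj_map_compose:
  assumes \<psi>: "\<psi> \<in> CE_emb"
  shows "conj_map (compose disc \<phi> \<psi>) = compose disc (conj_map \<phi>) (conj_map \<psi>)"
proof
  fix z
  show "conj_map (compose disc \<phi> \<psi>) z = compose disc (conj_map \<phi>) (conj_map \<psi>) z"
  proof (cases "z \<in> disc")
    case True
    then have "cnj z \<in> disc" by simp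
    moreover from this have "cnj (\<psi> (cnj z)) \<in> disc" using CE_embD(5)[OF \<psi>, of "cnj z"] by simp
    ultimately show ?thesis using True by (simp add: conj_map_def compose_def del: mem_ball mem_ball_0)
  qed (simp add: conj_map_def compose_def)
qed

section \<open>The cocycle identity\<close>

lemma compose_in_CE_emb:
  assumes \<phi>: "\<phi> \<in> CE_emb" and \<psi>: "\<psi> \<in> CE_emb"
  shows "compose disc \<phi> \<psi> \<in> CE_emb"
  unfolding CE_emb_def
proof (intro CollectI conjI)
  note D = CE_embD[OF \<phi>] and E = CE_embD[OF \<psi>]
  show "compose disc \<phi> \<psi> \<in> disc \<rightarrow>\<^sub>E disc"
    using D(5) E(5) by (simp add: compose_def PiE_iff del: mem_ball mem_ball_0)
  show "compose disc \<phi> \<psi> holomorphic_on disc"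
    by (rule holomorphic_transform[OF holomorphic_on_compose_gen[OF E(1) D(1) E(3)]]) (simp add: compose_def)
  show "inj_on (compose disc \<phi> \<psi>) disc"
  proof (rule inj_onI)
    fix x y assume xy: "x \<in> disc" "y \<in> disc" "compose disc \<phi> \<psi> x = compose disc \<phi> \<psi> y"
    then have "\<phi> (\<psi> x) = \<phi> (\<psi> y)" by (simp only: compose_eq)
    then have "\<psi> x = \<psi> y" by (rule inj_onD[OF D(2) _ E(5)[OF xy(1)] E(5)[OF xy(2)]])
    then show "x = y" by (rule inj_onD[OF E(2) _ xy(1,2)])
  qed
qed

lemma deriv_compose:
  assumes \<phi>: "\<phi> \<in> CE_emb" and \<psi>: "\<psi> \<in> CE_emb" and z: "z \<in> disc"
  shows "deriv (compose disc \<phi> \<psi>) z = deriv \<phi> (\<psi> z) * deriv \<psi> z"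
proof (rule DERIV_imp_deriv)
  have "(\<psi> has_field_derivative deriv \<psi> z) (at z)"
    by (rule holomorphic_derivI[OF CE_embD(1)[OF \<psi>] open_ball z])
  moreover have "(\<phi> has_field_derivative deriv \<phi> (\<psi> z)) (at (\<psi> z))"
    by (rule holomorphic_derivI[OF CE_embD(1)[OF \<phi>] open_ball CE_embD(5)[OF \<psi> z]])
  ultimately have "((\<lambda>x. \<phi> (\<psi> x)) has_field_derivative deriv \<phi> (\<psi> z) * deriv \<psi> z) (at z)"
    by (rule DERIV_chain2[rotated])
  then show "(compose disc \<phi> \<psi> has_field_derivative deriv \<phi> (\<psi> z) * deriv \<psi> z) (at z)"
    by (rule has_field_derivative_transform_within_open[of _ _ _ disc]) (use z in \<open>auto simp: compose_def\<close>)
qed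

text \<open>Add and subtract \<open>\<psi>'(z) \<psi>'(w) / (\<psi>(z) - \<psi>(w))\<^sup>2\<close> and use the chain rule.  On the diagonal all
  three terms have the value 0.\<close>

lemma F_kernel_compose:
  assumes \<phi>: "\<phi> \<in> CE_emb" and \<psi>: "\<psi> \<in> CE_emb" and z: "z \<in> disc" and w: "w \<in> disc"
  shows "F_kernel (compose disc \<phi> \<psi>) z w =
    deriv \<psi> z * deriv \<psi> w * F_kernel \<phi> (\<psi> z) (\<psi> w) + F_kernel \<psi> z w"
proof -
  have c: "compose disc \<phi> \<psi> z = \<phi> (\<psi> z)" "compose disc \<phi> \<psi> w = \<phi> (\<psi> w)"
    using z w by (simp_all only: compose_eq)
  show ?thesis
    unfolding F_kernel_def deriv_compose[OF \<phi> \<psi> z] deriv_compose[OF \<phi> \<psi> w] c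
    by (simp add: right_diff_distrib mult_ac)
qed

lemma F_kernel_compose_poly:
  assumes \<phi>: "\<phi> \<in> CE_emb" and \<psi>: "\<psi> \<in> CE_emb" and z: "z \<in> polydisc 2"
  shows "F_kernel (compose disc \<phi> \<psi>) (z 0) (z 1) =
    poly_T 2 \<psi> (\<lambda>z. F_kernel \<phi> (z 0) (z 1)) z + F_kernel \<psi> (z 0) (z 1)"
proof -
  have "(\<Prod>i<2. deriv \<psi> (z i)) = deriv \<psi> (z 0) * deriv \<psi> (z 1)"
    by (simp add: numeral_2_eq_2)
  then show ?thesis
    unfolding F_kernel_compose[OF \<phi> \<psi> polydisc2D(1)[OF z] polydisc2D(2)[OF z]]
    using z by (simp add: poly_T_def poly_map_def)
qed

lemma compose_in_CE_HS:
  assumes \<phi>: "\<phi> \<in> CE_HS" and \<psi>: "\<psi> \<in> CE_HS"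
  shows "compose disc \<phi> \<psi> \<in> CE_HS"
proof -
  note D = CE_HSD[OF \<phi>] and E = CE_HSD[OF \<psi>]
  have "square_integrable (poly_measure 2)
      (\<lambda>z. poly_T 2 \<psi> (\<lambda>z. F_kernel \<phi> (z 0) (z 1)) z + F_kernel \<psi> (z 0) (z 1))"
    by (intro square_integrable_add poly_T_square_integrable(1) E D)
  then have "square_integrable (poly_measure 2) (\<lambda>z. F_kernel (compose disc \<phi> \<psi>) (z 0) (z 1))"
    by (rule iffD2[OF square_integrable_cong, rotated]) (simp only: space_poly_measure F_kernel_compose_poly[OF D(1) E(1)])
  then show ?thesis using compose_in_CE_emb[OF D(1) E(1)] by (simp add: CE_HS_def)
qed

text \<open>Both sides lie in the Bergman space and agree off the diagonal; that \<open>\<psi>\<close> is injective keeps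
  \<open>(\<psi>(z), \<psi>(w))\<close> off the diagonal as well.\<close>

lemma kernel2_compose:
  assumes \<phi>: "\<phi> \<in> CE_HS" and \<psi>: "\<psi> \<in> CE_HS"
  shows "kernel2 (compose disc \<phi> \<psi>) = (\<lambda>z. poly_T 2 \<psi> (kernel2 \<phi>) z + kernel2 \<psi> z)"
proof (rule A2_eqI_AE)
  note D = CE_HSD[OF \<phi>] and E = CE_HSD[OF \<psi>]
  show "kernel2 (compose disc \<phi> \<psi>) \<in> A2 2" by (intro kernel2_in_A2 compose_in_CE_HS \<phi> \<psi>)
  show "(\<lambda>z. poly_T 2 \<psi> (kernel2 \<phi>) z + kernel2 \<psi> z) \<in> A2 2"
    by (intro A2_add poly_T_in_A2 kernel2_in_A2 \<phi> \<psi> E(1))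
  show "AE z in poly_measure 2. kernel2 (compose disc \<phi> \<psi>) z = poly_T 2 \<psi> (kernel2 \<phi>) z + kernel2 \<psi> z"
    using AE_kernel2[OF compose_in_CE_emb[OF D(1) E(1)]] AE_kernel2[OF E(1)] AE_off_diagonal AE_space
  proof eventually_elim
    case (elim z)
    then have z: "z \<in> polydisc 2" by simp
    note pm = poly_map_polydisc[OF CE_embD(3)[OF E(1)] z]
    have p01: "poly_map 2 \<psi> z 0 = \<psi> (z 0)" "poly_map 2 \<psi> z 1 = \<psi> (z 1)" by (simp_all add: poly_map_def)
    have "\<psi> (z 0) \<noteq> \<psi> (z 1)"
      using inj_onD[OF CE_embD(2)[OF E(1)] _ polydisc2D(1)[OF z] polydisc2D(2)[OF z]] elim(3) by blast
    then have "kernel2 \<phi> (poly_map 2 \<psi> z) = F_kernel \<phi> (poly_map 2 \<psi> z 0) (poly_map 2 \<psi> z 1)"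
      using F_ext(2)[OF D(1) polydisc2D(1)[OF pm] polydisc2D(2)[OF pm]] pm unfolding kernel2_def p01
      by (simp only: if_True not_sym not_False_eq_True simp_thms)
    then have "poly_T 2 \<psi> (kernel2 \<phi>) z = poly_T 2 \<psi> (\<lambda>z. F_kernel \<phi> (z 0) (z 1)) z"
      unfolding poly_T_def by simp
    then show ?case
      unfolding elim(1,2) F_kernel_compose_poly[OF D(1) E(1) z] by simp
  qed
qed

section \<open>Automorphisms have vanishing kernel\<close>

text \<open>Automorphisms satisfy \<open>(\<phi>(z) - \<phi>(w))\<^sup>2 = \<phi>'(z) \<phi>'(w) (z - w)\<^sup>2\<close>.\<close>

lemma F_kernel_psu:
  assumes \<alpha>: "cmod \<alpha> < 1" and z: "z \<in> disc" and w: "w \<in> disc"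
  shows "F_kernel (psu \<theta> \<alpha>) z w = 0"
proof (cases "z = w")
  case False
  let ?d = "1 - cnj \<alpha> * z" and ?e = "1 - cnj \<alpha> * w" and ?c = "cis \<theta> * (1 - cnj \<alpha> * \<alpha>)"
  have d: "?d \<noteq> 0" and e: "?e \<noteq> 0" and a: "1 - cnj \<alpha> * \<alpha> \<noteq> 0"
    by (rule one_minus_cnj_mult_ne; use \<alpha> z w in simp)+
  have c: "?c \<noteq> 0" using a by simp
  have "psu \<theta> \<alpha> z - psu \<theta> \<alpha> w = cis \<theta> * ((z - \<alpha>) / ?d - (w - \<alpha>) / ?e)"
    using z w by (simp add: psu_def right_diff_distrib)
  also have "(z - \<alpha>) / ?d - (w - \<alpha>) / ?e = ((z - \<alpha>) * ?e - (w - \<alpha>) * ?d) / (?d * ?e)"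
    by (rule diff_frac_eq[OF d e])
  also have "(z - \<alpha>) * ?e - (w - \<alpha>) * ?d = (1 - cnj \<alpha> * \<alpha>) * (z - w)"
    by (simp add: algebra_simps)
  finally have diff: "psu \<theta> \<alpha> z - psu \<theta> \<alpha> w = ?c * (z - w) / (?d * ?e)" by (simp only: times_divide_eq_right mult.assoc)
  have zw: "z - w \<noteq> 0" using False by simp
  have "deriv (psu \<theta> \<alpha>) z * deriv (psu \<theta> \<alpha>) w / (psu \<theta> \<alpha> z - psu \<theta> \<alpha> w)\<^sup>2 =
      (?c / ?d\<^sup>2) * (?c / ?e\<^sup>2) / (?c * (z - w) / (?d * ?e))\<^sup>2"
    unfolding deriv_psu[OF \<alpha> z] deriv_psu[OF \<alpha> w] diff ..
  also have "\<dots> = 1 / (z - w)\<^sup>2"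
  proof -
    have alg: "(C / x\<^sup>2) * (C / y\<^sup>2) / (C * t / (x * y))\<^sup>2 = 1 / t\<^sup>2" if "C \<noteq> 0" "x \<noteq> 0" "y \<noteq> 0" "t \<noteq> 0" for C x y t :: complex
      using that by (simp add: power2_eq_square)
    show ?thesis by (rule alg[OF c d e zw])
  qed
  finally show ?thesis unfolding F_kernel_def by simp
qed simp

lemma psu_in_CE_HS:
  assumes \<alpha>: "cmod \<alpha> < 1"
  shows "psu \<theta> \<alpha> \<in> CE_HS"
proof -
  have "square_integrable (poly_measure 2) (\<lambda>z. F_kernel (psu \<theta> \<alpha>) (z 0) (z 1))"
  proof (rule iffD2[OF square_integrable_cong square_integrable_zero])
    fix z assume "z \<in> space (poly_measure 2)"
    then have z: "z \<in> polydisc 2" by simp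
    show "F_kernel (psu \<theta> \<alpha>) (z 0) (z 1) = 0"
      by (rule F_kernel_psu[OF \<alpha> polydisc2D(1)[OF z] polydisc2D(2)[OF z]])
  qed
  then show ?thesis using psu_in_CE_emb[OF \<alpha>] by (simp add: CE_HS_def)
qed

lemma conj_map_psu: "cmod \<alpha> < 1 \<Longrightarrow> conj_map (psu \<theta> \<alpha>) = psu (- \<theta>) (cnj \<alpha>)"
  by (auto simp: conj_map_def psu_def fun_eq_iff cis_cnj)

lemma kernel2_psu:
  assumes \<alpha>: "cmod \<alpha> < 1"
  shows "kernel2 (psu \<theta> \<alpha>) = (\<lambda>_. 0)"
proof (rule A2_eqI_AE[OF kernel2_in_A2[OF psu_in_CE_HS[OF \<alpha>]] A2_zero])
  show "AE z in poly_measure 2. kernel2 (psu \<theta> \<alpha>) z = 0"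
    using AE_kernel2[OF psu_in_CE_emb[OF \<alpha>, of \<theta>]] AE_space
  proof eventually_elim
    case (elim z)
    then have z: "z \<in> polydisc 2" by simp
    show ?case unfolding elim(1) by (rule F_kernel_psu[OF \<alpha> polydisc2D(1)[OF z] polydisc2D(2)[OF z]])
  qed
qed

lemma psu_0: "psu 0 0 = (\<lambda>z\<in>disc. z)"
  by (auto simp: psu_def)

section \<open>Symmetric tensors of mixed degree\<close>

lemma SymA2_deg_zero: "(\<lambda>_. 0) \<in> SymA2_deg p"
  by (simp add: SymA2_deg_def A2_zero)

lemma SymA2_deg_add: "f \<in> SymA2_deg p \<Longrightarrow> g \<in> SymA2_deg p \<Longrightarrow> (\<lambda>x. f x + g x) \<in> SymA2_deg p"
  by (simp add: SymA2_deg_def A2_add)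

lemma SymA2_deg_scale: "f \<in> SymA2_deg p \<Longrightarrow> (\<lambda>x. c * f x) \<in> SymA2_deg p"
  by (simp add: SymA2_deg_def A2_scale)

definition vanish :: "nat \<Rightarrow> graded \<Rightarrow> bool" where
  "vanish N F \<longleftrightarrow> (\<forall>p\<ge>N. curry F p = (\<lambda>_. 0))"

lemma vanish_mono: "vanish N F \<Longrightarrow> N \<le> M \<Longrightarrow> vanish M F"
  by (simp add: vanish_def)

lemma vanish_0: "vanish 0 F \<longleftrightarrow> F = (\<lambda>_. 0)"
  by (auto simp: vanish_def fun_eq_iff)

lemma SymA2_I:
  assumes "\<And>p. curry F p \<in> SymA2_deg p" "vanish N F"
  shows "F \<in> SymA2"
proof -
  have "{p. curry F p \<noteq> (\<lambda>_. 0)} \<subseteq> {..<N}"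
  proof
    fix p assume "p \<in> {p. curry F p \<noteq> (\<lambda>_. 0)}"
    then show "p \<in> {..<N}" using assms(2) unfolding vanish_def by (cases "N \<le> p") auto
  qed
  then have "finite {p. curry F p \<noteq> (\<lambda>_. 0)}" by (rule finite_subset) simp
  with assms(1) show ?thesis by (simp add: SymA2_def)
qed

lemma SymA2_D: "F \<in> SymA2 \<Longrightarrow> curry F p \<in> SymA2_deg p"
  by (simp add: SymA2_def)

lemma SymA2_A2: "F \<in> SymA2 \<Longrightarrow> curry F p \<in> A2 p"
  using SymA2_D SymA2_degD(1) by blast

lemma SymA2_vanish:
  assumes "F \<in> SymA2"
  obtains N where "vanish N F"
proof -
  have "finite {p. curry F p \<noteq> (\<lambda>_. 0)}" using assms by (simp add: SymA2_def)
  then obtain N where N: "\<forall>p\<in>{p. curry F p \<noteq> (\<lambda>_. 0)}. p < N"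
    using finite_nat_set_iff_bounded by blast
  have "vanish N F"
    unfolding vanish_def
  proof (intro allI impI)
    fix p assume "N \<le> p"
    then show "curry F p = (\<lambda>_. 0)" using N by (meson CollectI not_less)
  qed
  then show ?thesis using that by blast
qed

lemma Hk_iff: "F \<in> Hk k \<longleftrightarrow> F \<in> SymA2 \<and> vanish (Suc k) F"
  by (simp add: Hk_def vanish_def Suc_le_eq)

lemma curry_lin:
  "curry (\<lambda>x. F x + G x) p = (\<lambda>z. curry F p z + curry G p z)"
  "curry (\<lambda>x. F x - G x) p = (\<lambda>z. curry F p z - curry G p z)"
  "curry (\<lambda>x. c * F x) p = (\<lambda>z. c * curry F p z)"
  "curry (\<lambda>x. \<Sum>i\<in>I. H i x) p = (\<lambda>z. \<Sum>i\<in>I. curry (H i) p z)"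
  by (simp_all add: curry_def)

lemma graded_eqI: "(\<And>p. curry F p = curry G p) \<Longrightarrow> F = (G :: graded)"
  by (metis case_prod_curry ext)

lemma SymA2_zero: "(\<lambda>_. 0) \<in> SymA2"
  by (rule SymA2_I[of _ 0]) (simp_all add: vanish_0 curry_def SymA2_deg_zero)

lemma SymA2_add:
  assumes F: "F \<in> SymA2" and G: "G \<in> SymA2"
  shows "(\<lambda>x. F x + G x) \<in> SymA2"
proof -
  obtain N M where N: "vanish N F" and M: "vanish M G"
    using SymA2_vanish[OF F] SymA2_vanish[OF G] by metis
  show ?thesis
  proof (rule SymA2_I)
    show "curry (\<lambda>x. F x + G x) p \<in> SymA2_deg p" for p
      unfolding curry_lin by (rule SymA2_deg_add[OF SymA2_D[OF F] SymA2_D[OF G]])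
    show "vanish (max N M) (\<lambda>x. F x + G x)"
      using N M by (simp add: vanish_def curry_lin)
  qed
qed

lemma SymA2_scale:
  assumes F: "F \<in> SymA2"
  shows "(\<lambda>x. c * F x) \<in> SymA2"
proof -
  obtain N where N: "vanish N F" using SymA2_vanish[OF F] .
  show ?thesis
  proof (rule SymA2_I)
    show "curry (\<lambda>x. c * F x) p \<in> SymA2_deg p" for p
      unfolding curry_lin by (rule SymA2_deg_scale[OF SymA2_D[OF F]])
    show "vanish N (\<lambda>x. c * F x)"
      using N by (simp add: vanish_def curry_lin)
  qed
qed

section \<open>Exponentials of commuting operators\<close>

lemma linear_opD:
  assumes "linear_op V W T"
  shows "f \<in> V \<Longrightarrow> T f \<in> W" "f \<in> V \<Longrightarrow> g \<in> V \<Longrightarrow> T (\<lambda>x. f x + g x) = (\<lambda>y. T f y + T g y)"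
    "f \<in> V \<Longrightarrow> T (\<lambda>x. c * f x) = (\<lambda>y. c * T f y)"
  using assms by (auto simp: linear_op_def)

lemma linear_op_sum:
  assumes T: "linear_op V W T" and z: "(\<lambda>_. 0) \<in> V"
    and add: "\<And>f g. f \<in> V \<Longrightarrow> g \<in> V \<Longrightarrow> (\<lambda>x. f x + g x) \<in> V"
    and scale: "\<And>c f. f \<in> V \<Longrightarrow> (\<lambda>x. c * f x) \<in> V"
    and I: "finite I" and f: "\<And>i. i \<in> I \<Longrightarrow> f i \<in> V"
  shows "T (\<lambda>x. \<Sum>i\<in>I. c i * f i x) = (\<lambda>y. \<Sum>i\<in>I. c i * T (f i) y) \<and> (\<lambda>x. \<Sum>i\<in>I. c i * f i x) \<in> V"
  using I f
proof (induction I)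
  case empty
  then show ?case using linear_opD(3)[OF T z, of 0] z by simp
next
  case (insert i I)
  then have IH: "T (\<lambda>x. \<Sum>i\<in>I. c i * f i x) = (\<lambda>y. \<Sum>i\<in>I. c i * T (f i) y)"
    and S: "(\<lambda>x. \<Sum>i\<in>I. c i * f i x) \<in> V" and fi: "f i \<in> V" by auto
  have "T (\<lambda>x. c i * f i x + (\<Sum>i\<in>I. c i * f i x)) = (\<lambda>y. c i * T (f i) y + (\<Sum>i\<in>I. c i * T (f i) y))"
    unfolding linear_opD(2)[OF T scale[OF fi] S] linear_opD(3)[OF T fi] IH ..
  then show ?case using insert(1,2) add[OF scale[OF fi] S] by simp
qed

lemma SymA2_linear_sum:
  assumes "linear_op SymA2 SymA2 T" "finite I" "\<And>i. i \<in> I \<Longrightarrow> f i \<in> SymA2"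
  shows "T (\<lambda>x. \<Sum>i\<in>I. c i * f i x) = (\<lambda>y. \<Sum>i\<in>I. c i * T (f i) y)"
    "(\<lambda>x. \<Sum>i\<in>I. c i * f i x) \<in> SymA2"
proof -
  have "T (\<lambda>x. \<Sum>i\<in>I. c i * f i x) = (\<lambda>y. \<Sum>i\<in>I. c i * T (f i) y) \<and> (\<lambda>x. \<Sum>i\<in>I. c i * f i x) \<in> SymA2"
    by (rule linear_op_sum[OF assms(1) SymA2_zero _ _ assms(2)]) (use SymA2_add SymA2_scale assms(3) in auto)
  then show "T (\<lambda>x. \<Sum>i\<in>I. c i * f i x) = (\<lambda>y. \<Sum>i\<in>I. c i * T (f i) y)"
    "(\<lambda>x. \<Sum>i\<in>I. c i * f i x) \<in> SymA2" by blast+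
qed

lemma linear_op_pow:
  assumes T: "linear_op V V T"
  shows "linear_op V V (T ^^ n)"
proof (induction n)
  case 0
  show ?case by (auto simp: linear_op_def)
next
  case (Suc n)
  show ?case
    unfolding linear_op_def
    using linear_opD[OF T] linear_opD[OF Suc] by simp
qed

text \<open>The exponential series cut off at \<open>N\<close>.  On tensors of degree less than \<open>N\<close> nothing is lost for an
  operator that lowers the degree.\<close>

definition exp_op :: "nat \<Rightarrow> (graded \<Rightarrow> graded) \<Rightarrow> graded \<Rightarrow> graded" where
  "exp_op N A F x = (\<Sum>n<N. (1 / fact n) * (A ^^ n) F x)"

text \<open>An operator that lowers the degree is locally nilpotent, with a bound that is uniform over the
  tensors of bounded degree.\<close>

definition lowering :: "(graded \<Rightarrow> graded) \<Rightarrow> bool" where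
  "lowering A \<longleftrightarrow> linear_op SymA2 SymA2 A \<and> (\<forall>F\<in>SymA2. \<forall>N. vanish N F \<longrightarrow> vanish (N - 1) (A F))"

lemma lowering_pow:
  assumes A: "lowering A" and F: "F \<in> SymA2" and N: "vanish N F"
  shows "(A ^^ n) F \<in> SymA2 \<and> vanish (N - n) ((A ^^ n) F)"
proof (induction n)
  case 0
  show ?case using F N by simp
next
  case (Suc n)
  then have "A ((A ^^ n) F) \<in> SymA2" "vanish (N - n - 1) (A ((A ^^ n) F))"
    using A linear_opD(1) unfolding lowering_def by blast+
  then show ?case by simp
qed

lemma exp_op_in:
  assumes A: "lowering A" and F: "F \<in> SymA2" and N: "vanish N F"
  shows "exp_op M A F \<in> SymA2" "vanish N (exp_op M A F)"
proof -
  have lin: "linear_op SymA2 SymA2 A" using A by (simp add: lowering_def)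
  have f: "(A ^^ n) F \<in> SymA2" for n using lowering_pow[OF A F N] by blast
  have id: "linear_op SymA2 SymA2 (\<lambda>F. F)" by (auto simp: linear_op_def)
  show "exp_op M A F \<in> SymA2"
    unfolding exp_op_def[abs_def] by (rule SymA2_linear_sum(2)[OF id finite_lessThan f])
  have v: "vanish N ((A ^^ n) F)" for n
    using lowering_pow[OF A F N, of n] vanish_mono diff_le_self by blast
  show "vanish N (exp_op M A F)"
    unfolding vanish_def
  proof (intro allI impI ext)
    fix p z assume p: "N \<le> p"
    have "(A ^^ n) F (p, z) = 0" for n
    proof -
      have "curry ((A ^^ n) F) p = (\<lambda>_. 0)" using v[of n] p unfolding vanish_def by blast
      from fun_cong[OF this, of z] show ?thesis by (simp add: curry_def)
    qed
    then show "curry (exp_op M A F) p z = 0" by (simp add: exp_op_def)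
  qed
qed

text \<open>The binomial theorem turns the left side into a sum over \<open>i + j < N\<close>.  The right side sums over the
  whole square, where the additional terms vanish because \<open>A\<^sup>i B\<^sup>j\<close> lowers the degree by \<open>i + j\<close>.\<close>

lemma exp_op_add:
  assumes A: "lowering A" and B: "lowering B"
    and comm: "\<And>F. F \<in> SymA2 \<Longrightarrow> A (B F) = B (A F)"
    and C: "\<And>F. F \<in> SymA2 \<Longrightarrow> C F = (\<lambda>x. A F x + B F x)"
    and F: "F \<in> SymA2" and N: "vanish N F"
  shows "exp_op N C F = exp_op N A (exp_op N B F)"
proof
  fix x
  have linA: "linear_op SymA2 SymA2 A" and linB: "linear_op SymA2 SymA2 B"
    using A B by (auto simp: lowering_def)
  have Bj: "(B ^^ j) F \<in> SymA2" "vanish (N - j) ((B ^^ j) F)" for j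
    using lowering_pow[OF B F N] by blast+
  have AB: "(A ^^ i) ((B ^^ j) F) \<in> SymA2" "vanish (N - j - i) ((A ^^ i) ((B ^^ j) F))" for i j
    using lowering_pow[OF A Bj] by blast+
  have commA: "B ((A ^^ i) G) = (A ^^ i) (B G)" if G: "G \<in> SymA2" for i G
  proof (induction i)
    case (Suc i)
    have "(A ^^ i) G \<in> SymA2" using linear_opD(1)[OF linear_op_pow[OF linA] G] .
    from comm[OF this] show ?case by (simp only: funpow.simps o_apply Suc[symmetric])
  qed simp
  define a where "a i j = (1 / (fact i * fact j)) * (A ^^ i) ((B ^^ j) F) x" for i j
  define S where "S i j = (A ^^ i) ((B ^^ j) F)" for i j
  have SS: "S i j \<in> SymA2" for i j unfolding S_def by (rule AB(1))
  have AS: "A (S i j) = S (Suc i) j" for i j by (simp add: S_def)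
  have BS: "B (S i j) = S i (Suc j)" for i j unfolding S_def using commA[OF Bj(1)] by simp
  have linC: "linear_op SymA2 SymA2 C"
    unfolding linear_op_def
  proof (intro conjI ballI allI Pi_I)
    show "C f \<in> SymA2" if "f \<in> SymA2" for f
      unfolding C[OF that] by (intro SymA2_add linear_opD(1)[OF linA] linear_opD(1)[OF linB] that)
    show "C (\<lambda>x. f x + g x) = (\<lambda>y. C f y + C g y)" if "f \<in> SymA2" "g \<in> SymA2" for f g
      unfolding C[OF SymA2_add[OF that]] C[OF that(1)] C[OF that(2)] linear_opD(2)[OF linA that] linear_opD(2)[OF linB that]
      by (simp add: add_ac)
    show "C (\<lambda>x. c * f x) = (\<lambda>y. c * C f y)" if "f \<in> SymA2" for f c
      unfolding C[OF SymA2_scale[OF that]] C[OF that] linear_opD(3)[OF linA that] linear_opD(3)[OF linB that]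
      by (simp add: distrib_left)
  qed
  have binom: "(C ^^ n) F = (\<lambda>x. \<Sum>k\<le>n. of_nat (n choose k) * S k (n - k) x)" for n
  proof (induction n)
    case 0
    show ?case by (simp add: S_def)
  next
    case (Suc n)
    have "(C ^^ Suc n) F = C (\<lambda>x. \<Sum>k\<le>n. of_nat (n choose k) * S k (n - k) x)"
      using Suc by simp
    also have "\<dots> = (\<lambda>x. \<Sum>k\<le>n. of_nat (n choose k) * C (S k (n - k)) x)"
      by (rule SymA2_linear_sum(1)[OF linC finite_atMost SS])
    also have "\<dots> = (\<lambda>x. \<Sum>k\<le>Suc n. of_nat (Suc n choose k) * S k (Suc n - k) x)"
    proof
      fix x
      have "(\<Sum>k\<le>n. of_nat (n choose k) * C (S k (n - k)) x) =
          (\<Sum>k\<le>n. of_nat (n choose k) * S (Suc k) (n - k) x) + (\<Sum>k\<le>n. of_nat (n choose k) * S k (Suc n - k) x)"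
        unfolding C[OF SS] AS BS by (simp add: sum.distrib distrib_left Suc_diff_le)
      also have "(\<Sum>k\<le>n. of_nat (n choose k) * S k (Suc n - k) x) = (\<Sum>k\<le>Suc n. of_nat (n choose k) * S k (Suc n - k) x)"
        by (simp add: binomial_eq_0)
      also have "\<dots> = S 0 (Suc n) x + (\<Sum>k\<le>n. of_nat (n choose Suc k) * S (Suc k) (n - k) x)"
        by (subst sum.atMost_Suc_shift) simp
      also have "(\<Sum>k\<le>n. of_nat (n choose k) * S (Suc k) (n - k) x) + \<dots> =
          S 0 (Suc n) x + (\<Sum>k\<le>n. of_nat (Suc n choose Suc k) * S (Suc k) (n - k) x)"
        by (simp add: sum.distrib distrib_right)
      also have "\<dots> = (\<Sum>k\<le>Suc n. of_nat (Suc n choose k) * S k (Suc n - k) x)"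
        by (subst sum.atMost_Suc_shift) simp
      finally show "(\<Sum>k\<le>n. of_nat (n choose k) * C (S k (n - k)) x) =
          (\<Sum>k\<le>Suc n. of_nat (Suc n choose k) * S k (Suc n - k) x)" .
    qed
    finally show ?case .
  qed
  have "exp_op N C F x = (\<Sum>n<N. \<Sum>k\<le>n. a k (n - k))"
    unfolding exp_op_def
  proof (rule sum.cong[OF refl])
    fix n
    have "(1 / fact n) * (C ^^ n) F x = (\<Sum>k\<le>n. (of_nat (n choose k) / fact n) * S k (n - k) x)"
      unfolding binom by (simp add: sum_distrib_left sum_divide_distrib)
    also have "\<dots> = (\<Sum>k\<le>n. a k (n - k))"
    proof (rule sum.cong[OF refl])
      fix k assume "k \<in> {..n}"
      then have "(of_nat (n choose k) :: complex) = fact n / (fact k * fact (n - k))"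
        by (simp add: binomial_fact)
      then show "(of_nat (n choose k) / fact n) * S k (n - k) x = a k (n - k)"
        by (simp add: a_def S_def)
    qed
    finally show "(1 / fact n) * (C ^^ n) F x = (\<Sum>k\<le>n. a k (n - k))" .
  qed
  also have "\<dots> = (\<Sum>(i, j)\<in>{(i, j). i + j < N}. a i j)"
    by (rule sum.triangle_reindex[symmetric])
  also have "\<dots> = (\<Sum>(i, j)\<in>{..<N} \<times> {..<N}. a i j)"
  proof (rule sum.mono_neutral_left)
    show "\<forall>y\<in>{..<N} \<times> {..<N} - {(i, j). i + j < N}. (case y of (i, j) \<Rightarrow> a i j) = 0"
    proof
      fix y assume y: "y \<in> {..<N} \<times> {..<N} - {(i, j). i + j < N}"
      obtain i j where ij: "y = (i, j)" by (cases y)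
      have "N - j - i = 0" using y ij by simp
      then have "S i j = (\<lambda>_. 0)" using AB(2)[of j i] by (simp add: S_def vanish_0)
      then show "(case y of (i, j) \<Rightarrow> a i j) = 0" by (simp add: ij a_def S_def)
    qed
  qed auto
  also have "\<dots> = (\<Sum>i<N. \<Sum>j<N. a i j)"
    by (simp add: sum.cartesian_product)
  also have "\<dots> = exp_op N A (exp_op N B F) x"
    unfolding exp_op_def[of N A]
  proof (rule sum.cong[OF refl])
    fix i
    have "(A ^^ i) (\<lambda>x. \<Sum>j<N. (1 / fact j) * (B ^^ j) F x) = (\<lambda>x. \<Sum>j<N. (1 / fact j) * (A ^^ i) ((B ^^ j) F) x)"
      by (rule SymA2_linear_sum(1)[OF linear_op_pow[OF linA] finite_lessThan Bj(1)])
    then have "(A ^^ i) (exp_op N B F) x = (\<Sum>j<N. (1 / fact j) * (A ^^ i) ((B ^^ j) F) x)"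
      unfolding exp_op_def[abs_def] by simp
    then show "(\<Sum>j<N. a i j) = (1 / fact i) * (A ^^ i) (exp_op N B F) x"
      by (simp add: a_def sum_divide_distrib mult.commute)
  qed
  finally show "exp_op N C F x = exp_op N A (exp_op N B F) x" .
qed

section \<open>The representation in terms of adjoints\<close>

text \<open>The factor is the number of pairs that can be contracted; on symmetric tensors all of them contribute
  equally.\<close>

definition grade_contr :: "((nat \<Rightarrow> complex) \<Rightarrow> complex) \<Rightarrow> graded \<Rightarrow> graded" where
  "grade_contr G F = (\<lambda>(m, z). of_nat (card (pairs (m + 2))) * contr m G (curry F (m + 2)) z)"

definition grade_T :: "(complex \<Rightarrow> complex) \<Rightarrow> graded \<Rightarrow> graded" where
  "grade_T \<psi> F = (\<lambda>(p, z). poly_T_adj p \<psi> (curry F p) z)"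

lemma curry_grade_contr:
  "curry (grade_contr G F) m = (\<lambda>z. of_nat (card (pairs (m + 2))) * contr m G (curry F (m + 2)) z)"
  by (simp add: grade_contr_def curry_def)

lemma curry_grade_T: "curry (grade_T \<psi> F) p = poly_T_adj p \<psi> (curry F p)"
  by (simp add: grade_T_def curry_def)

lemma linear_zero:
  assumes "\<And>c. T (\<lambda>x. c * (\<lambda>_. 0) x) = (\<lambda>y. c * T (\<lambda>_. 0) y)"
  shows "T (\<lambda>_. 0 :: complex) = (\<lambda>_. 0 :: complex)"
  using assms[of 0] by simp

lemma contr_zero:
  assumes G: "G \<in> A2 2"
  shows "contr m G (\<lambda>_. 0) = (\<lambda>_. 0)"
  by (rule linear_zero) (rule contr_linear(2)[OF G A2_zero])

lemma poly_T_adj_zero: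
  assumes \<psi>: "\<psi> \<in> CE_emb"
  shows "poly_T_adj p \<psi> (\<lambda>_. 0) = (\<lambda>_. 0)"
  by (rule linear_zero) (rule poly_T_adj_linear(2)[OF \<psi> A2_zero])

lemma lowering_grade_contr:
  assumes G: "G \<in> A2 2"
  shows "lowering (grade_contr G)"
proof -
  have van: "vanish (N - 1) (grade_contr G F)" if F: "F \<in> SymA2" and N: "vanish N F" for F N
    unfolding vanish_def
  proof (intro allI impI)
    fix p assume "N - 1 \<le> p"
    then have "curry F (p + 2) = (\<lambda>_. 0)" using N by (simp add: vanish_def)
    then show "curry (grade_contr G F) p = (\<lambda>_. 0)"
      unfolding curry_grade_contr by (simp only: contr_zero[OF G] mult_zero_right)
  qed
  have "grade_contr G F \<in> SymA2" if F: "F \<in> SymA2" for F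
  proof -
    obtain N where N: "vanish N F" using SymA2_vanish[OF F] .
    show ?thesis
    proof (rule SymA2_I[OF _ van[OF F N]])
      show "curry (grade_contr G F) p \<in> SymA2_deg p" for p
        unfolding curry_grade_contr by (intro SymA2_deg_scale contr_sym[OF G] SymA2_D[OF F])
    qed
  qed
  moreover have "grade_contr G (\<lambda>x. F x + H x) = (\<lambda>y. grade_contr G F y + grade_contr G H y)"
    if "F \<in> SymA2" "H \<in> SymA2" for F H
    by (rule graded_eqI)
      (simp only: curry_grade_contr curry_lin contr_linear(1)[OF G SymA2_A2[OF that(1)] SymA2_A2[OF that(2)]] distrib_left)
  moreover have "grade_contr G (\<lambda>x. c * F x) = (\<lambda>y. c * grade_contr G F y)" if "F \<in> SymA2" for F c
    by (rule graded_eqI)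
      (simp only: curry_grade_contr curry_lin contr_linear(2)[OF G SymA2_A2[OF that]] mult.left_commute)
  ultimately show ?thesis
    unfolding lowering_def linear_op_def using van by blast
qed

lemma grade_T_in:
  assumes \<psi>: "\<psi> \<in> CE_emb" and F: "F \<in> SymA2"
  shows "grade_T \<psi> F \<in> SymA2" "vanish N F \<Longrightarrow> vanish N (grade_T \<psi> F)"
proof -
  have van: "vanish N (grade_T \<psi> F)" if "vanish N F" for N
    using that unfolding vanish_def curry_grade_T by (simp add: poly_T_adj_zero[OF \<psi>])
  then show "vanish N F \<Longrightarrow> vanish N (grade_T \<psi> F)" .
  obtain N where N: "vanish N F" using SymA2_vanish[OF F] .
  show "grade_T \<psi> F \<in> SymA2"
    by (rule SymA2_I[OF _ van[OF N]]) (unfold curry_grade_T, rule poly_T_adj_sym[OF \<psi> SymA2_D[OF F]])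
qed

lemma linear_grade_T:
  assumes \<psi>: "\<psi> \<in> CE_emb"
  shows "linear_op SymA2 SymA2 (grade_T \<psi>)"
  unfolding linear_op_def
proof (intro conjI ballI allI Pi_I)
  show "grade_T \<psi> F \<in> SymA2" if "F \<in> SymA2" for F by (rule grade_T_in(1)[OF \<psi> that])
  show "grade_T \<psi> (\<lambda>x. F x + H x) = (\<lambda>y. grade_T \<psi> F y + grade_T \<psi> H y)" if "F \<in> SymA2" "H \<in> SymA2" for F H
    by (rule graded_eqI)
      (simp only: curry_grade_T curry_lin poly_T_adj_linear(1)[OF \<psi> SymA2_A2[OF that(1)] SymA2_A2[OF that(2)]])
  show "grade_T \<psi> (\<lambda>x. c * F x) = (\<lambda>y. c * grade_T \<psi> F y)" if "F \<in> SymA2" for F c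
    by (rule graded_eqI) (simp only: curry_grade_T curry_lin poly_T_adj_linear(2)[OF \<psi> SymA2_A2[OF that]])
qed

lemma grade_contr_commute:
  assumes G: "G \<in> A2 2" and H: "H \<in> A2 2" and F: "F \<in> SymA2"
  shows "grade_contr G (grade_contr H F) = grade_contr H (grade_contr G F)"
proof (rule graded_eqI)
  fix m
  have f: "curry F (m + 2 + 2) \<in> SymA2_deg (m + 2 + 2)" by (rule SymA2_D[OF F])
  note fA = SymA2_degD(1)[OF f]
  have "contr m G (\<lambda>z. c * contr (m + 2) H (curry F (m + 2 + 2)) z) =
      (\<lambda>z. c * contr m G (contr (m + 2) H (curry F (m + 2 + 2))) z)" for c
    by (rule contr_linear(2)[OF G contr_in[OF H fA]])
  moreover have "contr m H (\<lambda>z. c * contr (m + 2) G (curry F (m + 2 + 2)) z) =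
      (\<lambda>z. c * contr m H (contr (m + 2) G (curry F (m + 2 + 2))) z)" for c
    by (rule contr_linear(2)[OF H contr_in[OF G fA]])
  ultimately show "curry (grade_contr G (grade_contr H F)) m = curry (grade_contr H (grade_contr G F)) m"
    unfolding curry_grade_contr by (simp only: contr_commute[OF G H f])
qed

lemma grade_contr_add:
  assumes G: "G \<in> A2 2" and H: "H \<in> A2 2" and F: "F \<in> SymA2"
  shows "grade_contr (\<lambda>x. G x + H x) F = (\<lambda>x. grade_contr G F x + grade_contr H F x)"
  by (rule graded_eqI)
    (simp only: curry_grade_contr curry_lin contr_add_kernel[OF G H SymA2_A2[OF F]] distrib_left)

lemma grade_contr_T:
  assumes \<psi>: "\<psi> \<in> CE_emb" and G: "G \<in> A2 2" and F: "F \<in> SymA2"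
  shows "grade_contr G (grade_T \<psi> F) = grade_T \<psi> (grade_contr (poly_T 2 \<psi> G) F)"
proof (rule graded_eqI)
  fix m
  note fA = SymA2_A2[OF F, of "m + 2"]
  show "curry (grade_contr G (grade_T \<psi> F)) m = curry (grade_T \<psi> (grade_contr (poly_T 2 \<psi> G) F)) m"
    unfolding curry_grade_contr curry_grade_T contr_poly_T_adj[OF \<psi> G fA]
    by (rule poly_T_adj_linear(2)[OF \<psi> contr_in[OF poly_T_in_A2[OF \<psi> G] fA], symmetric])
qed

lemma exp_grade_contr_T:
  assumes \<psi>: "\<psi> \<in> CE_emb" and G: "G \<in> A2 2" and F: "F \<in> SymA2"
  shows "exp_op N (grade_contr G) (grade_T \<psi> F) = grade_T \<psi> (exp_op N (grade_contr (poly_T 2 \<psi> G)) F)"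
proof -
  let ?H = "poly_T 2 \<psi> G"
  have H: "?H \<in> A2 2" by (rule poly_T_in_A2[OF \<psi> G])
  have lin: "linear_op SymA2 SymA2 (grade_contr ?H)" using lowering_grade_contr[OF H] by (simp add: lowering_def)
  have in_S: "(grade_contr ?H ^^ n) F \<in> SymA2" for n by (rule linear_opD(1)[OF linear_op_pow[OF lin] F])
  have pow: "(grade_contr G ^^ n) (grade_T \<psi> F) = grade_T \<psi> ((grade_contr ?H ^^ n) F)" for n
  proof (induction n)
    case (Suc n)
    then show ?case using grade_contr_T[OF \<psi> G in_S[of n]] by (simp only: funpow.simps o_apply)
  qed simp
  have "grade_T \<psi> (exp_op N (grade_contr ?H) F) = (\<lambda>x. \<Sum>n<N. (1 / fact n) * grade_T \<psi> ((grade_contr ?H ^^ n) F) x)"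
    unfolding exp_op_def[abs_def] by (rule SymA2_linear_sum(1)[OF linear_grade_T[OF \<psi>] finite_lessThan in_S])
  then show ?thesis unfolding exp_op_def[abs_def] pow by (rule sym)
qed

lemma poly_map_compose:
  assumes \<psi>: "\<psi> \<in> CE_emb" and z: "z \<in> polydisc p"
  shows "poly_map p (compose disc \<phi> \<psi>) z = poly_map p \<phi> (poly_map p \<psi> z)"
proof
  fix i
  show "poly_map p (compose disc \<phi> \<psi>) z i = poly_map p \<phi> (poly_map p \<psi> z) i"
  proof (cases "i < p")
    case True
    then show ?thesis by (simp only: poly_map_def restrict_apply lessThan_iff if_True compose_eq[OF polydiscD[OF z True]])
  qed (simp add: poly_map_def)
qed

lemma poly_T_compose:
  assumes \<phi>: "\<phi> \<in> CE_emb" and \<psi>: "\<psi> \<in> CE_emb"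
  shows "poly_T p (compose disc \<phi> \<psi>) f = poly_T p \<psi> (poly_T p \<phi> f)"
proof
  fix z
  show "poly_T p (compose disc \<phi> \<psi>) f z = poly_T p \<psi> (poly_T p \<phi> f) z"
  proof (cases "z \<in> polydisc p")
    case True
    have "(\<Prod>i<p. deriv (compose disc \<phi> \<psi>) (z i)) = (\<Prod>i<p. deriv \<psi> (z i) * deriv \<phi> (poly_map p \<psi> z i))"
    proof (rule prod.cong[OF refl])
      fix i assume "i \<in> {..<p}"
      then have i: "i < p" by simp
      have "poly_map p \<psi> z i = \<psi> (z i)" using i by (simp add: poly_map_def)
      then show "deriv (compose disc \<phi> \<psi>) (z i) = deriv \<psi> (z i) * deriv \<phi> (poly_map p \<psi> z i)"
        unfolding deriv_compose[OF \<phi> \<psi> polydiscD[OF True i]] by (simp only: mult.commute)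
    qed
    then show ?thesis
      unfolding poly_T_def poly_map_compose[OF \<psi> True]
      using True poly_map_polydisc[OF CE_embD(3)[OF \<psi>] True]
      by (simp only: if_True prod.distrib mult.assoc)
  next
    case False
    then show ?thesis unfolding poly_T_def by (simp only: if_False)
  qed
qed

lemma poly_T_adj_compose:
  assumes \<phi>: "\<phi> \<in> CE_emb" and \<psi>: "\<psi> \<in> CE_emb" and f: "f \<in> A2 p"
  shows "poly_T_adj p (compose disc \<phi> \<psi>) f = poly_T_adj p \<phi> (poly_T_adj p \<psi> f)"
proof (rule hilbert_op.adj_eqI[OF hilbert_op_poly_T[OF compose_in_CE_emb[OF \<phi> \<psi>]] f])
  note g = poly_T_adj_in[OF \<psi> f]
  show "poly_T_adj p \<phi> (poly_T_adj p \<psi> f) \<in> A2 p" by (rule poly_T_adj_in[OF \<phi> g])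
  fix h assume h: "h \<in> A2 p"
  show "L2_inner (poly_measure p) (poly_T p (compose disc \<phi> \<psi>) h) f =
      L2_inner (poly_measure p) h (poly_T_adj p \<phi> (poly_T_adj p \<psi> f))"
    unfolding poly_T_compose[OF \<phi> \<psi>] poly_T_adj_inner[OF \<psi> f poly_T_in_A2[OF \<phi> h]]
    by (rule poly_T_adj_inner[OF \<phi> g h])
qed

lemma grade_T_compose:
  assumes \<phi>: "\<phi> \<in> CE_emb" and \<psi>: "\<psi> \<in> CE_emb" and F: "F \<in> SymA2"
  shows "grade_T (compose disc \<phi> \<psi>) F = grade_T \<phi> (grade_T \<psi> F)"
  by (rule graded_eqI) (simp only: curry_grade_T poly_T_adj_compose[OF \<phi> \<psi> SymA2_A2[OF F]])

abbreviation conj_kernel :: "(complex \<Rightarrow> complex) \<Rightarrow> (nat \<Rightarrow> complex) \<Rightarrow> complex" where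
  "conj_kernel \<phi> \<equiv> kernel2 (conj_map \<phi>)"

lemma conj_kernel_in_A2: "\<phi> \<in> CE_HS \<Longrightarrow> conj_kernel \<phi> \<in> A2 2"
  by (rule kernel2_in_A2[OF conj_map_in_CE_HS(1)])

text \<open>The integral defining the contraction is the inner product with the kernel of the conjugate map.\<close>

lemma partial_op_eq:
  assumes \<phi>: "\<phi> \<in> CE_HS" and F: "F \<in> SymA2"
  shows "partial_op \<phi> F = grade_contr (conj_kernel \<phi>) F"
proof (rule graded_eqI)
  fix m
  note E = CE_HSD(1)[OF \<phi>]
  have ae: "AE z in poly_measure 2. conj_kernel \<phi> z = cnj (F_kernel \<phi> (cnj (z 0)) (cnj (z 1)))"
    using AE_kernel2[OF conj_map_in_CE_emb[OF E]] AE_space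
  proof eventually_elim
    case (elim z)
    then have z: "z \<in> polydisc 2" by simp
    show ?case unfolding elim(1) by (rule F_kernel_conj_map[OF E polydisc2D(1)[OF z] polydisc2D(2)[OF z]])
  qed
  have "curry (partial_op \<phi> F) m = partial_deg m \<phi> (curry F (m + 2))"
    by (simp add: partial_op_def curry_def)
  also have "\<dots> = curry (grade_contr (conj_kernel \<phi>) F) m"
    unfolding curry_grade_contr
    by (rule partial_deg_sym[OF conj_kernel_in_A2[OF \<phi>] ae conj_map_in_CE_HS(2)[OF \<phi>] SymA2_D[OF F]])
  finally show "curry (partial_op \<phi> F) m = curry (grade_contr (conj_kernel \<phi>) F) m" .
qed

lemma exp_partial_eq:
  assumes \<phi>: "\<phi> \<in> CE_HS" and F: "F \<in> SymA2" and N: "vanish N F"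
  shows "exp_partial \<phi> F = exp_op N (grade_contr (conj_kernel \<phi>)) F"
proof
  fix x
  let ?A = "grade_contr (conj_kernel \<phi>)"
  note low = lowering_grade_contr[OF conj_kernel_in_A2[OF \<phi>]]
  note pw = lowering_pow[OF low F N]
  have pow: "(partial_op \<phi> ^^ n) F = (?A ^^ n) F" for n
  proof (induction n)
    case (Suc n)
    have "(?A ^^ n) F \<in> SymA2" using pw by blast
    from partial_op_eq[OF \<phi> this] show ?case by (simp only: funpow.simps o_apply Suc)
  qed simp
  have sub: "{n. (?A ^^ n) F \<noteq> (\<lambda>_. 0)} \<subseteq> {..<N}"
  proof
    fix n assume n: "n \<in> {n. (?A ^^ n) F \<noteq> (\<lambda>_. 0)}"
    show "n \<in> {..<N}"
    proof (rule ccontr)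
      assume "n \<notin> {..<N}"
      then have "vanish 0 ((?A ^^ n) F)" using pw[of n] by simp
      then show False using n by (simp add: vanish_0)
    qed
  qed
  have "exp_partial \<phi> F x = (\<Sum>n | (?A ^^ n) F \<noteq> (\<lambda>_. 0). (?A ^^ n) F x / fact n)"
    unfolding exp_partial_def pow ..
  also have "\<dots> = (\<Sum>n<N. (?A ^^ n) F x / fact n)"
    by (rule sum.mono_neutral_left[OF finite_lessThan sub]) auto
  finally show "exp_partial \<phi> F x = exp_op N ?A F x"
    by (simp add: exp_op_def)
qed

lemma rho_eq:
  assumes \<phi>: "\<phi> \<in> CE_HS" and F: "F \<in> SymA2" and N: "vanish N F"
  shows "rho \<phi> F = grade_T (conj_map \<phi>) (exp_op N (grade_contr (conj_kernel \<phi>)) F)"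
proof -
  let ?H = "exp_op N (grade_contr (conj_kernel \<phi>)) F"
  have H: "?H \<in> SymA2" by (rule exp_op_in(1)[OF lowering_grade_contr[OF conj_kernel_in_A2[OF \<phi>]] F N])
  have "rho_cl \<phi> ?H = grade_T (conj_map \<phi>) ?H"
    unfolding rho_cl_def grade_T_def rho_cl_deg_eq[OF CE_HSD(1)[OF \<phi>] SymA2_A2[OF H]] ..
  then show ?thesis unfolding rho_def exp_partial_eq[OF assms] .
qed

lemma rho_in:
  assumes \<phi>: "\<phi> \<in> CE_HS" and F: "F \<in> SymA2"
  shows "rho \<phi> F \<in> SymA2" "vanish N F \<Longrightarrow> vanish N (rho \<phi> F)"
proof -
  note low = lowering_grade_contr[OF conj_kernel_in_A2[OF \<phi>]]
  note T = grade_T_in[OF conj_map_in_CE_emb[OF CE_HSD(1)[OF \<phi>]]]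
  show "vanish N F \<Longrightarrow> vanish N (rho \<phi> F)"
    using rho_eq[OF \<phi> F] T(2) exp_op_in[OF low F] by simp
  obtain N where N: "vanish N F" using SymA2_vanish[OF F] .
  show "rho \<phi> F \<in> SymA2"
    unfolding rho_eq[OF \<phi> F N] by (rule T(1)[OF exp_op_in(1)[OF low F N]])
qed

lemma linear_exp_op:
  assumes A: "lowering A"
  shows "F \<in> SymA2 \<Longrightarrow> H \<in> SymA2 \<Longrightarrow> exp_op N A (\<lambda>x. F x + H x) = (\<lambda>y. exp_op N A F y + exp_op N A H y)"
    "F \<in> SymA2 \<Longrightarrow> exp_op N A (\<lambda>x. c * F x) = (\<lambda>y. c * exp_op N A F y)"
proof -
  have lin: "linear_op SymA2 SymA2 (A ^^ n)" for n
    using A by (intro linear_op_pow) (simp add: lowering_def)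
  show "exp_op N A (\<lambda>x. F x + H x) = (\<lambda>y. exp_op N A F y + exp_op N A H y)" if "F \<in> SymA2" "H \<in> SymA2"
    unfolding exp_op_def[abs_def] linear_opD(2)[OF lin that] by (simp add: sum.distrib add_divide_distrib)
  show "exp_op N A (\<lambda>x. c * F x) = (\<lambda>y. c * exp_op N A F y)" if "F \<in> SymA2"
    unfolding exp_op_def[abs_def] linear_opD(3)[OF lin that] by (simp add: sum_distrib_left)
qed

lemma linear_rho:
  assumes \<phi>: "\<phi> \<in> CE_HS"
  shows "linear_op SymA2 SymA2 (rho \<phi>)"
  unfolding linear_op_def
proof (intro conjI ballI allI Pi_I)
  note low = lowering_grade_contr[OF conj_kernel_in_A2[OF \<phi>]]
  note T = linear_opD[OF linear_grade_T[OF conj_map_in_CE_emb[OF CE_HSD(1)[OF \<phi>]]]]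
  show "rho \<phi> F \<in> SymA2" if "F \<in> SymA2" for F by (rule rho_in(1)[OF \<phi> that])
  show "rho \<phi> (\<lambda>x. F x + H x) = (\<lambda>y. rho \<phi> F y + rho \<phi> H y)" if F: "F \<in> SymA2" and H: "H \<in> SymA2" for F H
  proof -
    obtain N M where "vanish N F" "vanish M H"
      using SymA2_vanish[OF F] SymA2_vanish[OF H] by metis
    then have N: "vanish (max N M) F" and M: "vanish (max N M) H" by (auto elim: vanish_mono)
    then have NM: "vanish (max N M) (\<lambda>x. F x + H x)" by (simp add: vanish_def curry_lin)
    show ?thesis
      unfolding rho_eq[OF \<phi> SymA2_add[OF F H] NM] rho_eq[OF \<phi> F N] rho_eq[OF \<phi> H M] linear_exp_op(1)[OF low F H]
      by (rule T(2)[OF exp_op_in(1)[OF low F N] exp_op_in(1)[OF low H M]])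
  qed
  show "rho \<phi> (\<lambda>x. c * F x) = (\<lambda>y. c * rho \<phi> F y)" if F: "F \<in> SymA2" for F c
  proof -
    obtain N where N: "vanish N F" using SymA2_vanish[OF F] .
    then have N': "vanish N (\<lambda>x. c * F x)" by (simp add: vanish_def curry_lin)
    show ?thesis
      unfolding rho_eq[OF \<phi> SymA2_scale[OF F] N'] rho_eq[OF \<phi> F N] linear_exp_op(2)[OF low F]
      by (rule T(3)[OF exp_op_in(1)[OF low F N]])
  qed
qed

text \<open>Move the inner composition operator to the left of the outer exponential, which changes the kernel
  \<open>G\<close> into \<open>T G\<close>, and merge the two exponentials by the cocycle identity.\<close>

lemma rho_compose:
  assumes \<phi>: "\<phi> \<in> CE_HS" and \<psi>: "\<psi> \<in> CE_HS" and F: "F \<in> SymA2"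
  shows "rho (compose disc \<phi> \<psi>) F = rho \<phi> (rho \<psi> F)"
proof -
  obtain N where N: "vanish N F" using SymA2_vanish[OF F] .
  let ?J = conj_map
  have J\<phi>: "?J \<phi> \<in> CE_emb" and J\<psi>: "?J \<psi> \<in> CE_emb"
    by (intro conj_map_in_CE_emb CE_HSD \<phi> \<psi>)+
  let ?G = "conj_kernel \<phi>" and ?H = "conj_kernel \<psi>"
  have G: "?G \<in> A2 2" and H: "?H \<in> A2 2" by (intro conj_kernel_in_A2 \<phi> \<psi>)+
  let ?TG = "poly_T 2 (?J \<psi>) ?G"
  have TG: "?TG \<in> A2 2" by (rule poly_T_in_A2[OF J\<psi> G])
  have cocycle: "conj_kernel (compose disc \<phi> \<psi>) = (\<lambda>z. ?TG z + ?H z)"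
    unfolding conj_map_compose[OF CE_HSD(1)[OF \<psi>]]
    by (rule kernel2_compose[OF conj_map_in_CE_HS(1)[OF \<phi>] conj_map_in_CE_HS(1)[OF \<psi>]])
  let ?E = "exp_op N (grade_contr ?H) F"
  have E: "?E \<in> SymA2" and EN: "vanish N ?E"
    by (rule exp_op_in[OF lowering_grade_contr[OF H] F N])+
  let ?TE = "grade_T (?J \<psi>) ?E"
  have "rho \<phi> (rho \<psi> F) = rho \<phi> ?TE" unfolding rho_eq[OF \<psi> F N] ..
  also have "\<dots> = grade_T (?J \<phi>) (exp_op N (grade_contr ?G) ?TE)"
    by (rule rho_eq[OF \<phi> grade_T_in(1)[OF J\<psi> E] grade_T_in(2)[OF J\<psi> E EN]])
  also have "\<dots> = grade_T (?J \<phi>) (grade_T (?J \<psi>) (exp_op N (grade_contr ?TG) ?E))"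
    unfolding exp_grade_contr_T[OF J\<psi> G E] ..
  also have "exp_op N (grade_contr ?TG) ?E = exp_op N (grade_contr (conj_kernel (compose disc \<phi> \<psi>))) F"
    unfolding cocycle
    by (rule exp_op_add[symmetric, OF lowering_grade_contr[OF TG] lowering_grade_contr[OF H]
          grade_contr_commute[OF TG H] grade_contr_add[OF TG H] F N])
  also have "grade_T (?J \<phi>) (grade_T (?J \<psi>) \<dots>) = grade_T (?J (compose disc \<phi> \<psi>)) \<dots>"
    unfolding conj_map_compose[OF CE_HSD(1)[OF \<psi>]]
    by (rule grade_T_compose[OF J\<phi> J\<psi>, symmetric])
      (rule exp_op_in(1)[OF lowering_grade_contr[OF conj_kernel_in_A2[OF compose_in_CE_HS[OF \<phi> \<psi>], unfolded conj_map_compose[OF CE_HSD(1)[OF \<psi>]]]] F N])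
  also have "\<dots> = rho (compose disc \<phi> \<psi>) F"
    by (rule rho_eq[OF compose_in_CE_HS[OF \<phi> \<psi>] F N, symmetric])
  finally show ?thesis ..
qed

section \<open>Norms\<close>

abbreviation deg_norm :: "graded \<Rightarrow> nat \<Rightarrow> real" where
  "deg_norm F p \<equiv> L2_norm (poly_measure p) (curry F p)"

lemma sym_inner_Hk:
  assumes F: "vanish (Suc k) F"
  shows "sym_inner F G = (\<Sum>p\<le>k. L2_inner (poly_measure p) (curry F p) (curry G p))"
  unfolding sym_inner_def
proof (rule sum.mono_neutral_left)
  show "{p. curry F p \<noteq> (\<lambda>_. 0)} \<subseteq> {..k}"
  proof
    fix p assume "p \<in> {p. curry F p \<noteq> (\<lambda>_. 0)}"
    then show "p \<in> {..k}" using F unfolding vanish_def by (cases "Suc k \<le> p") auto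
  qed
qed auto

lemma sym_norm_Hk:
  assumes F: "vanish (Suc k) F"
  shows "sym_norm F = L2_set (deg_norm F) {..k}"
proof -
  have "sym_inner F F = of_real (\<Sum>p\<le>k. (deg_norm F p)\<^sup>2)"
    unfolding sym_inner_Hk[OF F] L2_inner_self by simp
  then show ?thesis by (simp add: sym_norm_def L2_set_def)
qed

lemma sym_norm_le_sum:
  assumes F: "vanish (Suc k) F"
  shows "sym_norm F \<le> (\<Sum>p\<le>k. deg_norm F p)"
  unfolding sym_norm_Hk[OF F] by (rule L2_set_le_sum) simp

lemma deg_norm_le_sym_norm:
  assumes F: "vanish (Suc k) F" and p: "p \<le> k"
  shows "deg_norm F p \<le> sym_norm F"
  unfolding sym_norm_Hk[OF F] by (rule member_le_L2_set) (use p in auto)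

lemma sum_le_sym_norm:
  assumes F: "vanish (Suc k) F"
  shows "(\<Sum>p\<le>k. deg_norm F p) \<le> real (Suc k) * sym_norm F"
proof -
  have "(\<Sum>p\<le>k. deg_norm F p) \<le> (\<Sum>p\<le>k. sym_norm F)"
    by (rule sum_mono) (rule deg_norm_le_sym_norm[OF F], simp)
  then show ?thesis by simp
qed

lemma L2_norm_sum_le:
  assumes "finite I" "\<And>i. i \<in> I \<Longrightarrow> square_integrable M (f i)"
  shows "square_integrable M (\<lambda>x. \<Sum>i\<in>I. f i x) \<and> L2_norm M (\<lambda>x. \<Sum>i\<in>I. f i x) \<le> (\<Sum>i\<in>I. L2_norm M (f i))"
  using assms
proof (induction I)
  case empty
  show ?case by (simp add: square_integrable_zero)
next
  case (insert i I)
  then have S: "square_integrable M (\<lambda>x. \<Sum>i\<in>I. f i x)" "L2_norm M (\<lambda>x. \<Sum>i\<in>I. f i x) \<le> (\<Sum>i\<in>I. L2_norm M (f i))"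
    and f: "square_integrable M (f i)" by auto
  show ?case
    using insert(1,2) square_integrable_add[OF f S(1)] L2_norm_triangle[OF f S(1)] S(2) by simp
qed

text \<open>Operators are estimated in the sum of the norms of the components, which on \<open>Hk k\<close> is equivalent to
  the Hilbert space norm by \<open>sym_norm_le_sum\<close> and \<open>sum_le_sym_norm\<close>.\<close>

lemma grade_contr_bound:
  assumes G: "G \<in> A2 2"
  shows "\<exists>C\<ge>0. \<forall>F\<in>Hk k. (\<Sum>p\<le>k. deg_norm (grade_contr G F) p) \<le> C * (\<Sum>p\<le>k. deg_norm F p)"
proof (intro exI conjI ballI)
  let ?c = "\<lambda>p. real (card (pairs (p + 2))) * L2_norm (poly_measure 2) G"
  show "0 \<le> (\<Sum>p\<le>k. ?c p)" by (intro sum_nonneg mult_nonneg_nonneg) auto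
  fix F assume "F \<in> Hk k"
  then have F: "F \<in> SymA2" and v: "vanish (Suc k) F" by (auto simp: Hk_iff)
  let ?S = "\<Sum>p\<le>k. deg_norm F p"
  have le: "deg_norm F p \<le> ?S" for p
  proof (cases "p \<le> k")
    case True
    then show ?thesis by (intro member_le_sum) auto
  next
    case False
    then have "curry F p = (\<lambda>_. 0)" using v by (simp add: vanish_def)
    then show ?thesis by (simp add: sum_nonneg)
  qed
  have "deg_norm (grade_contr G F) p \<le> ?c p * ?S" for p
  proof -
    have "deg_norm (grade_contr G F) p = real (card (pairs (p + 2))) * L2_norm (poly_measure p) (contr p G (curry F (p + 2)))"
      unfolding curry_grade_contr L2_norm_scale by simp
    also have "\<dots> \<le> real (card (pairs (p + 2))) * (L2_norm (poly_measure 2) G * deg_norm F (p + 2))"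
      by (intro mult_left_mono contr_bound[OF G SymA2_A2[OF F]]) simp
    also have "\<dots> \<le> real (card (pairs (p + 2))) * (L2_norm (poly_measure 2) G * ?S)"
      by (intro mult_left_mono le) auto
    finally show ?thesis by (simp only: mult.assoc)
  qed
  then have "(\<Sum>p\<le>k. deg_norm (grade_contr G F) p) \<le> (\<Sum>p\<le>k. ?c p * ?S)" by (intro sum_mono)
  then show "(\<Sum>p\<le>k. deg_norm (grade_contr G F) p) \<le> (\<Sum>p\<le>k. ?c p) * ?S"
    by (simp only: sum_distrib_right)
qed

lemma grade_contr_pow_bound:
  assumes G: "G \<in> A2 2"
  shows "\<exists>C\<ge>0. \<forall>F\<in>Hk k. (\<Sum>p\<le>k. deg_norm ((grade_contr G ^^ n) F) p) \<le> C * (\<Sum>p\<le>k. deg_norm F p)"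
proof (induction n)
  case 0
  show ?case by (intro exI[of _ 1]) simp
next
  case (Suc n)
  then obtain C where C: "0 \<le> C" "\<And>F. F \<in> Hk k \<Longrightarrow> (\<Sum>p\<le>k. deg_norm ((grade_contr G ^^ n) F) p) \<le> C * (\<Sum>p\<le>k. deg_norm F p)"
    by blast
  obtain D where D: "0 \<le> D" "\<And>F. F \<in> Hk k \<Longrightarrow> (\<Sum>p\<le>k. deg_norm (grade_contr G F) p) \<le> D * (\<Sum>p\<le>k. deg_norm F p)"
    using grade_contr_bound[OF G] by blast
  show ?case
  proof (intro exI conjI ballI)
    show "0 \<le> D * C" using C D by simp
    fix F assume F: "F \<in> Hk k"
    then have "(grade_contr G ^^ n) F \<in> Hk k"
      using lowering_pow[OF lowering_grade_contr[OF G]] vanish_mono unfolding Hk_iff by (meson diff_le_self)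
    from D(2)[OF this] have "(\<Sum>p\<le>k. deg_norm ((grade_contr G ^^ Suc n) F) p) \<le> D * (\<Sum>p\<le>k. deg_norm ((grade_contr G ^^ n) F) p)"
      by simp
    also have "\<dots> \<le> D * (C * (\<Sum>p\<le>k. deg_norm F p))" by (rule mult_left_mono[OF C(2)[OF F] D(1)])
    finally show "(\<Sum>p\<le>k. deg_norm ((grade_contr G ^^ Suc n) F) p) \<le> D * C * (\<Sum>p\<le>k. deg_norm F p)"
      by (simp only: mult.assoc)
  qed
qed

lemma Hk_SymA2: "F \<in> Hk k \<Longrightarrow> F \<in> SymA2" "F \<in> Hk k \<Longrightarrow> vanish (Suc k) F"
  by (simp_all add: Hk_iff)

lemma exp_grade_contr_bound:
  assumes G: "G \<in> A2 2"
  shows "\<exists>C\<ge>0. \<forall>F\<in>Hk k. (\<Sum>p\<le>k. deg_norm (exp_op N (grade_contr G) F) p) \<le> C * (\<Sum>p\<le>k. deg_norm F p)"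
proof -
  obtain C where C: "\<And>n. 0 \<le> C n"
    "\<And>n F. F \<in> Hk k \<Longrightarrow> (\<Sum>p\<le>k. deg_norm ((grade_contr G ^^ n) F) p) \<le> C n * (\<Sum>p\<le>k. deg_norm F p)"
  proof -
    have "\<exists>C. \<forall>n. 0 \<le> C n \<and> (\<forall>F\<in>Hk k.
        (\<Sum>p\<le>k. deg_norm ((grade_contr G ^^ n) F) p) \<le> C n * (\<Sum>p\<le>k. deg_norm F p))"
      by (rule choice, rule allI, rule grade_contr_pow_bound[OF G])
    then show thesis using that by blast
  qed
  show ?thesis
  proof (intro exI conjI ballI)
    show "0 \<le> (\<Sum>n<N. C n)" by (intro sum_nonneg C)
    fix F assume F: "F \<in> Hk k"
    have pw: "(grade_contr G ^^ n) F \<in> SymA2" for n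
      by (rule conjunct1[OF lowering_pow[OF lowering_grade_contr[OF G] Hk_SymA2[OF F]]])
    have "deg_norm (exp_op N (grade_contr G) F) p \<le> (\<Sum>n<N. deg_norm ((grade_contr G ^^ n) F) p)" for p
    proof -
      have "curry (exp_op N (grade_contr G) F) p = (\<lambda>z. \<Sum>n<N. (1 / fact n) * curry ((grade_contr G ^^ n) F) p z)"
        by (simp only: exp_op_def curry_def)
      then have "deg_norm (exp_op N (grade_contr G) F) p \<le>
          (\<Sum>n<N. L2_norm (poly_measure p) (\<lambda>z. (1 / fact n) * curry ((grade_contr G ^^ n) F) p z))"
        using conjunct2[OF L2_norm_sum_le[OF finite_lessThan square_integrable_scale[OF A2_D(2)[OF SymA2_A2[OF pw]]]]]
        by (simp only:)
      also have "\<dots> \<le> (\<Sum>n<N. deg_norm ((grade_contr G ^^ n) F) p)"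
      proof (rule sum_mono)
        fix n
        have "cmod (1 / fact n) \<le> 1" by (simp add: norm_divide)
        then show "L2_norm (poly_measure p) (\<lambda>z. (1 / fact n) * curry ((grade_contr G ^^ n) F) p z) \<le> deg_norm ((grade_contr G ^^ n) F) p"
          unfolding L2_norm_scale by (rule mult_left_le_one_le[OF L2_norm_nonneg norm_ge_zero])
      qed
      finally show ?thesis .
    qed
    then have "(\<Sum>p\<le>k. deg_norm (exp_op N (grade_contr G) F) p) \<le> (\<Sum>p\<le>k. \<Sum>n<N. deg_norm ((grade_contr G ^^ n) F) p)"
      by (intro sum_mono)
    also have "\<dots> = (\<Sum>n<N. \<Sum>p\<le>k. deg_norm ((grade_contr G ^^ n) F) p)" by (rule sum.swap)
    also have "\<dots> \<le> (\<Sum>n<N. C n * (\<Sum>p\<le>k. deg_norm F p))" by (intro sum_mono C(2) F)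
    finally show "(\<Sum>p\<le>k. deg_norm (exp_op N (grade_contr G) F) p) \<le> (\<Sum>n<N. C n) * (\<Sum>p\<le>k. deg_norm F p)"
      by (simp only: sum_distrib_right)
  qed
qed

lemma deg_norm_grade_T:
  assumes \<psi>: "\<psi> \<in> CE_emb" and F: "F \<in> SymA2"
  shows "deg_norm (grade_T \<psi> F) p \<le> deg_norm F p"
  unfolding curry_grade_T using hilbert_op.adj_bound[OF hilbert_op_poly_T[OF \<psi>] SymA2_A2[OF F]] by simp

lemma linear_rho_Hk:
  assumes \<phi>: "\<phi> \<in> CE_HS"
  shows "linear_op (Hk k) (Hk k) (rho \<phi>)"
  unfolding linear_op_def
proof (intro conjI ballI allI Pi_I)
  note L = linear_opD[OF linear_rho[OF \<phi>]]
  show "rho \<phi> F \<in> Hk k" if "F \<in> Hk k" for F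
    unfolding Hk_iff using rho_in[OF \<phi> Hk_SymA2(1)[OF that]] Hk_SymA2(2)[OF that] by simp
  show "rho \<phi> (\<lambda>x. F x + G x) = (\<lambda>y. rho \<phi> F y + rho \<phi> G y)" if "F \<in> Hk k" "G \<in> Hk k" for F G
    by (rule L(2)[OF Hk_SymA2(1)[OF that(1)] Hk_SymA2(1)[OF that(2)]])
  show "rho \<phi> (\<lambda>x. c * F x) = (\<lambda>y. c * rho \<phi> F y)" if "F \<in> Hk k" for F c
    by (rule L(3)[OF Hk_SymA2(1)[OF that]])
qed

lemma bounded_rho:
  assumes \<phi>: "\<phi> \<in> CE_HS"
  shows "bounded_op (Hk k) sym_norm (Hk k) sym_norm (rho \<phi>)"
proof -
  let ?G = "conj_kernel \<phi>"
  note G = conj_kernel_in_A2[OF \<phi>] and J = conj_map_in_CE_emb[OF CE_HSD(1)[OF \<phi>]]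
  obtain C where C: "0 \<le> C" "\<And>F. F \<in> Hk k \<Longrightarrow>
      (\<Sum>p\<le>k. deg_norm (exp_op (Suc k) (grade_contr ?G) F) p) \<le> C * (\<Sum>p\<le>k. deg_norm F p)"
    using exp_grade_contr_bound[OF G] by blast
  have "sym_norm (rho \<phi> F) \<le> (C * real (Suc k)) * sym_norm F" if F: "F \<in> Hk k" for F
  proof -
    note S = Hk_SymA2[OF F]
    let ?E = "exp_op (Suc k) (grade_contr ?G) F"
    have E: "?E \<in> SymA2" by (rule exp_op_in(1)[OF lowering_grade_contr[OF G] S])
    have "sym_norm (rho \<phi> F) \<le> (\<Sum>p\<le>k. deg_norm (rho \<phi> F) p)"
      by (rule sym_norm_le_sum[OF rho_in(2)[OF \<phi> S]])
    also have "\<dots> \<le> (\<Sum>p\<le>k. deg_norm ?E p)"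
      unfolding rho_eq[OF \<phi> S] by (intro sum_mono deg_norm_grade_T J E)
    also have "\<dots> \<le> C * (\<Sum>p\<le>k. deg_norm F p)" by (rule C(2)[OF F])
    also have "\<dots> \<le> C * (real (Suc k) * sym_norm F)"
      by (rule mult_left_mono[OF sum_le_sym_norm[OF S(2)] C(1)])
    finally show ?thesis by (simp only: mult.assoc)
  qed
  with linear_rho_Hk[OF \<phi>] show ?thesis unfolding bounded_op_def by blast
qed

section \<open>Automorphisms act unitarily\<close>

lemma contr_zero_kernel:
  assumes f: "f \<in> A2 (m + 2)"
  shows "contr m (\<lambda>_. 0) f = (\<lambda>_. 0)"
proof (rule contr_eqI[OF A2_zero f A2_zero])
  fix g
  have "mul_ker m (\<lambda>_. 0) g = (\<lambda>_. 0)" by (simp add: mul_ker_def fun_eq_iff)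
  then show "L2_inner (poly_measure (m + 2)) (mul_ker m (\<lambda>_. 0) g) f = L2_inner (poly_measure m) g (\<lambda>_. 0)"
    by simp
qed

lemma exp_zero_kernel:
  assumes F: "F \<in> SymA2"
  shows "exp_op (Suc N) (grade_contr (\<lambda>_. 0)) F = F"
proof
  fix x
  have z: "grade_contr (\<lambda>_. 0) H = (\<lambda>_. 0)" if "H \<in> SymA2" for H
  proof (rule graded_eqI)
    fix p :: nat
    have "curry (\<lambda>_. 0 :: complex) p = (\<lambda>_::nat \<Rightarrow> complex. 0)" by (simp add: curry_def)
    then show "curry (grade_contr (\<lambda>_. 0) H) p = curry (\<lambda>_. 0) p"
      unfolding curry_grade_contr contr_zero_kernel[OF SymA2_A2[OF that]] by simp
  qed
  have p: "(grade_contr (\<lambda>_. 0) ^^ Suc n) F = (\<lambda>_. 0)" for n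
  proof (induction n)
    case 0
    show ?case using z[OF F] by simp
  next
    case (Suc n)
    then show ?case using z[OF SymA2_zero] by simp
  qed
  have "exp_op (Suc N) (grade_contr (\<lambda>_. 0)) F x = F x + (\<Sum>n<N. (1 / fact (Suc n)) * (grade_contr (\<lambda>_. 0) ^^ Suc n) F x)"
    unfolding exp_op_def by (subst sum.lessThan_Suc_shift) simp
  also have "\<dots> = F x" unfolding p by simp
  finally show "exp_op (Suc N) (grade_contr (\<lambda>_. 0)) F x = F x" .
qed

lemma rho_psu_grade_T:
  assumes \<alpha>: "cmod \<alpha> < 1" and F: "F \<in> SymA2"
  shows "rho (psu \<theta> \<alpha>) F = grade_T (psu (- \<theta>) (cnj \<alpha>)) F"
proof -
  obtain N where "vanish N F" using SymA2_vanish[OF F] .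
  then have N: "vanish (Suc N) F" by (rule vanish_mono) simp
  have k: "conj_kernel (psu \<theta> \<alpha>) = (\<lambda>_. 0)"
    unfolding conj_map_psu[OF \<alpha>] by (rule kernel2_psu) (use \<alpha> in simp)
  show ?thesis
    unfolding rho_eq[OF psu_in_CE_HS[OF \<alpha>] F N] k exp_zero_kernel[OF F] unfolding conj_map_psu[OF \<alpha>] ..
qed

text \<open>Polarisation: the operator preserves norms.\<close>

lemma poly_T_inner_onto:
  assumes \<phi>: "\<phi> \<in> CE_emb" and onto: "\<phi> ` disc = disc" and f: "f \<in> A2 p" and g: "g \<in> A2 p"
  shows "L2_inner (poly_measure p) (poly_T p \<phi> f) (poly_T p \<phi> g) = L2_inner (poly_measure p) f g"
proof -
  note T = poly_T_in_A2[OF \<phi>]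
  interpret T: hilbert_op "poly_measure p" "A2 p" "poly_measure p" "A2 p" "poly_T p \<phi>" 1
    by (rule hilbert_op_poly_T[OF \<phi>])
  have norm: "L2_norm (poly_measure p) (poly_T p \<phi> h) = L2_norm (poly_measure p) h" if "h \<in> A2 p" for h
    by (rule poly_T_norm_onto[OF \<phi> onto A2_D(2)[OF that]])
  have re: "Re (L2_inner (poly_measure p) (poly_T p \<phi> f) (poly_T p \<phi> h)) = Re (L2_inner (poly_measure p) f h)"
    if h: "h \<in> A2 p" for h
  proof -
    have "L2_norm (poly_measure p) (\<lambda>x. poly_T p \<phi> f x + poly_T p \<phi> h x) = L2_norm (poly_measure p) (\<lambda>x. f x + h x)"
      unfolding T.T_add[OF f h, symmetric] by (rule norm[OF A2_add[OF f h]])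
    then have "(L2_norm (poly_measure p) (\<lambda>x. poly_T p \<phi> f x + poly_T p \<phi> h x))\<^sup>2 = (L2_norm (poly_measure p) (\<lambda>x. f x + h x))\<^sup>2"
      by simp
    then show ?thesis
      unfolding L2_norm_add_sq[OF A2_D(2)[OF f] A2_D(2)[OF h]] L2_norm_add_sq[OF A2_D(2)[OF T[OF f]] A2_D(2)[OF T[OF h]]]
        norm[OF f] norm[OF h] by simp
  qed
  have "Re (L2_inner (poly_measure p) (poly_T p \<phi> f) (poly_T p \<phi> (\<lambda>x. \<i> * g x))) = Re (L2_inner (poly_measure p) f (\<lambda>x. \<i> * g x))"
    by (rule re[OF A2_scale[OF g]])
  then have "Im (L2_inner (poly_measure p) (poly_T p \<phi> f) (poly_T p \<phi> g)) = Im (L2_inner (poly_measure p) f g)"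
    unfolding T.T_scale[OF g] L2_inner_scale_right by simp
  with re[OF g] show ?thesis by (simp add: complex_eq_iff)
qed

lemma psu_compose_inverse:
  assumes \<alpha>: "cmod \<alpha> < 1"
  shows "compose disc (psu \<theta> \<alpha>) (psu (- \<theta>) (- \<alpha> * cis \<theta>)) = (\<lambda>z\<in>disc. z)"
    "compose disc (psu (- \<theta>) (- \<alpha> * cis \<theta>)) (psu \<theta> \<alpha>) = (\<lambda>z\<in>disc. z)"
  unfolding compose_def by (rule restrict_ext, erule psu_inverse'[OF \<alpha>])
    (rule restrict_ext, erule psu_inverse[OF \<alpha>])

lemma poly_T_id:
  assumes f: "f \<in> A2 p"
  shows "poly_T p (\<lambda>z\<in>disc. z) f = f"
proof
  fix z
  show "poly_T p (\<lambda>z\<in>disc. z) f z = f z"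
  proof (cases "z \<in> polydisc p")
    case True
    have "poly_map p (\<lambda>z\<in>disc. z) z = z"
    proof (rule polydisc_eqI[OF _ True])
      show "poly_map p (\<lambda>z\<in>disc. z) z \<in> polydisc p"
        by (rule poly_map_polydisc[OF _ True]) (simp add: subset_iff image_iff)
      show "poly_map p (\<lambda>z\<in>disc. z) z i = z i" if "i < p" for i
        using polydiscD[OF True that] that by (simp add: poly_map_def)
    qed
    moreover have "deriv (\<lambda>z\<in>disc. z) (z i) = 1" if "i < p" for i
      unfolding psu_0[symmetric] using deriv_psu[of 0 "z i" 0] polydiscD[OF True that] by simp
    ultimately show ?thesis using True by (simp add: poly_T_def)
  next
    case False
    then show ?thesis using A2_D(3)[OF f] by (simp add: poly_T_def)
  qed
qed

text \<open>Composition with the inverse automorphism preserves inner products and undoes the operator.\<close>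

lemma poly_T_adj_psu:
  assumes \<alpha>: "cmod \<alpha> < 1" and f: "f \<in> A2 p"
  shows "poly_T_adj p (psu \<theta> \<alpha>) f = poly_T p (psu (- \<theta>) (- \<alpha> * cis \<theta>)) f"
proof (rule hilbert_op.adj_eqI[OF hilbert_op_poly_T[OF psu_in_CE_emb[OF \<alpha>]] f])
  have \<beta>: "cmod (- \<alpha> * cis \<theta>) < 1" using \<alpha> by (simp add: norm_mult)
  note E = psu_in_CE_emb[OF \<alpha>, of \<theta>] and E' = psu_in_CE_emb[OF \<beta>, of "- \<theta>"]
  show "poly_T p (psu (- \<theta>) (- \<alpha> * cis \<theta>)) f \<in> A2 p" by (rule poly_T_in_A2[OF E' f])
  fix g assume g: "g \<in> A2 p"
  have inv: "poly_T p (psu (- \<theta>) (- \<alpha> * cis \<theta>)) (poly_T p (psu \<theta> \<alpha>) g) = g"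
    unfolding poly_T_compose[OF E E', symmetric] psu_compose_inverse(1)[OF \<alpha>] by (rule poly_T_id[OF g])
  show "L2_inner (poly_measure p) (poly_T p (psu \<theta> \<alpha>) g) f =
      L2_inner (poly_measure p) g (poly_T p (psu (- \<theta>) (- \<alpha> * cis \<theta>)) f)"
    using poly_T_inner_onto[OF E' psu_onto[OF \<beta>] poly_T_in_A2[OF E g] f] unfolding inv by (rule sym)
qed

text \<open>The conjugate of an automorphism has the parameters \<open>- \<theta>\<close> and \<open>cnj \<alpha>\<close>; passing to the adjoint
  inverts it.\<close>

lemma curry_rho_psu:
  assumes \<alpha>: "cmod \<alpha> < 1" and F: "F \<in> SymA2"
  shows "curry (rho (psu \<theta> \<alpha>) F) p = poly_T p (psu \<theta> (- cnj \<alpha> * cis (- \<theta>))) (curry F p)"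
proof -
  have "cmod (cnj \<alpha>) < 1" using \<alpha> by simp
  from poly_T_adj_psu[OF this SymA2_A2[OF F], of p "- \<theta>"] show ?thesis
    unfolding rho_psu_grade_T[OF \<alpha> F] curry_grade_T by (simp only: minus_minus)
qed

text \<open>The identity is the automorphism with parameters 0 and 0.\<close>

lemma rho_id:
  assumes F: "F \<in> SymA2"
  shows "rho (\<lambda>z\<in>disc. z) F = F"
proof (rule graded_eqI)
  fix p
  have "curry (rho (psu 0 0) F) p = poly_T p (psu 0 0) (curry F p)"
    using curry_rho_psu[of 0 F 0 p] F by simp
  then show "curry (rho (\<lambda>z\<in>disc. z) F) p = curry F p"
    unfolding psu_0 poly_T_id[OF SymA2_A2[OF F]] .
qed

lemma PSU11_D:
  assumes "g \<in> PSU11"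
  obtains \<theta> \<alpha> where "g = psu \<theta> \<alpha>" "cmod \<alpha> < 1"
  using assms unfolding PSU11_def by blast

lemma PSU11_CE_HS: "PSU11 \<subseteq> CE_HS"
proof
  fix g assume "g \<in> PSU11"
  then obtain \<theta> \<alpha> where "g = psu \<theta> \<alpha>" "cmod \<alpha> < 1" by (rule PSU11_D)
  then show "g \<in> CE_HS" by (simp only: psu_in_CE_HS)
qed

lemma rho_Hk: "\<phi> \<in> CE_HS \<Longrightarrow> F \<in> Hk k \<Longrightarrow> rho \<phi> F \<in> Hk k"
  using linear_opD(1)[OF linear_rho_Hk] .

lemma unitary_rho_PSU11:
  assumes g: "g \<in> PSU11"
  shows "unitary_op (Hk k) sym_inner (rho g)"
proof -
  obtain \<theta> \<alpha> where ga: "g = psu \<theta> \<alpha>" and \<alpha>: "cmod \<alpha> < 1" using PSU11_D[OF g] .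
  have \<beta>: "cmod (- \<alpha> * cis \<theta>) < 1" and \<gamma>: "cmod (- cnj \<alpha> * cis (- \<theta>)) < 1" using \<alpha> by (simp_all add: norm_mult)
  let ?h = "psu (- \<theta>) (- \<alpha> * cis \<theta>)"
  have gH: "g \<in> CE_HS" unfolding ga by (rule psu_in_CE_HS[OF \<alpha>])
  have hH: "?h \<in> CE_HS" by (rule psu_in_CE_HS[OF \<beta>])
  have "rho g ` Hk k = Hk k"
  proof (intro equalityI subsetI)
    show "F \<in> Hk k" if "F \<in> rho g ` Hk k" for F using that rho_Hk[OF gH] by blast
    show "F \<in> rho g ` Hk k" if F: "F \<in> Hk k" for F
    proof (rule image_eqI)
      show "rho ?h F \<in> Hk k" by (rule rho_Hk[OF hH F])
      have "rho g (rho ?h F) = rho (compose disc g ?h) F" by (rule rho_compose[OF gH hH Hk_SymA2(1)[OF F], symmetric])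
      also have "\<dots> = F" unfolding ga psu_compose_inverse(1)[OF \<alpha>] by (rule rho_id[OF Hk_SymA2(1)[OF F]])
      finally show "F = rho g (rho ?h F)" ..
    qed
  qed
  moreover have "sym_inner (rho g F) (rho g G) = sym_inner F G" if F: "F \<in> Hk k" and G: "G \<in> Hk k" for F G
  proof -
    note SF = Hk_SymA2[OF F] and SG = Hk_SymA2[OF G]
    have "L2_inner (poly_measure p) (curry (rho g F) p) (curry (rho g G) p) = L2_inner (poly_measure p) (curry F p) (curry G p)" for p
      unfolding ga curry_rho_psu[OF \<alpha> SF(1)] curry_rho_psu[OF \<alpha> SG(1)]
      by (rule poly_T_inner_onto[OF psu_in_CE_emb[OF \<gamma>] psu_onto[OF \<gamma>] SymA2_A2[OF SF(1)] SymA2_A2[OF SG(1)]])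
    then show ?thesis
      unfolding sym_inner_Hk[OF SF(2)] sym_inner_Hk[OF rho_in(2)[OF gH SF]] by simp
  qed
  ultimately show ?thesis using linear_rho_Hk[OF gH] unfolding unitary_op_def by blast
qed

section \<open>Strong continuity\<close>

text \<open>Pointwise convergence together with convergence of the norms gives convergence in the mean, by
  Fatou's lemma for \<open>\<bar>f\<^sub>n + f\<bar>\<^sup>2\<close> and the parallelogram law.\<close>

lemma L2_convergence:
  assumes fn: "\<And>n. square_integrable M (f n)" and g: "square_integrable M g"
    and norm: "\<And>n. L2_norm M (f n) = L2_norm M g"
    and lim: "\<And>x. x \<in> space M \<Longrightarrow> (\<lambda>n. f n x) \<longlonglongrightarrow> g x"
  shows "(\<lambda>n. L2_norm M (\<lambda>x. f n x - g x)) \<longlonglongrightarrow> 0"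
proof -
  let ?N = "(2 * L2_norm M g)\<^sup>2"
  let ?a = "\<lambda>n. (L2_norm M (\<lambda>x. f n x + g x))\<^sup>2" and ?d = "\<lambda>n. (L2_norm M (\<lambda>x. f n x - g x))\<^sup>2"
  have par: "?d n = ?N - ?a n" for n
    using L2_parallelogram[OF fn[of n] g] norm[of n] by (simp add: power_mult_distrib)
  have [measurable]: "f n \<in> borel_measurable M" "g \<in> borel_measurable M" for n
    using fn g by (auto simp: square_integrable_def)
  have "ennreal ?N = (\<integral>\<^sup>+x. ennreal ((cmod (2 * g x))\<^sup>2) \<partial>M)"
    using nn_integral_L2_norm[OF square_integrable_scale[OF g, of 2]] by (simp add: L2_norm_scale)
  also have "\<dots> = (\<integral>\<^sup>+x. liminf (\<lambda>n. ennreal ((cmod (f n x + g x))\<^sup>2)) \<partial>M)"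
  proof (rule nn_integral_cong)
    fix x assume "x \<in> space M"
    then have "(\<lambda>n. ennreal ((cmod (f n x + g x))\<^sup>2)) \<longlonglongrightarrow> ennreal ((cmod (g x + g x))\<^sup>2)"
      by (intro tendsto_intros lim)
    then show "ennreal ((cmod (2 * g x))\<^sup>2) = liminf (\<lambda>n. ennreal ((cmod (f n x + g x))\<^sup>2))"
      unfolding mult_2 by (intro lim_imp_Liminf[symmetric]) simp_all
  qed
  also have "\<dots> \<le> liminf (\<lambda>n. \<integral>\<^sup>+x. ennreal ((cmod (f n x + g x))\<^sup>2) \<partial>M)"
    by (rule nn_integral_liminf) measurable
  also have "\<dots> = liminf (\<lambda>n. ennreal (?a n))"
    by (simp only: nn_integral_L2_norm[OF square_integrable_add[OF fn g]])
  finally have le: "ennreal ?N \<le> liminf (\<lambda>n. ennreal (?a n))" .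
  have "?d \<longlonglongrightarrow> 0"
  proof (rule LIMSEQ_I)
    fix e :: real assume e: "0 < e"
    show "\<exists>K. \<forall>n\<ge>K. norm (?d n - 0) < e"
    proof (cases "?N < e")
      case True
      have "norm (?d n - 0) < e" for n
      proof -
        have "0 \<le> ?a n" "0 \<le> ?d n" by (rule zero_le_power2)+
        then show ?thesis using par[of n] True unfolding real_norm_def by linarith
      qed
      then show ?thesis by blast
    next
      case False
      then have "ennreal (?N - e) < ennreal ?N" using e by (intro ennreal_lessI) auto
      then have "ennreal (?N - e) < liminf (\<lambda>n. ennreal (?a n))" using le by (rule less_le_trans)
      then have "\<forall>\<^sub>F n in sequentially. ennreal (?N - e) < ennreal (?a n)" by (rule less_LiminfD)
      then obtain K where K: "\<And>n. K \<le> n \<Longrightarrow> ennreal (?N - e) < ennreal (?a n)"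
        unfolding eventually_sequentially by blast
      have "norm (?d n - 0) < e" if "K \<le> n" for n
      proof -
        have "?N - e < ?a n" using K[OF that] False by (simp add: ennreal_less_iff)
        moreover have "0 \<le> ?d n" by (rule zero_le_power2)
        ultimately show ?thesis using par[of n] unfolding real_norm_def by linarith
      qed
      then show ?thesis by blast
    qed
  qed
  then have "(\<lambda>n. sqrt (?d n)) \<longlonglongrightarrow> sqrt 0" by (rule tendsto_real_sqrt)
  then show ?thesis by simp
qed

lemma continuous_poly_T_psu:
  assumes f: "f \<in> A2 p" and z: "z \<in> polydisc p" and b: "continuous_on S b" and b1: "\<And>x. x \<in> S \<Longrightarrow> cmod (b x) < 1"
    and t: "continuous_on S t"
  shows "continuous_on S (\<lambda>x. poly_T p (psu (t x) (b x)) f z)"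
proof -
  have cis: "continuous_on S (\<lambda>x. cis (t x))" by (intro continuous_intros t)
  have ne: "1 - cnj (b x) * z i \<noteq> 0" if "x \<in> S" "i < p" for x i
    by (rule one_minus_cnj_mult_ne[OF b1[OF that(1)]]) (use polydiscD[OF z that(2)] in simp)
  have psu: "psu (t x) (b x) (z i) = cis (t x) * ((z i - b x) / (1 - cnj (b x) * z i))" if "i < p" for x i
    using polydiscD[OF z that] by (simp add: psu_def)
  have "continuous_on S (\<lambda>x. poly_map p (psu (t x) (b x)) z)"
  proof (rule continuous_on_coordinatewise_then_product)
    fix i
    show "continuous_on S (\<lambda>x. poly_map p (psu (t x) (b x)) z i)"
    proof (cases "i < p")
      case True
      have "continuous_on S (\<lambda>x. cis (t x) * ((z i - b x) / (1 - cnj (b x) * z i)))"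
        by (intro continuous_intros cis b) (use ne True in blast)
      then show ?thesis using True by (simp add: poly_map_def psu)
    qed (simp add: poly_map_def)
  qed
  then have 1: "continuous_on S (\<lambda>x. f (poly_map p (psu (t x) (b x)) z))"
    by (rule continuous_on_compose2[OF A2_D(4)[OF f]])
      (use poly_map_polydisc[OF _ z] psu_onto[OF b1] in blast)
  have "continuous_on S (\<lambda>x. \<Prod>i<p. cis (t x) * (1 - cnj (b x) * b x) / (1 - cnj (b x) * z i)\<^sup>2)"
    by (intro continuous_on_prod continuous_on_divide continuous_on_mult continuous_on_diff continuous_on_power
        continuous_on_cnj continuous_on_const cis b) (use ne in auto)
  then have 2: "continuous_on S (\<lambda>x. (\<Prod>i<p. cis (t x) * (1 - cnj (b x) * b x) / (1 - cnj (b x) * z i)\<^sup>2) * f (poly_map p (psu (t x) (b x)) z))"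
    by (rule continuous_on_mult[OF _ 1])
  show ?thesis
  proof (rule continuous_on_eq[OF 2])
    fix x assume x: "x \<in> S"
    have "(\<Prod>i<p. deriv (psu (t x) (b x)) (z i)) = (\<Prod>i<p. cis (t x) * (1 - cnj (b x) * b x) / (1 - cnj (b x) * z i)\<^sup>2)"
      by (intro prod.cong refl deriv_psu[OF b1[OF x]] polydiscD[OF z]) simp
    then show "(\<Prod>i<p. cis (t x) * (1 - cnj (b x) * b x) / (1 - cnj (b x) * z i)\<^sup>2) * f (poly_map p (psu (t x) (b x)) z) =
        poly_T p (psu (t x) (b x)) f z"
      unfolding poly_T_def using z by (simp only: if_True)
  qed
qed

lemma Hk_diff:
  assumes F: "F \<in> Hk k" and G: "G \<in> Hk k"
  shows "(\<lambda>x. F x - G x) \<in> Hk k"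
proof -
  have "(\<lambda>x. F x + (-1) * G x) \<in> SymA2"
    by (intro SymA2_add SymA2_scale Hk_SymA2[OF F] Hk_SymA2[OF G])
  moreover have "vanish (Suc k) (\<lambda>x. F x - G x)"
    using Hk_SymA2(2)[OF F] Hk_SymA2(2)[OF G] by (simp add: vanish_def curry_lin)
  ultimately show ?thesis by (simp add: Hk_iff)
qed

lemma Metric_space_Hk: "Metric_space (Hk k) (\<lambda>F G. sym_norm (\<lambda>x. F x - G x))"
proof
  fix F G :: graded
  have "0 \<le> Re (sym_inner H H)" for H
    unfolding sym_inner_def L2_inner_self by (simp add: sum_nonneg)
  then show "0 \<le> sym_norm (\<lambda>x. F x - G x)" by (simp add: sym_norm_def)
  have "(\<lambda>z. curry F p z - curry G p z) = (\<lambda>_. 0) \<longleftrightarrow> (\<lambda>z. curry G p z - curry F p z) = (\<lambda>_. 0)" for p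
    unfolding fun_eq_iff right_minus_eq by (rule iff_allI) (rule eq_commute)
  then have "sym_inner (\<lambda>x. F x - G x) (\<lambda>x. F x - G x) = sym_inner (\<lambda>x. G x - F x) (\<lambda>x. G x - F x)"
    unfolding sym_inner_def L2_inner_self curry_lin
    by (intro sum.cong arg_cong[where f = of_real] arg_cong[where f = "\<lambda>t. t\<^sup>2"] L2_norm_diff_commute) simp
  then show "sym_norm (\<lambda>x. F x - G x) = sym_norm (\<lambda>x. G x - F x)" by (simp add: sym_norm_def)
next
  fix F G assume F: "F \<in> Hk k" and G: "G \<in> Hk k"
  note D = Hk_SymA2[OF Hk_diff[OF F G]]
  show "sym_norm (\<lambda>x. F x - G x) = 0 \<longleftrightarrow> F = G"
  proof
    assume 0: "sym_norm (\<lambda>x. F x - G x) = 0"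
    have "curry (\<lambda>x. F x - G x) p = (\<lambda>_. 0)" for p
    proof (cases "p \<le> k")
      case True
      have "deg_norm (\<lambda>x. F x - G x) p = 0"
        using deg_norm_le_sym_norm[OF D(2) True] 0 L2_norm_nonneg[of "poly_measure p" "curry (\<lambda>x. F x - G x) p"] by linarith
      then show ?thesis by (rule A2.definite[OF SymA2_A2[OF D(1)]])
    next
      case False
      then show ?thesis using D(2) by (simp add: vanish_def)
    qed
    then have "curry F p = curry G p" for p unfolding curry_lin by (simp add: fun_eq_iff)
    then show "F = G" by (rule graded_eqI)
  next
    assume "F = G"
    then show "sym_norm (\<lambda>x. F x - G x) = 0" by (simp add: sym_norm_def sym_inner_def curry_def)
  qed
next
  fix F G H assume F: "F \<in> Hk k" and G: "G \<in> Hk k" and H: "H \<in> Hk k"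
  note FG = Hk_SymA2[OF Hk_diff[OF F G]] and GH = Hk_SymA2[OF Hk_diff[OF G H]] and FH = Hk_SymA2[OF Hk_diff[OF F H]]
  let ?a = "deg_norm (\<lambda>x. F x - G x)" and ?b = "deg_norm (\<lambda>x. G x - H x)"
  have "deg_norm (\<lambda>x. F x - H x) p \<le> ?a p + ?b p" for p
    using L2_norm_triangle[OF A2_D(2)[OF SymA2_A2[OF FG(1)]] A2_D(2)[OF SymA2_A2[OF GH(1)]], of p]
    unfolding curry_lin by simp
  then have "L2_set (deg_norm (\<lambda>x. F x - H x)) {..k} \<le> L2_set (\<lambda>p. ?a p + ?b p) {..k}"
    by (intro L2_set_mono) auto
  also have "\<dots> \<le> L2_set ?a {..k} + L2_set ?b {..k}" by (rule L2_set_triangle_ineq)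
  finally show "sym_norm (\<lambda>x. F x - H x) \<le> sym_norm (\<lambda>x. F x - G x) + sym_norm (\<lambda>x. G x - H x)"
    unfolding sym_norm_Hk[OF FG(2)] sym_norm_Hk[OF GH(2)] sym_norm_Hk[OF FH(2)] .
qed

text \<open>In each degree the action is weighted composition with an automorphism, whose values depend
  continuously on the parameters and whose norm does not depend on them.\<close>

lemma tendsto_rho_psu:
  assumes F: "F \<in> Hk k" and x: "x \<in> UNIV \<times> disc" and X: "\<And>n. X n \<in> UNIV \<times> disc" and lim: "X \<longlonglongrightarrow> x"
  shows "(\<lambda>n. sym_norm (\<lambda>y. rho (psu (fst (X n)) (snd (X n))) F y - rho (psu (fst x) (snd x)) F y)) \<longlonglongrightarrow> 0"
proof (rule tendsto_sandwich[OF _ _ tendsto_const])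
  note S = Hk_SymA2[OF F]
  let ?b = "\<lambda>x. - cnj (snd x) * cis (- fst x)"
  let ?r = "\<lambda>x. rho (psu (fst x) (snd x)) F"
  let ?R = "\<lambda>p x. poly_T p (psu (fst x) (?b x)) (curry F p)"
  have a: "cmod (snd y) < 1" if "y \<in> UNIV \<times> disc" for y :: "real \<times> complex"
    using that by (auto simp: mem_Times_iff)
  have b1: "cmod (?b y) < 1" if "y \<in> UNIV \<times> disc" for y :: "real \<times> complex"
    using a[OF that] by (simp add: norm_mult)
  have rH: "?r y \<in> Hk k" if "y \<in> UNIV \<times> disc" for y
    by (rule rho_Hk[OF psu_in_CE_HS[OF a[OF that]] F])
  have cr: "curry (?r y) p = ?R p y" if "y \<in> UNIV \<times> disc" for y p
    by (rule curry_rho_psu[OF a[OF that] S(1)])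
  note D = Hk_SymA2(2)[OF Hk_diff[OF rH[OF X] rH[OF x]]]
  show "\<forall>\<^sub>F n in sequentially. 0 \<le> sym_norm (\<lambda>y. ?r (X n) y - ?r x y)"
    unfolding sym_norm_Hk[OF D] by simp
  show "\<forall>\<^sub>F n in sequentially. sym_norm (\<lambda>y. ?r (X n) y - ?r x y) \<le>
      (\<Sum>p\<le>k. L2_norm (poly_measure p) (\<lambda>z. ?R p (X n) z - ?R p x z))"
    using sym_norm_le_sum[OF D] unfolding curry_lin cr[OF X] cr[OF x] by (intro always_eventually allI)
  have "(\<lambda>n. L2_norm (poly_measure p) (\<lambda>z. ?R p (X n) z - ?R p x z)) \<longlonglongrightarrow> 0" for p
  proof (rule L2_convergence)
    note f = SymA2_A2[OF S(1), of p]
    have RA: "?R p y \<in> A2 p" if "y \<in> UNIV \<times> disc" for y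
      by (rule poly_T_in_A2[OF psu_in_CE_emb[OF b1[OF that]] f])
    show "square_integrable (poly_measure p) (?R p (X n))" for n by (rule A2_D(2)[OF RA[OF X]])
    show "square_integrable (poly_measure p) (?R p x)" by (rule A2_D(2)[OF RA[OF x]])
    have nr: "L2_norm (poly_measure p) (?R p y) = L2_norm (poly_measure p) (curry F p)" if "y \<in> UNIV \<times> disc" for y
      by (rule poly_T_norm_onto[OF psu_in_CE_emb[OF b1[OF that]] psu_onto[OF b1[OF that]] A2_D(2)[OF f]])
    show "L2_norm (poly_measure p) (?R p (X n)) = L2_norm (poly_measure p) (?R p x)" for n
      unfolding nr[OF X] nr[OF x] ..
    fix z assume "z \<in> space (poly_measure p)"
    then have z: "z \<in> polydisc p" by simp
    have "continuous_on (UNIV \<times> disc) (\<lambda>y. ?R p y z)"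
    proof (rule continuous_poly_T_psu[OF f z _ b1])
      show "continuous_on (UNIV \<times> disc) ?b" by (intro continuous_intros)
      show "continuous_on (UNIV \<times> disc) fst" by (intro continuous_intros)
    qed
    then show "(\<lambda>n. ?R p (X n) z) \<longlonglongrightarrow> ?R p x z"
      by (rule continuous_on_tendsto_compose[OF _ lim x]) (use X in simp)
  qed
  then have "(\<lambda>n. \<Sum>p\<le>k. L2_norm (poly_measure p) (\<lambda>z. ?R p (X n) z - ?R p x z)) \<longlonglongrightarrow> (\<Sum>p\<le>k. 0)"
    by (rule tendsto_sum)
  then show "(\<lambda>n. \<Sum>p\<le>k. L2_norm (poly_measure p) (\<lambda>z. ?R p (X n) z - ?R p x z)) \<longlonglongrightarrow> 0"
    by (simp only: sum.neutral_const)
qed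

text \<open>The group carries a quotient topology, so continuity may be checked on the parameters, where
  sequences suffice.\<close>

lemma strongly_continuous_rho:
  assumes F: "F \<in> Hk k"
  shows "continuous_map PSU11_topology
    (Metric_space.mtopology (Hk k) (\<lambda>G G'. sym_norm (\<lambda>x. G x - G' x))) (\<lambda>g. rho g F)"
proof (rule continuous_compose_quotient_map[OF quotient_map_PSU11_topology])
  interpret M: Metric_space "Hk k" "\<lambda>G G'. sym_norm (\<lambda>x. G x - G' x)" by (rule Metric_space_Hk)
  let ?S = "UNIV \<times> disc :: (real \<times> complex) set"
  let ?r = "\<lambda>x. rho (psu (fst x) (snd x)) F"
  let ?d = "\<lambda>x y. sym_norm (\<lambda>z. ?r y z - ?r x z)"
  have rH: "?r y \<in> Hk k" if "y \<in> ?S" for y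
    by (rule rho_Hk[OF psu_in_CE_HS F]) (use that in \<open>auto simp: mem_Times_iff\<close>)
  have "\<exists>U. openin (top_of_set ?S) U \<and> x \<in> U \<and> (\<forall>y\<in>U. ?r y \<in> M.mball (?r x) e)"
    if x: "x \<in> ?S" and e: "0 < e" for x e
  proof -
    have "(?d x \<longlongrightarrow> 0) (at x within ?S)"
      unfolding tendsto_at_iff_sequentially o_def
    proof (intro allI impI)
      fix X assume X: "\<forall>i. X i \<in> ?S - {x}" and lim: "X \<longlonglongrightarrow> x"
      show "(\<lambda>n. ?d x (X n)) \<longlonglongrightarrow> 0"
        by (rule tendsto_rho_psu[OF F x _ lim]) (use X in blast)
    qed
    then have "\<forall>\<^sub>F y in at x within ?S. ?d x y < e" using e by (rule order_tendstoD(2))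
    then obtain V where V: "open V" "x \<in> V" and Vd: "\<And>y. y \<in> V \<Longrightarrow> y \<noteq> x \<Longrightarrow> y \<in> ?S \<Longrightarrow> ?d x y < e"
      unfolding eventually_at_topological by blast
    show ?thesis
    proof (intro exI conjI ballI)
      show "openin (top_of_set ?S) (?S \<inter> V)" by (rule openin_open_Int[OF V(1)])
      show "x \<in> ?S \<inter> V" using x V by blast
      fix y assume y: "y \<in> ?S \<inter> V"
      have "?d x y < e"
      proof (cases "y = x")
        case True
        then show ?thesis using e M.zero[OF rH[OF x] rH[OF x]] by simp
      next
        case False
        then show ?thesis using Vd[of y] y by blast
      qed
      then have "sym_norm (\<lambda>z. ?r x z - ?r y z) < e" by (subst M.commute)
      then show "?r y \<in> M.mball (?r x) e" using rH[OF x] rH[of y] y by simp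
    qed
  qed
  then have "continuous_map (top_of_set ?S) M.mtopology ?r"
    unfolding M.continuous_map_to_metric topspace_euclidean_subtopology by blast
  then show "continuous_map (top_of_set ?S) M.mtopology ((\<lambda>g. rho g F) \<circ> (\<lambda>(\<theta>, \<alpha>). psu \<theta> \<alpha>))"
    by (simp add: o_def split_beta')
qed

theorem theorem2p6:
  shows "(\<forall>\<phi>\<in>CE_HS. linear_op SymA2 SymA2 (rho \<phi>)) \<and>
    (\<forall>\<phi>\<in>CE_HS. \<forall>\<psi>\<in>CE_HS. compose disc \<phi> \<psi> \<in> CE_HS \<and>
       (\<forall>F\<in>SymA2. rho (compose disc \<phi> \<psi>) F = rho \<phi> (rho \<psi> F))) \<and>
    (\<lambda>z\<in>disc. z) \<in> CE_HS \<and> (\<forall>F\<in>SymA2. rho (\<lambda>z\<in>disc. z) F = F) \<and>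
    (\<forall>k. \<forall>\<phi>\<in>CE_HS. bounded_op (Hk k) sym_norm (Hk k) sym_norm (rho \<phi>)) \<and>
    PSU11 \<subseteq> CE_HS \<and>
    (\<forall>k. strongly_continuous_unitary_rep k rho)"
proof (intro conjI ballI allI)
  show "linear_op SymA2 SymA2 (rho \<phi>)" if "\<phi> \<in> CE_HS" for \<phi>
    by (rule linear_rho[OF that])
  show "compose disc \<phi> \<psi> \<in> CE_HS" if "\<phi> \<in> CE_HS" "\<psi> \<in> CE_HS" for \<phi> \<psi>
    by (rule compose_in_CE_HS[OF that])
  show "rho (compose disc \<phi> \<psi>) F = rho \<phi> (rho \<psi> F)" if "\<phi> \<in> CE_HS" "\<psi> \<in> CE_HS" "F \<in> SymA2" for \<phi> \<psi> F
    by (rule rho_compose[OF that])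
  show "(\<lambda>z\<in>disc. z) \<in> CE_HS"
    unfolding psu_0[symmetric] by (rule psu_in_CE_HS) simp
  show "rho (\<lambda>z\<in>disc. z) F = F" if "F \<in> SymA2" for F
    by (rule rho_id[OF that])
  show "bounded_op (Hk k) sym_norm (Hk k) sym_norm (rho \<phi>)" if "\<phi> \<in> CE_HS" for k \<phi>
    by (rule bounded_rho[OF that])
  show "PSU11 \<subseteq> CE_HS" by (rule PSU11_CE_HS)
  show "strongly_continuous_unitary_rep k rho" for k
    unfolding strongly_continuous_unitary_rep_def
  proof (intro conjI ballI)
    show "unitary_op (Hk k) sym_inner (rho g)" if "g \<in> PSU11" for g
      by (rule unitary_rho_PSU11[OF that])
    show "rho (\<lambda>z\<in>disc. z) F = F" if "F \<in> Hk k" for F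
      by (rule rho_id[OF Hk_SymA2(1)[OF that]])
    show "rho (compose disc g h) F = rho g (rho h F)" if "g \<in> PSU11" "h \<in> PSU11" "F \<in> Hk k" for g h F
      using that PSU11_CE_HS by (intro rho_compose Hk_SymA2(1)) auto
    show "continuous_map PSU11_topology
        (Metric_space.mtopology (Hk k) (\<lambda>G G'. sym_norm (\<lambda>x. G x - G' x))) (\<lambda>g. rho g F)" if "F \<in> Hk k" for F
      by (rule strongly_continuous_rho[OF that])
  qed
qed

end
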